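(* Let $\nu$ be a $\Sigma$-tensor norm on duals, let $[\mathcal{A},A]$ be the maximal $\Sigma$-ideal (on the class of Banach spaces) associated to $\nu$, and let $\alpha$ be the finitely generated $\Sigma$-tensor norm on spaces on the class of Banach spaces defined by $\nu$. Then for every election $(n,X_1,\dots,X_n,Y,\beta)$ of Banach spaces $$\left(X_1\otimes\cdots\otimes X_n\otimes Y,\alpha^\beta\right)^*=\mathcal{A}^\beta(X_1,\dots,X_n;Y^* ),$$ $$\left(X_1\otimes\cdots\otimes X_n\otimes Y^*,\alpha^\beta\right)^*\cap\mathcal{L}(X_1,\dots,X_n;Y)=\mathcal{A}^\beta(X_1,\dots,X_n;Y)$$ hold linearly and isometrically. That is: (1) the map $\varphi\mapsto T_\varphi$, where $\langle T_\varphi(x^1,\dots,x^n),y\rangle=\varphi(x^1\otimes\cdots\otimes x^n\otimes y)$, is a linear isometric bijection from $(X_1\otimes\cdots\otimes X_n\otimes Y,\alpha^\beta)^*$ onto $(\mathcal{A}^\beta(X_1,\dots,X_n;Y^* ),A^\beta)$; (2) a bounded multilinear operator $T:X_1\times\cdots\times X_n\to Y$ belongs to $\mathcal{A}^\beta(X_1,\dots,X_n;Y)$ if and only if the functional $\varphi_T$ on $X_1\otimes\cdots\otimes X_n\otimes Y^*$ given by $\varphi_T(x^1\otimes\cdots\otimes x^n\otimes y^* )=y^*(T(x^1,\dots,x^n))$ is bounded for $\alpha^\beta$, and in this case $A^\beta(T)=\|\varphi_T\|$.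
   Context: **Basic notation.** $\mathbb{K}$ is the real or complex field. An election in the class of Banach spaces is a tuple $(n,X_1,\dots,X_n,Y,\beta)$ with $n$ a positive integer, $X_1,\dots,X_n,Y$ Banach spaces over $\mathbb{K}$ and $\beta$ a reasonable crossnorm on the algebraic tensor product $X_1\otimes\cdots\otimes X_n$, i.e. a norm with $\varepsilon\le\beta\le\pi$ ($\varepsilon$, $\pi$ the injective and projective tensor norms). An election of finite dimensional normed spaces is the same with all spaces finite dimensional. If $E_i\subset X_i$ are closed subspaces, $\beta|$ is the restriction of $\beta$ to $E_1\otimes\cdots\otimes E_n$ (again a reasonable crossnorm). $\Sigma_{X_1,\dots,X_n}=\{x^1\otimes\cdots\otimes x^n: x^i\in X_i\}$ is the set of decomposable tensors. $\mathcal{L}(X_1,\dots,X_n;Y)$ is the space of bounded multilinear operators. For a multilinear $T$, $\tilde T$ is its linearization on $X_1\otimes\cdots\otimes X_n$ and $f_T=\tilde T|_{\Sigma_{X_1,\dots,X_n}}$; $Lip^\beta(f_T)$ is the Lipschitz constant of $f_T$ for the metric $\beta(p-q)$. $\mathcal{L}^\beta(X_1,\dots,X_n)$ is the space of multilinear forms $\varphi$ on $X_1\times\cdots\times X_n$ whose linearization is bounded on $(X_1\otimes\cdots\otimes X_n,\beta)$, with norm $\|\varphi\|_\beta=\|\tilde\varphi\|$; it is identified with $(X_1\otimes\cdots\otimes X_n,\beta)^*$. $\mathcal{F}(X)$ is the set of finite dimensional subspaces of $X$, $\mathcal{CF}(Y)$ the set of closed finite codimensional subspaces of $Y$, and $Q_L:Y\to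 Y/L$ the quotient map. $K_X:X\to X^{**}$ is the canonical embedding. $\mathcal{F}(X)$-subspaces $E_i\subset X_i$ give the map $I_{E_1,\dots,E_n}:E_1\times\cdots\times E_n\to X_1\otimes\cdots\otimes X_n$, $(x^1,\dots,x^n)\mapsto x^1\otimes\cdots\otimes x^n$. **$\Sigma$-$\beta$-$\theta$-operators.** Given reasonable crossnorms $\theta$ on $Z_1\otimes\cdots\otimes Z_m$ and $\beta$ on $X_1\otimes\cdots\otimes X_n$, $f_R$ is a $\Sigma$-$\beta$-$\theta$-operator if $R:Z_1\times\cdots\times Z_m\to X_1\otimes\cdots\otimes X_n$ is multilinear with values in $\Sigma_{X_1,\dots,X_n}$ and $\tilde R:(Z_1\otimes\cdots\otimes Z_m,\theta)\to(X_1\otimes\cdots\otimes X_n,\beta)$ is bounded. **$\Sigma$-ideal.** A $\Sigma$-ideal $[\mathcal{A},A]$ on the class of Banach spaces assigns to each election $(n,X_1,\dots,X_n,Y,\beta)$ a linear subspace $\mathcal{A}^\beta(X_1,\dots,X_n;Y)$ of $\mathcal{L}(X_1,\dots,X_n;Y)$ and a complete norm $A^\beta$ on it such that: (I1) for $\varphi\in\mathcal{L}^\beta(X_1,\dots,X_n)$ and $y\in Y$, the operator $\varphi\cdot y$ ($x\mapsto\varphi(x)y$) is in $\mathcal{A}^\beta(X_1,\dots,X_n;Y)$ and $A^\beta(\varphi\cdot y)\le\|\varphi\|_\beta\|y\|$; (I2) $Lip^\beta(f_T)\le A^\beta(T)$ for $T\in\mathcal{A}^\beta(X_1,\dots,X_n;Y)$;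 (I3) if $f_R:\Sigma_{Z_1,\dots,Z_m}\to\Sigma_{X_1,\dots,X_n}$ is a $\Sigma$-$\beta$-$\theta$-operator, $T\in\mathcal{A}^\beta(X_1,\dots,X_n;Y)$ and $S:Y\to W$ is bounded linear, then $Sf_TR\in\mathcal{A}^\theta(Z_1,\dots,Z_m;W)$ and $A^\theta(Sf_TR)\le\|\tilde R\|A^\beta(T)\|S\|$. **Maximality.** For a multilinear $T:X_1\times\cdots\times X_n\to Y$ put $A^{max,\beta}(T)=\sup A^{\beta|}(Q_Lf_TI_{E_1,\dots,E_n}:E_1\times\cdots\times E_n\to Y/L)\le\infty$, the supremum over all $E_i\in\mathcal{F}(X_i)$ and $L\in\mathcal{CF}(Y)$. The $\Sigma$-ideal $[\mathcal{A},A]$ is maximal if it coincides with its maximal hull, i.e. for every election, $\mathcal{A}^\beta(X_1,\dots,X_n;Y)=\{T: A^{max,\beta}(T)<\infty\}$ and $A^\beta=A^{max,\beta}$ there. **$\Sigma$-tensor norm on duals.** A bounded linear operator $B:\mathcal{L}^\beta(X_1,\dots,X_n)\to\mathcal{L}^\theta(Z_1,\dots,Z_m)$ preserves $\Sigma$ if its adjoint $B^*:(Z_1\otimes\cdots\otimes Z_m,\theta)^{**}\to(X_1\otimes\cdots\otimes X_n,\beta)^{**}$ maps the canonical image of $\Sigma_{Z_1,\dots,Z_m}$ into the canonical image of $\Sigma_{X_1,\dots,X_n}$. A $\Sigma$-tensor norm on duals $\nu$ assigns to each election $(n,X_1,\dots,X_n,Y,\beta)$ a norm $\nu_\beta$ on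 $\mathcal{L}^\beta(X_1,\dots,X_n)\otimes Y$ such that: (D1) $\nu_\beta(\varphi\otimes y)\le\|\varphi\|_\beta\|y\|$; (D2) for $p,q\in\Sigma_{X_1,\dots,X_n}$, $y^*\in Y^*$, the functional $\varphi\otimes y\mapsto(f_\varphi(p)-f_\varphi(q))y^*(y)$ is bounded with norm $\le\beta(p-q)\|y^*\|$; (D3) if $B:\mathcal{L}^\beta(X_1,\dots,X_n)\to\mathcal{L}^\theta(Z_1,\dots,Z_m)$ is bounded linear and preserves $\Sigma$ and $C:Y\to W$ is bounded linear, then $B\otimes C:(\mathcal{L}^\beta(X_1,\dots,X_n)\otimes Y,\nu_\beta)\to(\mathcal{L}^\theta(Z_1,\dots,Z_m)\otimes W,\nu_\theta)$ is bounded with norm $\le\|B\|\|C\|$. **Associated.** $[\mathcal{A},A]$ and $\nu$ are associated if, for every election $(n,E_1,\dots,E_n,F,\beta)$ of finite dimensional normed spaces, $\varphi\otimes y\mapsto\varphi\cdot y$ is an isometric isomorphism of $(\mathcal{L}^\beta(E_1,\dots,E_n)\otimes F,\nu_\beta)$ onto $\mathcal{A}^\beta(E_1,\dots,E_n;F)$. **The $\alpha$ defined by $\nu$.** For finite dimensional normed spaces, $\alpha^\beta$ is the norm on $E_1\otimes\cdots\otimes E_n\otimes F$ given by $(E_1\otimes\cdots\otimes E_n\otimes F,\alpha^\beta):=(\mathcal{L}^\beta(E_1,\dots,E_n)\otimes F^*,\nu_\beta)^*$, with the pairing $\langle x^1\otimes\cdots\otimes x^n\otimes y,\varphi\otimes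 y^*\rangle=\varphi(x^1,\dots,x^n)y^*(y)$. For an election of Banach spaces and $u\in X_1\otimes\cdots\otimes X_n\otimes Y$, $\alpha^\beta(u;X_1,\dots,X_n,Y):=\inf\alpha^{\beta|}(u;E_1,\dots,E_n,F)$, the infimum over all $E_i\in\mathcal{F}(X_i)$, $F\in\mathcal{F}(Y)$ with $u\in E_1\otimes\cdots\otimes E_n\otimes F$. *)

theory Defs
  imports "HOL-Analysis.Analysis" "HOL-Algebra.Module" "HOL-Algebra.AbelCoset"
begin

section \<open>Scalars, normed spaces, bounded operators\<close>

text \<open>The scalar field is the real or the complex field, as a type class with the two
  instances below.\<close>

class real_or_complex = real_normed_field +
  assumes real_or_complex:
    "(\<forall>z. \<exists>a. z = a *\<^sub>R 1) \<or>
     (\<exists>i. i * i = - 1 \<and>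
        (\<forall>z. \<exists>a b. z = a *\<^sub>R 1 + b *\<^sub>R i \<and> norm z = sqrt (a\<^sup>2 + b\<^sup>2)))"

instance real :: real_or_complex
  by standard auto

instance complex :: real_or_complex
proof
  have "\<i> * \<i> = - 1 \<and> (\<forall>z. \<exists>a b. z = a *\<^sub>R 1 + b *\<^sub>R \<i> \<and> norm z = sqrt (a\<^sup>2 + b\<^sup>2))"
    by (auto simp: complex_eq_iff cmod_def)
  then show "(\<forall>z::complex. \<exists>a. z = a *\<^sub>R 1) \<or>
     (\<exists>i::complex. i * i = - 1 \<and>
        (\<forall>z. \<exists>a b. z = a *\<^sub>R 1 + b *\<^sub>R i \<and> norm z = sqrt (a\<^sup>2 + b\<^sup>2)))"
    by blast
qed

definition scalar_ring :: "'k::real_or_complex ring" where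
  "scalar_ring = \<lparr>carrier = UNIV, mult = (*), one = 1, zero = 0, add = (+)\<rparr>"

text \<open>Normed spaces are records with an explicit carrier, so that one can quantify over all
  Banach spaces whose underlying set is a subset of a given type; a theorem about an arbitrary
  such type is a theorem about every set of Banach spaces.  The ring fields \<open>mult\<close> and \<open>one\<close>,
  inherited from the library's module record, play no role.\<close>

record ('k, 'a) nspace = "('k, 'a) module" +
  nrm :: "'a \<Rightarrow> real"

definition is_norm :: "('k::real_or_complex, 'a) nspace \<Rightarrow> ('a \<Rightarrow> real) \<Rightarrow> bool" where
  "is_norm V N \<longleftrightarrow>
     (\<forall>v\<in>carrier V. 0 \<le> N v \<and> (N v = 0 \<longleftrightarrow> v = \<zero>\<^bsub>V\<^esub>)) \<and>
     (\<forall>c. \<forall>v\<in>carrier V. N (c \<odot>\<^bsub>V\<^esub> v) = norm c * N v) \<and>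
     (\<forall>v\<in>carrier V. \<forall>w\<in>carrier V. N (v \<oplus>\<^bsub>V\<^esub> w) \<le> N v + N w)"

definition normed_space :: "('k::real_or_complex, 'a) nspace \<Rightarrow> bool" where
  "normed_space V \<longleftrightarrow> module scalar_ring V \<and> is_norm V (nrm V)"

text \<open>The library's locale of metric spaces constrains the distance function also off the carrier.\<close>

definition ndist :: "('k::real_or_complex, 'a) nspace \<Rightarrow> 'a \<Rightarrow> 'a \<Rightarrow> real" where
  "ndist V x y = (if x \<in> carrier V \<and> y \<in> carrier V then nrm V (x \<ominus>\<^bsub>V\<^esub> y) else 0)"

definition banach_space :: "('k::real_or_complex, 'a) nspace \<Rightarrow> bool" where
  "banach_space V \<longleftrightarrow> normed_space V \<and> Metric_space.mcomplete (carrier V) (ndist V)"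

definition fin_dim :: "('k::real_or_complex, 'a) nspace \<Rightarrow> bool" where
  "fin_dim V \<longleftrightarrow> (\<exists>B. finite B \<and> B \<subseteq> carrier V \<and>
     (\<forall>S. submodule S scalar_ring V \<and> B \<subseteq> S \<longrightarrow> S = carrier V))"

text \<open>The sets \<open>\<F>(X)\<close> (each subspace with the induced norm) and \<open>\<C>\<F>(Y)\<close>.\<close>

definition fin_subspaces :: "('k::real_or_complex, 'a) nspace \<Rightarrow> ('k, 'a) nspace set" where
  "fin_subspaces X =
     {X\<lparr>carrier := S\<rparr> | S. submodule S scalar_ring X \<and> fin_dim (X\<lparr>carrier := S\<rparr>)}"

definition cofin_subspaces :: "('k::real_or_complex, 'a) nspace \<Rightarrow> 'a set set" where
  "cofin_subspaces Y = {L. submodule L scalar_ring Y \<and>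
     closedin (Metric_space.mtopology (carrier Y) (ndist Y)) L \<and>
     (\<exists>B. finite B \<and> B \<subseteq> carrier Y \<and>
        (\<forall>S. submodule S scalar_ring Y \<and> L \<union> B \<subseteq> S \<longrightarrow> S = carrier Y))}"

text \<open>The quotient \<open>Y/L\<close>.  To stay within the type of \<open>Y\<close>, each coset is replaced by a chosen
  element of it; \<open>quot_map Y L\<close> is the quotient map \<open>Q\<^sub>L\<close>.\<close>

definition quot_map :: "('k::real_or_complex, 'a) nspace \<Rightarrow> 'a set \<Rightarrow> 'a \<Rightarrow> 'a" where
  "quot_map Y L y = (SOME z. z \<in> L +>\<^bsub>Y\<^esub> y)"

definition quot_space :: "('k::real_or_complex, 'a) nspace \<Rightarrow> 'a set \<Rightarrow> ('k, 'a) nspace" where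
  "quot_space Y L =
     \<lparr>carrier = quot_map Y L ` carrier Y, mult = undefined, one = undefined,
      zero = quot_map Y L \<zero>\<^bsub>Y\<^esub>, add = (\<lambda>a b. quot_map Y L (a \<oplus>\<^bsub>Y\<^esub> b)),
      smult = (\<lambda>c a. quot_map Y L (c \<odot>\<^bsub>Y\<^esub> a)),
      nrm = (\<lambda>a. INF z\<in>L +>\<^bsub>Y\<^esub> a. nrm Y z)\<rparr>"

definition is_lin ::
  "('k::real_or_complex, 'a) nspace \<Rightarrow> ('k, 'b) nspace \<Rightarrow> ('a \<Rightarrow> 'b) \<Rightarrow> bool" where
  "is_lin V W f \<longleftrightarrow> f \<in> carrier V \<rightarrow> carrier W \<and>
     (\<forall>v\<in>carrier V. \<forall>w\<in>carrier V. f (v \<oplus>\<^bsub>V\<^esub> w) = f v \<oplus>\<^bsub>W\<^esub> f w) \<and>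
     (\<forall>c. \<forall>v\<in>carrier V. f (c \<odot>\<^bsub>V\<^esub> v) = c \<odot>\<^bsub>W\<^esub> f v)"

definition bounded_op ::
  "('k::real_or_complex, 'a) nspace \<Rightarrow> ('k, 'b) nspace \<Rightarrow> ('a \<Rightarrow> 'b) \<Rightarrow> bool" where
  "bounded_op V W f \<longleftrightarrow> is_lin V W f \<and> (\<exists>c. \<forall>v\<in>carrier V. nrm W (f v) \<le> c * nrm V v)"

definition opnorm ::
  "('k::real_or_complex, 'a) nspace \<Rightarrow> ('k, 'b) nspace \<Rightarrow> ('a \<Rightarrow> 'b) \<Rightarrow> real" where
  "opnorm V W f = (SUP v\<in>{v\<in>carrier V. nrm V v \<le> 1}. nrm W (f v))"

definition isometric_iso ::
  "('k::real_or_complex, 'a) nspace \<Rightarrow> ('k, 'b) nspace \<Rightarrow> ('a \<Rightarrow> 'b) \<Rightarrow> bool" where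
  "isometric_iso V W f \<longleftrightarrow> is_lin V W f \<and> bij_betw f (carrier V) (carrier W) \<and>
     (\<forall>v\<in>carrier V. nrm W (f v) = nrm V v)"

definition scalar_space :: "('k::real_or_complex, 'k) nspace" where
  "scalar_space = \<lparr>carrier = UNIV, mult = (*), one = 1, zero = 0, add = (+), smult = (*), nrm = norm\<rparr>"

text \<open>A space of \<open>W\<close>-valued functions with pointwise operations.  Functions on a set \<open>D\<close> are
  represented throughout by functions on the whole type that vanish outside \<open>D\<close>.\<close>

definition fun_space ::
  "('k::real_or_complex, 'b) nspace \<Rightarrow> ('a \<Rightarrow> 'b) set \<Rightarrow> (('a \<Rightarrow> 'b) \<Rightarrow> real) \<Rightarrow> ('k, 'a \<Rightarrow> 'b) nspace" where
  "fun_space W F N =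
     \<lparr>carrier = F, mult = undefined, one = undefined, zero = (\<lambda>_. \<zero>\<^bsub>W\<^esub>),
      add = (\<lambda>f g d. f d \<oplus>\<^bsub>W\<^esub> g d), smult = (\<lambda>c f d. c \<odot>\<^bsub>W\<^esub> f d), nrm = N\<rparr>"

definition lin_forms :: "('k::real_or_complex, 'a) nspace \<Rightarrow> ('a \<Rightarrow> 'k) set" where
  "lin_forms V = {f. is_lin V scalar_space f \<and> (\<forall>v. v \<notin> carrier V \<longrightarrow> f v = 0)}"

definition dual :: "('k::real_or_complex, 'a) nspace \<Rightarrow> ('k, 'a \<Rightarrow> 'k) nspace" where
  "dual V = fun_space scalar_space {f\<in>lin_forms V. bounded_op V scalar_space f} (opnorm V scalar_space)"

text \<open>\<open>(W, J)\<close> is a copy of the dual of \<open>V\<close>; the point is that \<open>W\<close> may live in a prescribed type.\<close>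

definition dual_copy ::
  "('k::real_or_complex, 'a) nspace \<Rightarrow> ('k, 'b) nspace \<Rightarrow> ('b \<Rightarrow> 'a \<Rightarrow> 'k) \<Rightarrow> bool" where
  "dual_copy V W J \<longleftrightarrow> banach_space W \<and> isometric_iso W (dual V) J"


section \<open>Algebraic tensor products\<close>

text \<open>For a set \<open>D\<close> (of tuples) and the space \<open>M\<close> of all multilinear forms on \<open>D\<close>, the tensor
  product is realised as the linear span of the evaluations \<open>\<phi> \<mapsto> \<phi> d\<close> in the algebraic dual
  of \<open>M\<close>; the evaluation at \<open>(x\<^sup>1, \<dots>, x\<^sup>n)\<close> is the decomposable tensor
  \<open>x\<^sup>1 \<otimes> \<cdots> \<otimes> x\<^sup>n\<close>.  The parameter \<open>N\<close> of \<open>tens\<close> is the norm put on it.\<close>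

definition elem_tensor :: "('d \<Rightarrow> 'k::real_or_complex) set \<Rightarrow> 'd \<Rightarrow> ('d \<Rightarrow> 'k) \<Rightarrow> 'k" where
  "elem_tensor M d = (\<lambda>\<phi>. if \<phi> \<in> M then \<phi> d else 0)"

definition tens :: "'d set \<Rightarrow> ('d \<Rightarrow> 'k::real_or_complex) set \<Rightarrow> ((('d \<Rightarrow> 'k) \<Rightarrow> 'k) \<Rightarrow> real) \<Rightarrow>
    ('k, ('d \<Rightarrow> 'k) \<Rightarrow> 'k) nspace" where
  "tens D M N = fun_space scalar_space
     {\<lambda>\<phi>. \<Sum>(c, d)\<leftarrow>cds. c * elem_tensor M d \<phi> | cds. snd ` set cds \<subseteq> D} N"

text \<open>The linearization of a multilinear \<open>T\<close>, given by the universal property.  Only its values on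
  the tensor product are determined (and used).\<close>

definition linearize :: "'d set \<Rightarrow> ('d \<Rightarrow> 'k::real_or_complex) set \<Rightarrow> ('k, 'b) nspace \<Rightarrow> ('d \<Rightarrow> 'b) \<Rightarrow>
    (('d \<Rightarrow> 'k) \<Rightarrow> 'k) \<Rightarrow> 'b" where
  "linearize D M W T = (SOME L. is_lin (tens D M (\<lambda>_. 0)) W L \<and> (\<forall>d\<in>D. L (elem_tensor M d) = T d))"

text \<open>Tuples in \<open>X\<^sub>1 \<times> \<cdots> \<times> X\<^sub>n\<close> are lists, and multilinear maps on them.\<close>

definition tuples :: "('k::real_or_complex, 'a) nspace list \<Rightarrow> 'a list set" where
  "tuples Xs = listset (map carrier Xs)"

definition ml_maps ::
  "('k::real_or_complex, 'a) nspace list \<Rightarrow> ('k, 'b) nspace \<Rightarrow> ('a list \<Rightarrow> 'b) set" where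
  "ml_maps Xs W = {T. T \<in> tuples Xs \<rightarrow> carrier W \<and> (\<forall>x. x \<notin> tuples Xs \<longrightarrow> T x = \<zero>\<^bsub>W\<^esub>) \<and>
     (\<forall>x\<in>tuples Xs. \<forall>i<length Xs. is_lin (Xs ! i) W (\<lambda>a. T (x[i := a])))}"

abbreviation forms :: "('k::real_or_complex, 'a) nspace list \<Rightarrow> ('a list \<Rightarrow> 'k) set" where
  "forms Xs \<equiv> ml_maps Xs scalar_space"

abbreviation tensor :: "('k::real_or_complex, 'a) nspace list \<Rightarrow> ((('a list \<Rightarrow> 'k) \<Rightarrow> 'k) \<Rightarrow> real) \<Rightarrow>
    ('k, ('a list \<Rightarrow> 'k) \<Rightarrow> 'k) nspace" where
  "tensor Xs N \<equiv> tens (tuples Xs) (forms Xs) N"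

text \<open>Given the forms \<open>M\<close> in the first variable(s), the forms that are in addition linear in a
  further variable from \<open>Y\<close>.  With \<open>M = forms Xs\<close> this yields
  \<open>X\<^sub>1 \<otimes> \<cdots> \<otimes> X\<^sub>n \<otimes> Y\<close>, with \<open>M = lin_forms V\<close> it yields \<open>V \<otimes> Y\<close>.\<close>

definition forms_with ::
  "('d \<Rightarrow> 'k::real_or_complex) set \<Rightarrow> ('k, 'b) nspace \<Rightarrow> ('d \<times> 'b \<Rightarrow> 'k) set" where
  "forms_with M Y = {\<phi>. (\<forall>y\<in>carrier Y. (\<lambda>d. \<phi> (d, y)) \<in> M) \<and> (\<forall>d. (\<lambda>y. \<phi> (d, y)) \<in> lin_forms Y)}"

abbreviation tensor_with :: "('k::real_or_complex, 'a) nspace list \<Rightarrow> ('k, 'b) nspace \<Rightarrow>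
    ((('a list \<times> 'b \<Rightarrow> 'k) \<Rightarrow> 'k) \<Rightarrow> real) \<Rightarrow> ('k, ('a list \<times> 'b \<Rightarrow> 'k) \<Rightarrow> 'k) nspace" where
  "tensor_with Xs Y N \<equiv> tens (tuples Xs \<times> carrier Y) (forms_with (forms Xs) Y) N"

abbreviation tensor2 :: "('k::real_or_complex, 'a) nspace \<Rightarrow> ('k, 'b) nspace \<Rightarrow>
    ((('a \<times> 'b \<Rightarrow> 'k) \<Rightarrow> 'k) \<Rightarrow> real) \<Rightarrow> ('k, ('a \<times> 'b \<Rightarrow> 'k) \<Rightarrow> 'k) nspace" where
  "tensor2 V Y N \<equiv> tens (carrier V \<times> carrier Y) (forms_with (lin_forms V) Y) N"

abbreviation otimes :: "('k::real_or_complex, 'a) nspace list \<Rightarrow> 'a list \<Rightarrow> ('a list \<Rightarrow> 'k) \<Rightarrow> 'k" where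
  "otimes Xs x \<equiv> elem_tensor (forms Xs) x"

abbreviation otimes_with :: "('k::real_or_complex, 'a) nspace list \<Rightarrow> ('k, 'b) nspace \<Rightarrow>
    'a list \<Rightarrow> 'b \<Rightarrow> ('a list \<times> 'b \<Rightarrow> 'k) \<Rightarrow> 'k" where
  "otimes_with Xs Y x y \<equiv> elem_tensor (forms_with (forms Xs) Y) (x, y)"

abbreviation otimes2 :: "('k::real_or_complex, 'a) nspace \<Rightarrow> ('k, 'b) nspace \<Rightarrow>
    'a \<Rightarrow> 'b \<Rightarrow> ('a \<times> 'b \<Rightarrow> 'k) \<Rightarrow> 'k" where
  "otimes2 V Y v y \<equiv> elem_tensor (forms_with (lin_forms V) Y) (v, y)"

abbreviation lin_ext :: "('k::real_or_complex, 'a) nspace list \<Rightarrow> ('k, 'b) nspace \<Rightarrow>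
    ('a list \<Rightarrow> 'b) \<Rightarrow> (('a list \<Rightarrow> 'k) \<Rightarrow> 'k) \<Rightarrow> 'b" where
  "lin_ext Xs W T \<equiv> linearize (tuples Xs) (forms Xs) W T"

abbreviation lin_ext_with :: "('k::real_or_complex, 'a) nspace list \<Rightarrow> ('k, 'b) nspace \<Rightarrow>
    ('k, 'c) nspace \<Rightarrow> ('a list \<Rightarrow> 'b \<Rightarrow> 'c) \<Rightarrow> (('a list \<times> 'b \<Rightarrow> 'k) \<Rightarrow> 'k) \<Rightarrow> 'c" where
  "lin_ext_with Xs Y W T \<equiv>
     linearize (tuples Xs \<times> carrier Y) (forms_with (forms Xs) Y) W (\<lambda>(x, y). T x y)"

abbreviation lin_ext2 :: "('k::real_or_complex, 'a) nspace \<Rightarrow> ('k, 'b) nspace \<Rightarrow>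
    ('k, 'c) nspace \<Rightarrow> ('a \<Rightarrow> 'b \<Rightarrow> 'c) \<Rightarrow> (('a \<times> 'b \<Rightarrow> 'k) \<Rightarrow> 'k) \<Rightarrow> 'c" where
  "lin_ext2 V Y W T \<equiv>
     linearize (carrier V \<times> carrier Y) (forms_with (lin_forms V) Y) W (\<lambda>(v, y). T v y)"

text \<open>For subspaces \<open>E\<^sub>i \<subseteq> X\<^sub>i\<close> and \<open>F \<subseteq> Y\<close>: the canonical inclusions of
  \<open>E\<^sub>1 \<otimes> \<cdots> \<otimes> E\<^sub>n\<close> into \<open>X\<^sub>1 \<otimes> \<cdots> \<otimes> X\<^sub>n\<close> and of
  \<open>E\<^sub>1 \<otimes> \<cdots> \<otimes> E\<^sub>n \<otimes> F\<close> into \<open>X\<^sub>1 \<otimes> \<cdots> \<otimes> X\<^sub>n \<otimes> Y\<close>, and the restriction of a norm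
  along the former.\<close>

definition tensor_incl :: "('k::real_or_complex, 'a) nspace list \<Rightarrow> ('k, 'a) nspace list \<Rightarrow>
    (('a list \<Rightarrow> 'k) \<Rightarrow> 'k) \<Rightarrow> (('a list \<Rightarrow> 'k) \<Rightarrow> 'k)" where
  "tensor_incl Es Xs = lin_ext Es (tensor Xs (\<lambda>_. 0)) (otimes Xs)"

definition tensor_with_incl :: "('k::real_or_complex, 'a) nspace list \<Rightarrow> ('k, 'b) nspace \<Rightarrow>
    ('k, 'a) nspace list \<Rightarrow> ('k, 'b) nspace \<Rightarrow>
    (('a list \<times> 'b \<Rightarrow> 'k) \<Rightarrow> 'k) \<Rightarrow> (('a list \<times> 'b \<Rightarrow> 'k) \<Rightarrow> 'k)" where
  "tensor_with_incl Es F Xs Y = lin_ext_with Es F (tensor_with Xs Y (\<lambda>_. 0)) (otimes_with Xs Y)"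

definition restr_norm :: "('k::real_or_complex, 'a) nspace list \<Rightarrow> ('k, 'a) nspace list \<Rightarrow>
    ((('a list \<Rightarrow> 'k) \<Rightarrow> 'k) \<Rightarrow> real) \<Rightarrow> (('a list \<Rightarrow> 'k) \<Rightarrow> 'k) \<Rightarrow> real" where
  "restr_norm Es Xs \<beta> = (\<lambda>u. \<beta> (tensor_incl Es Xs u))"


section \<open>Elections\<close>

definition inj_norm :: "('k::real_or_complex, 'a) nspace list \<Rightarrow> (('a list \<Rightarrow> 'k) \<Rightarrow> 'k) \<Rightarrow> real" where
  "inj_norm Xs u =
     (SUP f\<in>listset (map (\<lambda>X. {g\<in>carrier (dual X). nrm (dual X) g \<le> 1}) Xs).
        norm (lin_ext Xs scalar_space (\<lambda>x. \<Prod>i<length Xs. (f ! i) (x ! i)) u))"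

definition proj_norm :: "('k::real_or_complex, 'a) nspace list \<Rightarrow> (('a list \<Rightarrow> 'k) \<Rightarrow> 'k) \<Rightarrow> real" where
  "proj_norm Xs u =
     Inf {\<Sum>x\<leftarrow>xs. \<Prod>i<length Xs. nrm (Xs ! i) (x ! i) | xs.
            set xs \<subseteq> tuples Xs \<and> u = (\<lambda>\<phi>. \<Sum>x\<leftarrow>xs. otimes Xs x \<phi>)}"

definition reasonable :: "('k::real_or_complex, 'a) nspace list \<Rightarrow> ((('a list \<Rightarrow> 'k) \<Rightarrow> 'k) \<Rightarrow> real) \<Rightarrow> bool" where
  "reasonable Xs \<beta> \<longleftrightarrow> is_norm (tensor Xs \<beta>) \<beta> \<and>
     (\<forall>u\<in>carrier (tensor Xs \<beta>). inj_norm Xs u \<le> \<beta> u \<and> \<beta> u \<le> proj_norm Xs u)"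

text \<open>The number \<open>n\<close> of factors is the length of the list.\<close>

definition election :: "('k::real_or_complex, 'a) nspace list \<Rightarrow> ('k, 'a) nspace \<Rightarrow>
    ((('a list \<Rightarrow> 'k) \<Rightarrow> 'k) \<Rightarrow> real) \<Rightarrow> bool" where
  "election Xs Y \<beta> \<longleftrightarrow> Xs \<noteq> [] \<and> (\<forall>X\<in>set Xs. banach_space X) \<and> banach_space Y \<and> reasonable Xs \<beta>"

definition fin_election :: "('k::real_or_complex, 'a) nspace list \<Rightarrow> ('k, 'a) nspace \<Rightarrow>
    ((('a list \<Rightarrow> 'k) \<Rightarrow> 'k) \<Rightarrow> real) \<Rightarrow> bool" where
  "fin_election Es F \<beta> \<longleftrightarrow> Es \<noteq> [] \<and> (\<forall>E\<in>set Es. normed_space E \<and> fin_dim E) \<and>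
     normed_space F \<and> fin_dim F \<and> reasonable Es \<beta>"

definition Sig :: "('k::real_or_complex, 'a) nspace list \<Rightarrow> (('a list \<Rightarrow> 'k) \<Rightarrow> 'k) set" where
  "Sig Xs = otimes Xs ` tuples Xs"

text \<open>\<open>f\<^sub>T\<close>, which is well defined on \<open>Sig Xs\<close> for multilinear \<open>T\<close>.\<close>

definition f_of :: "('k::real_or_complex, 'a) nspace list \<Rightarrow> ('a list \<Rightarrow> 'b) \<Rightarrow> (('a list \<Rightarrow> 'k) \<Rightarrow> 'k) \<Rightarrow> 'b" where
  "f_of Xs T p = T (SOME x. x \<in> tuples Xs \<and> otimes Xs x = p)"

definition lip :: "('k::real_or_complex, 'a) nspace list \<Rightarrow> ('k, 'b) nspace \<Rightarrow>
    ((('a list \<Rightarrow> 'k) \<Rightarrow> 'k) \<Rightarrow> real) \<Rightarrow> ('a list \<Rightarrow> 'b) \<Rightarrow> ereal" where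
  "lip Xs Y \<beta> T = Inf {ereal c | c. 0 \<le> c \<and>
     (\<forall>p\<in>Sig Xs. \<forall>q\<in>Sig Xs. nrm Y (f_of Xs T p \<ominus>\<^bsub>Y\<^esub> f_of Xs T q) \<le> c * \<beta> (p \<ominus>\<^bsub>tensor Xs \<beta>\<^esub> q))}"

definition bounded_ml_maps ::
  "('k::real_or_complex, 'a) nspace list \<Rightarrow> ('k, 'b) nspace \<Rightarrow> ('a list \<Rightarrow> 'b) set" where
  "bounded_ml_maps Xs Y = {T\<in>ml_maps Xs Y.
     \<exists>c. \<forall>x\<in>tuples Xs. nrm Y (T x) \<le> c * (\<Prod>i<length Xs. nrm (Xs ! i) (x ! i))}"

text \<open>The space \<open>\<L>\<^sup>\<beta>(X\<^sub>1, \<dots>, X\<^sub>n)\<close>.\<close>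

definition beta_forms :: "('k::real_or_complex, 'a) nspace list \<Rightarrow> ((('a list \<Rightarrow> 'k) \<Rightarrow> 'k) \<Rightarrow> real) \<Rightarrow>
    ('k, 'a list \<Rightarrow> 'k) nspace" where
  "beta_forms Xs \<beta> = fun_space scalar_space
     {\<phi>\<in>forms Xs. bounded_op (tensor Xs \<beta>) scalar_space (lin_ext Xs scalar_space \<phi>)}
     (\<lambda>\<phi>. opnorm (tensor Xs \<beta>) scalar_space (lin_ext Xs scalar_space \<phi>))"


section \<open>Sigma-ideals\<close>

text \<open>A pair consisting of the classes \<open>\<A>\<^sup>\<beta>(X\<^sub>1, \<dots>, X\<^sub>n; Y)\<close> and the norms on them.\<close>

type_synonym ('k, 'u) ideal_sets =
  "('k, 'u) nspace list \<Rightarrow> ('k, 'u) nspace \<Rightarrow> ((('u list \<Rightarrow> 'k) \<Rightarrow> 'k) \<Rightarrow> real) \<Rightarrow> ('u list \<Rightarrow> 'u) set"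

type_synonym ('k, 'u) ideal_norms =
  "('k, 'u) nspace list \<Rightarrow> ('k, 'u) nspace \<Rightarrow> ((('u list \<Rightarrow> 'k) \<Rightarrow> 'k) \<Rightarrow> real) \<Rightarrow> ('u list \<Rightarrow> 'u) \<Rightarrow> real"

abbreviation ideal_space :: "('k::real_or_complex, 'u) ideal_sets \<Rightarrow> ('k, 'u) ideal_norms \<Rightarrow>
    ('k, 'u) nspace list \<Rightarrow> ('k, 'u) nspace \<Rightarrow> ((('u list \<Rightarrow> 'k) \<Rightarrow> 'k) \<Rightarrow> real) \<Rightarrow>
    ('k, 'u list \<Rightarrow> 'u) nspace" where
  "ideal_space \<A> A Xs Y \<beta> \<equiv> fun_space Y (\<A> Xs Y \<beta>) (A Xs Y \<beta>)"

definition sigma_op :: "('k::real_or_complex, 'a) nspace list \<Rightarrow> ((('a list \<Rightarrow> 'k) \<Rightarrow> 'k) \<Rightarrow> real) \<Rightarrow>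
    ('k, 'a) nspace list \<Rightarrow> ((('a list \<Rightarrow> 'k) \<Rightarrow> 'k) \<Rightarrow> real) \<Rightarrow>
    ('a list \<Rightarrow> ('a list \<Rightarrow> 'k) \<Rightarrow> 'k) \<Rightarrow> bool" where
  "sigma_op Zs \<theta> Xs \<beta> R \<longleftrightarrow> R \<in> ml_maps Zs (tensor Xs \<beta>) \<and> R ` tuples Zs \<subseteq> Sig Xs \<and>
     bounded_op (tensor Zs \<theta>) (tensor Xs \<beta>) (lin_ext Zs (tensor Xs \<beta>) R)"

text \<open>The multilinear map \<open>S f\<^sub>T R\<close> into \<open>W\<close>.\<close>

definition sigma_comp :: "('k::real_or_complex, 'a) nspace list \<Rightarrow> ('k, 'c) nspace \<Rightarrow>
    ('k, 'a) nspace list \<Rightarrow> ('b \<Rightarrow> 'c) \<Rightarrow> ('a list \<Rightarrow> 'b) \<Rightarrow> ('a list \<Rightarrow> ('a list \<Rightarrow> 'k) \<Rightarrow> 'k) \<Rightarrow>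
    'a list \<Rightarrow> 'c" where
  "sigma_comp Zs W Xs S T R = (\<lambda>z. if z \<in> tuples Zs then S (f_of Xs T (R z)) else \<zero>\<^bsub>W\<^esub>)"

definition sigma_ideal :: "('k::real_or_complex, 'u) ideal_sets \<Rightarrow> ('k, 'u) ideal_norms \<Rightarrow> bool" where
  "sigma_ideal \<A> A \<longleftrightarrow>
     (\<forall>Xs Y \<beta>. election Xs Y \<beta> \<longrightarrow>
        \<A> Xs Y \<beta> \<subseteq> bounded_ml_maps Xs Y \<and> banach_space (ideal_space \<A> A Xs Y \<beta>)) \<and>
     (\<forall>Xs Y \<beta>. election Xs Y \<beta> \<longrightarrow>
        (\<forall>\<phi>\<in>carrier (beta_forms Xs \<beta>). \<forall>y\<in>carrier Y.
           (\<lambda>x. \<phi> x \<odot>\<^bsub>Y\<^esub> y) \<in> \<A> Xs Y \<beta> \<and>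
           A Xs Y \<beta> (\<lambda>x. \<phi> x \<odot>\<^bsub>Y\<^esub> y) \<le> nrm (beta_forms Xs \<beta>) \<phi> * nrm Y y)) \<and>
     (\<forall>Xs Y \<beta>. election Xs Y \<beta> \<longrightarrow>
        (\<forall>T\<in>\<A> Xs Y \<beta>. lip Xs Y \<beta> T \<le> ereal (A Xs Y \<beta> T))) \<and>
     (\<forall>Xs Y \<beta> Zs W \<theta> R S. election Xs Y \<beta> \<and> election Zs W \<theta> \<and>
        sigma_op Zs \<theta> Xs \<beta> R \<and> bounded_op Y W S \<longrightarrow>
        (\<forall>T\<in>\<A> Xs Y \<beta>.
           sigma_comp Zs W Xs S T R \<in> \<A> Zs W \<theta> \<and>
           A Zs W \<theta> (sigma_comp Zs W Xs S T R)
             \<le> opnorm (tensor Zs \<theta>) (tensor Xs \<beta>) (lin_ext Zs (tensor Xs \<beta>) R)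
                * A Xs Y \<beta> T * opnorm Y W S))"

text \<open>The operators \<open>Q\<^sub>L f\<^sub>T I\<^bsub>E\<^sub>1,\<dots>,E\<^sub>n\<^esub>\<close> below have finite dimensional domains and range, and all
  such operators belong to any ideal.\<close>

definition A_max :: "('k::real_or_complex, 'u) ideal_norms \<Rightarrow> ('k, 'u) nspace list \<Rightarrow> ('k, 'u) nspace \<Rightarrow>
    ((('u list \<Rightarrow> 'k) \<Rightarrow> 'k) \<Rightarrow> real) \<Rightarrow> ('u list \<Rightarrow> 'u) \<Rightarrow> ereal" where
  "A_max A Xs Y \<beta> T =
     (SUP (Es, L)\<in>listset (map fin_subspaces Xs) \<times> cofin_subspaces Y.
        ereal (A Es (quot_space Y L) (restr_norm Es Xs \<beta>)
          (sigma_comp Es (quot_space Y L) Xs (quot_map Y L) T (otimes Xs))))"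

definition maximal_ideal :: "('k::real_or_complex, 'u) ideal_sets \<Rightarrow> ('k, 'u) ideal_norms \<Rightarrow> bool" where
  "maximal_ideal \<A> A \<longleftrightarrow> (\<forall>Xs Y \<beta>. election Xs Y \<beta> \<longrightarrow>
     \<A> Xs Y \<beta> = {T\<in>ml_maps Xs Y. A_max A Xs Y \<beta> T < \<infinity>} \<and>
     (\<forall>T\<in>\<A> Xs Y \<beta>. ereal (A Xs Y \<beta> T) = A_max A Xs Y \<beta> T))"


section \<open>Sigma-tensor norms on duals\<close>

type_synonym ('k, 'u) dual_norms =
  "('k, 'u) nspace list \<Rightarrow> ('k, 'u) nspace \<Rightarrow> ((('u list \<Rightarrow> 'k) \<Rightarrow> 'k) \<Rightarrow> real) \<Rightarrow>
   ((('u list \<Rightarrow> 'k) \<times> 'u \<Rightarrow> 'k) \<Rightarrow> 'k) \<Rightarrow> real"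

abbreviation nu_space :: "('k::real_or_complex, 'u) dual_norms \<Rightarrow> ('k, 'u) nspace list \<Rightarrow>
    ('k, 'u) nspace \<Rightarrow> ((('u list \<Rightarrow> 'k) \<Rightarrow> 'k) \<Rightarrow> real) \<Rightarrow>
    ('k, (('u list \<Rightarrow> 'k) \<times> 'u \<Rightarrow> 'k) \<Rightarrow> 'k) nspace" where
  "nu_space \<nu> Xs Y \<beta> \<equiv> tensor2 (beta_forms Xs \<beta>) Y (\<nu> Xs Y \<beta>)"

text \<open>Through the identification of \<open>\<L>\<^sup>\<beta>(X\<^sub>1, \<dots>, X\<^sub>n)\<close> with the dual of
  \<open>(X\<^sub>1 \<otimes> \<cdots> \<otimes> X\<^sub>n, \<beta>)\<close>, the bidual of the latter is \<open>dual (beta_forms Xs \<beta>)\<close>;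
  \<open>bidual_emb\<close> is the canonical embedding into it.\<close>

definition bidual_emb :: "('k::real_or_complex, 'a) nspace list \<Rightarrow> ((('a list \<Rightarrow> 'k) \<Rightarrow> 'k) \<Rightarrow> real) \<Rightarrow>
    (('a list \<Rightarrow> 'k) \<Rightarrow> 'k) \<Rightarrow> ('a list \<Rightarrow> 'k) \<Rightarrow> 'k" where
  "bidual_emb Xs \<beta> u =
     (\<lambda>\<phi>. if \<phi> \<in> carrier (beta_forms Xs \<beta>) then lin_ext Xs scalar_space \<phi> u else 0)"

definition adjoint :: "('k::real_or_complex, 'a) nspace \<Rightarrow> ('a \<Rightarrow> 'b) \<Rightarrow> ('b \<Rightarrow> 'k) \<Rightarrow> 'a \<Rightarrow> 'k" where
  "adjoint V B \<psi> = (\<lambda>v. if v \<in> carrier V then \<psi> (B v) else 0)"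

definition preserves_sigma :: "('k::real_or_complex, 'a) nspace list \<Rightarrow> ((('a list \<Rightarrow> 'k) \<Rightarrow> 'k) \<Rightarrow> real) \<Rightarrow>
    ('k, 'a) nspace list \<Rightarrow> ((('a list \<Rightarrow> 'k) \<Rightarrow> 'k) \<Rightarrow> real) \<Rightarrow>
    (('a list \<Rightarrow> 'k) \<Rightarrow> ('a list \<Rightarrow> 'k)) \<Rightarrow> bool" where
  "preserves_sigma Xs \<beta> Zs \<theta> B \<longleftrightarrow>
     adjoint (beta_forms Xs \<beta>) B ` bidual_emb Zs \<theta> ` Sig Zs \<subseteq> bidual_emb Xs \<beta> ` Sig Xs"

definition sigma_dual_norm :: "('k::real_or_complex, 'u) dual_norms \<Rightarrow> bool" where
  "sigma_dual_norm \<nu> \<longleftrightarrow>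
     (\<forall>Xs Y \<beta>. election Xs Y \<beta> \<longrightarrow> is_norm (nu_space \<nu> Xs Y \<beta>) (\<nu> Xs Y \<beta>)) \<and>
     (\<forall>Xs Y \<beta>. election Xs Y \<beta> \<longrightarrow>
        (\<forall>\<phi>\<in>carrier (beta_forms Xs \<beta>). \<forall>y\<in>carrier Y.
           \<nu> Xs Y \<beta> (otimes2 (beta_forms Xs \<beta>) Y \<phi> y) \<le> nrm (beta_forms Xs \<beta>) \<phi> * nrm Y y)) \<and>
     (\<forall>Xs Y \<beta>. election Xs Y \<beta> \<longrightarrow>
        (\<forall>p\<in>Sig Xs. \<forall>q\<in>Sig Xs. \<forall>y'\<in>carrier (dual Y).
           let h = lin_ext2 (beta_forms Xs \<beta>) Y scalar_space
                     (\<lambda>\<phi> y. (f_of Xs \<phi> p - f_of Xs \<phi> q) * y' y)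
           in bounded_op (nu_space \<nu> Xs Y \<beta>) scalar_space h \<and>
              opnorm (nu_space \<nu> Xs Y \<beta>) scalar_space h
                \<le> \<beta> (p \<ominus>\<^bsub>tensor Xs \<beta>\<^esub> q) * nrm (dual Y) y')) \<and>
     (\<forall>Xs Y \<beta> Zs W \<theta> B C. election Xs Y \<beta> \<and> election Zs W \<theta> \<and>
        bounded_op (beta_forms Xs \<beta>) (beta_forms Zs \<theta>) B \<and> preserves_sigma Xs \<beta> Zs \<theta> B \<and>
        bounded_op Y W C \<longrightarrow>
        (let BC = lin_ext2 (beta_forms Xs \<beta>) Y (nu_space \<nu> Zs W \<theta>)
                    (\<lambda>\<phi> y. otimes2 (beta_forms Zs \<theta>) W (B \<phi>) (C y))
         in bounded_op (nu_space \<nu> Xs Y \<beta>) (nu_space \<nu> Zs W \<theta>) BC \<and>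
            opnorm (nu_space \<nu> Xs Y \<beta>) (nu_space \<nu> Zs W \<theta>) BC
              \<le> opnorm (beta_forms Xs \<beta>) (beta_forms Zs \<theta>) B * opnorm Y W C))"

definition associated :: "('k::real_or_complex, 'u) ideal_sets \<Rightarrow> ('k, 'u) ideal_norms \<Rightarrow>
    ('k, 'u) dual_norms \<Rightarrow> bool" where
  "associated \<A> A \<nu> \<longleftrightarrow> (\<forall>Es F \<beta>. fin_election Es F \<beta> \<longrightarrow>
     isometric_iso (nu_space \<nu> Es F \<beta>) (ideal_space \<A> A Es F \<beta>)
       (lin_ext2 (beta_forms Es \<beta>) F (ideal_space \<A> A Es F \<beta>) (\<lambda>\<phi> y x. \<phi> x \<odot>\<^bsub>F\<^esub> y)))"


section \<open>The tensor norm on spaces defined by a tensor norm on duals\<close>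

text \<open>The functional on \<open>\<L>\<^sup>\<beta>(E\<^sub>1, \<dots>, E\<^sub>n) \<otimes> F\<^sup>*\<close> given by \<open>u \<in> E\<^sub>1 \<otimes> \<cdots> \<otimes> E\<^sub>n \<otimes> F\<close>,
  when the dual of \<open>F\<close> is represented by the copy \<open>(W, J)\<close>.\<close>

definition pairing :: "('k::real_or_complex, 'a) nspace list \<Rightarrow> ('k, 'b) nspace \<Rightarrow>
    ((('a list \<Rightarrow> 'k) \<Rightarrow> 'k) \<Rightarrow> real) \<Rightarrow> ('k, 'c) nspace \<Rightarrow> ('c \<Rightarrow> 'b \<Rightarrow> 'k) \<Rightarrow>
    (('a list \<times> 'b \<Rightarrow> 'k) \<Rightarrow> 'k) \<Rightarrow> ((('a list \<Rightarrow> 'k) \<times> 'c \<Rightarrow> 'k) \<Rightarrow> 'k) \<Rightarrow> 'k" where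
  "pairing Es F \<beta> W J u = lin_ext2 (beta_forms Es \<beta>) W scalar_space
     (\<lambda>\<phi> w. lin_ext_with Es F scalar_space (\<lambda>x y. \<phi> x * J w y) u)"

text \<open>\<open>\<nu>\<close> must be evaluated at \<open>F\<^sup>*\<close>, hence at a space with carrier in the type \<open>'u\<close>.  For finite
  dimensional \<open>F\<close> a copy of \<open>F\<^sup>*\<close> in that type exists, and by functoriality of \<open>\<nu>\<close> the
  choice does not matter.  The type of \<open>F\<close> is left free so that \<open>F\<close> may be a subspace of a dual.\<close>

definition alpha_fin :: "('k::real_or_complex, 'u) dual_norms \<Rightarrow> ('k, 'u) nspace list \<Rightarrow>
    ('k, 'b) nspace \<Rightarrow> ((('u list \<Rightarrow> 'k) \<Rightarrow> 'k) \<Rightarrow> real) \<Rightarrow>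
    (('u list \<times> 'b \<Rightarrow> 'k) \<Rightarrow> 'k) \<Rightarrow> real" where
  "alpha_fin \<nu> Es F \<beta> u =
     (let (W, J) = (SOME (W, J). dual_copy F W J)
      in opnorm (nu_space \<nu> Es W \<beta>) scalar_space (pairing Es F \<beta> W J u))"

definition alpha :: "('k::real_or_complex, 'u) dual_norms \<Rightarrow> ('k, 'u) nspace list \<Rightarrow>
    ('k, 'b) nspace \<Rightarrow> ((('u list \<Rightarrow> 'k) \<Rightarrow> 'k) \<Rightarrow> real) \<Rightarrow>
    (('u list \<times> 'b \<Rightarrow> 'k) \<Rightarrow> 'k) \<Rightarrow> real" where
  "alpha \<nu> Xs Y \<beta> u =
     Inf {alpha_fin \<nu> Es F (restr_norm Es Xs \<beta>) v | Es F v.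
            Es \<in> listset (map fin_subspaces Xs) \<and> F \<in> fin_subspaces Y \<and>
            v \<in> carrier (tensor_with Es F (\<lambda>_. 0)) \<and> tensor_with_incl Es F Xs Y v = u}"

abbreviation alpha_space :: "('k::real_or_complex, 'u) dual_norms \<Rightarrow> ('k, 'u) nspace list \<Rightarrow>
    ('k, 'b) nspace \<Rightarrow> ((('u list \<Rightarrow> 'k) \<Rightarrow> 'k) \<Rightarrow> real) \<Rightarrow>
    ('k, ('u list \<times> 'b \<Rightarrow> 'k) \<Rightarrow> 'k) nspace" where
  "alpha_space \<nu> Xs Y \<beta> \<equiv> tensor_with Xs Y (alpha \<nu> Xs Y \<beta>)"

end

theory Submission
  imports Defs
begin

text \<open>Everything is reduced to finite dimensional spaces. For finite dimensional \<open>E\<^sub>i\<close> and \<open>F\<close> the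
  association of \<open>\<nu>\<close> with the ideal says that \<open>\<alpha>\<close> on \<open>E\<^sub>1 \<otimes> \<cdots> \<otimes> E\<^sub>n \<otimes> F\<close> is the dual norm of
  \<open>A\<close> on \<open>\<A>(E\<^sub>1, \<dots>, E\<^sub>n; F\<^sup>*)\<close>, so by reflexivity \<open>A\<close> is the dual norm of \<open>\<alpha>\<close>. A subspace
  \<open>F\<close> of the last factor corresponds to the closed finite codimensional subspace \<open>L\<close> of the target on
  which \<open>F\<close> vanishes, and \<open>F\<^sup>*\<close> is the quotient by \<open>L\<close>; hence the norm of a functional on
  the tensor product is the supremum of the numbers \<open>A(Q\<^sub>L f\<^sub>T I)\<close> over these \<open>L\<close>. When the last factor is
  \<open>Y\<^sup>*\<close> and the target \<open>Y\<close>, every \<open>L\<close> is of this form. When the target is \<open>Y\<^sup>*\<close>, only the weak*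
  closed ones are, and a weak form of the principle of local reflexivity covers the others.\<close>

section \<open>Vector spaces and linear forms\<close>

text \<open>Both sides of the duality are assembled from finite dimensional pieces:
  \<open>alpha\<close> is an infimum over pairs (Es, F) and \<open>A_max\<close> a supremum over
  pairs (Es, L). Local reflexivity is needed only in a weak form because a multilinear map on Es is
  determined by its finitely many values at tuples of generators: the quotient map of L has to be
  reproduced exactly only at those values of T, while its norm may grow by a factor 1 + \<delta>.
  The replacement is a finite sum of evaluations at vectors of Y times vectors of the quotient. It
  therefore factors through the quotient by the annihilator of the span of these vectors of Y, and
  the ideal property compares the two terms of the supremum. As \<delta> is arbitrary and the value
  to be bounded does not depend on it, the identity remains isometric. Both halves of the theorem
  run through one notion of dual pair, \<open>good_pair\<close>, used once for a copy of the dual of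
  Y paired with Y and once for Y paired with its dual; the two cases differ only in how the required
  functionals or vectors are found.\<close>

definition vs :: "('k::real_or_complex, 'a) nspace \<Rightarrow> bool" where
  "vs V \<longleftrightarrow> module scalar_ring V"

lemma scalar_ring_simps [simp]:
  "carrier scalar_ring = UNIV" "mult scalar_ring = (*)" "one scalar_ring = 1"
  "zero scalar_ring = 0" "add scalar_ring = (+)"
  by (auto simp: scalar_ring_def)

lemma cring_scalar_ring: "cring (scalar_ring :: 'k::real_or_complex ring)"
proof (rule cringI)
  show "abelian_group (scalar_ring :: 'k ring)"
    by (rule abelian_groupI) (auto simp: algebra_simps intro: exI[of _ "- _"])
  show "comm_monoid (scalar_ring :: 'k ring)"
    by (rule comm_monoidI) (auto simp: algebra_simps)
qed (auto simp: algebra_simps)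

lemma vsI:
  fixes V :: "('k::real_or_complex, 'a) nspace"
  assumes "\<And>v w. v \<in> carrier V \<Longrightarrow> w \<in> carrier V \<Longrightarrow> v \<oplus>\<^bsub>V\<^esub> w \<in> carrier V"
    and "\<zero>\<^bsub>V\<^esub> \<in> carrier V"
    and "\<And>c v. v \<in> carrier V \<Longrightarrow> c \<odot>\<^bsub>V\<^esub> v \<in> carrier V"
    and "\<And>u v w. u \<in> carrier V \<Longrightarrow> v \<in> carrier V \<Longrightarrow> w \<in> carrier V \<Longrightarrow> (u \<oplus>\<^bsub>V\<^esub> v) \<oplus>\<^bsub>V\<^esub> w = u \<oplus>\<^bsub>V\<^esub> (v \<oplus>\<^bsub>V\<^esub> w)"
    and "\<And>v w. v \<in> carrier V \<Longrightarrow> w \<in> carrier V \<Longrightarrow> v \<oplus>\<^bsub>V\<^esub> w = w \<oplus>\<^bsub>V\<^esub> v"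
    and "\<And>v. v \<in> carrier V \<Longrightarrow> \<zero>\<^bsub>V\<^esub> \<oplus>\<^bsub>V\<^esub> v = v"
    and "\<And>v. v \<in> carrier V \<Longrightarrow> (-1) \<odot>\<^bsub>V\<^esub> v \<oplus>\<^bsub>V\<^esub> v = \<zero>\<^bsub>V\<^esub>"
    and "\<And>c d v. v \<in> carrier V \<Longrightarrow> (c + d) \<odot>\<^bsub>V\<^esub> v = c \<odot>\<^bsub>V\<^esub> v \<oplus>\<^bsub>V\<^esub> d \<odot>\<^bsub>V\<^esub> v"
    and "\<And>c v w. v \<in> carrier V \<Longrightarrow> w \<in> carrier V \<Longrightarrow> c \<odot>\<^bsub>V\<^esub> (v \<oplus>\<^bsub>V\<^esub> w) = c \<odot>\<^bsub>V\<^esub> v \<oplus>\<^bsub>V\<^esub> c \<odot>\<^bsub>V\<^esub> w"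
    and "\<And>c d v. v \<in> carrier V \<Longrightarrow> (c * d) \<odot>\<^bsub>V\<^esub> v = c \<odot>\<^bsub>V\<^esub> (d \<odot>\<^bsub>V\<^esub> v)"
    and "\<And>v. v \<in> carrier V \<Longrightarrow> 1 \<odot>\<^bsub>V\<^esub> v = v"
  shows "vs V"
  unfolding vs_def
proof (rule moduleI)
  show "abelian_group V"
  proof (rule abelian_groupI)
    fix v assume v: "v \<in> carrier V"
    show "\<exists>w\<in>carrier V. w \<oplus>\<^bsub>V\<^esub> v = \<zero>\<^bsub>V\<^esub>"
      using assms(3,7) v by blast
  qed (rule assms; assumption)+
qed (simp_all add: assms(3,8-11) cring_scalar_ring)

context
  fixes V :: "('k::real_or_complex, 'a) nspace"
  assumes V: "vs V"
begin

interpretation module scalar_ring V using V by (simp add: vs_def)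

lemma vs_add [simp, intro]: "v \<in> carrier V \<Longrightarrow> w \<in> carrier V \<Longrightarrow> v \<oplus>\<^bsub>V\<^esub> w \<in> carrier V"
  and vs_zero [simp, intro]: "\<zero>\<^bsub>V\<^esub> \<in> carrier V"
  and vs_smult [simp, intro]: "v \<in> carrier V \<Longrightarrow> c \<odot>\<^bsub>V\<^esub> v \<in> carrier V"
  and vs_assoc: "u \<in> carrier V \<Longrightarrow> v \<in> carrier V \<Longrightarrow> w \<in> carrier V \<Longrightarrow> (u \<oplus>\<^bsub>V\<^esub> v) \<oplus>\<^bsub>V\<^esub> w = u \<oplus>\<^bsub>V\<^esub> (v \<oplus>\<^bsub>V\<^esub> w)"
  and vs_comm: "v \<in> carrier V \<Longrightarrow> w \<in> carrier V \<Longrightarrow> v \<oplus>\<^bsub>V\<^esub> w = w \<oplus>\<^bsub>V\<^esub> v"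
  and vs_lcomm: "u \<in> carrier V \<Longrightarrow> v \<in> carrier V \<Longrightarrow> w \<in> carrier V \<Longrightarrow> u \<oplus>\<^bsub>V\<^esub> (v \<oplus>\<^bsub>V\<^esub> w) = v \<oplus>\<^bsub>V\<^esub> (u \<oplus>\<^bsub>V\<^esub> w)"
  and vs_zero_left [simp]: "v \<in> carrier V \<Longrightarrow> \<zero>\<^bsub>V\<^esub> \<oplus>\<^bsub>V\<^esub> v = v"
  and vs_zero_right [simp]: "v \<in> carrier V \<Longrightarrow> v \<oplus>\<^bsub>V\<^esub> \<zero>\<^bsub>V\<^esub> = v"
  and vs_smult_assoc [simp]: "v \<in> carrier V \<Longrightarrow> c \<odot>\<^bsub>V\<^esub> (d \<odot>\<^bsub>V\<^esub> v) = (c * d) \<odot>\<^bsub>V\<^esub> v"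
  and vs_smult_one [simp]: "v \<in> carrier V \<Longrightarrow> 1 \<odot>\<^bsub>V\<^esub> v = v"
  and vs_smult_left_distrib: "v \<in> carrier V \<Longrightarrow> (c + d) \<odot>\<^bsub>V\<^esub> v = c \<odot>\<^bsub>V\<^esub> v \<oplus>\<^bsub>V\<^esub> d \<odot>\<^bsub>V\<^esub> v"
  and vs_smult_right_distrib: "v \<in> carrier V \<Longrightarrow> w \<in> carrier V \<Longrightarrow> c \<odot>\<^bsub>V\<^esub> (v \<oplus>\<^bsub>V\<^esub> w) = c \<odot>\<^bsub>V\<^esub> v \<oplus>\<^bsub>V\<^esub> c \<odot>\<^bsub>V\<^esub> w"
  and vs_smult_zero_left [simp]: "v \<in> carrier V \<Longrightarrow> 0 \<odot>\<^bsub>V\<^esub> v = \<zero>\<^bsub>V\<^esub>"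
  and vs_smult_zero_right [simp]: "c \<odot>\<^bsub>V\<^esub> \<zero>\<^bsub>V\<^esub> = \<zero>\<^bsub>V\<^esub>"
  using smult_closed smult_l_distr smult_r_distr smult_assoc1 smult_one smult_l_null smult_r_null
  by (auto simp: M.a_ac)

lemma vs_add_neg [simp]: "v \<in> carrier V \<Longrightarrow> v \<oplus>\<^bsub>V\<^esub> (-1) \<odot>\<^bsub>V\<^esub> v = \<zero>\<^bsub>V\<^esub>"
  using vs_smult_left_distrib[of v 1 "-1"] by simp

lemma vs_neg_eq: "v \<in> carrier V \<Longrightarrow> \<ominus>\<^bsub>V\<^esub> v = (-1) \<odot>\<^bsub>V\<^esub> v"
  by (rule M.minus_equality) (auto simp: vs_comm)

lemma vs_minus_eq: "v \<in> carrier V \<Longrightarrow> w \<in> carrier V \<Longrightarrow> v \<ominus>\<^bsub>V\<^esub> w = v \<oplus>\<^bsub>V\<^esub> (-1) \<odot>\<^bsub>V\<^esub> w"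
  by (simp add: a_minus_def vs_neg_eq)

text \<open>Differences are written \<open>v \<oplus> (-1) \<odot> w\<close> throughout, so that
  additivity and homogeneity alone carry a linear map through them.\<close>

lemma vs_eq_iff:
  assumes "v \<in> carrier V" "w \<in> carrier V"
  shows "v = w \<longleftrightarrow> v \<oplus>\<^bsub>V\<^esub> (-1) \<odot>\<^bsub>V\<^esub> w = \<zero>\<^bsub>V\<^esub>"
proof
  assume *: "v \<oplus>\<^bsub>V\<^esub> (-1) \<odot>\<^bsub>V\<^esub> w = \<zero>\<^bsub>V\<^esub>"
  have "w \<oplus>\<^bsub>V\<^esub> (v \<oplus>\<^bsub>V\<^esub> (-1) \<odot>\<^bsub>V\<^esub> w) = v \<oplus>\<^bsub>V\<^esub> (w \<oplus>\<^bsub>V\<^esub> (-1) \<odot>\<^bsub>V\<^esub> w)"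
    using assms by (intro vs_lcomm) auto
  then show "v = w" using assms * by simp
qed (use assms in simp)

end

text \<open>Submodules in a form that simplification can check; closure under negatives is hidden in
  the multiples by -1.\<close>

definition subsp :: "('k::real_or_complex, 'a) nspace \<Rightarrow> 'a set \<Rightarrow> bool" where
  "subsp V S \<longleftrightarrow> S \<subseteq> carrier V \<and> \<zero>\<^bsub>V\<^esub> \<in> S \<and> (\<forall>v\<in>S. \<forall>w\<in>S. v \<oplus>\<^bsub>V\<^esub> w \<in> S) \<and> (\<forall>c. \<forall>v\<in>S. c \<odot>\<^bsub>V\<^esub> v \<in> S)"

lemma subspD:
  assumes "subsp V S"
  shows "v \<in> S \<Longrightarrow> v \<in> carrier V" "\<zero>\<^bsub>V\<^esub> \<in> S" "v \<in> S \<Longrightarrow> w \<in> S \<Longrightarrow> v \<oplus>\<^bsub>V\<^esub> w \<in> S" "v \<in> S \<Longrightarrow> c \<odot>\<^bsub>V\<^esub> v \<in> S"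
  using assms by (auto simp: subsp_def)

lemma vs_subsp: "vs V \<Longrightarrow> subsp V S \<Longrightarrow> vs (V\<lparr>carrier := S\<rparr>)"
  by (rule vsI)
    (auto simp: subspD vs_assoc vs_comm vs_lcomm vs_smult_left_distrib vs_smult_right_distrib)

lemma subsp_carrier [simp]: "vs V \<Longrightarrow> subsp V (carrier V)"
  by (auto simp: subsp_def)

lemma submodule_iff_subsp:
  fixes V :: "('k::real_or_complex, 'a) nspace"
  assumes V: "vs V"
  shows "submodule S scalar_ring V \<longleftrightarrow> subsp V S"
proof
  interpret module scalar_ring V using V by (simp add: vs_def)
  assume S: "submodule S scalar_ring V"
  then have "\<zero>\<^bsub>V\<^esub> \<in> S"
    using submoduleE[OF S] by (metis UNIV_I all_not_in_conv scalar_ring_simps(1) smult_l_null subset_eq)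
  then show "subsp V S"
    using submoduleE[OF S] unfolding subsp_def by auto
next
  interpret module scalar_ring V using V by (simp add: vs_def)
  assume "subsp V S"
  then show "submodule S scalar_ring V"
    by (intro submoduleI) (auto simp: subsp_def vs_neg_eq[OF V] subset_iff)
qed

text \<open>Linear combinations are indexed by lists of pairs, so that concatenation represents the
  sum and repeated vectors need no bookkeeping.\<close>

fun lc :: "('k::real_or_complex, 'a) nspace \<Rightarrow> ('k \<times> 'a) list \<Rightarrow> 'a" where
  "lc V [] = \<zero>\<^bsub>V\<^esub>"
| "lc V (cv # cvs) = fst cv \<odot>\<^bsub>V\<^esub> snd cv \<oplus>\<^bsub>V\<^esub> lc V cvs"

lemma lc_closed: "subsp V S \<Longrightarrow> snd ` set cvs \<subseteq> S \<Longrightarrow> lc V cvs \<in> S"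
  by (induction cvs) (auto simp: subspD)

lemma lc_carrier [simp]: "vs V \<Longrightarrow> snd ` set cvs \<subseteq> carrier V \<Longrightarrow> lc V cvs \<in> carrier V"
  by (rule lc_closed) auto

lemma lc_append:
  "vs V \<Longrightarrow> snd ` set xs \<subseteq> carrier V \<Longrightarrow> snd ` set ys \<subseteq> carrier V \<Longrightarrow> lc V (xs @ ys) = lc V xs \<oplus>\<^bsub>V\<^esub> lc V ys"
  by (induction xs) (auto simp: vs_assoc)

lemma lc_smult:
  "vs V \<Longrightarrow> snd ` set xs \<subseteq> carrier V \<Longrightarrow> lc V (map (\<lambda>(c, v). (d * c, v)) xs) = d \<odot>\<^bsub>V\<^esub> lc V xs"
  by (induction xs) (auto simp: vs_smult_right_distrib)

lemma lc_subsp [simp]: "lc (V\<lparr>carrier := S\<rparr>) cvs = lc V cvs"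
  by (induction cvs) auto

definition lspan :: "('k::real_or_complex, 'a) nspace \<Rightarrow> 'a set \<Rightarrow> 'a set" where
  "lspan V B = {lc V cvs | cvs. snd ` set cvs \<subseteq> B}"

lemma subsp_lspan: "vs V \<Longrightarrow> B \<subseteq> carrier V \<Longrightarrow> subsp V (lspan V B)"
  unfolding subsp_def lspan_def
proof (safe, goal_cases)
  case (1 x cvs) then show ?case by auto
next
  case 2 then show ?case by (intro exI[of _ "[]"]) auto
next
  case (3 v w xs ys) then show ?case
    by (intro exI[of _ "xs @ ys"]) (auto simp: lc_append)
next
  case (4 c v xs) then show ?case
    by (intro exI[of _ "map (\<lambda>(d, v). (c * d, v)) xs"]) (auto simp: lc_smult)
qed

lemma lspan_mono: "B \<subseteq> C \<Longrightarrow> lspan V B \<subseteq> lspan V C"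
  unfolding lspan_def by blast

lemma lspan_superset: "vs V \<Longrightarrow> B \<subseteq> carrier V \<Longrightarrow> B \<subseteq> lspan V B"
  unfolding lspan_def by (auto intro!: exI[of _ "[(1, _)]"])

lemma lspan_minimal: "subsp V S \<Longrightarrow> B \<subseteq> S \<Longrightarrow> lspan V B \<subseteq> S"
  unfolding lspan_def using lc_closed by blast

lemma fin_dim_iff:
  assumes V: "vs V"
  shows "fin_dim V \<longleftrightarrow> (\<exists>B. finite B \<and> B \<subseteq> carrier V \<and> lspan V B = carrier V)"
  unfolding fin_dim_def submodule_iff_subsp[OF V]
proof (rule ex_cong1, intro conj_cong refl iffI allI impI)
  fix B assume "B \<subseteq> carrier V" "\<forall>S. subsp V S \<and> B \<subseteq> S \<longrightarrow> S = carrier V"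
  then show "lspan V B = carrier V"
    using subsp_lspan[OF V] lspan_superset[OF V] by blast
next
  fix B S assume "lspan V B = carrier V" "subsp V S \<and> B \<subseteq> S"
  then show "S = carrier V"
    using lspan_minimal[of V S B] subspD(1)[of V S] by auto
qed

lemma is_linD:
  assumes "is_lin V W f"
  shows "v \<in> carrier V \<Longrightarrow> f v \<in> carrier W"
    "v \<in> carrier V \<Longrightarrow> w \<in> carrier V \<Longrightarrow> f (v \<oplus>\<^bsub>V\<^esub> w) = f v \<oplus>\<^bsub>W\<^esub> f w"
    "v \<in> carrier V \<Longrightarrow> f (c \<odot>\<^bsub>V\<^esub> v) = c \<odot>\<^bsub>W\<^esub> f v"
  using assms by (auto simp: is_lin_def)

lemma scalar_space_simps [simp]:
  "carrier scalar_space = UNIV" "\<zero>\<^bsub>scalar_space\<^esub> = 0" "add scalar_space = (+)"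
  "smult scalar_space = (*)" "nrm scalar_space = norm"
  by (auto simp: scalar_space_def)

lemma vs_scalar_space [simp]: "vs (scalar_space :: ('k::real_or_complex, 'k) nspace)"
  by (rule vsI) (auto simp: algebra_simps)

lemma is_lin_zero: "vs V \<Longrightarrow> vs W \<Longrightarrow> is_lin V W f \<Longrightarrow> f \<zero>\<^bsub>V\<^esub> = \<zero>\<^bsub>W\<^esub>"
  using is_linD(3)[of V W f "\<zero>\<^bsub>V\<^esub>" 0] is_linD(1)[of V W f "\<zero>\<^bsub>V\<^esub>"] by simp

lemma is_lin_lc:
  "vs V \<Longrightarrow> vs W \<Longrightarrow> is_lin V W f \<Longrightarrow> snd ` set cvs \<subseteq> carrier V \<Longrightarrow>
    f (lc V cvs) = lc W (map (\<lambda>(c, v). (c, f v)) cvs)"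
  by (induction cvs) (auto simp: is_lin_zero is_linD)

lemma lc_scalar: "lc scalar_space cvs = (\<Sum>(c, v)\<leftarrow>cvs. c * v)"
  by (induction cvs) (auto simp: case_prod_unfold)

lemma is_lin_subsp: "is_lin V W f \<Longrightarrow> S \<subseteq> carrier V \<Longrightarrow> is_lin (V\<lparr>carrier := S\<rparr>) W f"
  by (auto simp: is_lin_def subset_iff)

lemma is_lin_comp: "is_lin U V f \<Longrightarrow> is_lin V W g \<Longrightarrow> is_lin U W (\<lambda>u. g (f u))"
  by (auto simp: is_lin_def Pi_iff)

lemma is_lin_cong: "vs V \<Longrightarrow> (\<And>v. v \<in> carrier V \<Longrightarrow> f v = g v) \<Longrightarrow> is_lin V W f \<longleftrightarrow> is_lin V W g"
  by (auto simp: is_lin_def Pi_iff)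

lemma is_lin_id: "is_lin V V (\<lambda>v. v)"
  by (auto simp: is_lin_def)

section \<open>Linear forms, separation and function spaces\<close>

lemma lin_formsD:
  assumes "f \<in> lin_forms V"
  shows "is_lin V scalar_space f" "v \<notin> carrier V \<Longrightarrow> f v = 0"
    "v \<in> carrier V \<Longrightarrow> w \<in> carrier V \<Longrightarrow> f (v \<oplus>\<^bsub>V\<^esub> w) = f v + f w"
    "v \<in> carrier V \<Longrightarrow> f (c \<odot>\<^bsub>V\<^esub> v) = c * f v"
  using assms by (auto simp: lin_forms_def is_lin_def)

lemma lin_forms_zero: "vs V \<Longrightarrow> f \<in> lin_forms V \<Longrightarrow> f \<zero>\<^bsub>V\<^esub> = 0"
  using is_lin_zero[of V scalar_space f] by (auto simp: lin_forms_def)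

lemma lin_formsI:
  assumes "\<And>v w. v \<in> carrier V \<Longrightarrow> w \<in> carrier V \<Longrightarrow> f (v \<oplus>\<^bsub>V\<^esub> w) = f v + f w"
    and "\<And>c v. v \<in> carrier V \<Longrightarrow> f (c \<odot>\<^bsub>V\<^esub> v) = c * f v"
    and "\<And>v. v \<notin> carrier V \<Longrightarrow> f v = 0"
  shows "f \<in> lin_forms V"
  using assms by (auto simp: lin_forms_def is_lin_def)

lemma lin_forms_restrict:
  "vs V \<Longrightarrow> is_lin V scalar_space f \<Longrightarrow> (\<lambda>v. if v \<in> carrier V then f v else 0) \<in> lin_forms V"
  by (rule lin_formsI) (auto simp: is_linD[of V scalar_space f])

lemma lin_forms_lc:
  "vs V \<Longrightarrow> f \<in> lin_forms V \<Longrightarrow> snd ` set cvs \<subseteq> carrier V \<Longrightarrow> f (lc V cvs) = (\<Sum>(c, v)\<leftarrow>cvs. c * f v)"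
  by (induction cvs) (auto simp: lin_forms_zero lin_formsD)

lemma lin_forms_comb:
  "f \<in> lin_forms V \<Longrightarrow> g \<in> lin_forms V \<Longrightarrow> (\<lambda>v. a * f v + b * g v) \<in> lin_forms V"
  by (rule lin_formsI) (auto simp: lin_formsD algebra_simps)

lemma lin_forms_0: "(\<lambda>_. 0) \<in> lin_forms V"
  by (rule lin_formsI) auto

text \<open>A vector identity in a separated space can be checked by applying linear forms, which
  turns it into a field identity.\<close>

definition separated :: "('k::real_or_complex, 'a) nspace \<Rightarrow> bool" where
  "separated V \<longleftrightarrow> (\<forall>v\<in>carrier V. (\<forall>f\<in>lin_forms V. f v = 0) \<longrightarrow> v = \<zero>\<^bsub>V\<^esub>)"

lemma separated_eqI:
  assumes "vs V" "separated V" "v \<in> carrier V" "w \<in> carrier V" "\<And>f. f \<in> lin_forms V \<Longrightarrow> f v = f w"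
  shows "v = w"
proof -
  have "v \<oplus>\<^bsub>V\<^esub> (-1) \<odot>\<^bsub>V\<^esub> w = \<zero>\<^bsub>V\<^esub>"
    using assms by (auto simp: separated_def lin_formsD)
  then show ?thesis using vs_eq_iff[OF assms(1,3,4)] by simp
qed

lemma fun_space_simps [simp]:
  "carrier (fun_space W F N) = F" "\<zero>\<^bsub>fun_space W F N\<^esub> = (\<lambda>_. \<zero>\<^bsub>W\<^esub>)"
  "add (fun_space W F N) = (\<lambda>f g d. f d \<oplus>\<^bsub>W\<^esub> g d)" "smult (fun_space W F N) = (\<lambda>c f d. c \<odot>\<^bsub>W\<^esub> f d)"
  "nrm (fun_space W F N) = N"
  by (auto simp: fun_space_def)

lemma vs_fun_space:
  assumes W: "vs W" and "\<And>f d. f \<in> F \<Longrightarrow> f d \<in> carrier W" "(\<lambda>_. \<zero>\<^bsub>W\<^esub>) \<in> F"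
    "\<And>f g. f \<in> F \<Longrightarrow> g \<in> F \<Longrightarrow> (\<lambda>d. f d \<oplus>\<^bsub>W\<^esub> g d) \<in> F" "\<And>c f. f \<in> F \<Longrightarrow> (\<lambda>d. c \<odot>\<^bsub>W\<^esub> f d) \<in> F"
  shows "vs (fun_space W F N)"
proof (rule vsI)
  fix v assume "v \<in> carrier (fun_space W F N)"
  then have "v d \<in> carrier W" for d using assms by auto
  then have "(-1) \<odot>\<^bsub>W\<^esub> v d \<oplus>\<^bsub>W\<^esub> v d = \<zero>\<^bsub>W\<^esub>" for d
    using W vs_comm[OF W] by simp
  then show "(-1) \<odot>\<^bsub>fun_space W F N\<^esub> v \<oplus>\<^bsub>fun_space W F N\<^esub> v = \<zero>\<^bsub>fun_space W F N\<^esub>"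
    by auto
qed (use assms in \<open>auto simp: fun_eq_iff vs_assoc vs_comm vs_lcomm vs_smult_left_distrib vs_smult_right_distrib\<close>)

lemma vs_fun_space_scalar:
  assumes "(\<lambda>_. 0) \<in> F" "\<And>f g. f \<in> F \<Longrightarrow> g \<in> F \<Longrightarrow> (\<lambda>d. f d + g d) \<in> F" "\<And>c f. f \<in> F \<Longrightarrow> (\<lambda>d. c * f d) \<in> F"
  shows "vs (fun_space scalar_space F N)"
  by (rule vs_fun_space) (use assms in auto)

section \<open>The kernel lemma and interpolation\<close>

text \<open>Induction on the list. If some \<open>v0\<close> in the common kernel of the remaining
  forms has \<open>f v0 \<noteq> 0\<close>, a multiple of \<open>f\<close> is subtracted from \<psi>
  so that the difference vanishes on that common kernel. If there is no such \<open>v0\<close>, the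
  condition \<open>f v = 0\<close> follows from the others and the coefficient of \<open>f\<close>
  is 0.\<close>

lemma lin_forms_kernel:
  assumes V: "vs V" and fs: "set fs \<subseteq> lin_forms V" and psi: "\<psi> \<in> lin_forms V"
    and ker: "\<And>v. v \<in> carrier V \<Longrightarrow> (\<forall>f\<in>set fs. f v = 0) \<Longrightarrow> \<psi> v = 0"
  shows "\<exists>cs. length cs = length fs \<and> (\<forall>v. \<psi> v = (\<Sum>(c, f)\<leftarrow>zip cs fs. c * f v))"
  using fs psi ker
proof (induction fs arbitrary: \<psi>)
  case Nil
  then have "\<psi> v = 0" for v using lin_formsD(2) by (cases "v \<in> carrier V") auto
  then show ?case by auto
next
  case (Cons f fs)
  show ?case
  proof (cases "\<exists>v0\<in>carrier V. (\<forall>g\<in>set fs. g v0 = 0) \<and> f v0 \<noteq> 0")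
    case True
    then obtain v0 where v0: "v0 \<in> carrier V" "\<forall>g\<in>set fs. g v0 = 0" "f v0 \<noteq> 0" by blast
    define d where "d = \<psi> v0 / f v0"
    have f: "f \<in> lin_forms V" using Cons.prems by auto
    let ?psi = "\<lambda>v. 1 * \<psi> v + (- d) * f v"
    have 1: "?psi \<in> lin_forms V" by (rule lin_forms_comb) (use Cons.prems in auto)
    have 2: "?psi v = 0" if v: "v \<in> carrier V" and *: "\<forall>g\<in>set fs. g v = 0" for v
    proof -
      \<comment> \<open>Moving along \<open>v0\<close> makes \<open>f\<close> vanish and leaves the
        remaining forms at zero, so the hypothesis on \<psi> applies to the moved vector.\<close>
      let ?w = "v \<oplus>\<^bsub>V\<^esub> (- (f v / f v0)) \<odot>\<^bsub>V\<^esub> v0"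
      have "f ?w = 0" "\<forall>g\<in>set fs. g ?w = 0"
        using v v0 V * Cons.prems(1) by (auto simp: lin_formsD[OF f] lin_formsD subset_iff)
      then have "\<psi> ?w = 0" using Cons.prems(3) v v0 V by auto
      moreover have "\<psi> ?w = \<psi> v - d * f v"
        using v v0 V by (simp add: lin_formsD[OF Cons.prems(2)] d_def)
      ultimately show ?thesis by simp
    qed
    obtain cs where cs: "length cs = length fs" "\<forall>v. ?psi v = (\<Sum>(c, f)\<leftarrow>zip cs fs. c * f v)"
      using Cons.IH[OF _ 1 2] Cons.prems by auto
    have "\<psi> v = (\<Sum>(c, g)\<leftarrow>zip (d # cs) (f # fs). c * g v)" for v
      using cs(2)[rule_format, of v] by (auto simp: algebra_simps)
    then show ?thesis using cs(1) by (intro exI[of _ "d # cs"]) auto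
  next
    case False
    obtain cs where cs: "length cs = length fs" "\<forall>v. \<psi> v = (\<Sum>(c, f)\<leftarrow>zip cs fs. c * f v)"
      using Cons.IH[of \<psi>] Cons.prems False by fastforce
    then show ?thesis by (intro exI[of _ "0 # cs"]) auto
  qed
qed

text \<open>A solution for \<open>G\<close> is corrected at the new point \<open>g\<close> by a
  multiple of some \<open>y0\<close> that pairs to zero with \<open>G\<close> but not with
  \<open>g\<close>. If no such \<open>y0\<close> exists, \<open>lin_forms_kernel\<close> makes the
  functional of \<open>g\<close> a combination of those of \<open>G\<close>, nondegeneracy makes
  \<open>g\<close> itself the same combination of \<open>G\<close>, and the old solution is already
  right at \<open>g\<close>. No norm control is claimed; that is what allows an exact
  solution.\<close>

lemma interpolation:
  fixes X :: "('k::real_or_complex, 'a) nspace" and Y :: "('k, 'b) nspace"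
  assumes X: "vs X" and Y: "vs Y"
    and b: "\<And>x. x \<in> carrier X \<Longrightarrow> (\<lambda>y. if y \<in> carrier Y then b x y else 0) \<in> lin_forms Y"
    and b': "\<And>y. y \<in> carrier Y \<Longrightarrow> is_lin X scalar_space (\<lambda>x. b x y)"
    and nondeg: "\<And>x. x \<in> carrier X \<Longrightarrow> (\<forall>y\<in>carrier Y. b x y = 0) \<Longrightarrow> x = \<zero>\<^bsub>X\<^esub>"
    and l: "is_lin X scalar_space l"
    and G: "set G \<subseteq> carrier X"
  shows "\<exists>y\<in>carrier Y. \<forall>g\<in>set G. b g y = l g"
  using G
proof (induction G)
  case Nil show ?case using vs_zero[OF Y] by auto
next
  case (Cons g G)
  have bl: "b x (y \<oplus>\<^bsub>Y\<^esub> y') = b x y + b x y'" "b x (c \<odot>\<^bsub>Y\<^esub> y) = c * b x y"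
    if "x \<in> carrier X" "y \<in> carrier Y" "y' \<in> carrier Y" for x y y' c
    using lin_formsD(3,4)[OF b[OF that(1)]] that Y by simp_all
  obtain y where y: "y \<in> carrier Y" "\<forall>g\<in>set G. b g y = l g" using Cons by auto
  show ?case
  proof (cases "\<exists>y0\<in>carrier Y. (\<forall>x\<in>set G. b x y0 = 0) \<and> b g y0 \<noteq> 0")
    case True
    then obtain y0 where y0: "y0 \<in> carrier Y" "\<forall>x\<in>set G. b x y0 = 0" "b g y0 \<noteq> 0" by blast
    let ?y = "y \<oplus>\<^bsub>Y\<^esub> ((l g - b g y) / b g y0) \<odot>\<^bsub>Y\<^esub> y0"
    have "\<forall>x\<in>set (g # G). b x ?y = l x"
      using y y0 Y Cons.prems by (auto simp: bl subset_iff)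
    moreover have "?y \<in> carrier Y" using y y0 Y by auto
    ultimately show ?thesis by blast
  next
    case False
    let ?B = "\<lambda>x y. if y \<in> carrier Y then b x y else 0"
    obtain cs where cs: "length cs = length (map ?B G)" "\<forall>v. ?B g v = (\<Sum>(c, f)\<leftarrow>zip cs (map ?B G). c * f v)"
      using lin_forms_kernel[OF Y, of "map ?B G" "?B g"] b Cons.prems False by fastforce
    have mem: "snd ` set (zip cs G) \<subseteq> carrier X" using Cons.prems by (auto dest: set_zip_rightD)
    \<comment> \<open>The relation found holds between functionals on Y. It says that this vector
      pairs to zero with all of Y, which turns it into a relation between vectors.\<close>
    let ?x = "g \<oplus>\<^bsub>X\<^esub> (-1) \<odot>\<^bsub>X\<^esub> lc X (zip cs G)"
    have gX: "g \<in> carrier X" using Cons.prems by auto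
    have "b ?x v = 0" if v: "v \<in> carrier Y" for v
    proof -
      have "b (lc X (zip cs G)) v = (\<Sum>(c, x)\<leftarrow>zip cs G. c * b x v)"
        using is_lin_lc[OF X vs_scalar_space b'[OF v] mem]
        by (simp add: lc_scalar comp_def case_prod_unfold)
      also have "\<dots> = b g v"
        using cs(2)[rule_format, of v] v by (simp add: zip_map2 comp_def case_prod_unfold)
      finally show ?thesis using is_linD[OF b'[OF v]] X gX mem v by simp
    qed
    then have "?x = \<zero>\<^bsub>X\<^esub>" using nondeg X mem gX by auto
    then have g: "g = lc X (zip cs G)" using vs_eq_iff[OF X gX] X mem by auto
    have "b g y = (\<Sum>(c, x)\<leftarrow>zip cs G. c * b x y)"
      using is_lin_lc[OF X vs_scalar_space b'[OF y(1)] mem]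
      unfolding g[symmetric] by (simp add: lc_scalar comp_def case_prod_unfold)
    also have "\<dots> = (\<Sum>(c, x)\<leftarrow>zip cs G. c * l x)"
      by (rule arg_cong[where f=sum_list], rule map_cong[OF refl]) (use y in \<open>auto dest: set_zip_rightD\<close>)
    also have "\<dots> = l g"
      using is_lin_lc[OF X vs_scalar_space l mem]
      unfolding g[symmetric] by (simp add: lc_scalar comp_def case_prod_unfold)
    finally show ?thesis using y by auto
  qed
qed

text \<open>Each form adds at most one vector to \<open>B\<close>. It is taken in the common kernel
  of the forms treated before, so a multiple of it corrects the value of the new form and disturbs
  none of the others. This is the finite codimension of annihilators.\<close>

lemma common_kernel_complement:
  assumes V: "vs V" and fs: "set fs \<subseteq> lin_forms V"
  shows "\<exists>B. finite B \<and> B \<subseteq> carrier V \<and>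
    (\<forall>v\<in>carrier V. \<exists>b\<in>lspan V B. \<forall>f\<in>set fs. f (v \<oplus>\<^bsub>V\<^esub> b) = 0)"
  using fs
proof (induction fs)
  case Nil
  show ?case using V by (intro exI[of _ "{}"]) (auto simp: lspan_def)
next
  case (Cons f fs)
  then obtain B where B: "finite B" "B \<subseteq> carrier V"
    "\<forall>v\<in>carrier V. \<exists>b\<in>lspan V B. \<forall>f\<in>set fs. f (v \<oplus>\<^bsub>V\<^esub> b) = 0" by auto
  show ?case
  proof (cases "\<exists>v0\<in>carrier V. (\<forall>g\<in>set fs. g v0 = 0) \<and> f v0 \<noteq> 0")
    case False
    then show ?thesis using B subspD(1)[OF subsp_lspan[OF V B(2)]] vs_add[OF V]
      by (intro exI[of _ B]) (auto; metis)
  next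
    case True
    then obtain v0 where v0: "v0 \<in> carrier V" "\<forall>g\<in>set fs. g v0 = 0" "f v0 \<noteq> 0" by blast
    note S = subsp_lspan[OF V, of "insert v0 B"]
    have S': "lspan V B \<subseteq> lspan V (insert v0 B)" "v0 \<in> lspan V (insert v0 B)" "subsp V (lspan V (insert v0 B))"
      using B v0 lspan_superset[OF V, of "insert v0 B"] S lspan_mono[of B "insert v0 B" V] by auto
    show ?thesis
    proof (intro exI[of _ "insert v0 B"] conjI ballI)
      fix v assume v: "v \<in> carrier V"
      then obtain b where b: "b \<in> lspan V B" "\<forall>g\<in>set fs. g (v \<oplus>\<^bsub>V\<^esub> b) = 0" using B by blast
      have bV: "b \<in> carrier V" using subspD(1)[OF subsp_lspan[OF V B(2)]] b by auto
      let ?b = "b \<oplus>\<^bsub>V\<^esub> (- (f (v \<oplus>\<^bsub>V\<^esub> b) / f v0)) \<odot>\<^bsub>V\<^esub> v0"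
      have "?b \<in> lspan V (insert v0 B)" using S' b by (auto simp: subspD)
      moreover have "\<forall>g\<in>set (f # fs). g (v \<oplus>\<^bsub>V\<^esub> ?b) = 0"
      proof -
        have eq: "g (v \<oplus>\<^bsub>V\<^esub> ?b) = g (v \<oplus>\<^bsub>V\<^esub> b) - (f (v \<oplus>\<^bsub>V\<^esub> b) / f v0) * g v0" if "g \<in> set (f # fs)" for g
        proof -
          have g: "g \<in> lin_forms V" using Cons.prems that by auto
          show ?thesis using v bV v0 V by (simp add: lin_formsD[OF g])
        qed
        show ?thesis
        proof
          fix g assume g: "g \<in> set (f # fs)"
          show "g (v \<oplus>\<^bsub>V\<^esub> ?b) = 0"
            unfolding eq[OF g] using b(2) v0(2,3) g by (cases "g = f") auto
        qed
      qed
      ultimately show "\<exists>b\<in>lspan V (insert v0 B). \<forall>g\<in>set (f # fs). g (v \<oplus>\<^bsub>V\<^esub> b) = 0" by blast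
    qed (use B v0 in auto)
  qed
qed

section \<open>The Hahn-Banach theorem\<close>

text \<open>Homogeneity is demanded for nonnegative real scalars only: the minimality argument takes
  place over the reals also when the field is complex, and \<open>ex_real_part\<close> recovers a
  linear form over the field.\<close>

definition sublin :: "('k::real_or_complex, 'a) nspace \<Rightarrow> ('a \<Rightarrow> real) \<Rightarrow> bool" where
  "sublin V p \<longleftrightarrow> (\<forall>v\<in>carrier V. \<forall>w\<in>carrier V. p (v \<oplus>\<^bsub>V\<^esub> w) \<le> p v + p w) \<and>
     (\<forall>t\<ge>0. \<forall>v\<in>carrier V. p (of_real t \<odot>\<^bsub>V\<^esub> v) = t * p v)"

definition real_lin :: "('k::real_or_complex, 'a) nspace \<Rightarrow> ('a \<Rightarrow> real) \<Rightarrow> bool" where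
  "real_lin V p \<longleftrightarrow> (\<forall>v\<in>carrier V. \<forall>w\<in>carrier V. p (v \<oplus>\<^bsub>V\<^esub> w) = p v + p w) \<and>
     (\<forall>t. \<forall>v\<in>carrier V. p (of_real t \<odot>\<^bsub>V\<^esub> v) = t * p v)"

lemma sublinD:
  assumes "sublin V p"
  shows "v \<in> carrier V \<Longrightarrow> w \<in> carrier V \<Longrightarrow> p (v \<oplus>\<^bsub>V\<^esub> w) \<le> p v + p w"
    "0 \<le> t \<Longrightarrow> v \<in> carrier V \<Longrightarrow> p (of_real t \<odot>\<^bsub>V\<^esub> v) = t * p v"
  using assms by (auto simp: sublin_def)

lemma sublin_zero: "vs V \<Longrightarrow> sublin V p \<Longrightarrow> p \<zero>\<^bsub>V\<^esub> = 0"
  using sublinD(2)[of V p 0 "\<zero>\<^bsub>V\<^esub>"] by simp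

lemma sublin_neg: "vs V \<Longrightarrow> sublin V p \<Longrightarrow> v \<in> carrier V \<Longrightarrow> - p v \<le> p ((-1) \<odot>\<^bsub>V\<^esub> v)"
  using sublinD(1)[of V p v "(-1) \<odot>\<^bsub>V\<^esub> v"] sublin_zero[of V p] by simp

text \<open>Subadditivity applied to w = (v + w) - v. It is the lower bound that keeps the infima in
  \<open>sublin_inf_translate\<close> and \<open>hahn_banach\<close> finite.\<close>

lemma sublin_lower:
  assumes "vs V" "sublin V p" "v \<in> carrier V" "w \<in> carrier V"
  shows "- p ((-1) \<odot>\<^bsub>V\<^esub> v) + p w \<le> p (v \<oplus>\<^bsub>V\<^esub> w)"
proof -
  have "(v \<oplus>\<^bsub>V\<^esub> w) \<oplus>\<^bsub>V\<^esub> (-1) \<odot>\<^bsub>V\<^esub> v = w \<oplus>\<^bsub>V\<^esub> (v \<oplus>\<^bsub>V\<^esub> (-1) \<odot>\<^bsub>V\<^esub> v)"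
    using assms by (simp only: vs_assoc vs_comm vs_lcomm vs_add vs_smult)
  then show ?thesis
    using sublinD(1)[OF assms(2), of "v \<oplus>\<^bsub>V\<^esub> w" "(-1) \<odot>\<^bsub>V\<^esub> v"] assms by simp
qed

text \<open>The parameter t = 0 gives \<open>q \<le> p\<close> and t = 1 gives
  \<open>q x \<le> p (x + v) - p v\<close>. Hence if \<open>q = p\<close>, the second bound is
  superadditivity of \<open>p\<close> in the direction \<open>v\<close>.\<close>

lemma sublin_inf_translate:
  assumes V: "vs V" and p: "sublin V p" and v: "v \<in> carrier V"
  defines "q \<equiv> \<lambda>x. INF t\<in>{0..}. p (x \<oplus>\<^bsub>V\<^esub> of_real t \<odot>\<^bsub>V\<^esub> v) - t * p v"
  shows "sublin V q" and "\<And>x t. x \<in> carrier V \<Longrightarrow> 0 \<le> t \<Longrightarrow> q x \<le> p (x \<oplus>\<^bsub>V\<^esub> of_real t \<odot>\<^bsub>V\<^esub> v) - t * p v"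
proof -
  have lower: "- p ((-1) \<odot>\<^bsub>V\<^esub> x) \<le> p (x \<oplus>\<^bsub>V\<^esub> of_real t \<odot>\<^bsub>V\<^esub> v) - t * p v" if "x \<in> carrier V" "0 \<le> t" for x t
    using sublin_lower[OF V p that(1) vs_smult[OF V v, of "of_real t"]] sublinD(2)[OF p that(2) v] by simp
  then have bdd: "bdd_below ((\<lambda>t. p (x \<oplus>\<^bsub>V\<^esub> of_real t \<odot>\<^bsub>V\<^esub> v) - t * p v) ` {0..})" if "x \<in> carrier V" for x
    using that by (intro bdd_belowI[of _ "- p ((-1) \<odot>\<^bsub>V\<^esub> x)"]) auto
  show upper: "q x \<le> p (x \<oplus>\<^bsub>V\<^esub> of_real t \<odot>\<^bsub>V\<^esub> v) - t * p v" if "x \<in> carrier V" "0 \<le> t" for x t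
    unfolding q_def using that by (intro cINF_lower bdd) auto
  have add: "q (x \<oplus>\<^bsub>V\<^esub> y) \<le> q x + q y" if x: "x \<in> carrier V" and y: "y \<in> carrier V" for x y
  proof -
    have 1: "q (x \<oplus>\<^bsub>V\<^esub> y) \<le> (p (x \<oplus>\<^bsub>V\<^esub> of_real s \<odot>\<^bsub>V\<^esub> v) - s * p v) + (p (y \<oplus>\<^bsub>V\<^esub> of_real t \<odot>\<^bsub>V\<^esub> v) - t * p v)"
      if "0 \<le> s" "0 \<le> t" for s t
    proof -
      have "q (x \<oplus>\<^bsub>V\<^esub> y) \<le> p ((x \<oplus>\<^bsub>V\<^esub> y) \<oplus>\<^bsub>V\<^esub> of_real (s + t) \<odot>\<^bsub>V\<^esub> v) - (s + t) * p v"
        using upper[of "x \<oplus>\<^bsub>V\<^esub> y" "s + t"] that x y V by simp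
      also have "(x \<oplus>\<^bsub>V\<^esub> y) \<oplus>\<^bsub>V\<^esub> of_real (s + t) \<odot>\<^bsub>V\<^esub> v
          = (x \<oplus>\<^bsub>V\<^esub> of_real s \<odot>\<^bsub>V\<^esub> v) \<oplus>\<^bsub>V\<^esub> (y \<oplus>\<^bsub>V\<^esub> of_real t \<odot>\<^bsub>V\<^esub> v)"
        using x y V v by (simp add: vs_smult_left_distrib vs_assoc vs_comm vs_lcomm)
      finally show ?thesis
        using sublinD(1)[OF p, of "x \<oplus>\<^bsub>V\<^esub> of_real s \<odot>\<^bsub>V\<^esub> v" "y \<oplus>\<^bsub>V\<^esub> of_real t \<odot>\<^bsub>V\<^esub> v"] x y V v
        by (simp add: algebra_simps)
    qed
    have "q (x \<oplus>\<^bsub>V\<^esub> y) - (p (y \<oplus>\<^bsub>V\<^esub> of_real t \<odot>\<^bsub>V\<^esub> v) - t * p v) \<le> q x" if "0 \<le> t" for t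
      unfolding q_def[of ] by (rule cINF_greatest) (use 1[OF _ that] in \<open>auto simp: q_def algebra_simps\<close>)
    then have "q (x \<oplus>\<^bsub>V\<^esub> y) - q x \<le> p (y \<oplus>\<^bsub>V\<^esub> of_real t \<odot>\<^bsub>V\<^esub> v) - t * p v" if "0 \<le> t" for t
      using that by (simp add: algebra_simps)
    then have "q (x \<oplus>\<^bsub>V\<^esub> y) - q x \<le> q y"
      unfolding q_def by (intro cINF_greatest) auto
    then show ?thesis by simp
  qed
  have hom: "q (of_real s \<odot>\<^bsub>V\<^esub> x) = s * q x" if s: "0 \<le> s" and x: "x \<in> carrier V" for s x
  proof (cases "s = 0")
    case True
    have "p (\<zero>\<^bsub>V\<^esub> \<oplus>\<^bsub>V\<^esub> of_real t \<odot>\<^bsub>V\<^esub> v) - t * p v = 0" if "0 \<le> t" for t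
      using sublinD(2)[OF p that v] V v by simp
    then have "q \<zero>\<^bsub>V\<^esub> = (INF t\<in>{0::real..}. 0)" unfolding q_def by (intro INF_cong) auto
    then show ?thesis using True x V by simp
  next
    case False
    then have s: "s > 0" using s by simp
    \<comment> \<open>It is enough to have one inequality for all s > 0: applied to 1 / s and the
      scaled vector it becomes the other one.\<close>
    have le: "q (of_real s \<odot>\<^bsub>V\<^esub> x) \<le> s * q x" if s: "s > 0" and x: "x \<in> carrier V" for s x
    proof -
      have "q (of_real s \<odot>\<^bsub>V\<^esub> x) / s \<le> p (x \<oplus>\<^bsub>V\<^esub> of_real t \<odot>\<^bsub>V\<^esub> v) - t * p v" if t: "0 \<le> t" for t
      proof -
        have "q (of_real s \<odot>\<^bsub>V\<^esub> x) \<le> p (of_real s \<odot>\<^bsub>V\<^esub> x \<oplus>\<^bsub>V\<^esub> of_real (s * t) \<odot>\<^bsub>V\<^esub> v) - (s * t) * p v"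
          by (rule upper) (use s t x V in auto)
        also have "of_real s \<odot>\<^bsub>V\<^esub> x \<oplus>\<^bsub>V\<^esub> of_real (s * t) \<odot>\<^bsub>V\<^esub> v = of_real s \<odot>\<^bsub>V\<^esub> (x \<oplus>\<^bsub>V\<^esub> of_real t \<odot>\<^bsub>V\<^esub> v)"
          using x v V by (simp add: vs_smult_right_distrib)
        finally show ?thesis
          using sublinD(2)[OF p, of s "x \<oplus>\<^bsub>V\<^esub> of_real t \<odot>\<^bsub>V\<^esub> v"] s x v V
          by (simp add: field_simps)
      qed
      then have "q (of_real s \<odot>\<^bsub>V\<^esub> x) / s \<le> q x"
        unfolding q_def by (intro cINF_greatest) auto
      then show ?thesis using s by (simp add: field_simps)
    qed
    have "q x \<le> (1 / s) * q (of_real s \<odot>\<^bsub>V\<^esub> x)"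
      using le[of "1 / s" "of_real s \<odot>\<^bsub>V\<^esub> x"] s x V by (simp flip: of_real_mult)
    then show ?thesis using le[OF s x] s by (simp add: field_simps)
  qed
  show "sublin V q" using add hom by (auto simp: sublin_def)
qed

text \<open>A minimal element among the sublinear functionals below \<open>q\<close> is linear: otherwise
  \<open>sublin_inf_translate\<close> gives a smaller one.\<close>

lemma sublin_minimal:
  fixes V :: "('k::real_or_complex, 'a) nspace"
  assumes V: "vs V" and q: "sublin V q"
  shows "\<exists>g. real_lin V g \<and> (\<forall>v\<in>carrier V. g v \<le> q v)"
proof -
  \<comment> \<open>Values off the carrier are pinned to 0, so that the pointwise order at all
    arguments only compares values on the carrier. The relation \<open>R\<close> is reversed,
    because Zorn's lemma delivers maximal elements and a minimal functional is wanted.\<close>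
  define P where "P = {p. sublin V p \<and> (\<forall>v\<in>carrier V. p v \<le> q v) \<and> (\<forall>v. v \<notin> carrier V \<longrightarrow> p v = 0)}"
  define R :: "('a \<Rightarrow> real) \<Rightarrow> ('a \<Rightarrow> real) \<Rightarrow> bool" where "R = (\<lambda>p p'. \<forall>v. p' v \<le> p v)"
  have cut: "sublin V (\<lambda>v. if v \<in> carrier V then p v else 0)" if "sublin V p" for p
    using that V by (auto simp: sublin_def)
  let ?q = "\<lambda>v. if v \<in> carrier V then q v else 0"
  have qP: "?q \<in> P" using cut[OF q] by (auto simp: P_def)
  have "\<exists>m\<in>P. \<forall>a\<in>P. R m a \<longrightarrow> a = m"
  proof (rule predicate_Zorn)
    show "partial_order_on P (relation_of R P)"
      by (rule partial_order_on_relation_ofI) (auto simp: R_def fun_eq_iff intro: order_trans order.antisym)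
  next
    fix C assume C: "C \<in> Chains (relation_of R P)"
    then have CP: "C \<subseteq> P" by (rule Chains_relation_of)
    have total: "R p p' \<or> R p' p" if "p \<in> C" "p' \<in> C" for p p'
      using C that by (auto simp: Chains_def relation_of_def)
    show "\<exists>u\<in>P. \<forall>a\<in>C. R a u"
    proof (cases "C = {}")
      case True then show ?thesis using qP by auto
    next
      case False
      define u where "u = (\<lambda>v. INF p\<in>C. p v)"
      have u_eq: "u v = (INF p\<in>C. p v)" for v by (simp add: u_def)
      have pC: "sublin V p" "v \<in> carrier V \<Longrightarrow> p v \<le> q v" "v \<notin> carrier V \<Longrightarrow> p v = 0" if "p \<in> C" for p v
        using that CP by (auto simp: P_def)
      have "- q ((-1) \<odot>\<^bsub>V\<^esub> v) \<le> p v" if "v \<in> carrier V" "p \<in> C" for v p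
      proof -
        have "- p ((-1) \<odot>\<^bsub>V\<^esub> v) \<le> p ((-1) \<odot>\<^bsub>V\<^esub> ((-1) \<odot>\<^bsub>V\<^esub> v))"
          using that V by (intro sublin_neg[OF V pC(1)]) auto
        then have "- p ((-1) \<odot>\<^bsub>V\<^esub> v) \<le> p v" using that V by simp
        then show ?thesis using pC(2)[OF that(2), of "(-1) \<odot>\<^bsub>V\<^esub> v"] that V by simp
      qed
      then have bdd: "bdd_below ((\<lambda>p. p v) ` C)" for v
        by (intro bdd_belowI[of _ "if v \<in> carrier V then - q ((-1) \<odot>\<^bsub>V\<^esub> v) else 0"])
          (auto simp: pC(3))
      have low: "u v \<le> p v" if "p \<in> C" for v p
        unfolding u_def using that by (intro cINF_lower bdd)
      have "u (v \<oplus>\<^bsub>V\<^esub> w) \<le> u v + u w" if vw: "v \<in> carrier V" "w \<in> carrier V" for v w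
      proof -
        have 1: "u (v \<oplus>\<^bsub>V\<^esub> w) \<le> p v + p' w" if pp: "p \<in> C" "p' \<in> C" for p p'
        proof -
          \<comment> \<open>In a chain the smaller of \<open>p\<close> and \<open>p'\<close> bounds
            both terms at once; this is where totality makes the infimum subadditive.\<close>
          obtain r where "r \<in> C" "r v \<le> p v" "r w \<le> p' w"
            using total[OF pp] pp by (auto simp: R_def)
          then show ?thesis using low[of r "v \<oplus>\<^bsub>V\<^esub> w"] sublinD(1)[OF pC(1) vw, of r] by force
        qed
        have "u (v \<oplus>\<^bsub>V\<^esub> w) - p' w \<le> u v" if "p' \<in> C" for p'
          unfolding u_eq[of v] by (rule cINF_greatest) (use False 1[OF _ that] in \<open>auto simp: u_def algebra_simps\<close>)
        then have "u (v \<oplus>\<^bsub>V\<^esub> w) - u v \<le> p' w" if "p' \<in> C" for p'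
          using that by (simp add: algebra_simps)
        then have "u (v \<oplus>\<^bsub>V\<^esub> w) - u v \<le> u w"
          unfolding u_def using False by (intro cINF_greatest) auto
        then show ?thesis by simp
      qed
      moreover have "u (of_real t \<odot>\<^bsub>V\<^esub> v) = t * u v" if t: "0 \<le> t" and v: "v \<in> carrier V" for t v
      proof (cases "t = 0")
        case True
        have "p \<zero>\<^bsub>V\<^esub> = 0" if "p \<in> C" for p using sublin_zero[OF V pC(1)[OF that]] .
        then have "u \<zero>\<^bsub>V\<^esub> = (INF p\<in>C. 0)" unfolding u_def by (intro INF_cong) auto
        then show ?thesis using True v V False by simp
      next
        case False
        then have t: "t > 0" using t by simp
        have le: "t * u v \<le> u (of_real t \<odot>\<^bsub>V\<^esub> v)" if t: "t > 0" and v: "v \<in> carrier V" for t v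
          unfolding u_eq[of "of_real t \<odot>\<^bsub>V\<^esub> v"] 
        proof (rule cINF_greatest[OF \<open>C \<noteq> {}\<close>])
          fix p assume "p \<in> C"
          then show "t * u v \<le> p (of_real t \<odot>\<^bsub>V\<^esub> v)"
            using sublinD(2)[OF pC(1) _ v, of p t] t low[of p v] by simp
        qed
        have "(1 / t) * u (of_real t \<odot>\<^bsub>V\<^esub> v) \<le> u v"
          using le[of "1 / t" "of_real t \<odot>\<^bsub>V\<^esub> v"] t v V by (simp flip: of_real_mult)
        then show ?thesis using le[OF t v] t by (simp add: field_simps)
      qed
      moreover have "u v \<le> q v" if "v \<in> carrier V" for v
        using False low pC(2)[OF _ that] by (meson all_not_in_conv order_trans)
      moreover have "u v = 0" if "v \<notin> carrier V" for v
      proof -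
        have "u v = (INF p\<in>C. 0)" unfolding u_def using pC(3) that by (intro INF_cong) auto
        then show ?thesis using False by simp
      qed
      ultimately have "u \<in> P" by (auto simp: P_def sublin_def)
      then show ?thesis using low by (auto simp: R_def)
    qed
  qed
  then obtain p where p: "p \<in> P" and min: "\<And>a. a \<in> P \<Longrightarrow> (\<forall>v. a v \<le> p v) \<Longrightarrow> a = p"
    by (auto simp: R_def)
  have ps: "sublin V p" using p by (auto simp: P_def)
  have super: "p x + p v \<le> p (x \<oplus>\<^bsub>V\<^esub> v)" if x: "x \<in> carrier V" and v: "v \<in> carrier V" for x v
  proof -
    define r where "r = (\<lambda>x. INF t\<in>{0..}. p (x \<oplus>\<^bsub>V\<^esub> of_real t \<odot>\<^bsub>V\<^esub> v) - t * p v)"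
    have r: "sublin V r" "\<And>x t. x \<in> carrier V \<Longrightarrow> 0 \<le> t \<Longrightarrow> r x \<le> p (x \<oplus>\<^bsub>V\<^esub> of_real t \<odot>\<^bsub>V\<^esub> v) - t * p v"
      unfolding r_def by (rule sublin_inf_translate[OF V ps v]; assumption?)+
    let ?r = "\<lambda>v. if v \<in> carrier V then r v else 0"
    have rp: "r y \<le> p y" if "y \<in> carrier V" for y
      using r(2)[OF that, of 0] that v V by simp
    moreover have "r y \<le> q y" if "y \<in> carrier V" for y
      using rp[OF that] p that by (force simp: P_def)
    ultimately have "?r \<in> P" "\<forall>v. ?r v \<le> p v"
      using cut[OF r(1)] p by (auto simp: P_def)
    then have "?r = p" by (rule min)
    then have "p x = r x" using x fun_cong[of ?r p x] by simp
    then show ?thesis using r(2)[OF x, of 1] v V by simp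
  qed
  have add: "p (x \<oplus>\<^bsub>V\<^esub> v) = p x + p v" if "x \<in> carrier V" "v \<in> carrier V" for x v
    using super[OF that] sublinD(1)[OF ps that] by simp
  have neg: "p ((-1) \<odot>\<^bsub>V\<^esub> v) = - p v" if "v \<in> carrier V" for v
    using add[of v "(-1) \<odot>\<^bsub>V\<^esub> v"] that V sublin_zero[OF V ps] by simp
  have "p (of_real t \<odot>\<^bsub>V\<^esub> v) = t * p v" if v: "v \<in> carrier V" for t v
  proof (cases "0 \<le> t")
    case True then show ?thesis using sublinD(2)[OF ps] v by simp
  next
    case False
    then have "p (of_real (- t) \<odot>\<^bsub>V\<^esub> v) = (- t) * p v" by (intro sublinD(2)[OF ps] v) simp
    then show ?thesis using neg[of "of_real (- t) \<odot>\<^bsub>V\<^esub> v"] v V by simp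
  qed
  then show ?thesis using add p by (intro exI[of _ p]) (auto simp: real_lin_def P_def)
qed

lemma real_or_complex_cases:
  obtains (real) "\<forall>z::'k::real_or_complex. \<exists>a. z = of_real a"
  | (complex) i :: "'k::real_or_complex" where "i * i = -1"
      "\<forall>z. \<exists>a b. z = of_real a + of_real b * i \<and> norm z = sqrt (a\<^sup>2 + b\<^sup>2)"
  using real_or_complex[where 'a = 'k] by (auto simp: of_real_def)

text \<open>The scalar class names no real part, so one is produced together with everything that
  \<open>hahn_banach\<close> uses of it. Over a real field \<open>g\<close> itself is the linear
  form sought; over a complex one it is \<open>h v = g v - i g (i v)\<close>, whose real part is
  \<open>g\<close>.\<close>

lemma ex_real_part:
  "\<exists>re :: 'k::real_or_complex \<Rightarrow> real. (\<forall>x y. re (x + y) = re x + re y) \<and>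
     (\<forall>t x. re (of_real t * x) = t * re x) \<and> (\<forall>x. \<bar>re x\<bar> \<le> norm x) \<and> re 1 = 1 \<and>
     (\<forall>(V :: ('k, 'a) nspace) g. vs V \<and> real_lin V g \<longrightarrow> (\<exists>h\<in>lin_forms V. \<forall>v\<in>carrier V. re (h v) = g v))"
proof (cases rule: real_or_complex_cases[where 'k = 'k])
  case real
  define re :: "'k \<Rightarrow> real" where "re z = (SOME a. z = of_real a)" for z
  have re: "z = of_real (re z)" for z unfolding re_def using real by (metis (mono_tags, lifting) someI_ex)
  then have re': "re (of_real a) = a" for a by (metis of_real_eq_iff)
  have r1: "re (x + y) = re x + re y" for x y by (metis of_real_add re re')
  have r2: "re (of_real t * x) = t * re x" for t x by (metis of_real_mult re re')
  have r3: "\<bar>re x\<bar> \<le> norm x" for x by (metis norm_of_real order_refl re)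
  have r4: "re 1 = 1" by (metis of_real_1 re')
  have "\<exists>h\<in>lin_forms V. \<forall>v\<in>carrier V. re (h v) = g v" if V: "vs V" and g: "real_lin V g"
    for V :: "('k, 'a) nspace" and g
  proof (intro bexI ballI)
    show "(\<lambda>v. if v \<in> carrier V then of_real (g v) else 0) \<in> lin_forms V"
    proof (rule lin_formsI)
      fix c v assume v: "v \<in> carrier V"
      have "g (of_real (re c) \<odot>\<^bsub>V\<^esub> v) = re c * g v" using g v by (auto simp: real_lin_def)
      then have "of_real (g (c \<odot>\<^bsub>V\<^esub> v)) = c * of_real (g v)" by (metis of_real_mult re)
      then show "(if c \<odot>\<^bsub>V\<^esub> v \<in> carrier V then of_real (g (c \<odot>\<^bsub>V\<^esub> v)) else 0) =
         c * (if v \<in> carrier V then of_real (g v) else 0)" using v V by simp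
    qed (use g V in \<open>auto simp: real_lin_def\<close>)
  qed (auto simp: re')
  then show ?thesis using r1 r2 r3 r4 by blast
next
  case (complex i)
  \<comment> \<open>Squaring a - a' = (b' - b) i equates a nonnegative with a nonpositive real
    number, so both differences vanish.\<close>
  have uniq: "a = a' \<and> b = b'" if "of_real a + of_real b * i = of_real a' + of_real b' * i" for a b a' b'
  proof -
    have "of_real (a - a') = of_real (b' - b) * i" using that by (simp add: algebra_simps)
    then have "of_real (a - a') * of_real (a - a') = (of_real (b' - b) * of_real (b' - b)) * (i * i)"
      by (metis (no_types, lifting) mult.assoc mult.commute)
    then have "of_real ((a - a') * (a - a')) = (of_real (- ((b' - b) * (b' - b))) :: 'k)"
      using complex(1) by simp
    then have "(a - a') * (a - a') = - ((b' - b) * (b' - b))" by (metis of_real_eq_iff)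
    then have "(a - a') * (a - a') + (b' - b) * (b' - b) = 0" by simp
    then show ?thesis by (simp add: sum_squares_eq_zero_iff)
  qed
  define re :: "'k \<Rightarrow> real" where "re z = (SOME a. \<exists>b. z = of_real a + of_real b * i)" for z
  have re_ex: "\<exists>b. z = of_real (re z) + of_real b * i" for z
    unfolding re_def using complex(2) by (metis (mono_tags, lifting) someI_ex)
  have re': "re (of_real a + of_real b * i) = a" for a b
    using re_ex[of "of_real a + of_real b * i"] uniq by metis
  have r1: "re (x + y) = re x + re y" for x y
  proof -
    obtain a b where "x = of_real (re x) + of_real a * i" "y = of_real (re y) + of_real b * i"
      using re_ex by metis
    then have "x + y = of_real (re x + re y) + of_real (a + b) * i" by (simp add: algebra_simps)
    then show ?thesis using re' by metis
  qed
  have r2: "re (of_real t * x) = t * re x" for t x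
  proof -
    obtain a where "x = of_real (re x) + of_real a * i" using re_ex by metis
    then have "of_real t * x = of_real t * (of_real (re x) + of_real a * i)" by metis
    then have "of_real t * x = of_real (t * re x) + of_real (t * a) * i" by (simp add: algebra_simps)
    then show ?thesis using re' by metis
  qed
  have r3: "\<bar>re x\<bar> \<le> norm x" for x
  proof -
    obtain a b where *: "x = of_real a + of_real b * i" "norm x = sqrt (a\<^sup>2 + b\<^sup>2)" using complex by metis
    then have "re x = a" using re' by metis
    then show ?thesis using *(2) by (simp add: real_le_rsqrt)
  qed
  have r4: "re 1 = 1" using re'[of 1 0] by simp
  have "\<exists>h\<in>lin_forms V. \<forall>v\<in>carrier V. re (h v) = g v" if V: "vs V" and g: "real_lin V g"
    for V :: "('k, 'a) nspace" and g
  proof (intro bexI ballI)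
    let ?h = "\<lambda>v. if v \<in> carrier V then of_real (g v) - of_real (g (i \<odot>\<^bsub>V\<^esub> v)) * i else 0"
    have ga: "g (v \<oplus>\<^bsub>V\<^esub> w) = g v + g w" "g (of_real t \<odot>\<^bsub>V\<^esub> v) = t * g v"
      if "v \<in> carrier V" "w \<in> carrier V" for v w t
      using g that by (auto simp: real_lin_def)
    show "?h \<in> lin_forms V"
    proof (rule lin_formsI)
      fix c v assume v: "v \<in> carrier V"
      obtain a b where c: "c = of_real a + of_real b * i" using complex by metis
      have 1: "g (c \<odot>\<^bsub>V\<^esub> v) = a * g v + b * g (i \<odot>\<^bsub>V\<^esub> v)"
        using ga(1)[of "of_real a \<odot>\<^bsub>V\<^esub> v" "of_real b \<odot>\<^bsub>V\<^esub> (i \<odot>\<^bsub>V\<^esub> v)"] ga(2)[OF v v, of a]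
          ga(2)[of "i \<odot>\<^bsub>V\<^esub> v" v b] v V by (simp add: c vs_smult_left_distrib)
      have ic: "i * c = of_real a * i + of_real (- b)"
    proof -
      have "i * c = of_real a * i + of_real b * (i * i)" by (simp add: c algebra_simps)
      then show ?thesis using complex(1) by simp
    qed
      have 2: "g (i \<odot>\<^bsub>V\<^esub> (c \<odot>\<^bsub>V\<^esub> v)) = a * g (i \<odot>\<^bsub>V\<^esub> v) - b * g v"
        using ga(1)[of "of_real a \<odot>\<^bsub>V\<^esub> (i \<odot>\<^bsub>V\<^esub> v)" "of_real (- b) \<odot>\<^bsub>V\<^esub> v"] ga(2)[OF v v, of "- b"]
          ga(2)[of "i \<odot>\<^bsub>V\<^esub> v" v a] v V ic by (simp add: vs_smult_left_distrib del: of_real_minus)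
      have sq: "i * (i * x) = - x" for x using complex(1) by (simp flip: mult.assoc)
      show "?h (c \<odot>\<^bsub>V\<^esub> v) = c * ?h v"
        using v V 1 2 by (simp del: vs_smult_assoc) (simp add: c algebra_simps sq)
    qed (use V ga in \<open>auto simp: vs_smult_right_distrib algebra_simps\<close>)
    fix v assume "v \<in> carrier V"
    then show "re (?h v) = g v" using re'[of "g v" "- g (i \<odot>\<^bsub>V\<^esub> v)"] by simp
  qed
  then show ?thesis using r1 r2 r3 r4 by blast
qed

text \<open>Hahn-Banach is applied below to distances from subspaces, which are zero on the subspace
  and hence only seminorms.\<close>

definition seminorm :: "('k::real_or_complex, 'a) nspace \<Rightarrow> ('a \<Rightarrow> real) \<Rightarrow> bool" where
  "seminorm V p \<longleftrightarrow> (\<forall>v\<in>carrier V. \<forall>w\<in>carrier V. p (v \<oplus>\<^bsub>V\<^esub> w) \<le> p v + p w) \<and>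
     (\<forall>c. \<forall>v\<in>carrier V. p (c \<odot>\<^bsub>V\<^esub> v) = norm c * p v)"

lemma seminormD:
  assumes "seminorm V p"
  shows "v \<in> carrier V \<Longrightarrow> w \<in> carrier V \<Longrightarrow> p (v \<oplus>\<^bsub>V\<^esub> w) \<le> p v + p w"
    "v \<in> carrier V \<Longrightarrow> p (c \<odot>\<^bsub>V\<^esub> v) = norm c * p v"
  using assms by (auto simp: seminorm_def)

lemma seminorm_zero: "vs V \<Longrightarrow> seminorm V p \<Longrightarrow> p \<zero>\<^bsub>V\<^esub> = 0"
  using seminormD(2)[of V p "\<zero>\<^bsub>V\<^esub>" 0] by simp

lemma seminorm_nonneg:
  assumes "vs V" "seminorm V p" "v \<in> carrier V"
  shows "0 \<le> p v"
  using seminormD(1)[OF assms(2), of v "(-1) \<odot>\<^bsub>V\<^esub> v"] seminormD(2)[OF assms(2), of v "-1"]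
    seminorm_zero[OF assms(1,2)] assms by simp

text \<open>Extension is reduced to domination. The functional \<open>q v\<close>, the infimum of
  \<open>p (v + s) - re (f s)\<close> over s in S, is sublinear, lies below \<open>p\<close>, and
  satisfies \<open>q (-s) \<le> - re (f s)\<close> on S. A real linear \<open>g\<close> below
  \<open>q\<close> is therefore dominated by \<open>p\<close>, and its values at s and -s force it
  to agree with the real part of \<open>f\<close> on S.\<close>

theorem hahn_banach:
  fixes V :: "('k::real_or_complex, 'a) nspace"
  assumes V: "vs V" and p: "seminorm V p" and S: "subsp V S"
    and f: "is_lin (V\<lparr>carrier := S\<rparr>) scalar_space f" and le: "\<And>s. s \<in> S \<Longrightarrow> norm (f s) \<le> p s"
  obtains h where "h \<in> lin_forms V" "\<And>s. s \<in> S \<Longrightarrow> h s = f s" "\<And>v. v \<in> carrier V \<Longrightarrow> norm (h v) \<le> p v"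
proof -
  obtain re :: "'k \<Rightarrow> real" where r1: "\<And>x y. re (x + y) = re x + re y"
    and r2: "\<And>t x. re (of_real t * x) = t * re x" and r3: "\<And>x. \<bar>re x\<bar> \<le> norm x" and r4: "re 1 = 1"
    and r5: "\<And>(V :: ('k, 'a) nspace) g. vs V \<Longrightarrow> real_lin V g \<Longrightarrow> \<exists>h\<in>lin_forms V. \<forall>v\<in>carrier V. re (h v) = g v"
    using ex_real_part[where 'k = 'k and 'a = 'a] by blast
  have rneg: "re (- x) = - re x" for x using r2[of "-1" x] by simp
  have flin: "f (s \<oplus>\<^bsub>V\<^esub> t) = f s + f t" "f (c \<odot>\<^bsub>V\<^esub> s) = c * f s" if "s \<in> S" "t \<in> S" for s t c
    using f that by (auto simp: is_lin_def)
  note SD = subspD[OF S]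
  have ps: "sublin V p" using p by (auto simp: seminorm_def sublin_def)
  define q where "q = (\<lambda>v. INF s\<in>S. p (v \<oplus>\<^bsub>V\<^esub> s) - re (f s))"
  have lower: "- p ((-1) \<odot>\<^bsub>V\<^esub> v) \<le> p (v \<oplus>\<^bsub>V\<^esub> s) - re (f s)" if "v \<in> carrier V" "s \<in> S" for v s
    using sublin_lower[OF V ps that(1) SD(1)[OF that(2)]] le[OF that(2)] r3[of "f s"] by simp
  then have bdd: "bdd_below ((\<lambda>s. p (v \<oplus>\<^bsub>V\<^esub> s) - re (f s)) ` S)" if "v \<in> carrier V" for v
    using that by (intro bdd_belowI[of _ "- p ((-1) \<odot>\<^bsub>V\<^esub> v)"]) auto
  have upper: "q v \<le> p (v \<oplus>\<^bsub>V\<^esub> s) - re (f s)" if "v \<in> carrier V" "s \<in> S" for v s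
    unfolding q_def using that by (intro cINF_lower bdd)
  have "S \<noteq> {}" using SD(2) by auto
  have "q (x \<oplus>\<^bsub>V\<^esub> y) \<le> q x + q y" if x: "x \<in> carrier V" and y: "y \<in> carrier V" for x y
  proof -
    have 1: "q (x \<oplus>\<^bsub>V\<^esub> y) \<le> (p (x \<oplus>\<^bsub>V\<^esub> s) - re (f s)) + (p (y \<oplus>\<^bsub>V\<^esub> t) - re (f t))"
      if st: "s \<in> S" "t \<in> S" for s t
    proof -
      have "q (x \<oplus>\<^bsub>V\<^esub> y) \<le> p ((x \<oplus>\<^bsub>V\<^esub> y) \<oplus>\<^bsub>V\<^esub> (s \<oplus>\<^bsub>V\<^esub> t)) - re (f (s \<oplus>\<^bsub>V\<^esub> t))"
        using st x y V SD by (intro upper) auto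
      also have "(x \<oplus>\<^bsub>V\<^esub> y) \<oplus>\<^bsub>V\<^esub> (s \<oplus>\<^bsub>V\<^esub> t) = (x \<oplus>\<^bsub>V\<^esub> s) \<oplus>\<^bsub>V\<^esub> (y \<oplus>\<^bsub>V\<^esub> t)"
        using x y V SD(1)[OF st(1)] SD(1)[OF st(2)] by (simp add: vs_assoc vs_comm vs_lcomm)
      finally show ?thesis
        using seminormD(1)[OF p, of "x \<oplus>\<^bsub>V\<^esub> s" "y \<oplus>\<^bsub>V\<^esub> t"] x y V SD(1)[OF st(1)] SD(1)[OF st(2)] st
        by (simp add: flin r1)
    qed
    have "q (x \<oplus>\<^bsub>V\<^esub> y) - (p (y \<oplus>\<^bsub>V\<^esub> t) - re (f t)) \<le> q x" if "t \<in> S" for t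
      unfolding q_def[of ] by (rule cINF_greatest) (use \<open>S \<noteq> {}\<close> 1[OF _ that] in \<open>auto simp: q_def algebra_simps\<close>)
    then have "q (x \<oplus>\<^bsub>V\<^esub> y) - q x \<le> p (y \<oplus>\<^bsub>V\<^esub> t) - re (f t)" if "t \<in> S" for t
      using that by (simp add: algebra_simps)
    then have "q (x \<oplus>\<^bsub>V\<^esub> y) - q x \<le> q y"
      unfolding q_def using \<open>S \<noteq> {}\<close> by (intro cINF_greatest) auto
    then show ?thesis by simp
  qed
  moreover have "q (of_real s \<odot>\<^bsub>V\<^esub> x) = s * q x" if s: "0 \<le> s" and x: "x \<in> carrier V" for s x
  proof (cases "s = 0")
    case True
    have "q \<zero>\<^bsub>V\<^esub> \<le> 0" using upper[of "\<zero>\<^bsub>V\<^esub>" "\<zero>\<^bsub>V\<^esub>"] V SD flin(2)[of "\<zero>\<^bsub>V\<^esub>" "\<zero>\<^bsub>V\<^esub>" 0] seminorm_zero[OF V p] rneg[of 0]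
      by simp
    moreover have "0 \<le> q \<zero>\<^bsub>V\<^esub>"
      unfolding q_def
    proof (rule cINF_greatest[OF \<open>S \<noteq> {}\<close>])
      fix s assume "s \<in> S"
      then show "0 \<le> p (\<zero>\<^bsub>V\<^esub> \<oplus>\<^bsub>V\<^esub> s) - re (f s)" using SD(1) V le[of s] r3[of "f s"] by simp
    qed
    ultimately show ?thesis using True x V by simp
  next
    case False
    then have s: "s > 0" using s by simp
    have le: "q (of_real s \<odot>\<^bsub>V\<^esub> x) \<le> s * q x" if s: "s > 0" and x: "x \<in> carrier V" for s x
    proof -
      have "q (of_real s \<odot>\<^bsub>V\<^esub> x) / s \<le> p (x \<oplus>\<^bsub>V\<^esub> t) - re (f t)" if t: "t \<in> S" for t
      proof -
        have "q (of_real s \<odot>\<^bsub>V\<^esub> x) \<le> p (of_real s \<odot>\<^bsub>V\<^esub> x \<oplus>\<^bsub>V\<^esub> of_real s \<odot>\<^bsub>V\<^esub> t) - re (f (of_real s \<odot>\<^bsub>V\<^esub> t))"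
          by (rule upper) (use s t x V SD in auto)
        also have "of_real s \<odot>\<^bsub>V\<^esub> x \<oplus>\<^bsub>V\<^esub> of_real s \<odot>\<^bsub>V\<^esub> t = of_real s \<odot>\<^bsub>V\<^esub> (x \<oplus>\<^bsub>V\<^esub> t)"
          using x SD(1)[OF t] V by (simp add: vs_smult_right_distrib)
        finally show ?thesis
          using seminormD(2)[OF p, of "x \<oplus>\<^bsub>V\<^esub> t" "of_real s"] s x SD(1)[OF t] V t
          by (simp add: flin r2 field_simps)
      qed
      then have "q (of_real s \<odot>\<^bsub>V\<^esub> x) / s \<le> q x"
        unfolding q_def using \<open>S \<noteq> {}\<close> by (intro cINF_greatest) auto
      then show ?thesis using s by (simp add: field_simps)
    qed
    have "q x \<le> (1 / s) * q (of_real s \<odot>\<^bsub>V\<^esub> x)"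
      using le[of "1 / s" "of_real s \<odot>\<^bsub>V\<^esub> x"] s x V by (simp flip: of_real_mult)
    then show ?thesis using le[OF s x] s by (simp add: field_simps)
  qed
  ultimately have "sublin V q" by (auto simp: sublin_def)
  then obtain g where g: "real_lin V g" and gq: "\<And>v. v \<in> carrier V \<Longrightarrow> g v \<le> q v"
    using sublin_minimal[OF V] by blast
  have gneg: "g ((-1) \<odot>\<^bsub>V\<^esub> v) = - g v" if "v \<in> carrier V" for v
    using g that unfolding real_lin_def by (metis mult_minus1 of_real_1 of_real_minus)
  obtain h where h: "h \<in> lin_forms V" and hg: "\<And>v. v \<in> carrier V \<Longrightarrow> re (h v) = g v" using r5[OF V g] by blast
  have gp: "g v \<le> p v" if v: "v \<in> carrier V" for v
  proof -
    have "f \<zero>\<^bsub>V\<^esub> = 0" using flin(2)[OF SD(2) SD(2), of 0] V by simp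
    then show ?thesis using gq[OF v] upper[OF v SD(2)] v V rneg[of 0] by simp
  qed
  have gf: "g s = re (f s)" if s: "s \<in> S" for s
  proof -
    have *: "re (f t) \<le> g t" if t: "t \<in> S" for t
    proof -
      have "g ((-1) \<odot>\<^bsub>V\<^esub> t) \<le> p ((-1) \<odot>\<^bsub>V\<^esub> t \<oplus>\<^bsub>V\<^esub> t) - re (f t)"
        using gq[of "(-1) \<odot>\<^bsub>V\<^esub> t"] upper[of "(-1) \<odot>\<^bsub>V\<^esub> t" t] t SD V by force
      also have "(-1) \<odot>\<^bsub>V\<^esub> t \<oplus>\<^bsub>V\<^esub> t = \<zero>\<^bsub>V\<^esub>" using SD(1)[OF t] V vs_comm[OF V] by simp
      finally show ?thesis using gneg[OF SD(1)[OF t]] seminorm_zero[OF V p] by simp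
    qed
    have "re (f ((-1) \<odot>\<^bsub>V\<^esub> s)) \<le> g ((-1) \<odot>\<^bsub>V\<^esub> s)" using * SD(4)[OF s] by blast
    then show ?thesis using *[OF s] gneg[OF SD(1)[OF s]] flin(2)[OF s s] rneg by simp
  qed
  have unit: "z = 0" if "\<And>c::'k. re (c * z) = 0" for z :: 'k
  proof (rule ccontr)
    assume "z \<noteq> 0" then show False using that[of "inverse z"] r4 by simp
  qed
  have hf: "h s = f s" if s: "s \<in> S" for s
  proof -
    \<comment> \<open>Only real parts are known to agree on S. Testing them at all multiples
      \<open>c s\<close>, which stay in S, recovers the scalar values.\<close>
    have "re (c * (h s - f s)) = 0" for c
    proof -
      have "re (h (c \<odot>\<^bsub>V\<^esub> s)) = re (f (c \<odot>\<^bsub>V\<^esub> s))" using hg gf SD(1,4) s by metis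
      then have "re (c * h s) = re (c * f s)" using lin_formsD(4)[OF h SD(1)[OF s]] flin(2)[OF s s] by simp
      then show ?thesis using r1[of "c * h s" "- (c * f s)"] rneg by (simp add: algebra_simps)
    qed
    then show ?thesis using unit by force
  qed
  have hp: "norm (h v) \<le> p v" if v: "v \<in> carrier V" for v
  proof (cases "h v = 0")
    case True then show ?thesis using seminorm_nonneg[OF V p v] by simp
  next
    case False
    \<comment> \<open>The unimodular factor makes the value of \<open>h\<close> real and
      nonnegative, so the one-sided bound on its real part bounds the modulus.\<close>
    define c where "c = of_real (norm (h v)) / h v"
    have c: "norm c = 1" "c * h v = of_real (norm (h v)) * 1" using False by (auto simp: c_def norm_divide)
    have "norm (h v) = re (h (c \<odot>\<^bsub>V\<^esub> v))" using c(2) r2[of "norm (h v)" 1] r4 lin_formsD(4)[OF h v] by simp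
    also have "\<dots> \<le> p (c \<odot>\<^bsub>V\<^esub> v)" using hg gp v V by simp
    also have "\<dots> = p v" using seminormD(2)[OF p v] c(1) by simp
    finally show ?thesis .
  qed
  show thesis using that[OF h hf hp] .
qed

corollary hahn_banach_norming:
  fixes V :: "('k::real_or_complex, 'a) nspace"
  assumes V: "vs V" and p: "seminorm V p" and v0: "v0 \<in> carrier V"
  obtains h where "h \<in> lin_forms V" "h v0 = of_real (p v0)" "\<And>v. v \<in> carrier V \<Longrightarrow> norm (h v) \<le> p v"
proof (cases "p v0 = 0")
  case True
  then show ?thesis using that[OF lin_forms_0] seminorm_nonneg[OF V p] by simp
next
  case False
  define S where "S = {c \<odot>\<^bsub>V\<^esub> v0 | c. True}"
  have S: "subsp V S"
    unfolding subsp_def S_def using v0 V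
    by (auto simp flip: vs_smult_left_distrib intro: exI[of _ 0])
  have inj: "c = d" if "c \<odot>\<^bsub>V\<^esub> v0 = d \<odot>\<^bsub>V\<^esub> v0" for c d
  proof -
    have "p ((c + - d) \<odot>\<^bsub>V\<^esub> v0) = p (c \<odot>\<^bsub>V\<^esub> v0 \<oplus>\<^bsub>V\<^esub> (- d) \<odot>\<^bsub>V\<^esub> v0)"
      by (simp only: vs_smult_left_distrib[OF V v0])
    also have "\<dots> = p ((d + - d) \<odot>\<^bsub>V\<^esub> v0)"
      unfolding vs_smult_left_distrib[OF V v0] that ..
    also have "\<dots> = 0" using v0 V seminorm_zero[OF V p] by simp
    finally show ?thesis using seminormD(2)[OF p v0] False by simp
  qed
  define f where "f s = (THE c. s = c \<odot>\<^bsub>V\<^esub> v0) * of_real (p v0)" for s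
  have f: "f (c \<odot>\<^bsub>V\<^esub> v0) = c * of_real (p v0)" for c
    unfolding f_def using inj by (subst the_equality[of _ c]) auto
  have "is_lin (V\<lparr>carrier := S\<rparr>) scalar_space f"
    unfolding is_lin_def using v0 V
    by (auto simp: S_def f algebra_simps simp flip: vs_smult_left_distrib)
  moreover have "norm (f s) \<le> p s" if "s \<in> S" for s
    using that seminormD(2)[OF p v0] seminorm_nonneg[OF V p v0] by (auto simp: S_def f norm_mult)
  ultimately obtain h where "h \<in> lin_forms V" "\<And>s. s \<in> S \<Longrightarrow> h s = f s" "\<And>v. v \<in> carrier V \<Longrightarrow> norm (h v) \<le> p v"
    using hahn_banach[OF V p S] by blast
  moreover have "v0 \<in> S" unfolding S_def using v0 V by (auto intro!: exI[of _ 1])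
  moreover have "f v0 = of_real (p v0)" using f[of 1] v0 V by simp
  ultimately show ?thesis using that by metis
qed

section \<open>Normed spaces and bounded operators\<close>

lemma normed_spaceD:
  assumes "normed_space V"
  shows "vs V" "v \<in> carrier V \<Longrightarrow> 0 \<le> nrm V v" "v \<in> carrier V \<Longrightarrow> nrm V v = 0 \<longleftrightarrow> v = \<zero>\<^bsub>V\<^esub>"
    "v \<in> carrier V \<Longrightarrow> nrm V (c \<odot>\<^bsub>V\<^esub> v) = norm c * nrm V v"
    "v \<in> carrier V \<Longrightarrow> w \<in> carrier V \<Longrightarrow> nrm V (v \<oplus>\<^bsub>V\<^esub> w) \<le> nrm V v + nrm V w"
  using assms by (auto simp: normed_space_def is_norm_def vs_def)

lemma normed_spaceI: "vs V \<Longrightarrow> is_norm V (nrm V) \<Longrightarrow> normed_space V"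
  by (simp add: normed_space_def vs_def)

lemma normed_vs [simp]: "normed_space V \<Longrightarrow> vs V"
  by (rule normed_spaceD)

lemma normed_seminorm: "normed_space V \<Longrightarrow> seminorm V (nrm V)"
  by (simp add: seminorm_def normed_spaceD)

lemma nrm_zero [simp]: "normed_space V \<Longrightarrow> nrm V \<zero>\<^bsub>V\<^esub> = 0"
  by (simp add: normed_spaceD)

lemma banach_normed: "banach_space V \<Longrightarrow> normed_space V"
  by (simp add: banach_space_def)

lemma separated_normed: "normed_space V \<Longrightarrow> separated V"
  unfolding separated_def
proof (intro ballI impI)
  fix v assume V: "normed_space V" and v: "v \<in> carrier V" "\<forall>f\<in>lin_forms V. f v = 0"
  obtain h where h: "h \<in> lin_forms V" "h v = of_real (nrm V v)"
    using hahn_banach_norming[OF normed_spaceD(1) normed_seminorm, OF V V v(1)] by blast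
  have "h v = 0" using h v by blast
  then show "v = \<zero>\<^bsub>V\<^esub>" using h(2) v(1) normed_spaceD(3)[OF V v(1)] by simp
qed

lemma normed_subsp: "normed_space V \<Longrightarrow> subsp V S \<Longrightarrow> normed_space (V\<lparr>carrier := S\<rparr>)"
  using vs_subsp[of V S] by (auto simp: normed_space_def is_norm_def vs_def subspD)

lemma seminorm_lc:
  "vs V \<Longrightarrow> seminorm V p \<Longrightarrow> snd ` set cvs \<subseteq> carrier V \<Longrightarrow> p (lc V cvs) \<le> (\<Sum>(c, v)\<leftarrow>cvs. norm c * p v)"
proof (induction cvs)
  case Nil then show ?case by (simp add: seminorm_zero)
next
  case (Cons cv cvs)
  then show ?case
    using seminormD(1)[of V p "fst cv \<odot>\<^bsub>V\<^esub> snd cv" "lc V cvs"] seminormD(2)[of V p "snd cv" "fst cv"]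
    by (auto simp: case_prod_unfold)
qed

text \<open>This is what operator norms and duals ask of the norm of the domain. With it in place of
  a norm, \<open>dual\<close> can be applied to \<open>alpha_space\<close> and to the tensor
  products without first proving a triangle inequality for \<open>alpha\<close>.\<close>

definition homog :: "('k::real_or_complex, 'a) nspace \<Rightarrow> ('a \<Rightarrow> real) \<Rightarrow> bool" where
  "homog V p \<longleftrightarrow> (\<forall>v\<in>carrier V. 0 \<le> p v) \<and> (\<forall>c. \<forall>v\<in>carrier V. p (c \<odot>\<^bsub>V\<^esub> v) = norm c * p v)"

lemma homog_normed [simp]: "normed_space V \<Longrightarrow> homog V (nrm V)"
  by (auto simp: homog_def normed_spaceD)

lemma homog_scalar [simp]: "homog scalar_space norm"
  by (auto simp: homog_def norm_mult)

lemma bounded_opD: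
  assumes "bounded_op V W f"
  shows "is_lin V W f" "\<exists>c. \<forall>v\<in>carrier V. nrm W (f v) \<le> c * nrm V v"
  using assms by (auto simp: bounded_op_def)

lemma opnorm_bdd_above:
  assumes "homog V (nrm V)" "bounded_op V W f"
  shows "bdd_above ((\<lambda>v. nrm W (f v)) ` {v \<in> carrier V. nrm V v \<le> 1})"
proof -
  obtain c where c: "\<And>v. v \<in> carrier V \<Longrightarrow> nrm W (f v) \<le> c * nrm V v" using assms by (auto simp: bounded_op_def)
  have "nrm W (f v) \<le> max c 0" if v: "v \<in> carrier V" "nrm V v \<le> 1" for v
  proof -
    have "c * nrm V v \<le> max c 0 * nrm V v" using assms v by (intro mult_right_mono) (auto simp: homog_def)
    also have "\<dots> \<le> max c 0 * 1" using v by (intro mult_left_mono) auto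
    finally show ?thesis using c[OF v(1)] by simp
  qed
  then show ?thesis by (intro bdd_aboveI[of _ "max c 0"]) auto
qed

lemma opnorm_bound:
  assumes V: "vs V" "homog V (nrm V)" and W: "homog W (nrm W)" and f: "bounded_op V W f" and v: "v \<in> carrier V"
  shows "nrm W (f v) \<le> opnorm V W f * nrm V v"
proof (cases "nrm V v = 0")
  case True
  \<comment> \<open>A homogeneous function may vanish at nonzero vectors, so the vector cannot be
    normalised here; boundedness itself makes the image small.\<close>
  obtain c where "nrm W (f v) \<le> c * nrm V v" using f v by (auto simp: bounded_op_def)
  then show ?thesis using True by simp
next
  case False
  define r where "r = nrm V v"
  have r: "r > 0" using False V v by (auto simp: homog_def r_def less_le)
  have fv: "f v \<in> carrier W" using f v by (auto simp: bounded_op_def is_lin_def)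
  let ?w = "of_real (1 / r) \<odot>\<^bsub>V\<^esub> v"
  have w: "?w \<in> carrier V" "nrm V ?w = 1"
    using V v r by (auto simp: homog_def simp flip: r_def simp del: of_real_divide)
  have "nrm W (f ?w) \<le> opnorm V W f"
    unfolding opnorm_def using w by (intro cSUP_upper opnorm_bdd_above[OF V(2) f]) auto
  moreover have "nrm W (f ?w) = (1 / r) * nrm W (f v)"
    using is_linD(3)[OF bounded_opD(1)[OF f] v] W fv r
    by (auto simp: homog_def simp del: of_real_divide)
  ultimately have "(1 / r) * nrm W (f v) \<le> opnorm V W f" by simp
  then show ?thesis using r unfolding r_def[symmetric] by (simp add: pos_divide_le_eq)
qed

lemma opnorm_nonneg:
  assumes V: "vs V" "homog V (nrm V)" and W: "homog W (nrm W)" and f: "bounded_op V W f"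
  shows "0 \<le> opnorm V W f"
proof -
  have z: "nrm V \<zero>\<^bsub>V\<^esub> = 0" using V vs_smult_zero_left[OF V(1) vs_zero[OF V(1)]]
    unfolding homog_def by (metis mult_zero_left norm_zero vs_zero)
  then have "nrm W (f \<zero>\<^bsub>V\<^esub>) \<le> opnorm V W f"
    unfolding opnorm_def using V by (intro cSUP_upper opnorm_bdd_above[OF V(2) f]) auto
  moreover have "0 \<le> nrm W (f \<zero>\<^bsub>V\<^esub>)"
    using W is_linD(1)[OF bounded_opD(1)[OF f]] V by (auto simp: homog_def)
  ultimately show ?thesis by simp
qed

lemma opnorm_le:
  assumes V: "vs V" "homog V (nrm V)" and c: "0 \<le> c"
    and le: "\<And>v. v \<in> carrier V \<Longrightarrow> nrm W (f v) \<le> c * nrm V v"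
  shows "opnorm V W f \<le> c"
  unfolding opnorm_def
proof (rule cSUP_least)
  have "nrm V \<zero>\<^bsub>V\<^esub> = 0" using V vs_smult_zero_left[OF V(1) vs_zero[OF V(1)]]
    unfolding homog_def by (metis mult_zero_left norm_zero vs_zero)
  then show "{v \<in> carrier V. nrm V v \<le> 1} \<noteq> {}" using V by fastforce
next
  fix v assume v: "v \<in> {v \<in> carrier V. nrm V v \<le> 1}"
  have "c * nrm V v \<le> c * 1" using v c by (intro mult_left_mono) auto
  then show "nrm W (f v) \<le> c" using le[of v] v by auto
qed

lemma bounded_opI: "is_lin V W f \<Longrightarrow> (\<And>v. v \<in> carrier V \<Longrightarrow> nrm W (f v) \<le> c * nrm V v) \<Longrightarrow> bounded_op V W f"
  by (auto simp: bounded_op_def)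

lemma opnorm_cong: "(\<And>v. v \<in> carrier V \<Longrightarrow> nrm W (f v) = nrm W' (g v)) \<Longrightarrow> opnorm V W f = opnorm V W' g"
  unfolding opnorm_def by (rule SUP_cong) auto

lemma bounded_op_cong:
  "vs V \<Longrightarrow> (\<And>v. v \<in> carrier V \<Longrightarrow> f v = g v) \<Longrightarrow> bounded_op V W f \<longleftrightarrow> bounded_op V W g"
  unfolding bounded_op_def using is_lin_cong[of V f g W] by simp

lemma carrier_dual: "carrier (dual V) = {f \<in> lin_forms V. bounded_op V scalar_space f}"
  by (simp add: dual_def)

lemma nrm_dual: "nrm (dual V) = opnorm V scalar_space"
  by (simp add: dual_def)

lemma dual_simps [simp]:
  "\<zero>\<^bsub>dual V\<^esub> = (\<lambda>_. 0)" "add (dual V) = (\<lambda>f g v. f v + g v)" "smult (dual V) = (\<lambda>c f v. c * f v)"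
  by (auto simp: dual_def)

lemma dualD:
  assumes "vs V" "homog V (nrm V)" "f \<in> carrier (dual V)"
  shows "f \<in> lin_forms V" "v \<in> carrier V \<Longrightarrow> norm (f v) \<le> nrm (dual V) f * nrm V v" "0 \<le> nrm (dual V) f"
    "bounded_op V scalar_space f"
  using assms opnorm_bound[of V scalar_space f v] opnorm_nonneg[of V scalar_space f]
  by (auto simp: carrier_dual nrm_dual)

lemma dualI:
  assumes "f \<in> lin_forms V" "\<And>v. v \<in> carrier V \<Longrightarrow> norm (f v) \<le> c * nrm V v"
  shows "f \<in> carrier (dual V)"
  using assms lin_formsD(1) by (auto simp: carrier_dual intro!: bounded_opI)

lemma nrm_dual_le:
  assumes "vs V" "homog V (nrm V)" "0 \<le> c" "\<And>v. v \<in> carrier V \<Longrightarrow> norm (f v) \<le> c * nrm V v"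
  shows "nrm (dual V) f \<le> c"
  unfolding nrm_dual by (rule opnorm_le) (use assms in auto)

lemma dual_comb:
  assumes "vs V" "homog V (nrm V)" "f \<in> carrier (dual V)" "g \<in> carrier (dual V)"
  shows "(\<lambda>v. a * f v + b * g v) \<in> carrier (dual V)"
proof (rule dualI[where c = "norm a * nrm (dual V) f + norm b * nrm (dual V) g"])
  show "(\<lambda>v. a * f v + b * g v) \<in> lin_forms V"
    using dualD(1)[OF assms(1,2)] assms by (intro lin_forms_comb) auto
  fix v assume v: "v \<in> carrier V"
  have "norm (a * f v + b * g v) \<le> norm a * norm (f v) + norm b * norm (g v)"
    by (metis norm_mult norm_triangle_ineq)
  also have "\<dots> \<le> norm a * (nrm (dual V) f * nrm V v) + norm b * (nrm (dual V) g * nrm V v)"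
    using dualD(2)[OF assms(1,2) _ v] assms by (intro add_mono mult_left_mono) auto
  finally show "norm (a * f v + b * g v) \<le> (norm a * nrm (dual V) f + norm b * nrm (dual V) g) * nrm V v"
    by (simp add: algebra_simps)
qed

lemma normed_dual:
  assumes V: "vs V" "homog V (nrm V)"
  shows "normed_space (dual V)"
proof (rule normed_spaceI)
  show D: "vs (dual V)"
    unfolding dual_def
    by (rule vs_fun_space_scalar)
      (use dual_comb[OF V, unfolded carrier_dual, of _ _ 1 1] dual_comb[OF V, unfolded carrier_dual, of _ _ _ 0]
        lin_forms_0 lin_formsD(1)[OF lin_forms_0] in \<open>auto intro!: bounded_opI[where c = 0]\<close>)
  have sm: "nrm (dual V) (\<lambda>v. c * f v) \<le> norm c * nrm (dual V) f" if "f \<in> carrier (dual V)" for c f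
    using dualD[OF V that] by (intro nrm_dual_le V) (auto simp: norm_mult mult.assoc intro: mult_left_mono)
  show "is_norm (dual V) (nrm (dual V))"
    unfolding is_norm_def
  proof (intro conjI ballI allI iffI)
    fix f assume f: "f \<in> carrier (dual V)"
    show "0 \<le> nrm (dual V) f" by (rule dualD[OF V f])
    { assume "nrm (dual V) f = 0"
      then have "f v = 0" for v
        using dualD(2)[OF V f, of v] lin_formsD(2)[OF dualD(1)[OF V f], of v] by (cases "v \<in> carrier V") auto
      then show "f = \<zero>\<^bsub>dual V\<^esub>" by auto }
    { assume "f = \<zero>\<^bsub>dual V\<^esub>"
      then have "nrm (dual V) f \<le> 0" by (intro nrm_dual_le V) auto
      then show "nrm (dual V) f = 0" using dualD(3)[OF V f] by simp }
    fix c
    show "nrm (dual V) (c \<odot>\<^bsub>dual V\<^esub> f) = norm c * nrm (dual V) f"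
    proof (cases "c = 0")
      case True
      have "nrm (dual V) (\<lambda>v. 0 * f v) = 0"
        using sm[OF f, of 0] dualD(3)[OF V vs_smult[OF D f, of 0]] by simp
      then show ?thesis using True by simp
    next
      case False
      have "(\<lambda>v. c * f v) \<in> carrier (dual V)" using vs_smult[OF D f, of c] by simp
      from sm[OF this, of "inverse c"] have "nrm (dual V) f \<le> inverse (norm c) * nrm (dual V) (\<lambda>v. c * f v)"
        using False by (simp add: norm_inverse flip: mult.assoc)
      then show ?thesis using sm[OF f, of c] False by (simp add: field_simps)
    qed
    fix g assume g: "g \<in> carrier (dual V)"
    show "nrm (dual V) (f \<oplus>\<^bsub>dual V\<^esub> g) \<le> nrm (dual V) f + nrm (dual V) g"
    proof (rule nrm_dual_le[OF V])
      show "0 \<le> nrm (dual V) f + nrm (dual V) g" using dualD(3)[OF V] f g by simp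
      fix v assume v: "v \<in> carrier V"
      show "norm ((f \<oplus>\<^bsub>dual V\<^esub> g) v) \<le> (nrm (dual V) f + nrm (dual V) g) * nrm V v"
        using norm_triangle_ineq[of "f v" "g v"] dualD(2)[OF V f v] dualD(2)[OF V g v]
        by (simp add: algebra_simps)
    qed
  qed
qed

section \<open>The distance from a subspace\<close>

text \<open>The quotient seminorm. It is written with \<open>s \<oplus> v\<close> instead of a
  difference to match the cosets in \<open>quot_space\<close>; the infimum is the same because S
  contains negatives.\<close>

definition sdist :: "('k::real_or_complex, 'a) nspace \<Rightarrow> ('a \<Rightarrow> real) \<Rightarrow> 'a set \<Rightarrow> 'a \<Rightarrow> real" where
  "sdist V p S v = (INF s\<in>S. p (s \<oplus>\<^bsub>V\<^esub> v))"

context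
  fixes V :: "('k::real_or_complex, 'a) nspace" and p S
  assumes V: "vs V" and p: "seminorm V p" and S: "subsp V S"
begin

lemma sdist_le: "v \<in> carrier V \<Longrightarrow> s \<in> S \<Longrightarrow> sdist V p S v \<le> p (s \<oplus>\<^bsub>V\<^esub> v)"
  unfolding sdist_def using seminorm_nonneg[OF V p] subspD[OF S] V
  by (intro cINF_lower bdd_belowI[of _ 0]) auto

lemma sdist_le_self: "v \<in> carrier V \<Longrightarrow> sdist V p S v \<le> p v"
  using sdist_le[of v "\<zero>\<^bsub>V\<^esub>"] subspD[OF S] V by simp

lemma sdist_greatest: "(\<And>s. s \<in> S \<Longrightarrow> c \<le> p (s \<oplus>\<^bsub>V\<^esub> v)) \<Longrightarrow> c \<le> sdist V p S v"
  unfolding sdist_def using subspD(2)[OF S] by (intro cINF_greatest) auto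

lemma sdist_less:
  assumes "v \<in> carrier V" "sdist V p S v < c"
  shows "\<exists>s\<in>S. p (s \<oplus>\<^bsub>V\<^esub> v) < c"
  using assms sdist_greatest[of c v] by (meson not_le)

lemma sdist_zero_on: "s \<in> S \<Longrightarrow> sdist V p S s = 0"
proof (rule antisym)
  assume s: "s \<in> S"
  have "(-1) \<odot>\<^bsub>V\<^esub> s \<oplus>\<^bsub>V\<^esub> s = \<zero>\<^bsub>V\<^esub>" using vs_comm[OF V] s V subspD(1)[OF S] by simp
  then show "sdist V p S s \<le> 0"
    using sdist_le[of s "(-1) \<odot>\<^bsub>V\<^esub> s"] s subspD[OF S] seminorm_zero[OF V p] by simp
  show "0 \<le> sdist V p S s" by (rule sdist_greatest) (use s subspD[OF S] V seminorm_nonneg[OF V p] in auto)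
qed

lemma seminorm_sdist: "seminorm V (sdist V p S)"
  unfolding seminorm_def
proof (intro conjI ballI allI)
  fix v w assume v: "v \<in> carrier V" and w: "w \<in> carrier V"
  have 1: "sdist V p S (v \<oplus>\<^bsub>V\<^esub> w) \<le> p (s \<oplus>\<^bsub>V\<^esub> v) + p (t \<oplus>\<^bsub>V\<^esub> w)" if st: "s \<in> S" "t \<in> S" for s t
  proof -
    have [simp]: "s \<in> carrier V" "t \<in> carrier V" using subspD(1)[OF S] st by auto
    have "sdist V p S (v \<oplus>\<^bsub>V\<^esub> w) \<le> p ((s \<oplus>\<^bsub>V\<^esub> t) \<oplus>\<^bsub>V\<^esub> (v \<oplus>\<^bsub>V\<^esub> w))"
      using sdist_le[of "v \<oplus>\<^bsub>V\<^esub> w" "s \<oplus>\<^bsub>V\<^esub> t"] subspD(3)[OF S st] v w V by simp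
    also have "(s \<oplus>\<^bsub>V\<^esub> t) \<oplus>\<^bsub>V\<^esub> (v \<oplus>\<^bsub>V\<^esub> w) = (s \<oplus>\<^bsub>V\<^esub> v) \<oplus>\<^bsub>V\<^esub> (t \<oplus>\<^bsub>V\<^esub> w)"
      using v w V by (simp add: vs_assoc vs_comm vs_lcomm)
    also have "p \<dots> \<le> p (s \<oplus>\<^bsub>V\<^esub> v) + p (t \<oplus>\<^bsub>V\<^esub> w)" using v w V by (intro seminormD(1)[OF p]) auto
    finally show ?thesis .
  qed
  have "sdist V p S (v \<oplus>\<^bsub>V\<^esub> w) - p (t \<oplus>\<^bsub>V\<^esub> w) \<le> sdist V p S v" if "t \<in> S" for t
    using 1[OF _ that] by (intro sdist_greatest) (simp add: algebra_simps)
  then have "sdist V p S (v \<oplus>\<^bsub>V\<^esub> w) - sdist V p S v \<le> sdist V p S w"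
    by (intro sdist_greatest) (simp add: algebra_simps)
  then show "sdist V p S (v \<oplus>\<^bsub>V\<^esub> w) \<le> sdist V p S v + sdist V p S w" by simp
next
  fix c v assume v: "v \<in> carrier V"
  show "sdist V p S (c \<odot>\<^bsub>V\<^esub> v) = norm c * sdist V p S v"
  proof (cases "c = 0")
    case True then show ?thesis using v V sdist_zero_on[OF subspD(2)[OF S]] by simp
  next
    case False
    have le: "norm c * sdist V p S v \<le> sdist V p S (c \<odot>\<^bsub>V\<^esub> v)" if v: "v \<in> carrier V" and c: "c \<noteq> 0" for v and c :: 'k
    proof (rule sdist_greatest)
      fix s assume s: "s \<in> S"
      have "sdist V p S v \<le> p (inverse c \<odot>\<^bsub>V\<^esub> s \<oplus>\<^bsub>V\<^esub> v)" using sdist_le[OF v] subspD(4)[OF S s] by simp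
      then have "norm c * sdist V p S v \<le> p (c \<odot>\<^bsub>V\<^esub> (inverse c \<odot>\<^bsub>V\<^esub> s \<oplus>\<^bsub>V\<^esub> v))"
        using seminormD(2)[OF p, of "inverse c \<odot>\<^bsub>V\<^esub> s \<oplus>\<^bsub>V\<^esub> v" c] subspD(1)[OF S s] v V
        by (simp add: mult_left_mono)
      then show "norm c * sdist V p S v \<le> p (s \<oplus>\<^bsub>V\<^esub> c \<odot>\<^bsub>V\<^esub> v)"
        using subspD(1)[OF S s] v V c by (simp add: vs_smult_right_distrib)
    qed
    have "norm (inverse c) * sdist V p S (c \<odot>\<^bsub>V\<^esub> v) \<le> sdist V p S v"
      using le[of "c \<odot>\<^bsub>V\<^esub> v" "inverse c"] v V False by simp
    then show ?thesis using le[OF v False] False by (simp add: norm_inverse norm_divide field_simps)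
  qed
qed

lemma sdist_translate:
  assumes "s \<in> S" "v \<in> carrier V"
  shows "sdist V p S (s \<oplus>\<^bsub>V\<^esub> v) = sdist V p S v"
proof -
  note D = seminormD[OF seminorm_sdist] and sV = subspD(1)[OF S assms(1)]
  have "v = (-1) \<odot>\<^bsub>V\<^esub> s \<oplus>\<^bsub>V\<^esub> (s \<oplus>\<^bsub>V\<^esub> v)"
    using sV assms(2) V vs_comm[OF V, of "(-1) \<odot>\<^bsub>V\<^esub> s" s] by (simp flip: vs_assoc)
  then have "sdist V p S v \<le> sdist V p S ((-1) \<odot>\<^bsub>V\<^esub> s) + sdist V p S (s \<oplus>\<^bsub>V\<^esub> v)"
    using D(1)[of "(-1) \<odot>\<^bsub>V\<^esub> s" "s \<oplus>\<^bsub>V\<^esub> v"] sV assms(2) V by simp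
  then show ?thesis
    using D(1)[OF sV assms(2)] sdist_zero_on[OF assms(1)] sdist_zero_on[OF subspD(4)[OF S assms(1)]] by simp
qed

end

section \<open>Finite dimensional normed spaces\<close>

text \<open>The pairs encode a bounded finite rank projection of V onto S, sending v to the sum of
  the \<open>f v \<odot> b\<close>. The functionals live on all of V, so coordinates come with
  continuity built in.\<close>

definition coords :: "('k::real_or_complex, 'a) nspace \<Rightarrow> 'a set \<Rightarrow> ('a \<times> ('a \<Rightarrow> 'k)) list \<Rightarrow> bool" where
  "coords V S bfs \<longleftrightarrow> (\<forall>(b, f)\<in>set bfs. b \<in> S \<and> f \<in> carrier (dual V)) \<and>
     (\<forall>v\<in>S. v = lc V (map (\<lambda>(b, f). (f v, b)) bfs))"

text \<open>The projection P fixes S, so v - P v is unchanged when v is replaced by s + v with s in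
  S. Its norm is thus at most a constant times the norm of every s + v, hence at most that constant
  times the distance; distance zero leaves v = P v. In other words, finite dimensional subspaces are
  closed.\<close>

lemma coords_residual:
  assumes V: "normed_space V" and S: "subsp V S" and c: "coords V S bfs" and v: "v \<in> carrier V"
    and 0: "sdist V (nrm V) S v = 0"
  shows "v \<in> S"
proof -
  note Vv = normed_spaceD(1)[OF V] and Vh = homog_normed[OF V]
  let ?P = "\<lambda>w. lc V (map (\<lambda>(b, f). (f w, b)) bfs)"
  have mem: "snd ` set (map (\<lambda>(b, f). (f w, b)) bfs) \<subseteq> S" for w
    using c by (auto simp: coords_def)
  have PS: "?P w \<in> S" for w by (rule lc_closed[OF S mem])
  have mem': "snd ` set (map (\<lambda>(b, f). (f w, b)) bfs) \<subseteq> carrier V" for w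
    using mem subspD(1)[OF S] by blast
  have bf: "b \<in> carrier V" "f \<in> carrier (dual V)" "f \<in> lin_forms V" if "(b, f) \<in> set bfs" for b f
    using c that subspD(1)[OF S] dualD(1)[OF Vv Vh] by (auto simp: coords_def)
  \<comment> \<open>A bound for the norm of the identity minus P; the summand 1 for the identity
    also makes it positive.\<close>
  define C where "C = 1 + (\<Sum>(b, f)\<leftarrow>bfs. nrm (dual V) f * nrm V b)"
  have C0: "0 < C"
  proof -
    have "0 \<le> (\<Sum>(b, f)\<leftarrow>bfs. nrm (dual V) f * nrm V b)"
      using bf by (intro sum_list_nonneg) (auto intro!: mult_nonneg_nonneg dualD(3)[OF Vv Vh] normed_spaceD(2)[OF V])
    then show ?thesis by (simp add: C_def)
  qed
  have key: "nrm V (v \<oplus>\<^bsub>V\<^esub> (-1) \<odot>\<^bsub>V\<^esub> ?P v) \<le> C * nrm V (s \<oplus>\<^bsub>V\<^esub> v)" if s: "s \<in> S" for s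
  proof -
    let ?w = "s \<oplus>\<^bsub>V\<^esub> v"
    have sV: "s \<in> carrier V" and w: "?w \<in> carrier V" using s subspD(1)[OF S] v Vv by auto
    have "v \<oplus>\<^bsub>V\<^esub> (-1) \<odot>\<^bsub>V\<^esub> ?P v = ?w \<oplus>\<^bsub>V\<^esub> (-1) \<odot>\<^bsub>V\<^esub> ?P ?w"
    proof (rule separated_eqI[OF Vv separated_normed[OF V]])
      fix h assume h: "h \<in> lin_forms V"
      have hP: "h (?P w) = (\<Sum>(b, f)\<leftarrow>bfs. f w * h b)" for w
        using lin_forms_lc[OF Vv h mem'] by (simp add: comp_def case_prod_unfold)
      have "s = ?P s" using c s by (auto simp: coords_def)
      then have "h s = (\<Sum>(b, f)\<leftarrow>bfs. f s * h b)" using hP by metis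
      moreover have "(\<Sum>(b, f)\<leftarrow>bfs. f ?w * h b) = (\<Sum>(b, f)\<leftarrow>bfs. f s * h b) + (\<Sum>(b, f)\<leftarrow>bfs. f v * h b)"
        unfolding sum_list_addf[symmetric]
        by (rule arg_cong[where f = sum_list], rule map_cong[OF refl])
          (use bf in \<open>auto simp: lin_formsD(3)[OF _ sV v] algebra_simps\<close>)
      ultimately show "h (v \<oplus>\<^bsub>V\<^esub> (-1) \<odot>\<^bsub>V\<^esub> ?P v) = h (?w \<oplus>\<^bsub>V\<^esub> (-1) \<odot>\<^bsub>V\<^esub> ?P ?w)"
        using v sV w Vv mem' by (simp add: lin_formsD[OF h] hP)
    qed (use v w Vv mem' in auto)
    also have "nrm V \<dots> \<le> nrm V ?w + nrm V (?P ?w)"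
      using normed_spaceD(5)[OF V w, of "(-1) \<odot>\<^bsub>V\<^esub> ?P ?w"] normed_spaceD(4)[OF V, of "?P ?w" "-1"] mem' Vv by simp
    also have "nrm V (?P ?w) \<le> (\<Sum>(b, f)\<leftarrow>bfs. norm (f ?w) * nrm V b)"
      using seminorm_lc[OF Vv normed_seminorm[OF V] mem', of ?w] by (simp add: comp_def case_prod_unfold)
    also have "\<dots> \<le> (\<Sum>(b, f)\<leftarrow>bfs. (nrm (dual V) f * nrm V b) * nrm V ?w)"
    proof (rule sum_list_mono)
      fix bf assume "bf \<in> set bfs"
      then show "(case bf of (b, f) \<Rightarrow> norm (f ?w) * nrm V b) \<le> (case bf of (b, f) \<Rightarrow> nrm (dual V) f * nrm V b * nrm V ?w)"
        using mult_right_mono[OF dualD(2)[OF Vv Vh bf(2) w] normed_spaceD(2)[OF V bf(1)], of "fst bf" "snd bf" "fst bf" "snd bf"]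
        by (auto simp: case_prod_unfold algebra_simps)
    qed
    also have "\<dots> = (\<Sum>(b, f)\<leftarrow>bfs. nrm (dual V) f * nrm V b) * nrm V ?w"
      by (simp add: sum_list_mult_const case_prod_unfold)
    finally show ?thesis by (simp add: C_def algebra_simps)
  qed
  have "nrm V (v \<oplus>\<^bsub>V\<^esub> (-1) \<odot>\<^bsub>V\<^esub> ?P v) / C \<le> sdist V (nrm V) S v"
    by (rule sdist_greatest[OF Vv normed_seminorm[OF V] S]) (use key C0 in \<open>simp add: field_simps\<close>)
  then have "nrm V (v \<oplus>\<^bsub>V\<^esub> (-1) \<odot>\<^bsub>V\<^esub> ?P v) \<le> 0" using 0 C0 by (simp add: field_simps)
  moreover have PV: "?P v \<in> carrier V" using PS subspD(1)[OF S] by auto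
  ultimately have "v \<oplus>\<^bsub>V\<^esub> (-1) \<odot>\<^bsub>V\<^esub> ?P v = \<zero>\<^bsub>V\<^esub>"
    using normed_spaceD(2,3)[OF V, of "v \<oplus>\<^bsub>V\<^esub> (-1) \<odot>\<^bsub>V\<^esub> ?P v"] v Vv by force
  then have "v = ?P v" using vs_eq_iff[OF Vv v PV] by simp
  then show ?thesis using PS by metis
qed

text \<open>Each new basis vector is split off by a Hahn-Banach functional that is dominated by the
  distance from the span of the previous ones; \<open>coords_residual\<close> says that this distance is positive.\<close>

lemma coords_exist:
  assumes V: "normed_space V" and B: "finite B" "B \<subseteq> carrier V"
  shows "\<exists>bfs. coords V (lspan V B) bfs"
  using B
proof (induction B rule: finite_induct)
  case empty
  then show ?case by (intro exI[of _ "[]"]) (auto simp: coords_def lspan_def)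
next
  case (insert b B)
  note Vv = normed_spaceD(1)[OF V] and Vh = homog_normed[OF V]
  let ?S = "lspan V B"
  have S: "subsp V ?S" using insert by (intro subsp_lspan[OF Vv]) auto
  have b: "b \<in> carrier V" using insert by auto
  obtain bfs where c: "coords V ?S bfs" using insert by auto
  have sub: "subsp V {s \<oplus>\<^bsub>V\<^esub> c \<odot>\<^bsub>V\<^esub> b | s c. s \<in> ?S}"
    unfolding subsp_def
  proof (safe, goal_cases)
    case (1 x s c) then show ?case using b Vv subspD(1)[OF S] by auto
  next
    case 2 then show ?case using b Vv subspD(2)[OF S] by (intro exI[of _ "\<zero>\<^bsub>V\<^esub>"] exI[of _ 0]) auto
  next
    case (3 v w s t c d)
    then show ?case using b Vv subspD(1,3)[OF S]
      by (intro exI[of _ "s \<oplus>\<^bsub>V\<^esub> t"] exI[of _ "c + d"])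
        (auto simp: vs_smult_left_distrib vs_assoc vs_comm vs_lcomm)
  next
    case (4 d v s c)
    then show ?case using b Vv subspD(1,4)[OF S]
      by (intro exI[of _ "d \<odot>\<^bsub>V\<^esub> s"] exI[of _ "d * c"]) (auto simp: vs_smult_right_distrib)
  qed
  have "insert b B \<subseteq> {s \<oplus>\<^bsub>V\<^esub> c \<odot>\<^bsub>V\<^esub> b | s c. s \<in> ?S}"
  proof -
    have "\<exists>s c. b = s \<oplus>\<^bsub>V\<^esub> c \<odot>\<^bsub>V\<^esub> b \<and> s \<in> ?S"
      using b Vv subspD(2)[OF S] by (intro exI[of _ "\<zero>\<^bsub>V\<^esub>"] exI[of _ 1]) auto
    moreover have "\<exists>s c. x = s \<oplus>\<^bsub>V\<^esub> c \<odot>\<^bsub>V\<^esub> b \<and> s \<in> ?S" if "x \<in> B" for x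
      using b Vv lspan_superset[OF Vv, of B] insert that by (intro exI[of _ x] exI[of _ 0]) auto
    ultimately show ?thesis by auto
  qed
  then have decomp: "lspan V (insert b B) \<subseteq> {s \<oplus>\<^bsub>V\<^esub> c \<odot>\<^bsub>V\<^esub> b | s c. s \<in> ?S}"
    by (rule lspan_minimal[OF sub])
  have SS: "?S \<subseteq> lspan V (insert b B)" by (rule lspan_mono) auto
  have bS: "b \<in> lspan V (insert b B)" using lspan_superset[OF Vv, of "insert b B"] insert by auto
  show ?case
  proof (cases "b \<in> ?S")
    case True
    then have "insert b B \<subseteq> ?S" using lspan_superset[OF Vv, of B] insert by auto
    then have "lspan V (insert b B) = ?S" using lspan_minimal[OF S] SS by blast
    then show ?thesis using c by auto
  next
    case False
    define d where "d = sdist V (nrm V) ?S b"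
    note sd = seminorm_sdist[OF Vv normed_seminorm[OF V] S]
    have d: "d \<noteq> 0" unfolding d_def using coords_residual[OF V S c b] False by blast
    obtain g where g: "g \<in> lin_forms V" "g b = of_real d" "\<And>v. v \<in> carrier V \<Longrightarrow> norm (g v) \<le> sdist V (nrm V) ?S v"
      using hahn_banach_norming[OF Vv sd b] unfolding d_def by blast
    have gS: "g s = 0" if "s \<in> ?S" for s
      using g(3)[of s] sdist_zero_on[OF Vv normed_seminorm[OF V] S that] subspD(1)[OF S that] by simp
    have gd: "g \<in> carrier (dual V)"
      by (rule dualI[OF g(1), where c = 1])
        (use g(3) sdist_le_self[OF Vv normed_seminorm[OF V] S] in force)
    \<comment> \<open>The coordinate along \<open>b\<close> is \<open>g / d\<close>. The old
      functionals are corrected by a multiple of \<open>g\<close> so that they vanish at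
      \<open>b\<close>, and stay the same on the old span because \<open>g\<close> is zero there.
      Terms such as \<open>0 * g v\<close> only give them the shape of
      \<open>dual_comb\<close>.\<close>
    let ?bfs = "(b, \<lambda>v. inverse (of_real d) * g v + 0 * g v)
      # map (\<lambda>(b', f). (b', \<lambda>v. 1 * f v + (- (f b / of_real d)) * g v)) bfs"
    have bf: "b' \<in> ?S" "b' \<in> carrier V" "f \<in> carrier (dual V)" "f \<in> lin_forms V" if "(b', f) \<in> set bfs" for b' f
      using c that subspD(1)[OF S] dualD(1)[OF Vv Vh] by (auto simp: coords_def)
    have "coords V (lspan V (insert b B)) ?bfs"
      unfolding coords_def
    proof (intro conjI ballI)
      fix x assume "x \<in> set ?bfs"
      then consider "x = (b, \<lambda>v. inverse (of_real d) * g v + 0 * g v)"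
        | b' f where "(b', f) \<in> set bfs" "x = (b', \<lambda>v. 1 * f v + (- (f b / of_real d)) * g v)" by auto
      then show "case x of (b', f) \<Rightarrow> b' \<in> lspan V (insert b B) \<and> f \<in> carrier (dual V)"
      proof cases
        case 1 then show ?thesis using dual_comb[OF Vv Vh gd gd] bS by (simp only: prod.case)
      next
        case 2 then show ?thesis using dual_comb[OF Vv Vh bf(3) gd] bf(1) SS by (auto simp only: prod.case)
      qed
    next
      fix v assume "v \<in> lspan V (insert b B)"
      then obtain s a where s: "s \<in> ?S" and v: "v = s \<oplus>\<^bsub>V\<^esub> a \<odot>\<^bsub>V\<^esub> b" using decomp by blast
      have sV: "s \<in> carrier V" using s subspD(1)[OF S] by auto
      have gv: "g v = a * of_real d" using v gS[OF s] sV b Vv by (simp add: lin_formsD[OF g(1)] g(2))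
      have ga: "inverse (of_real d) * g v = a" using gv d by (simp add: field_simps)
      have "lc V (map (\<lambda>(b, f). (f v, b)) (map (\<lambda>(b', f). (b', \<lambda>v. 1 * f v + (- (f b / of_real d)) * g v)) bfs))
          = lc V (map (\<lambda>(b, f). (f s, b)) bfs)"
        unfolding map_map
        by (rule arg_cong[where f = "lc V"], rule map_cong[OF refl])
          (use bf(4) sV b Vv d in \<open>auto simp: v gv[unfolded v] lin_formsD(3,4)\<close>)
      also have "\<dots> = s" using c s by (auto simp: coords_def)
      finally show "v = lc V (map (\<lambda>(b, f). (f v, b)) ?bfs)"
        using v sV b Vv ga by (simp add: vs_comm)
    qed
    then show ?thesis by blast
  qed
qed

corollary fin_dim_coords:
  assumes "normed_space V" "fin_dim V"
  obtains bfs where "coords V (carrier V) bfs"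
  using assms coords_exist fin_dim_iff[OF normed_spaceD(1)] by metis

section \<open>Compactness and completeness in finite dimensions\<close>

lemma compact_cball_scalar: "compact (cball (0::'k::real_or_complex) r)"
proof (cases rule: real_or_complex_cases[where 'k = 'k])
  case real
  have "compact (of_real ` {-r..r} :: 'k set)"
    by (intro compact_continuous_image continuous_intros) auto
  moreover have "cball (0::'k) r \<subseteq> of_real ` {-r..r}"
  proof
    fix z :: 'k assume "z \<in> cball 0 r"
    moreover obtain a where a: "z = of_real a" using real by blast
    ultimately show "z \<in> of_real ` {-r..r}" by (auto simp: abs_le_iff)
  qed
  ultimately show ?thesis by (metis closed_cball compact_Int_closed inf.absorb_iff2)
next
  case (complex i)
  have "compact ((\<lambda>(a, b). of_real a + of_real b * i) ` ({-r..r} \<times> {-r..r}) :: 'k set)"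
    unfolding case_prod_unfold
    by (intro compact_continuous_image continuous_intros compact_Times) auto
  moreover have "cball (0::'k) r \<subseteq> (\<lambda>(a, b). of_real a + of_real b * i) ` ({-r..r} \<times> {-r..r})"
  proof
    fix z :: 'k assume z: "z \<in> cball 0 r"
    obtain a b where ab: "z = of_real a + of_real b * i" "norm z = sqrt (a\<^sup>2 + b\<^sup>2)" using complex by blast
    have "\<bar>a\<bar> \<le> norm z" "\<bar>b\<bar> \<le> norm z" unfolding ab(2) by (auto intro: real_le_rsqrt)
    then show "z \<in> (\<lambda>(a, b). of_real a + of_real b * i) ` ({-r..r} \<times> {-r..r})"
      using z ab(1) by (intro image_eqI[of _ _ "(a, b)"]) auto
  qed
  ultimately show ?thesis by (metis closed_cball compact_Int_closed inf.absorb_iff2)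
qed

text \<open>Completeness of the scalar field is drawn from its compact balls, in one of which a
  Cauchy sequence stays.\<close>

lemma Cauchy_scalar:
  fixes X :: "nat \<Rightarrow> 'k::real_or_complex"
  assumes "Cauchy X"
  shows "convergent X"
proof -
  obtain r where "\<And>n. norm (X n) \<le> r" using Cauchy_Bseq[OF assms] by (auto simp: Bseq_def)
  then show ?thesis
    using compact_imp_complete[OF compact_cball_scalar[of r]] assms
    unfolding complete_def convergent_def by (metis mem_cball_0)
qed

lemma Metric_space_ndist:
  assumes V: "normed_space V"
  shows "Metric_space (carrier V) (ndist V)"
proof -
  note Vv = normed_spaceD(1)[OF V]
  have sym: "nrm V (x \<oplus>\<^bsub>V\<^esub> (-1) \<odot>\<^bsub>V\<^esub> y) \<le> nrm V (y \<oplus>\<^bsub>V\<^esub> (-1) \<odot>\<^bsub>V\<^esub> x)" if "x \<in> carrier V" "y \<in> carrier V" for x y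
    using normed_spaceD(4)[OF V, of "y \<oplus>\<^bsub>V\<^esub> (-1) \<odot>\<^bsub>V\<^esub> x" "-1"] that Vv
    by (simp add: vs_smult_right_distrib vs_comm)
  show ?thesis
  proof
    fix x y z assume x: "x \<in> carrier V" and y: "y \<in> carrier V" and z: "z \<in> carrier V"
    have "x \<oplus>\<^bsub>V\<^esub> (-1) \<odot>\<^bsub>V\<^esub> z = (x \<oplus>\<^bsub>V\<^esub> (-1) \<odot>\<^bsub>V\<^esub> y) \<oplus>\<^bsub>V\<^esub> (y \<oplus>\<^bsub>V\<^esub> (-1) \<odot>\<^bsub>V\<^esub> z)"
      by (rule separated_eqI[OF Vv separated_normed[OF V]]) (use x y z Vv in \<open>auto simp: lin_formsD(3,4)\<close>)
    then show "ndist V x z \<le> ndist V x y + ndist V y z"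
      using normed_spaceD(5)[OF V, of "x \<oplus>\<^bsub>V\<^esub> (-1) \<odot>\<^bsub>V\<^esub> y" "y \<oplus>\<^bsub>V\<^esub> (-1) \<odot>\<^bsub>V\<^esub> z"] x y z Vv
      by (simp add: ndist_def vs_minus_eq)
  qed (use normed_spaceD(2,3)[OF V] Vv sym in
      \<open>auto simp: ndist_def vs_minus_eq vs_eq_iff[symmetric] intro!: antisym\<close>)
qed

lemma coordsD:
  assumes "normed_space V" "subsp V S" "coords V S bfs"
  shows "(b, f) \<in> set bfs \<Longrightarrow> b \<in> carrier V" "(b, f) \<in> set bfs \<Longrightarrow> f \<in> carrier (dual V)"
    "(b, f) \<in> set bfs \<Longrightarrow> f \<in> lin_forms V" "snd ` set (map (\<lambda>(b, f). (g f, b)) bfs) \<subseteq> carrier V"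
    "v \<in> S \<Longrightarrow> lc V (map (\<lambda>(b, f). (f v, b)) bfs) = v"
  using assms subspD(1)[OF assms(2)] dualD(1)[OF normed_spaceD(1) homog_normed, OF assms(1,1)]
  by (auto simp: coords_def)

text \<open>Bounded coordinate functionals send a Cauchy sequence to convergent scalar sequences,
  and their limits are the coordinates of the limit. This admits finite dimensional subspaces and
  quotients to elections, which ask for Banach spaces.\<close>

lemma fin_dim_banach:
  fixes V :: "('k::real_or_complex, 'a) nspace"
  assumes V: "normed_space V" and fd: "fin_dim V"
  shows "banach_space V"
proof -
  note Vv = normed_spaceD(1)[OF V] and Vh = homog_normed[OF V]
  interpret M: Metric_space "carrier V" "ndist V" by (rule Metric_space_ndist[OF V])
  obtain bfs where c: "coords V (carrier V) bfs" using fin_dim_coords[OF V fd] .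
  note cD = coordsD[OF V subsp_carrier[OF Vv] c]
  have "M.mcomplete"
    unfolding M.mcomplete_def
  proof (intro allI impI)
    fix \<sigma> assume "M.MCauchy \<sigma>"
    then have \<sigma>: "\<And>n. \<sigma> n \<in> carrier V" and ca: "\<And>\<epsilon>. \<epsilon> > 0 \<Longrightarrow> \<exists>N. \<forall>n n'. N \<le> n \<longrightarrow> N \<le> n' \<longrightarrow> ndist V (\<sigma> n) (\<sigma> n') < \<epsilon>"
      by (auto simp: M.MCauchy_def)
    have "convergent (\<lambda>n. f (\<sigma> n))" if bf: "(b, f) \<in> set bfs" for b f
    proof (rule Cauchy_scalar, rule metric_CauchyI)
      fix e :: real assume e: "e > 0"
      define C where "C = nrm (dual V) f + 1"
      note fD = dualD[OF Vv Vh cD(2)[OF bf]]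
      have C: "C > 0" using fD(3) by (simp add: C_def)
      obtain N where N: "\<forall>n n'. N \<le> n \<longrightarrow> N \<le> n' \<longrightarrow> ndist V (\<sigma> n) (\<sigma> n') < e / C" using ca[of "e / C"] e C by auto
      have "dist (f (\<sigma> m)) (f (\<sigma> n)) < e" if "N \<le> m" "N \<le> n" for m n
      proof -
        let ?w = "\<sigma> m \<oplus>\<^bsub>V\<^esub> (-1) \<odot>\<^bsub>V\<^esub> \<sigma> n"
        have w: "?w \<in> carrier V" using \<sigma> Vv by simp
        have "dist (f (\<sigma> m)) (f (\<sigma> n)) = norm (f ?w)"
          using \<sigma> Vv by (simp add: dist_norm lin_formsD[OF fD(1)])
        also have "\<dots> \<le> C * nrm V ?w"
          using fD(2)[OF w] normed_spaceD(2)[OF V w] by (simp add: C_def algebra_simps)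
        also have "\<dots> < C * (e / C)"
          using N[rule_format, OF that] \<sigma> Vv C by (intro mult_strict_left_mono) (auto simp: ndist_def vs_minus_eq)
        finally show ?thesis using C by simp
      qed
      then show "\<exists>M. \<forall>m\<ge>M. \<forall>n\<ge>M. dist (f (\<sigma> m)) (f (\<sigma> n)) < e" by blast
    qed
    note conv = this
    define a :: "('a \<Rightarrow> 'k) \<Rightarrow> 'k" where "a f = lim (\<lambda>n. f (\<sigma> n))" for f
    have a: "(\<lambda>n. f (\<sigma> n)) \<longlonglongrightarrow> a f" if "(b, f) \<in> set bfs" for b f
      using conv[OF that] by (simp add: a_def convergent_LIMSEQ_iff)
    define l where "l = lc V (map (\<lambda>(b, f). (a f, b)) bfs)"
    have l: "l \<in> carrier V" unfolding l_def by (rule lc_carrier[OF Vv cD(4)])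
    have bound: "ndist V (\<sigma> n) l \<le> (\<Sum>(b, f)\<leftarrow>bfs. norm (f (\<sigma> n) - a f) * nrm V b)" for n
    proof -
      have "\<sigma> n \<oplus>\<^bsub>V\<^esub> (-1) \<odot>\<^bsub>V\<^esub> l = lc V (map (\<lambda>(b, f). (f (\<sigma> n) - a f, b)) bfs)"
      proof (rule separated_eqI[OF Vv separated_normed[OF V]])
        fix h assume h: "h \<in> lin_forms V"
        have hl: "h (lc V (map (\<lambda>(b, f). (g f, b)) bfs)) = (\<Sum>(b, f)\<leftarrow>bfs. g f * h b)" for g
          using lin_forms_lc[OF Vv h cD(4)] by (simp add: comp_def case_prod_unfold)
        have diff: "(\<Sum>(b, f)\<leftarrow>bfs. (f (\<sigma> n) - a f) * h b)
            = (\<Sum>(b, f)\<leftarrow>bfs. f (\<sigma> n) * h b) - (\<Sum>(b, f)\<leftarrow>bfs. a f * h b)"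
          by (induction bfs) (auto simp: algebra_simps)
        have "h (\<sigma> n) = (\<Sum>(b, f)\<leftarrow>bfs. f (\<sigma> n) * h b)"
          using hl[of "\<lambda>f. f (\<sigma> n)"] unfolding cD(5)[OF \<sigma>] .
        then show "h (\<sigma> n \<oplus>\<^bsub>V\<^esub> (-1) \<odot>\<^bsub>V\<^esub> l) = h (lc V (map (\<lambda>(b, f). (f (\<sigma> n) - a f, b)) bfs))"
          using \<sigma> l Vv hl[of a, folded l_def] hl[of "\<lambda>f. f (\<sigma> n) - a f"] diff
          by (simp add: lin_formsD[OF h])
      qed (use \<sigma> l Vv lc_carrier[OF Vv cD(4)] in auto)
      then show ?thesis
        using seminorm_lc[OF Vv normed_seminorm[OF V] cD(4), of "\<lambda>f. f (\<sigma> n) - a f"] \<sigma> l Vv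
        by (simp add: ndist_def vs_minus_eq comp_def case_prod_unfold)
    qed
    have lim: "(\<lambda>n. \<Sum>(b, f)\<leftarrow>bfs'. norm (f (\<sigma> n) - a f) * nrm V b) \<longlonglongrightarrow> 0" if "set bfs' \<subseteq> set bfs" for bfs'
      using that
    proof (induction bfs')
      case (Cons x xs)
      obtain b f where x: "x = (b, f)" by force
      have "(\<lambda>n. norm (f (\<sigma> n) - a f) * nrm V b) \<longlonglongrightarrow> norm (a f - a f) * nrm V b"
        using Cons.prems a[of b f] x by (intro tendsto_intros) auto
      then show ?case using tendsto_add[OF _ Cons.IH] Cons.prems x by force
    qed auto
    have "\<exists>N. \<forall>n\<ge>N. ndist V (\<sigma> n) l < e" if e: "e > 0" for e
    proof -
      obtain N where N: "\<And>n. n \<ge> N \<Longrightarrow> \<bar>\<Sum>(b, f)\<leftarrow>bfs. norm (f (\<sigma> n) - a f) * nrm V b\<bar> < e"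
        using LIMSEQ_D[OF lim[OF subset_refl] e] by auto
      have "ndist V (\<sigma> n) l < e" if "n \<ge> N" for n
        using N[OF that] bound[of n] by linarith
      then show ?thesis by blast
    qed
    then have "limitin M.mtopology \<sigma> l sequentially"
      unfolding M.limit_metric_sequentially using l \<sigma> by auto
    then show "\<exists>x. limitin M.mtopology \<sigma> x sequentially" by blast
  qed
  then show ?thesis using V by (simp add: banach_space_def)
qed

text \<open>Total boundedness of bounded sets, seen through coefficients: half of the error is spent
  on the first coefficient and the other half on the remaining sum.\<close>

lemma lc_net:
  fixes V :: "('k::real_or_complex, 'a) nspace"
  assumes V: "normed_space V" and bs: "set bs \<subseteq> carrier V" and r: "0 \<le> r" and e: "e > 0"
  shows "\<exists>N. finite N \<and> N \<subseteq> carrier V \<and> (\<forall>cs. length cs = length bs \<and> (\<forall>c\<in>set cs. norm c \<le> r) \<longrightarrow>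
    (\<exists>w\<in>N. nrm V (lc V (zip cs bs) \<oplus>\<^bsub>V\<^esub> (-1) \<odot>\<^bsub>V\<^esub> w) \<le> e))"
  using bs e
proof (induction bs arbitrary: e)
  case Nil
  then show ?case using V normed_spaceD(1)[OF V] by (intro exI[of _ "{\<zero>\<^bsub>V\<^esub>}"]) auto
next
  case (Cons b bs)
  note Vv = normed_spaceD(1)[OF V]
  have b: "b \<in> carrier V" "0 \<le> nrm V b" using Cons normed_spaceD(2)[OF V] by auto
  obtain N where N: "finite N" "N \<subseteq> carrier V"
    "\<forall>cs. length cs = length bs \<and> (\<forall>c\<in>set cs. norm c \<le> r) \<longrightarrow> (\<exists>w\<in>N. nrm V (lc V (zip cs bs) \<oplus>\<^bsub>V\<^esub> (-1) \<odot>\<^bsub>V\<^esub> w) \<le> e / 2)"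
    using Cons.IH[of "e / 2"] Cons.prems by auto
  \<comment> \<open>An error \<eta> in the coefficient of \<open>b\<close> costs at most e / 2; the
    summand 1 keeps the denominator positive when \<open>b\<close> is zero.\<close>
  define \<eta> where "\<eta> = e / (2 * (nrm V b + 1))"
  have \<eta>: "\<eta> > 0" using Cons.prems b by (simp add: \<eta>_def)
  obtain D :: "'k set" where D: "finite D" "cball 0 r \<subseteq> (\<Union>x\<in>D. ball x \<eta>)"
    using seq_compact_imp_totally_bounded[OF compact_imp_seq_compact[OF compact_cball_scalar[where 'k = 'k and r = r]],
      rule_format, OF \<eta>] by blast
  show ?case
  proof (intro exI[of _ "(\<lambda>(d, w). d \<odot>\<^bsub>V\<^esub> b \<oplus>\<^bsub>V\<^esub> w) ` (D \<times> N)"] conjI allI impI)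
    show "finite ((\<lambda>(d, w). d \<odot>\<^bsub>V\<^esub> b \<oplus>\<^bsub>V\<^esub> w) ` (D \<times> N))" using D N by auto
    show "(\<lambda>(d, w). d \<odot>\<^bsub>V\<^esub> b \<oplus>\<^bsub>V\<^esub> w) ` (D \<times> N) \<subseteq> carrier V" using b N Vv by auto
    fix cs :: "'k list" assume cs: "length cs = length (b # bs) \<and> (\<forall>c\<in>set cs. norm c \<le> r)"
    then obtain c cs' where c: "cs = c # cs'" "length cs' = length bs" by (cases cs) auto
    obtain w where w: "w \<in> N" "nrm V (lc V (zip cs' bs) \<oplus>\<^bsub>V\<^esub> (-1) \<odot>\<^bsub>V\<^esub> w) \<le> e / 2"
      using N(3) cs c by auto
    obtain d where d: "d \<in> D" "norm (c - d) < \<eta>"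
      using D(2) cs c by (force simp: subset_iff dist_norm norm_minus_commute)
    let ?l = "lc V (zip cs' bs)"
    have l: "?l \<in> carrier V" by (rule lc_carrier[OF Vv]) (use Cons.prems in \<open>auto dest: set_zip_rightD\<close>)
    have wV: "w \<in> carrier V" using w N by auto
    have "lc V (zip cs (b # bs)) \<oplus>\<^bsub>V\<^esub> (-1) \<odot>\<^bsub>V\<^esub> (d \<odot>\<^bsub>V\<^esub> b \<oplus>\<^bsub>V\<^esub> w) = (c - d) \<odot>\<^bsub>V\<^esub> b \<oplus>\<^bsub>V\<^esub> (?l \<oplus>\<^bsub>V\<^esub> (-1) \<odot>\<^bsub>V\<^esub> w)"
      by (rule separated_eqI[OF Vv separated_normed[OF V]])
        (use l wV b Vv c in \<open>auto simp: lin_formsD(3,4) algebra_simps\<close>)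
    also have "nrm V \<dots> \<le> norm (c - d) * nrm V b + e / 2"
      using normed_spaceD(5)[OF V, of "(c - d) \<odot>\<^bsub>V\<^esub> b" "?l \<oplus>\<^bsub>V\<^esub> (-1) \<odot>\<^bsub>V\<^esub> w"] w(2) l wV b Vv
      by (simp add: normed_spaceD(4)[OF V])
    also have "norm (c - d) * nrm V b \<le> \<eta> * (nrm V b + 1)" using d b \<eta> by (intro mult_mono) auto
    also have "\<dots> = e / 2"
    proof -
      have "nrm V b + 1 \<noteq> 0" using b by simp
      then show ?thesis unfolding \<eta>_def by (metis mult.commute nonzero_divide_mult_cancel_left nonzero_mult_div_cancel_left divide_divide_eq_left' times_divide_eq_left)
    qed
    finally show "\<exists>w\<in>(\<lambda>(d, w). d \<odot>\<^bsub>V\<^esub> b \<oplus>\<^bsub>V\<^esub> w) ` (D \<times> N). nrm V (lc V (zip cs (b # bs)) \<oplus>\<^bsub>V\<^esub> (-1) \<odot>\<^bsub>V\<^esub> w) \<le> e"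
      using d w by auto
  qed
qed

text \<open>The list consists of norming functionals of a finite net of the unit sphere.\<close>

lemma fin_dim_norming:
  fixes V :: "('k::real_or_complex, 'a) nspace"
  assumes V: "normed_space V" and fd: "fin_dim V" and \<delta>: "0 < \<delta>"
  obtains hs where "set hs \<subseteq> lin_forms V" "\<And>h v. h \<in> set hs \<Longrightarrow> v \<in> carrier V \<Longrightarrow> norm (h v) \<le> nrm V v"
    "\<And>v. v \<in> carrier V \<Longrightarrow> \<exists>h\<in>set hs. nrm V v \<le> (1 + \<delta>) * norm (h v)"
proof -
  note Vv = normed_spaceD(1)[OF V] and Vh = homog_normed[OF V]
  obtain bfs where c: "coords V (carrier V) bfs" using fin_dim_coords[OF V fd] .
  note cD = coordsD[OF V subsp_carrier[OF Vv] c]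
  \<comment> \<open>A common bound for all coordinates of unit vectors, so that
    \<open>lc_net\<close> covers the unit sphere.\<close>
  define r where "r = (\<Sum>(b, f)\<leftarrow>bfs. nrm (dual V) f)"
  have fr: "nrm (dual V) f \<le> r" "0 \<le> nrm (dual V) f" if "(b, f) \<in> set bfs" for b f
  proof -
    show "0 \<le> nrm (dual V) f" using dualD(3)[OF Vv Vh cD(2)[OF that]] .
    have "nrm (dual V) f \<in> set (map (\<lambda>(b, f). nrm (dual V) f) bfs)" using that by force
    then show "nrm (dual V) f \<le> r" unfolding r_def
      by (rule member_le_sum_list) (use dualD(3)[OF Vv Vh cD(2)] in auto)
  qed
  have r: "0 \<le> r" unfolding r_def using fr(2) by (intro sum_list_nonneg) auto
  \<comment> \<open>Solves (1 + \<delta>) (1 - 2 \<eta>) = 1. The error of the net enters twice: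
    once in the norm of the approximating \<open>w\<close>, and once in the value of its norming
    functional at v.\<close>
  define \<eta> where "\<eta> = \<delta> / (2 * (1 + \<delta>))"
  have \<eta>: "\<eta> > 0" using \<delta> by (simp add: \<eta>_def)
  obtain N where N: "finite N" "N \<subseteq> carrier V"
    "\<forall>cs. length cs = length (map fst bfs) \<and> (\<forall>c\<in>set cs. norm c \<le> r) \<longrightarrow>
      (\<exists>w\<in>N. nrm V (lc V (zip cs (map fst bfs)) \<oplus>\<^bsub>V\<^esub> (-1) \<odot>\<^bsub>V\<^esub> w) \<le> \<eta>)"
    using lc_net[OF V _ r \<eta>, of "map fst bfs"] cD(1) by force
  have "\<exists>h. h \<in> lin_forms V \<and> h w = of_real (nrm V w) \<and> (\<forall>v\<in>carrier V. norm (h v) \<le> nrm V v)" if "w \<in> N" for w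
    using hahn_banach_norming[OF Vv normed_seminorm[OF V], of w] N that by (metis subsetD)
  then obtain H where H: "\<And>w. w \<in> N \<Longrightarrow> H w \<in> lin_forms V \<and> H w w = of_real (nrm V w) \<and> (\<forall>v\<in>carrier V. norm (H w v) \<le> nrm V v)"
    by metis
  obtain ws where ws: "set ws = N" using finite_list[OF N(1)] by blast
  \<comment> \<open>The zero form keeps the list nonempty and serves the vectors of norm
    zero.\<close>
  let ?hs = "(\<lambda>_. 0) # map H ws"
  have unit: "\<exists>h\<in>set ?hs. 1 \<le> (1 + \<delta>) * norm (h v)" if v: "v \<in> carrier V" "nrm V v = 1" for v
  proof -
    let ?cs = "map (\<lambda>(b, f). f v) bfs"
    have "zip ?cs (map fst bfs) = map (\<lambda>(b, f). (f v, b)) bfs"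
      by (induction bfs) auto
    then have l: "lc V (zip ?cs (map fst bfs)) = v" using cD(5)[OF v(1)] by simp
    have "norm (f v) \<le> r" if "(b, f) \<in> set bfs" for b f
      using dualD(2)[OF Vv Vh cD(2)[OF that] v(1)] fr[OF that] v(2) by simp
    then have "\<forall>c\<in>set ?cs. norm c \<le> r" by auto
    then have "\<exists>w\<in>N. nrm V (lc V (zip ?cs (map fst bfs)) \<oplus>\<^bsub>V\<^esub> (-1) \<odot>\<^bsub>V\<^esub> w) \<le> \<eta>"
      using N(3)[rule_format, of ?cs] by simp
    then obtain w where w: "w \<in> N" "nrm V (v \<oplus>\<^bsub>V\<^esub> (-1) \<odot>\<^bsub>V\<^esub> w) \<le> \<eta>" unfolding l by blast
    have wV: "w \<in> carrier V" using w N by auto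
    let ?u = "v \<oplus>\<^bsub>V\<^esub> (-1) \<odot>\<^bsub>V\<^esub> w"
    have u: "?u \<in> carrier V" using v wV Vv by simp
    have "v = w \<oplus>\<^bsub>V\<^esub> ?u" using v wV Vv by (simp add: vs_lcomm[of V w v])
    then have 1: "1 \<le> nrm V w + \<eta>" using normed_spaceD(5)[OF V wV u] w(2) v(2) by simp
    have Hw: "H w \<in> lin_forms V" using H w by blast
    have "H w v = H w w + H w ?u" using v wV Vv by (simp add: lin_formsD[OF Hw])
    moreover have "norm (H w ?u) \<le> \<eta>" using H[OF w(1)] u w(2) by (meson order_trans)
    moreover have "norm (H w w) = nrm V w" using H[OF w(1)] normed_spaceD(2)[OF V wV] by simp
    ultimately have "nrm V w - \<eta> \<le> norm (H w v)" using norm_diff_ineq[of "H w w" "H w ?u"] by simp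
    then have "1 - 2 * \<eta> \<le> norm (H w v)" using 1 by simp
    then have "(1 + \<delta>) * (1 - 2 * \<eta>) \<le> (1 + \<delta>) * norm (H w v)" using \<delta> by (intro mult_left_mono) auto
    moreover have "(1 + \<delta>) * (1 - 2 * \<eta>) = 1" using \<delta> by (simp add: \<eta>_def field_simps)
    ultimately show ?thesis using w ws by auto
  qed
  show thesis
  proof (rule that[of ?hs])
    show "set ?hs \<subseteq> lin_forms V" using H ws by (auto simp: lin_forms_0)
    show "norm (h v) \<le> nrm V v" if "h \<in> set ?hs" "v \<in> carrier V" for h v
      using that H ws normed_spaceD(2)[OF V] by auto
    fix v assume v: "v \<in> carrier V"
    show "\<exists>h\<in>set ?hs. nrm V v \<le> (1 + \<delta>) * norm (h v)"
    proof (cases "nrm V v = 0")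
      case True then show ?thesis using \<delta> by auto
    next
      case False
      define n where "n = nrm V v"
      have n: "n > 0" using False normed_spaceD(2)[OF V v] by (simp add: n_def)
      let ?u = "of_real (inverse n) \<odot>\<^bsub>V\<^esub> v"
      have "nrm V ?u = 1" using n normed_spaceD(4)[OF V v, of "of_real (inverse n)"]
        by (simp add: n_def[symmetric] norm_inverse)
      then obtain h where h: "h \<in> set ?hs" "1 \<le> (1 + \<delta>) * norm (h ?u)" using unit[of ?u] v Vv by auto
      have "h \<in> lin_forms V" using h(1) H ws by (auto simp: lin_forms_0)
      then have "norm (h ?u) = inverse n * norm (h v)"
        using v n lin_formsD(4)[of h V v "of_real (inverse n)"] by (simp add: norm_mult norm_inverse)
      then have "1 \<le> (1 + \<delta>) * norm (h v) / n" using h(2) by (simp add: divide_inverse_commute mult.left_commute)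
      then have "n \<le> (1 + \<delta>) * norm (h v)" using n by (simp add: pos_le_divide_eq)
      then show ?thesis using h(1) by (auto simp: n_def)
    qed
  qed
qed

section \<open>Quotients\<close>

lemma coset_eq: "L +>\<^bsub>Z\<^esub> z = (\<lambda>l. l \<oplus>\<^bsub>Z\<^esub> z) ` L"
  by (auto simp: a_r_coset_def r_coset_def)

lemma quot_space_simps:
  "carrier (quot_space Y L) = quot_map Y L ` carrier Y" "\<zero>\<^bsub>quot_space Y L\<^esub> = quot_map Y L \<zero>\<^bsub>Y\<^esub>"
  "a \<oplus>\<^bsub>quot_space Y L\<^esub> b = quot_map Y L (a \<oplus>\<^bsub>Y\<^esub> b)" "c \<odot>\<^bsub>quot_space Y L\<^esub> a = quot_map Y L (c \<odot>\<^bsub>Y\<^esub> a)"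
  "nrm (quot_space Y L) a = sdist Y (nrm Y) L a"
  by (auto simp: quot_space_def sdist_def coset_eq image_image)

text \<open>The axioms pass through a surjection that respects the operations. Applied to
  \<open>quot_map\<close>, this replaces all arguments about the chosen representatives of
  cosets.\<close>

lemma vs_hom_image:
  assumes V: "vs V" and f: "is_lin V W f" and surj: "carrier W = f ` carrier V" and z: "\<zero>\<^bsub>W\<^esub> = f \<zero>\<^bsub>V\<^esub>"
  shows "vs W"
proof -
  have fl: "f v \<oplus>\<^bsub>W\<^esub> f w = f (v \<oplus>\<^bsub>V\<^esub> w)" "c \<odot>\<^bsub>W\<^esub> f v = f (c \<odot>\<^bsub>V\<^esub> v)"
    if "v \<in> carrier V" "w \<in> carrier V" for v w c
    using is_linD[OF f] that by auto
  show ?thesis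
    by (rule vsI; unfold surj z; (elim imageE)?; hypsubst?)
      (use V in \<open>auto simp: fl vs_assoc vs_comm vs_lcomm vs_smult_left_distrib vs_smult_right_distrib\<close>)
qed

context
  fixes Z :: "('k::real_or_complex, 'a) nspace" and L
  assumes Z: "vs Z" and L: "subsp Z L"
begin

lemma quot_map_in: "z \<in> carrier Z \<Longrightarrow> \<exists>l\<in>L. quot_map Z L z = l \<oplus>\<^bsub>Z\<^esub> z"
proof -
  have "z' \<in> L +>\<^bsub>Z\<^esub> z" if "z' = \<zero>\<^bsub>Z\<^esub> \<oplus>\<^bsub>Z\<^esub> z" for z'
    using that subspD(2)[OF L] by (auto simp: coset_eq)
  then have "quot_map Z L z \<in> L +>\<^bsub>Z\<^esub> z" unfolding quot_map_def by (metis someI)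
  then show ?thesis by (auto simp: coset_eq)
qed

lemma quot_map_translate:
  assumes "z \<in> carrier Z" "l \<in> L"
  shows "quot_map Z L (l \<oplus>\<^bsub>Z\<^esub> z) = quot_map Z L z"
proof -
  have l: "l \<in> carrier Z" using assms subspD(1)[OF L] by auto
  have "L +>\<^bsub>Z\<^esub> (l \<oplus>\<^bsub>Z\<^esub> z) = L +>\<^bsub>Z\<^esub> z"
  proof
    show "L +>\<^bsub>Z\<^esub> (l \<oplus>\<^bsub>Z\<^esub> z) \<subseteq> L +>\<^bsub>Z\<^esub> z"
      unfolding coset_eq
    proof (clarsimp, rule image_eqI)
      fix k assume k: "k \<in> L"
      then show "k \<oplus>\<^bsub>Z\<^esub> (l \<oplus>\<^bsub>Z\<^esub> z) = (k \<oplus>\<^bsub>Z\<^esub> l) \<oplus>\<^bsub>Z\<^esub> z" "k \<oplus>\<^bsub>Z\<^esub> l \<in> L"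
        using Z l assms subspD[OF L] by (auto simp: vs_assoc)
    qed
    show "L +>\<^bsub>Z\<^esub> z \<subseteq> L +>\<^bsub>Z\<^esub> (l \<oplus>\<^bsub>Z\<^esub> z)"
      unfolding coset_eq
    proof (clarsimp, rule image_eqI)
      fix k assume k: "k \<in> L"
      then have kZ: "k \<in> carrier Z" using subspD(1)[OF L] by auto
      have "((-1) \<odot>\<^bsub>Z\<^esub> l \<oplus>\<^bsub>Z\<^esub> k) \<oplus>\<^bsub>Z\<^esub> (l \<oplus>\<^bsub>Z\<^esub> z) = (l \<oplus>\<^bsub>Z\<^esub> (-1) \<odot>\<^bsub>Z\<^esub> l) \<oplus>\<^bsub>Z\<^esub> (k \<oplus>\<^bsub>Z\<^esub> z)"
        using l kZ Z assms by (simp only: vs_assoc vs_comm vs_lcomm vs_add vs_smult)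
      then show "k \<oplus>\<^bsub>Z\<^esub> z = ((-1) \<odot>\<^bsub>Z\<^esub> l \<oplus>\<^bsub>Z\<^esub> k) \<oplus>\<^bsub>Z\<^esub> (l \<oplus>\<^bsub>Z\<^esub> z)" using l kZ Z assms by simp
      show "(-1) \<odot>\<^bsub>Z\<^esub> l \<oplus>\<^bsub>Z\<^esub> k \<in> L" using k assms subspD[OF L] by auto
    qed
  qed
  then show ?thesis by (simp add: quot_map_def)
qed

lemma quot_map_closed [simp]: "z \<in> carrier Z \<Longrightarrow> quot_map Z L z \<in> carrier Z"
  using quot_map_in[of z] subspD(1)[OF L] Z by fastforce

lemma quot_map_add: 
  assumes "z \<in> carrier Z" "w \<in> carrier Z"
  shows "quot_map Z L (quot_map Z L z \<oplus>\<^bsub>Z\<^esub> quot_map Z L w) = quot_map Z L (z \<oplus>\<^bsub>Z\<^esub> w)"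
proof -
  obtain l k where lk: "l \<in> L" "quot_map Z L z = l \<oplus>\<^bsub>Z\<^esub> z" "k \<in> L" "quot_map Z L w = k \<oplus>\<^bsub>Z\<^esub> w"
    using quot_map_in assms by metis
  have [simp]: "l \<in> carrier Z" "k \<in> carrier Z" using lk subspD(1)[OF L] by auto
  have "(l \<oplus>\<^bsub>Z\<^esub> z) \<oplus>\<^bsub>Z\<^esub> (k \<oplus>\<^bsub>Z\<^esub> w) = (l \<oplus>\<^bsub>Z\<^esub> k) \<oplus>\<^bsub>Z\<^esub> (z \<oplus>\<^bsub>Z\<^esub> w)"
    using Z assms by (simp add: vs_assoc vs_comm vs_lcomm)
  then show ?thesis
    using quot_map_translate[of "z \<oplus>\<^bsub>Z\<^esub> w" "l \<oplus>\<^bsub>Z\<^esub> k"] lk subspD(3)[OF L] assms Z by simp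
qed

lemma quot_map_smult: 
  assumes "z \<in> carrier Z"
  shows "quot_map Z L (c \<odot>\<^bsub>Z\<^esub> quot_map Z L z) = quot_map Z L (c \<odot>\<^bsub>Z\<^esub> z)"
proof -
  obtain l where l: "l \<in> L" "quot_map Z L z = l \<oplus>\<^bsub>Z\<^esub> z" using quot_map_in assms by metis
  then have "c \<odot>\<^bsub>Z\<^esub> quot_map Z L z = c \<odot>\<^bsub>Z\<^esub> l \<oplus>\<^bsub>Z\<^esub> c \<odot>\<^bsub>Z\<^esub> z"
    using Z assms subspD(1)[OF L] by (simp add: vs_smult_right_distrib)
  then show ?thesis
    using quot_map_translate[of "c \<odot>\<^bsub>Z\<^esub> z" "c \<odot>\<^bsub>Z\<^esub> l"] l subspD(4)[OF L] assms Z by simp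
qed

lemma is_lin_quot_map: "is_lin Z (quot_space Z L) (quot_map Z L)"
  unfolding is_lin_def by (auto simp: quot_space_simps quot_map_add quot_map_smult)

lemma vs_quot: "vs (quot_space Z L)"
  by (rule vs_hom_image[OF Z is_lin_quot_map]) (auto simp: quot_space_simps)

lemma quot_map_eq_iff:
  assumes "z \<in> carrier Z" "w \<in> carrier Z"
  shows "quot_map Z L z = quot_map Z L w \<longleftrightarrow> z \<oplus>\<^bsub>Z\<^esub> (-1) \<odot>\<^bsub>Z\<^esub> w \<in> L"
proof
  assume "quot_map Z L z = quot_map Z L w"
  then obtain l k where lk: "l \<in> L" "k \<in> L" "l \<oplus>\<^bsub>Z\<^esub> z = k \<oplus>\<^bsub>Z\<^esub> w" using quot_map_in assms by metis
  have [simp]: "l \<in> carrier Z" "k \<in> carrier Z" using lk subspD(1)[OF L] by auto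
  have "(z \<oplus>\<^bsub>Z\<^esub> (-1) \<odot>\<^bsub>Z\<^esub> w) \<oplus>\<^bsub>Z\<^esub> (l \<oplus>\<^bsub>Z\<^esub> (-1) \<odot>\<^bsub>Z\<^esub> k) = (l \<oplus>\<^bsub>Z\<^esub> z) \<oplus>\<^bsub>Z\<^esub> (-1) \<odot>\<^bsub>Z\<^esub> (k \<oplus>\<^bsub>Z\<^esub> w)"
    using Z assms by (simp add: vs_smult_right_distrib vs_assoc vs_comm vs_lcomm)
  also have "\<dots> = \<zero>\<^bsub>Z\<^esub>" using lk Z assms by simp
  finally have "(z \<oplus>\<^bsub>Z\<^esub> (-1) \<odot>\<^bsub>Z\<^esub> w) \<oplus>\<^bsub>Z\<^esub> (-1) \<odot>\<^bsub>Z\<^esub> (k \<oplus>\<^bsub>Z\<^esub> (-1) \<odot>\<^bsub>Z\<^esub> l) = \<zero>\<^bsub>Z\<^esub>"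
    using Z assms by (simp add: vs_smult_right_distrib vs_comm[OF Z, of l])
  then have "z \<oplus>\<^bsub>Z\<^esub> (-1) \<odot>\<^bsub>Z\<^esub> w = k \<oplus>\<^bsub>Z\<^esub> (-1) \<odot>\<^bsub>Z\<^esub> l"
    using vs_eq_iff[OF Z, of "z \<oplus>\<^bsub>Z\<^esub> (-1) \<odot>\<^bsub>Z\<^esub> w" "k \<oplus>\<^bsub>Z\<^esub> (-1) \<odot>\<^bsub>Z\<^esub> l"] Z assms by simp
  then show "z \<oplus>\<^bsub>Z\<^esub> (-1) \<odot>\<^bsub>Z\<^esub> w \<in> L" using lk subspD[OF L] by simp
next
  assume *: "z \<oplus>\<^bsub>Z\<^esub> (-1) \<odot>\<^bsub>Z\<^esub> w \<in> L"
  have "(z \<oplus>\<^bsub>Z\<^esub> (-1) \<odot>\<^bsub>Z\<^esub> w) \<oplus>\<^bsub>Z\<^esub> w = z"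
    using assms Z vs_comm[OF Z, of "(-1) \<odot>\<^bsub>Z\<^esub> w" w] by (simp add: vs_assoc)
  then show "quot_map Z L z = quot_map Z L w" using quot_map_translate[OF assms(2) *] by simp
qed

lemma quot_map_zero_iff: "z \<in> carrier Z \<Longrightarrow> quot_map Z L z = \<zero>\<^bsub>quot_space Z L\<^esub> \<longleftrightarrow> z \<in> L"
  using quot_map_eq_iff[of z "\<zero>\<^bsub>Z\<^esub>"] Z by (simp add: quot_space_simps)

end

lemma nrm_quot_map:
  assumes Z: "normed_space Z" and L: "subsp Z L" and z: "z \<in> carrier Z"
  shows "nrm (quot_space Z L) (quot_map Z L z) = sdist Z (nrm Z) L z"
proof -
  note Zv = normed_spaceD(1)[OF Z]
  obtain l where "l \<in> L" "quot_map Z L z = l \<oplus>\<^bsub>Z\<^esub> z" using quot_map_in[OF Zv L z] by blast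
  then show ?thesis
    using sdist_translate[OF Zv normed_seminorm[OF Z] L _ z] by (simp add: quot_space_simps)
qed

text \<open>Closedness in the form in which it acts: it makes the quotient seminorm definite.
  \<open>sdist_pos_iff_closedin\<close> identifies it with topological closedness.\<close>

definition quot_closed :: "('k::real_or_complex, 'a) nspace \<Rightarrow> 'a set \<Rightarrow> bool" where
  "quot_closed Z L \<longleftrightarrow> subsp Z L \<and> (\<forall>z\<in>carrier Z. sdist Z (nrm Z) L z = 0 \<longrightarrow> z \<in> L)"

text \<open>A ball about z misses L exactly when its radius is at most the distance from L. The
  point of L whose distance from z is the norm of l + z is -l, whence the factors -1.\<close>

lemma sdist_pos_iff_closedin:
  assumes Z: "normed_space Z" and L: "subsp Z L"
  shows "closedin (Metric_space.mtopology (carrier Z) (ndist Z)) L \<longleftrightarrow>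
    (\<forall>z\<in>carrier Z. sdist Z (nrm Z) L z = 0 \<longrightarrow> z \<in> L)"
proof -
  interpret M: Metric_space "carrier Z" "ndist Z" by (rule Metric_space_ndist[OF Z])
  note Zv = normed_spaceD(1)[OF Z] and sd = sdist_le[OF normed_spaceD(1)[OF Z] normed_seminorm[OF Z] L]
    sdist_less[OF normed_spaceD(1)[OF Z] normed_seminorm[OF Z] L]
  have nd: "ndist Z z ((-1) \<odot>\<^bsub>Z\<^esub> l) = nrm Z (l \<oplus>\<^bsub>Z\<^esub> z)" if "l \<in> L" "z \<in> carrier Z" for l z
    using that Zv subspD(1)[OF L] by (simp add: ndist_def vs_minus_eq vs_comm)
  have "(\<exists>r>0. disjnt L (M.mball z r)) \<longleftrightarrow> sdist Z (nrm Z) L z \<noteq> 0" if z: "z \<in> carrier Z" for z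
  proof
    assume "\<exists>r>0. disjnt L (M.mball z r)"
    then obtain r where r: "r > 0" "disjnt L (M.mball z r)" by blast
    have "r \<le> nrm Z (l \<oplus>\<^bsub>Z\<^esub> z)" if l: "l \<in> L" for l
    proof -
      have "(-1) \<odot>\<^bsub>Z\<^esub> l \<notin> M.mball z r" using r(2) subspD(4)[OF L l, of "-1"] by (auto simp: disjnt_iff)
      then show ?thesis using nd[OF l z] subspD(1)[OF L l] z Zv by simp
    qed
    then have "r \<le> sdist Z (nrm Z) L z"
      by (rule sdist_greatest[OF Zv normed_seminorm[OF Z] L])
    then show "sdist Z (nrm Z) L z \<noteq> 0" using r by simp
  next
    assume "sdist Z (nrm Z) L z \<noteq> 0"
    then have pos: "sdist Z (nrm Z) L z > 0"
      using seminorm_nonneg[OF Zv seminorm_sdist[OF Zv normed_seminorm[OF Z] L] z] by simp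
    have "\<not> ndist Z z l < sdist Z (nrm Z) L z" if l: "l \<in> L" for l
      using nd[OF subspD(4)[OF L l] z, of "-1"] sd(1)[OF z subspD(4)[OF L l], of "-1"] Zv subspD(1)[OF L l] by simp
    then show "\<exists>r>0. disjnt L (M.mball z r)" using pos by (auto simp: disjnt_iff)
  qed
  then show ?thesis unfolding M.closedin_metric using subspD(1)[OF L] by blast
qed

lemma normed_quot:
  assumes Z: "normed_space Z" and L: "quot_closed Z L"
  shows "normed_space (quot_space Z L)"
proof -
  note Zv = normed_spaceD(1)[OF Z]
  have Ls: "subsp Z L" using L by (simp add: quot_closed_def)
  note Q = is_linD[OF is_lin_quot_map[OF Zv Ls]] and nQ = nrm_quot_map[OF Z Ls]
  note sd = seminorm_sdist[OF Zv normed_seminorm[OF Z] Ls]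
  show ?thesis
  proof (rule normed_spaceI[OF vs_quot[OF Zv Ls]])
    show "is_norm (quot_space Z L) (nrm (quot_space Z L))"
      unfolding is_norm_def
    proof (intro conjI ballI allI; unfold quot_space_simps(1); elim imageE; hypsubst)
      fix z assume z: "z \<in> carrier Z"
      show "0 \<le> nrm (quot_space Z L) (quot_map Z L z)"
        using nQ[OF z] seminorm_nonneg[OF Zv sd z] by simp
      show "nrm (quot_space Z L) (quot_map Z L z) = 0 \<longleftrightarrow> quot_map Z L z = \<zero>\<^bsub>quot_space Z L\<^esub>"
        unfolding nQ[OF z] quot_map_zero_iff[OF Zv Ls z]
        using L z sdist_zero_on[OF Zv normed_seminorm[OF Z] Ls] by (auto simp: quot_closed_def)
      fix c show "nrm (quot_space Z L) (c \<odot>\<^bsub>quot_space Z L\<^esub> quot_map Z L z) = norm c * nrm (quot_space Z L) (quot_map Z L z)"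
        using nQ[of "c \<odot>\<^bsub>Z\<^esub> z"] nQ[OF z] seminormD(2)[OF sd z] z Zv Q(3)[OF z] by simp
    next
      fix z w assume z: "z \<in> carrier Z" and w: "w \<in> carrier Z"
      show "nrm (quot_space Z L) (quot_map Z L z \<oplus>\<^bsub>quot_space Z L\<^esub> quot_map Z L w)
        \<le> nrm (quot_space Z L) (quot_map Z L z) + nrm (quot_space Z L) (quot_map Z L w)"
        using nQ[of "z \<oplus>\<^bsub>Z\<^esub> w"] nQ[OF z] nQ[OF w] seminormD(1)[OF sd z w] z w Zv Q(2)[OF z w] by simp
    qed
  qed
qed

lemma cofin_subspaces_iff:
  assumes Z: "normed_space Z"
  shows "L \<in> cofin_subspaces Z \<longleftrightarrow> quot_closed Z L \<and>
    (\<exists>B. finite B \<and> B \<subseteq> carrier Z \<and> (\<forall>S. subsp Z S \<and> L \<union> B \<subseteq> S \<longrightarrow> S = carrier Z))"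
  using sdist_pos_iff_closedin[OF Z]
  unfolding cofin_subspaces_def quot_closed_def submodule_iff_subsp[OF normed_spaceD(1)[OF Z]] by blast

lemma cofin_quot:
  assumes Z: "normed_space Z" and L: "L \<in> cofin_subspaces Z"
  shows "quot_closed Z L" "subsp Z L" "normed_space (quot_space Z L)" "fin_dim (quot_space Z L)"
    "banach_space (quot_space Z L)" "bounded_op Z (quot_space Z L) (quot_map Z L)"
    "opnorm Z (quot_space Z L) (quot_map Z L) \<le> 1"
    "z \<in> carrier Z \<Longrightarrow> nrm (quot_space Z L) (quot_map Z L z) \<le> nrm Z z"
proof -
  note Zv = normed_spaceD(1)[OF Z]
  show cl: "quot_closed Z L" using L by (simp add: cofin_subspaces_iff[OF Z])
  then show Ls: "subsp Z L" by (simp add: quot_closed_def)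
  show n: "normed_space (quot_space Z L)" by (rule normed_quot[OF Z cl])
  obtain B where B: "finite B" "B \<subseteq> carrier Z" "\<And>S. subsp Z S \<Longrightarrow> L \<union> B \<subseteq> S \<Longrightarrow> S = carrier Z"
    using L by (auto simp: cofin_subspaces_iff[OF Z])
  note lin = is_lin_quot_map[OF Zv Ls] and Q = is_linD[OF is_lin_quot_map[OF Zv Ls]]
  show fd: "fin_dim (quot_space Z L)"
    unfolding fin_dim_def submodule_iff_subsp[OF vs_quot[OF Zv Ls]]
  proof (intro exI[of _ "quot_map Z L ` B"] conjI allI impI)
    fix S assume S: "subsp (quot_space Z L) S \<and> quot_map Z L ` B \<subseteq> S"
    \<comment> \<open>The preimage of S is a subspace that contains L and B, hence
      everything.\<close>
    let ?S = "{z \<in> carrier Z. quot_map Z L z \<in> S}"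
    have "subsp Z ?S"
      using S is_lin_zero[OF Zv vs_quot[OF Zv Ls] lin] Zv subspD[of "quot_space Z L" S]
      by (auto simp: subsp_def[of Z] Q)
    moreover have "quot_map Z L l \<in> S" if "l \<in> L" for l
      using quot_map_zero_iff[OF Zv Ls, of l] that subspD(1)[OF Ls that] S subspD(2)[of "quot_space Z L" S] by simp
    then have "L \<union> B \<subseteq> ?S" using S B(2) subspD(1)[OF Ls] by auto
    ultimately have "?S = carrier Z" by (rule B(3))
    then have "carrier (quot_space Z L) \<subseteq> S" by (auto simp: quot_space_simps(1))
    then show "S = carrier (quot_space Z L)" using S subspD(1)[of "quot_space Z L" S] by auto
  qed (use B in \<open>auto simp: quot_space_simps(1)\<close>)
  show "banach_space (quot_space Z L)" by (rule fin_dim_banach[OF n fd])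
  show le: "nrm (quot_space Z L) (quot_map Z L z) \<le> nrm Z z" if "z \<in> carrier Z" for z
    using nrm_quot_map[OF Z Ls that] sdist_le_self[OF Zv normed_seminorm[OF Z] Ls that] by simp
  show "bounded_op Z (quot_space Z L) (quot_map Z L)"
    by (rule bounded_opI[OF lin, where c = 1]) (use le in simp)
  show "opnorm Z (quot_space Z L) (quot_map Z L) \<le> 1"
    by (rule opnorm_le[OF Zv homog_normed[OF Z]]) (use le in auto)
qed

section \<open>Dual pairs\<close>

lemma dual_copyD:
  assumes Y: "normed_space Y" and J: "dual_copy Y Z J"
  shows "banach_space Z" "normed_space Z" "z \<in> carrier Z \<Longrightarrow> J z \<in> carrier (dual Y)"
    "z \<in> carrier Z \<Longrightarrow> J z \<in> lin_forms Y" "z \<in> carrier Z \<Longrightarrow> nrm (dual Y) (J z) = nrm Z z"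
    "z \<in> carrier Z \<Longrightarrow> y \<in> carrier Y \<Longrightarrow> norm (J z y) \<le> nrm Z z * nrm Y y"
    "is_lin Z scalar_space (\<lambda>z. J z y)"
    "f \<in> carrier (dual Y) \<Longrightarrow> \<exists>z\<in>carrier Z. J z = f"
    "z \<in> carrier Z \<Longrightarrow> w \<in> carrier Z \<Longrightarrow> J z = J w \<Longrightarrow> z = w"
    "z \<in> carrier Z \<Longrightarrow> (\<forall>y\<in>carrier Y. J z y = 0) \<Longrightarrow> z = \<zero>\<^bsub>Z\<^esub>"
proof -
  note Yv = normed_spaceD(1)[OF Y] and Yh = homog_normed[OF Y]
  show b: "banach_space Z" and n: "normed_space Z" using J by (auto simp: dual_copy_def banach_normed)
  have i: "is_lin Z (dual Y) J" "bij_betw J (carrier Z) (carrier (dual Y))" "\<And>z. z \<in> carrier Z \<Longrightarrow> nrm (dual Y) (J z) = nrm Z z"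
    using J by (auto simp: dual_copy_def isometric_iso_def)
  show 3: "J z \<in> carrier (dual Y)" if "z \<in> carrier Z" for z using is_linD(1)[OF i(1)] that .
  show 4: "J z \<in> lin_forms Y" if "z \<in> carrier Z" for z using dualD(1)[OF Yv Yh 3[OF that]] .
  show 5: "nrm (dual Y) (J z) = nrm Z z" if "z \<in> carrier Z" for z using i(3) that .
  show "norm (J z y) \<le> nrm Z z * nrm Y y" if "z \<in> carrier Z" "y \<in> carrier Y"
    using dualD(2)[OF Yv Yh 3[OF that(1)] that(2)] 5[OF that(1)] by simp
  show "is_lin Z scalar_space (\<lambda>z. J z y)" using i(1) by (auto simp: is_lin_def)
  show "\<exists>z\<in>carrier Z. J z = f" if "f \<in> carrier (dual Y)" using i(2) that by (metis bij_betw_imp_surj_on imageE)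
  show inj: "z = w" if "z \<in> carrier Z" "w \<in> carrier Z" "J z = J w" for z w
    using i(2) that by (auto simp: bij_betw_def inj_on_def)
  show "z = \<zero>\<^bsub>Z\<^esub>" if z: "z \<in> carrier Z" "\<forall>y\<in>carrier Y. J z y = 0"
  proof -
    have "J z y = 0" for y using z lin_formsD(2)[OF 4[OF z(1)]] by (cases "y \<in> carrier Y") auto
    then have "J z = J \<zero>\<^bsub>Z\<^esub>"
      using is_lin_zero[OF _ _ i(1)] n normed_dual[OF Yv Yh] by auto
    then show ?thesis using inj z n by simp
  qed
qed

lemma fin_subspaces_iff:
  assumes "vs X"
  shows "E \<in> fin_subspaces X \<longleftrightarrow> (\<exists>S. E = X\<lparr>carrier := S\<rparr> \<and> subsp X S \<and> (\<exists>G. set G \<subseteq> S \<and> S = lspan X (set G)))"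
proof -
  have *: "fin_dim (X\<lparr>carrier := S\<rparr>) \<longleftrightarrow> (\<exists>G. set G \<subseteq> S \<and> S = lspan X (set G))" if "subsp X S" for S
  proof -
    have "lspan (X\<lparr>carrier := S\<rparr>) B = lspan X B" for B by (simp add: lspan_def)
    then show ?thesis using fin_dim_iff[OF vs_subsp[OF assms that]]
      by (auto, metis finite_list)
  qed
  then show ?thesis unfolding fin_subspaces_def submodule_iff_subsp[OF assms] by auto
qed

lemma fin_subspaces_span:
  assumes "vs X" "set G \<subseteq> carrier X"
  shows "X\<lparr>carrier := lspan X (set G)\<rparr> \<in> fin_subspaces X"
  unfolding fin_subspaces_iff[OF assms(1)]
  using subsp_lspan[OF assms] lspan_superset[OF assms] by blast

lemma fin_subspacesD:
  assumes X: "normed_space X" and E: "E \<in> fin_subspaces X"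
  shows "normed_space E" "fin_dim E" "banach_space E" "subsp X (carrier E)" "E = X\<lparr>carrier := carrier E\<rparr>"
proof -
  obtain S where S: "E = X\<lparr>carrier := S\<rparr>" "subsp X S" using E X by (auto simp: fin_subspaces_iff)
  show n: "normed_space E" using S X normed_subsp by auto
  show f: "fin_dim E" using E by (auto simp: fin_subspaces_def)
  show "banach_space E" by (rule fin_dim_banach[OF n f])
  show "subsp X (carrier E)" "E = X\<lparr>carrier := carrier E\<rparr>" using S by auto
qed

lemma lc_zero: "vs V \<Longrightarrow> \<forall>(c, v)\<in>set cvs. c = 0 \<and> v \<in> carrier V \<Longrightarrow> lc V cvs = \<zero>\<^bsub>V\<^esub>"
  by (induction cvs) auto

definition perp :: "('k::real_or_complex, 'a) nspace \<Rightarrow> ('a \<Rightarrow> 'b \<Rightarrow> 'k) \<Rightarrow> 'b set \<Rightarrow> 'a set" where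
  "perp Z b S = {z \<in> carrier Z. \<forall>y\<in>S. b z y = 0}"

definition pairing_on :: "('k::real_or_complex, 'a) nspace \<Rightarrow> ('k, 'b) nspace \<Rightarrow> ('a \<Rightarrow> 'b \<Rightarrow> 'k) \<Rightarrow> bool" where
  "pairing_on Z Y b \<longleftrightarrow> (\<forall>z\<in>carrier Z. (\<lambda>y. if y \<in> carrier Y then b z y else 0) \<in> lin_forms Y) \<and>
     (\<forall>y\<in>carrier Y. is_lin Z scalar_space (\<lambda>z. b z y)) \<and>
     (\<forall>z\<in>carrier Z. \<forall>y\<in>carrier Y. norm (b z y) \<le> nrm Z z * nrm Y y)"

text \<open>Says that Z modulo the annihilator of F is isometrically the dual of F, for each finite
  dimensional F in Y. The functional of a quotient element is read off its chosen representative,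
  which is legitimate since elements of the annihilator vanish on F. The two instances are a copy of
  the dual of Y paired with Y, and a space paired with its dual.\<close>

definition good_pair :: "('k::real_or_complex, 'a) nspace \<Rightarrow> ('k, 'b) nspace \<Rightarrow> ('a \<Rightarrow> 'b \<Rightarrow> 'k) \<Rightarrow> bool" where
  "good_pair Z Y b \<longleftrightarrow> pairing_on Z Y b \<and>
     (\<forall>F\<in>fin_subspaces Y. perp Z b (carrier F) \<in> cofin_subspaces Z \<and>
       dual_copy F (quot_space Z (perp Z b (carrier F))) (\<lambda>q y. if y \<in> carrier F then b q y else 0))"

context
  fixes Z :: "('k::real_or_complex, 'a) nspace" and Y :: "('k, 'b) nspace" and b
  assumes Z: "normed_space Z" and Y: "normed_space Y" and b: "pairing_on Z Y b"
begin

lemma pair_left_vs: "vs Z" and pair_right_vs: "vs Y"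
  using Z Y by simp_all

lemma pair_lin:
  "z \<in> carrier Z \<Longrightarrow> w \<in> carrier Z \<Longrightarrow> y \<in> carrier Y \<Longrightarrow> b (z \<oplus>\<^bsub>Z\<^esub> w) y = b z y + b w y"
  "z \<in> carrier Z \<Longrightarrow> y \<in> carrier Y \<Longrightarrow> b (c \<odot>\<^bsub>Z\<^esub> z) y = c * b z y"
  "z \<in> carrier Z \<Longrightarrow> y \<in> carrier Y \<Longrightarrow> y' \<in> carrier Y \<Longrightarrow> b z (y \<oplus>\<^bsub>Y\<^esub> y') = b z y + b z y'"
  "z \<in> carrier Z \<Longrightarrow> y \<in> carrier Y \<Longrightarrow> b z (c \<odot>\<^bsub>Y\<^esub> y) = c * b z y"
  "z \<in> carrier Z \<Longrightarrow> b z \<zero>\<^bsub>Y\<^esub> = 0"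
  "z \<in> carrier Z \<Longrightarrow> y \<in> carrier Y \<Longrightarrow> norm (b z y) \<le> nrm Z z * nrm Y y"
  "y \<in> carrier Y \<Longrightarrow> b \<zero>\<^bsub>Z\<^esub> y = 0"
proof -
  show "y \<in> carrier Y \<Longrightarrow> b \<zero>\<^bsub>Z\<^esub> y = 0"
    using is_lin_zero[OF pair_left_vs vs_scalar_space, of "\<lambda>z. b z y"] b by (auto simp: pairing_on_def)
  show "z \<in> carrier Z \<Longrightarrow> w \<in> carrier Z \<Longrightarrow> y \<in> carrier Y \<Longrightarrow> b (z \<oplus>\<^bsub>Z\<^esub> w) y = b z y + b w y"
    "z \<in> carrier Z \<Longrightarrow> y \<in> carrier Y \<Longrightarrow> b (c \<odot>\<^bsub>Z\<^esub> z) y = c * b z y"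
    "z \<in> carrier Z \<Longrightarrow> y \<in> carrier Y \<Longrightarrow> norm (b z y) \<le> nrm Z z * nrm Y y"
    using b by (auto simp: pairing_on_def is_lin_def)
  have *: "z \<in> carrier Z \<Longrightarrow> (\<lambda>y. if y \<in> carrier Y then b z y else 0) \<in> lin_forms Y"
    using b by (auto simp: pairing_on_def)
  show "z \<in> carrier Z \<Longrightarrow> y \<in> carrier Y \<Longrightarrow> y' \<in> carrier Y \<Longrightarrow> b z (y \<oplus>\<^bsub>Y\<^esub> y') = b z y + b z y'"
    "z \<in> carrier Z \<Longrightarrow> y \<in> carrier Y \<Longrightarrow> b z (c \<odot>\<^bsub>Y\<^esub> y) = c * b z y"
    "z \<in> carrier Z \<Longrightarrow> b z \<zero>\<^bsub>Y\<^esub> = 0"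
    using lin_formsD(3,4)[OF *] lin_forms_zero[OF pair_right_vs *] pair_right_vs by fastforce+
qed

lemma perp_span: "set G \<subseteq> carrier Y \<Longrightarrow> perp Z b (lspan Y (set G)) = perp Z b (set G)"
proof -
  assume G: "set G \<subseteq> carrier Y"
  have "b z y = 0" if "y \<in> lspan Y (set G)" "z \<in> carrier Z" "\<forall>y\<in>set G. b z y = 0" for z y
  proof -
    have "subsp Y {y \<in> carrier Y. b z y = 0}"
      using that pair_right_vs by (auto simp: subsp_def pair_lin)
    moreover have "set G \<subseteq> {y \<in> carrier Y. b z y = 0}" using that G by auto
    ultimately show ?thesis using lspan_minimal that by blast
  qed
  then show ?thesis using lspan_superset[OF pair_right_vs G] by (fastforce simp: perp_def)
qed

text \<open>Pairing with y does not see translations by the annihilator, so the modulus of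
  \<open>b z y\<close> is at most the norm of y times the distance of z from it. Distance zero
  therefore forces z into the annihilator. Its codimension is that of a common kernel of finitely
  many forms.\<close>

lemma perp_cofin:
  assumes F: "F \<in> fin_subspaces Y"
  shows "perp Z b (carrier F) \<in> cofin_subspaces Z"
proof -
  obtain G where G: "set G \<subseteq> carrier Y" "carrier F = lspan Y (set G)"
    using F subspD(1) by (fastforce simp: fin_subspaces_iff[OF pair_right_vs])
  let ?L = "perp Z b (set G)"
  have L: "subsp Z ?L" using G pair_left_vs unfolding subsp_def perp_def
    by (auto simp: pair_lin subset_iff)
  have cl: "quot_closed Z ?L"
    unfolding quot_closed_def
  proof (intro conjI L ballI impI)
    fix z assume z: "z \<in> carrier Z" "sdist Z (nrm Z) ?L z = 0"
    have "b z y = 0" if y: "y \<in> set G" for y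
    proof (cases "nrm Y y = 0")
      case True then show ?thesis using pair_lin(6)[OF z(1), of y] y G by auto
    next
      case False
      have yY: "y \<in> carrier Y" using y G by auto
      have pos: "nrm Y y > 0" using False normed_spaceD(2)[OF Y yY] by simp
      have "norm (b z y) / nrm Y y \<le> sdist Z (nrm Z) ?L z"
      proof (rule sdist_greatest[OF pair_left_vs normed_seminorm[OF Z] L])
        fix l assume l: "l \<in> ?L"
        then have "b (l \<oplus>\<^bsub>Z\<^esub> z) y = b z y" using z y yY by (auto simp: pair_lin perp_def)
        then show "norm (b z y) / nrm Y y \<le> nrm Z (l \<oplus>\<^bsub>Z\<^esub> z)"
          using pair_lin(6)[of "l \<oplus>\<^bsub>Z\<^esub> z" y] pos z pair_left_vs yY l by (simp add: field_simps perp_def)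
      qed
      then show ?thesis using z(2) pos by (simp add: field_simps)
    qed
    then show "z \<in> ?L" using z by (auto simp: perp_def)
  qed
  let ?f = "\<lambda>y z. if z \<in> carrier Z then b z y else 0"
  have fs: "set (map ?f G) \<subseteq> lin_forms Z"
  proof -
    have "is_lin Z scalar_space (\<lambda>z. b z y)" if "y \<in> set G" for y
      using G(1) that b by (auto simp: pairing_on_def)
    then show ?thesis using lin_forms_restrict[OF pair_left_vs] by auto
  qed
  obtain B where B: "finite B" "B \<subseteq> carrier Z"
    "\<And>v. v \<in> carrier Z \<Longrightarrow> \<exists>x\<in>lspan Z B. \<forall>f\<in>set (map ?f G). f (v \<oplus>\<^bsub>Z\<^esub> x) = 0"
    using common_kernel_complement[OF pair_left_vs fs] by (elim exE conjE) (rule, assumption+, blast)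
  have "S = carrier Z" if S: "subsp Z S" "?L \<union> B \<subseteq> S" for S
  proof -
    have "v \<in> S" if v: "v \<in> carrier Z" for v
    proof -
      obtain x where x: "x \<in> lspan Z B" "\<forall>f\<in>set (map ?f G). f (v \<oplus>\<^bsub>Z\<^esub> x) = 0" using B(3)[OF v] by blast
      have xS: "x \<in> S" using x lspan_minimal[of Z S B] S by auto
      then have xZ: "x \<in> carrier Z" using subspD(1)[OF S(1)] by auto
      have "v \<oplus>\<^bsub>Z\<^esub> x \<in> ?L" using x v xZ pair_left_vs by (auto simp: perp_def)
      then have "v \<oplus>\<^bsub>Z\<^esub> x \<in> S" using S(2) by blast
      then have "(v \<oplus>\<^bsub>Z\<^esub> x) \<oplus>\<^bsub>Z\<^esub> (-1) \<odot>\<^bsub>Z\<^esub> x \<in> S" by (rule subspD(3)[OF S(1) _ subspD(4)[OF S(1) xS]])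
      then show ?thesis using v xZ pair_left_vs by (simp add: vs_assoc)
    qed
    then show ?thesis using subspD(1)[OF S(1)] by auto
  qed
  then have "?L \<in> cofin_subspaces Z" using cl B by (auto simp: cofin_subspaces_iff[OF Z])
  then show ?thesis using perp_span[OF G(1)] G(2) by simp
qed

text \<open>The norm of z restricted to F never exceeds the quotient norm, because the pairing has
  norm at most 1. What remains for an isometry is the reverse estimate \<open>ext\<close>, and
  \<open>surj\<close> makes every functional on F come from Z.\<close>

lemma good_pairI:
  assumes ext: "\<And>F z c. F \<in> fin_subspaces Y \<Longrightarrow> z \<in> carrier Z \<Longrightarrow> 0 \<le> c \<Longrightarrow>
      (\<And>y. y \<in> carrier F \<Longrightarrow> norm (b z y) \<le> c * nrm Y y) \<Longrightarrow> sdist Z (nrm Z) (perp Z b (carrier F)) z \<le> c"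
    and surj: "\<And>F f. F \<in> fin_subspaces Y \<Longrightarrow> f \<in> carrier (dual F) \<Longrightarrow> \<exists>z\<in>carrier Z. \<forall>y\<in>carrier F. b z y = f y"
  shows "good_pair Z Y b"
  unfolding good_pair_def
proof (intro conjI ballI b perp_cofin)
  fix F assume F: "F \<in> fin_subspaces Y"
  let ?L = "perp Z b (carrier F)"
  let ?W = "quot_space Z ?L" and ?Q = "quot_map Z ?L"
  let ?J = "\<lambda>q y. if y \<in> carrier F then b q y else 0"
  note L = cofin_quot[OF Z perp_cofin[OF F]] and FD = fin_subspacesD[OF Y F]
  note Fv = normed_spaceD(1)[OF FD(1)] and Fh = homog_normed[OF FD(1)]
  have FY: "y \<in> carrier Y" if "y \<in> carrier F" for y using subspD(1)[OF FD(4) that] .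
  have Fsimps: "add F = add Y" "smult F = smult Y" "nrm F = nrm Y" by (subst FD(5), simp)+
  have bQ: "b (?Q z) y = b z y" if z: "z \<in> carrier Z" and y: "y \<in> carrier F" for z y
  proof -
    obtain l where "l \<in> ?L" "?Q z = l \<oplus>\<^bsub>Z\<^esub> z" using quot_map_in[OF pair_left_vs L(2) z] by blast
    then show ?thesis using z y FY by (auto simp: pair_lin perp_def)
  qed
  have JQ: "?J (?Q z) = ?J z" if "z \<in> carrier Z" for z using bQ[OF that] by auto
  have Jl: "?J z \<in> lin_forms F" if z: "z \<in> carrier Z" for z
    using z FY Fv vs_add[OF Fv] vs_smult[OF Fv] by (intro lin_formsI) (auto simp: pair_lin Fsimps)
  have Jle: "norm (?J z y) \<le> nrm ?W (?Q z) * nrm F y" if z: "z \<in> carrier Z" and y: "y \<in> carrier F" for z y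
  proof (cases "nrm Y y = 0")
    case True then show ?thesis using pair_lin(6)[OF z FY[OF y]] y by (simp add: Fsimps)
  next
    case False
    have pos: "nrm Y y > 0" using False normed_spaceD(2)[OF Y FY[OF y]] by simp
    have "norm (b z y) / nrm Y y \<le> sdist Z (nrm Z) ?L z"
    proof (rule sdist_greatest[OF pair_left_vs normed_seminorm[OF Z] L(2)])
      fix l assume l: "l \<in> ?L"
      then have "b (l \<oplus>\<^bsub>Z\<^esub> z) y = b z y" using z y FY by (auto simp: pair_lin perp_def)
      then show "norm (b z y) / nrm Y y \<le> nrm Z (l \<oplus>\<^bsub>Z\<^esub> z)"
        using pair_lin(6)[of "l \<oplus>\<^bsub>Z\<^esub> z" y] pos z pair_left_vs FY[OF y] l by (simp add: field_simps perp_def)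
    qed
    then show ?thesis using nrm_quot_map[OF Z L(2) z] y pos by (simp add: Fsimps field_simps)
  qed
  have Jd: "?J z \<in> carrier (dual F)" if z: "z \<in> carrier Z" for z
    by (rule dualI[OF Jl[OF z], where c = "nrm ?W (?Q z)"]) (use Jle[OF z] in auto)
  have Jn: "nrm (dual F) (?J z) = nrm ?W (?Q z)" if z: "z \<in> carrier Z" for z
  proof (rule antisym)
    have QW: "?Q z \<in> carrier ?W" using z by (simp add: quot_space_simps)
    show "nrm (dual F) (?J z) \<le> nrm ?W (?Q z)"
      by (rule nrm_dual_le[OF Fv Fh normed_spaceD(2)[OF L(3) QW]]) (use Jle[OF z] in auto)
    show "nrm ?W (?Q z) \<le> nrm (dual F) (?J z)"
      unfolding nrm_quot_map[OF Z L(2) z]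
    proof (rule ext[OF F z dualD(3)[OF Fv Fh Jd[OF z]]])
      fix y assume "y \<in> carrier F"
      then show "norm (b z y) \<le> nrm (dual F) (?J z) * nrm Y y"
        using dualD(2)[OF Fv Fh Jd[OF z], of y] by (simp add: Fsimps)
    qed
  qed
  have lin: "is_lin ?W (dual F) ?J"
    unfolding is_lin_def quot_space_simps(1)
  proof (intro conjI ballI allI Pi_I; (elim imageE)?; hypsubst)
    fix z assume z: "z \<in> carrier Z"
    show "?J (?Q z) \<in> carrier (dual F)" using JQ[OF z] Jd[OF z] by simp
    fix c
    show "?J (c \<odot>\<^bsub>?W\<^esub> ?Q z) = c \<odot>\<^bsub>dual F\<^esub> ?J (?Q z)"
      using is_linD(3)[OF is_lin_quot_map[OF pair_left_vs L(2)] z, of c, symmetric] z pair_left_vs FY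
      by (auto simp: fun_eq_iff bQ pair_lin)
  next
    fix z w assume z: "z \<in> carrier Z" and w: "w \<in> carrier Z"
    show "?J (?Q z \<oplus>\<^bsub>?W\<^esub> ?Q w) = ?J (?Q z) \<oplus>\<^bsub>dual F\<^esub> ?J (?Q w)"
      using is_linD(2)[OF is_lin_quot_map[OF pair_left_vs L(2)] z w, symmetric] z w pair_left_vs FY
      by (auto simp: fun_eq_iff bQ pair_lin)
  qed
  have nJ: "nrm (dual F) (?J q) = nrm ?W q" if q: "q \<in> carrier ?W" for q
  proof -
    obtain z where z: "z \<in> carrier Z" "q = ?Q z" using q by (auto simp: quot_space_simps)
    show ?thesis unfolding z(2) JQ[OF z(1)] by (rule Jn[OF z(1)])
  qed
  have "inj_on ?J (carrier ?W)"
  proof (rule inj_onI)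
    fix p q assume p: "p \<in> carrier ?W" and q: "q \<in> carrier ?W" and eq: "?J p = ?J q"
    note Wv = normed_spaceD(1)[OF L(3)]
    let ?d = "p \<oplus>\<^bsub>?W\<^esub> (-1) \<odot>\<^bsub>?W\<^esub> q"
    have "?J ?d = \<zero>\<^bsub>dual F\<^esub>"
      using is_linD(2)[OF lin p vs_smult[OF Wv q, of "-1"]] is_linD(3)[OF lin q, of "-1"] eq by (simp add: fun_eq_iff)
    then have "nrm ?W ?d = 0"
      using nJ[of ?d] p q Wv nrm_zero[OF normed_dual[OF Fv Fh]] by simp
    then show "p = q" using vs_eq_iff[OF Wv p q] normed_spaceD(3)[OF L(3), of ?d] p q Wv by simp
  qed
  moreover have "f \<in> ?J ` carrier ?W" if f: "f \<in> carrier (dual F)" for f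
  proof -
    obtain z where z: "z \<in> carrier Z" "\<forall>y\<in>carrier F. b z y = f y" using surj[OF F f] by blast
    have "?J (?Q z) = f" using JQ[OF z(1)] z lin_formsD(2)[OF dualD(1)[OF Fv Fh f]] by (auto simp: fun_eq_iff)
    then show ?thesis using z by (intro image_eqI[of _ _ "?Q z"]) (auto simp: quot_space_simps)
  qed
  ultimately have "bij_betw ?J (carrier ?W) (carrier (dual F))"
    unfolding bij_betw_def using is_linD(1)[OF lin] by auto
  then show "dual_copy F ?W ?J"
    unfolding dual_copy_def isometric_iso_def using lin nJ L(5) by auto
qed

end

text \<open>Both conditions are Hahn-Banach extensions from F to Y. An extension of
  \<open>J z\<close> restricted to F, with the same bound c, is some \<open>J w\<close>; then w and
  z differ by an element of the annihilator, so w witnesses that the distance is at most c.\<close>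

lemma good_pair_dual_copy:
  fixes Y :: "('k::real_or_complex, 'b) nspace"
  assumes Y: "normed_space Y" and J: "dual_copy Y Z J"
  shows "good_pair Z Y J"
proof -
  note D = dual_copyD[OF Y J] and Yv = normed_spaceD(1)[OF Y] and Yh = homog_normed[OF Y]
  note Zv = normed_spaceD(1)[OF D(2)]
  have cut: "(\<lambda>y. if y \<in> carrier Y then J z y else 0) = J z" if "z \<in> carrier Z" for z
    using lin_formsD(2)[OF D(4)[OF that]] by auto
  have b: "pairing_on Z Y J"
    unfolding pairing_on_def using D cut by auto
  show ?thesis
  proof (rule good_pairI[OF D(2) Y b])
    fix F z and c :: real
    assume F: "F \<in> fin_subspaces Y" and z: "z \<in> carrier Z" and c: "0 \<le> c"
      and le: "\<And>y. y \<in> carrier F \<Longrightarrow> norm (J z y) \<le> c * nrm Y y"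
    note FD = fin_subspacesD[OF Y F]
    note L = cofin_quot(2)[OF D(2) perp_cofin[OF D(2) Y b F]]
    have sm: "seminorm Y (\<lambda>y. c * nrm Y y)"
      using normed_seminorm[OF Y] c by (auto simp: seminorm_def simp flip: distrib_left intro: mult_left_mono)
    have ln: "is_lin (Y\<lparr>carrier := carrier F\<rparr>) scalar_space (J z)"
      using is_lin_subsp[OF lin_formsD(1)[OF D(4)[OF z]]] subspD(1)[OF FD(4)] by auto
    obtain h where h: "h \<in> lin_forms Y" "\<And>y. y \<in> carrier F \<Longrightarrow> h y = J z y"
        "\<And>y. y \<in> carrier Y \<Longrightarrow> norm (h y) \<le> c * nrm Y y"
      using hahn_banach[OF Yv sm FD(4) ln le] by blast
    obtain w where w: "w \<in> carrier Z" "J w = h" using D(8)[OF dualI[OF h(1,3)]] by blast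
    have nw: "nrm Z w \<le> c" using D(5)[OF w(1)] w(2) nrm_dual_le[OF Yv Yh c h(3)] by simp
    have "w \<oplus>\<^bsub>Z\<^esub> (-1) \<odot>\<^bsub>Z\<^esub> z \<in> perp Z J (carrier F)"
      using w z h(2) Zv is_linD[OF D(7)] by (auto simp: perp_def)
    moreover have "(w \<oplus>\<^bsub>Z\<^esub> (-1) \<odot>\<^bsub>Z\<^esub> z) \<oplus>\<^bsub>Z\<^esub> z = w"
      using w z Zv vs_comm[OF Zv, of "(-1) \<odot>\<^bsub>Z\<^esub> z" z] by (simp add: vs_assoc)
    ultimately show "sdist Z (nrm Z) (perp Z J (carrier F)) z \<le> c"
      using sdist_le[OF Zv normed_seminorm[OF D(2)] L z] nw by fastforce
  next
    fix F f assume F: "F \<in> fin_subspaces Y" and f: "f \<in> carrier (dual F)"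
    note FD = fin_subspacesD[OF Y F]
    note fD = dualD[OF normed_spaceD(1)[OF FD(1)] homog_normed[OF FD(1)] f]
    have nF: "nrm F = nrm Y" by (subst FD(5), simp)
    let ?c = "nrm (dual F) f"
    have sm: "seminorm Y (\<lambda>y. ?c * nrm Y y)"
      using normed_seminorm[OF Y] fD(3) by (auto simp: seminorm_def simp flip: distrib_left intro: mult_left_mono)
    have ln: "is_lin (Y\<lparr>carrier := carrier F\<rparr>) scalar_space f"
      using lin_formsD(1)[OF fD(1)] FD(5) by simp
    have le: "norm (f y) \<le> ?c * nrm Y y" if "y \<in> carrier F" for y
      using fD(2)[OF that] nF by simp
    obtain h where h: "h \<in> lin_forms Y" "\<And>y. y \<in> carrier F \<Longrightarrow> h y = f y"
        "\<And>y. y \<in> carrier Y \<Longrightarrow> norm (h y) \<le> ?c * nrm Y y"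
      using hahn_banach[OF Yv sm FD(4) ln le] by blast
    then show "\<exists>z\<in>carrier Z. \<forall>y\<in>carrier F. J z y = f y" using D(8)[OF dualI[OF h(1,3)]] by auto
  qed
qed

text \<open>The representing elements must lie in Z, where extending functionals on F would only
  yield elements of the bidual. The distance of z from the annihilator is instead attained by a
  functional \<open>h\<close> that vanishes there. By \<open>lin_forms_kernel\<close> such an
  \<open>h\<close> belongs to F, so the bound c applies to it. Surjectivity asks for no norm control
  and is exact interpolation.\<close>

lemma good_pair_predual:
  fixes Z :: "('k::real_or_complex, 'a) nspace"
  assumes Z: "normed_space Z"
  shows "good_pair Z (dual Z) (\<lambda>z f. f z)"
proof -
  note Zv = normed_spaceD(1)[OF Z] and Zh = homog_normed[OF Z]
  note D = normed_dual[OF Zv Zh]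
  note Dv = normed_spaceD(1)[OF D]
  have b: "pairing_on Z (dual Z) (\<lambda>z f. f z)"
    unfolding pairing_on_def
  proof (intro conjI ballI)
    fix z assume z: "z \<in> carrier Z"
    show "(\<lambda>f. if f \<in> carrier (dual Z) then f z else 0) \<in> lin_forms (dual Z)"
      using vs_add[OF Dv] vs_smult[OF Dv] by (intro lin_formsI) auto
    fix f assume f: "f \<in> carrier (dual Z)"
    show "norm (f z) \<le> nrm Z z * nrm (dual Z) f"
      using dualD(2)[OF Zv Zh f z] by (simp add: mult.commute)
  qed (use dualD(1)[OF Zv Zh] lin_formsD(1) in auto)
  show ?thesis
  proof (rule good_pairI[OF Z D b])
    fix F z and c :: real
    assume F: "F \<in> fin_subspaces (dual Z)" and z: "z \<in> carrier Z" and c: "0 \<le> c"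
      and le: "\<And>f. f \<in> carrier F \<Longrightarrow> norm (f z) \<le> c * nrm (dual Z) f"
    note FD = fin_subspacesD[OF D F]
    let ?L = "perp Z (\<lambda>z f. f z) (carrier F)"
    note L = cofin_quot(2)[OF Z perp_cofin[OF Z D b F]]
    note sd = seminorm_sdist[OF Zv normed_seminorm[OF Z] L]
    obtain G where G: "set G \<subseteq> carrier F" "carrier F = lspan (dual Z) (set G)"
      using F by (auto simp: fin_subspaces_iff[OF Dv])
    have GD: "set G \<subseteq> carrier (dual Z)" using G subspD(1)[OF FD(4)] by auto
    obtain h where h: "h \<in> lin_forms Z" "h z = of_real (sdist Z (nrm Z) ?L z)"
        "\<And>v. v \<in> carrier Z \<Longrightarrow> norm (h v) \<le> sdist Z (nrm Z) ?L v"
      using hahn_banach_norming[OF Zv sd z] by blast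
    have hn: "norm (h v) \<le> 1 * nrm Z v" if "v \<in> carrier Z" for v
      using h(3)[OF that] sdist_le_self[OF Zv normed_seminorm[OF Z] L that] by simp
    have "h v = 0" if v: "v \<in> carrier Z" "\<forall>f\<in>set G. f v = 0" for v
    proof -
      have "v \<in> perp Z (\<lambda>z f. f z) (set G)" using v by (auto simp: perp_def)
      then have "v \<in> ?L" using perp_span[OF Z D b GD] G(2) by simp
      then show ?thesis using h(3)[OF v(1)] sdist_zero_on[OF Zv normed_seminorm[OF Z] L] by simp
    qed
    then obtain cs where cs: "length cs = length G" "\<forall>v. h v = (\<Sum>(c, f)\<leftarrow>zip cs G. c * f v)"
      using lin_forms_kernel[OF Zv _ h(1), of G] GD dualD(1)[OF Zv Zh] by blast
    have "lc (dual Z) cfs = (\<lambda>v. \<Sum>(c, f)\<leftarrow>cfs. c * f v)" for cfs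
      by (induction cfs) (auto simp: fun_eq_iff)
    then have "h = lc (dual Z) (zip cs G)" using cs(2) by (auto simp: fun_eq_iff)
    then have hF: "h \<in> carrier F"
      unfolding G(2) lspan_def by (auto intro!: exI[of _ "zip cs G"] dest: set_zip_rightD)
    have "sdist Z (nrm Z) ?L z = norm (h z)"
      using h(2) seminorm_nonneg[OF Zv sd z] by simp
    also have "\<dots> \<le> c * nrm (dual Z) h" by (rule le[OF hF])
    also have "\<dots> \<le> c * 1" using c nrm_dual_le[OF Zv Zh, of 1 h] hn by (intro mult_left_mono) auto
    finally show "sdist Z (nrm Z) ?L z \<le> c" by simp
  next
    fix F f assume F: "F \<in> fin_subspaces (dual Z)" and f: "f \<in> carrier (dual F)"
    note FD = fin_subspacesD[OF D F]
    note Fv = normed_spaceD(1)[OF FD(1)]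
    note fl = dualD(1)[OF Fv homog_normed[OF FD(1)] f]
    obtain G where G: "set G \<subseteq> carrier F" "carrier F = lspan (dual Z) (set G)"
      using F by (auto simp: fin_subspaces_iff[OF Dv])
    have FZ: "x \<in> lin_forms Z" if "x \<in> carrier F" for x
      using subspD(1)[OF FD(4) that] dualD(1)[OF Zv Zh] by blast
    have lcF: "lc F = lc (dual Z)" by (subst FD(5)) (simp add: fun_eq_iff)
    have zF: "\<zero>\<^bsub>F\<^esub> = (\<lambda>_. 0)" and aF: "add F = (\<lambda>f g v. f v + g v)" "smult F = (\<lambda>c f v. c * f v)"
      by (subst FD(5), simp)+
    have "\<exists>z\<in>carrier Z. \<forall>g\<in>set G. g z = f g"
    proof (rule interpolation[OF Fv Zv])
      fix x assume x: "x \<in> carrier F"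
      have "(\<lambda>y. if y \<in> carrier Z then x y else 0) = x" using lin_formsD(2)[OF FZ[OF x]] by auto
      then show "(\<lambda>y. if y \<in> carrier Z then x y else 0) \<in> lin_forms Z" using FZ[OF x] by simp
      assume "\<forall>y\<in>carrier Z. x y = 0"
      then have "x y = 0" for y using lin_formsD(2)[OF FZ[OF x]] by (cases "y \<in> carrier Z") auto
      then show "x = \<zero>\<^bsub>F\<^esub>" by (auto simp: zF)
    qed (use G lin_formsD(1)[OF fl] in \<open>auto simp: is_lin_def aF\<close>)
    then obtain z where z: "z \<in> carrier Z" "\<forall>g\<in>set G. g z = f g" by blast
    have "y z = f y" if yF: "y \<in> carrier F" for y
    proof -
      obtain cfs where y: "y = lc F cfs" "snd ` set cfs \<subseteq> set G"
        using yF unfolding G(2) lspan_def lcF by blast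
      have mem: "snd ` set cfs \<subseteq> carrier F" using y G by auto
      have "is_lin F scalar_space (\<lambda>y. y z)" by (auto simp: is_lin_def aF)
      then have "y z = (\<Sum>(c, g)\<leftarrow>cfs. c * g z)"
        using is_lin_lc[OF Fv vs_scalar_space _ mem] y by (simp add: lc_scalar comp_def case_prod_unfold)
      also have "\<dots> = (\<Sum>(c, g)\<leftarrow>cfs. c * f g)"
        by (rule arg_cong[where f = sum_list], rule map_cong[OF refl]) (use y z in force)
      also have "\<dots> = f y" using lin_forms_lc[OF Fv fl mem] y by simp
      finally show ?thesis .
    qed
    then show "\<exists>z\<in>carrier Z. \<forall>y\<in>carrier F. y z = f y" using z by blast
  qed
qed

text \<open>F is spanned by the coordinate functionals of the quotient, pulled back to Z. They are
  bounded because the quotient map is a contraction, and they vanish together exactly on L.\<close>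

lemma cofin_eq_perp:
  fixes Z :: "('k::real_or_complex, 'a) nspace"
  assumes Z: "normed_space Z" and L: "L \<in> cofin_subspaces Z"
  shows "\<exists>F\<in>fin_subspaces (dual Z). L = perp Z (\<lambda>z f. f z) (carrier F)"
proof -
  note Zv = normed_spaceD(1)[OF Z] and Zh = homog_normed[OF Z] and C = cofin_quot[OF Z L]
  note D = normed_dual[OF Zv Zh]
  note Dv = normed_spaceD(1)[OF D]
  let ?H = "quot_space Z L" and ?Q = "quot_map Z L"
  note Hv = normed_spaceD(1)[OF C(3)] and Hh = homog_normed[OF C(3)]
  obtain bfs where c: "coords ?H (carrier ?H) bfs" using fin_dim_coords[OF C(3,4)] .
  note cD = coordsD[OF C(3) subsp_carrier[OF Hv] c]
  define G where "G = map (\<lambda>(b, f) z. if z \<in> carrier Z then f (?Q z) else 0) bfs"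
  have GD: "set G \<subseteq> carrier (dual Z)"
  proof -
    have "(\<lambda>z. if z \<in> carrier Z then f (?Q z) else 0) \<in> carrier (dual Z)" if bf: "(b, f) \<in> set bfs" for b f
    proof (rule dualI[where c = "nrm (dual ?H) f"])
      show "(\<lambda>z. if z \<in> carrier Z then f (?Q z) else 0) \<in> lin_forms Z"
        by (rule lin_forms_restrict[OF Zv is_lin_comp[OF bounded_opD(1)[OF C(6)] lin_formsD(1)[OF cD(3)[OF bf]]]])
      fix z assume z: "z \<in> carrier Z"
      have Qz: "?Q z \<in> carrier ?H" using z by (simp add: quot_space_simps)
      have "nrm (dual ?H) f * nrm ?H (?Q z) \<le> nrm (dual ?H) f * nrm Z z"
        using dualD(3)[OF Hv Hh cD(2)[OF bf]] C(8)[OF z] by (intro mult_left_mono)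
      then show "norm (if z \<in> carrier Z then f (?Q z) else 0) \<le> nrm (dual ?H) f * nrm Z z"
        using dualD(2)[OF Hv Hh cD(2)[OF bf] Qz] z by simp
    qed
    then show ?thesis by (auto simp: G_def)
  qed
  have b: "pairing_on Z (dual Z) (\<lambda>z f. f z)"
    using good_pair_predual[OF Z] by (simp add: good_pair_def)
  have "z \<in> L \<longleftrightarrow> (\<forall>g\<in>set G. g z = 0)" if z: "z \<in> carrier Z" for z
  proof -
    have Qz: "?Q z \<in> carrier ?H" using z by (simp add: quot_space_simps)
    have "?Q z = \<zero>\<^bsub>?H\<^esub> \<longleftrightarrow> (\<forall>(b, f)\<in>set bfs. f (?Q z) = 0)"
    proof
      assume *: "\<forall>(b, f)\<in>set bfs. f (?Q z) = 0"
      have "lc ?H (map (\<lambda>(b, f). (f (?Q z), b)) bfs) = \<zero>\<^bsub>?H\<^esub>"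
        by (rule lc_zero[OF Hv]) (use * cD(1) in auto)
      then show "?Q z = \<zero>\<^bsub>?H\<^esub>" using cD(5)[OF Qz] by simp
    next
      assume "?Q z = \<zero>\<^bsub>?H\<^esub>"
      then show "\<forall>(b, f)\<in>set bfs. f (?Q z) = 0" using lin_forms_zero[OF Hv cD(3)] by auto
    qed
    then show ?thesis using quot_map_zero_iff[OF Zv C(2) z] z by (auto simp: G_def)
  qed
  then have "L = perp Z (\<lambda>z f. f z) (set G)" using subspD(1)[OF C(2)] by (auto simp: perp_def)
  also have "\<dots> = perp Z (\<lambda>z f. f z) (lspan (dual Z) (set G))" using perp_span[OF Z D b GD] by simp
  finally show ?thesis using fin_subspaces_span[OF Dv GD] by (intro bexI) auto
qed

section \<open>Weak local reflexivity\<close>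

text \<open>Rotating a nearly maximising vector by a unimodular scalar makes the value real, so that
  such values for several functionals can be added without cancellation.\<close>

lemma dual_approx:
  assumes V: "vs V" "homog V (nrm V)" and f: "f \<in> carrier (dual V)" and e: "e > 0"
  shows "\<exists>v\<in>carrier V. nrm V v \<le> 1 \<and> (\<exists>r. f v = of_real r \<and> nrm (dual V) f - e \<le> r)"
proof -
  have z: "nrm V \<zero>\<^bsub>V\<^esub> = 0" using V vs_smult_zero_left[OF V(1) vs_zero[OF V(1)]]
    unfolding homog_def by (metis mult_zero_left norm_zero vs_zero)
  have "nrm (dual V) f - e < (SUP v\<in>{v \<in> carrier V. nrm V v \<le> 1}. norm (f v))"
    using e by (simp add: nrm_dual opnorm_def)
  moreover have "bdd_above ((\<lambda>v. norm (f v)) ` {v \<in> carrier V. nrm V v \<le> 1})"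
    using opnorm_bdd_above[OF V(2) dualD(4)[OF V f]] by simp
  moreover have "{v \<in> carrier V. nrm V v \<le> 1} \<noteq> {}" using V z by fastforce
  ultimately obtain v where v: "v \<in> carrier V" "nrm V v \<le> 1" "nrm (dual V) f - e < norm (f v)"
    by (auto simp: less_cSUP_iff)
  note fl = lin_formsD[OF dualD(1)[OF V f]]
  show ?thesis
  proof (cases "f v = 0")
    case True
    then show ?thesis using v by (intro bexI[of _ v]) (auto intro!: exI[of _ 0])
  next
    case False
    define c where "c = of_real (norm (f v)) / f v"
    have c: "norm c = 1" "c * f v = of_real (norm (f v))" using False by (auto simp: c_def norm_divide)
    then show ?thesis using v V fl(4)[OF v(1), of c]
      by (intro bexI[of _ "c \<odot>\<^bsub>V\<^esub> v"]) (auto simp: homog_def intro!: exI[of _ "norm (f v)"])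
  qed
qed

text \<open>The sum of copies of Y over I with the maximum norm. Below, I is a finite norming set of
  functionals on a finite dimensional H, and an operator with values in H is represented by its
  compositions with them.\<close>

definition powsp :: "('k::real_or_complex, 'a) nspace \<Rightarrow> 'i set \<Rightarrow> ('k, 'i \<Rightarrow> 'a) nspace" where
  "powsp Y I = fun_space Y {w. (\<forall>i. w i \<in> carrier Y) \<and> (\<forall>i. i \<notin> I \<longrightarrow> w i = \<zero>\<^bsub>Y\<^esub>)} (\<lambda>w. MAX i\<in>I. nrm Y (w i))"

context
  fixes Y :: "('k::real_or_complex, 'a) nspace" and I :: "'i set"
  assumes Y: "normed_space Y" and I: "finite I" "I \<noteq> {}"
begin

lemma powsp_simps [simp]:
  "w \<in> carrier (powsp Y I) \<longleftrightarrow> (\<forall>i. w i \<in> carrier Y) \<and> (\<forall>i. i \<notin> I \<longrightarrow> w i = \<zero>\<^bsub>Y\<^esub>)"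
  "\<zero>\<^bsub>powsp Y I\<^esub> = (\<lambda>_. \<zero>\<^bsub>Y\<^esub>)" "v \<oplus>\<^bsub>powsp Y I\<^esub> w = (\<lambda>i. v i \<oplus>\<^bsub>Y\<^esub> w i)" "c \<odot>\<^bsub>powsp Y I\<^esub> w = (\<lambda>i. c \<odot>\<^bsub>Y\<^esub> w i)"
  by (auto simp: powsp_def)

lemma vs_powsp: "vs (powsp Y I)"
  unfolding powsp_def by (rule vs_fun_space) (use Y in auto)

lemma nrm_powsp_le_iff: "nrm (powsp Y I) w \<le> c \<longleftrightarrow> (\<forall>i\<in>I. nrm Y (w i) \<le> c)"
  using I by (simp add: powsp_def)

lemma nrm_powsp_ge: "i \<in> I \<Longrightarrow> nrm Y (w i) \<le> nrm (powsp Y I) w"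
  using nrm_powsp_le_iff by blast

lemma seminorm_powsp: "seminorm (powsp Y I) (nrm (powsp Y I))"
  unfolding seminorm_def
proof (intro conjI ballI allI)
  fix v w assume v: "v \<in> carrier (powsp Y I)" and w: "w \<in> carrier (powsp Y I)"
  show "nrm (powsp Y I) (v \<oplus>\<^bsub>powsp Y I\<^esub> w) \<le> nrm (powsp Y I) v + nrm (powsp Y I) w"
    unfolding nrm_powsp_le_iff
  proof
    fix i assume i: "i \<in> I"
    have "nrm Y (v i \<oplus>\<^bsub>Y\<^esub> w i) \<le> nrm Y (v i) + nrm Y (w i)" using v w by (intro normed_spaceD(5)[OF Y]) auto
    then show "nrm Y ((v \<oplus>\<^bsub>powsp Y I\<^esub> w) i) \<le> nrm (powsp Y I) v + nrm (powsp Y I) w"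
      using nrm_powsp_ge[OF i, of v] nrm_powsp_ge[OF i, of w] by simp
  qed
next
  fix c w assume w: "w \<in> carrier (powsp Y I)"
  have "nrm (powsp Y I) (c \<odot>\<^bsub>powsp Y I\<^esub> w) = (MAX i\<in>I. norm c * nrm Y (w i))"
    using w normed_spaceD(4)[OF Y] by (simp add: powsp_def)
  also have "\<dots> = norm c * (MAX i\<in>I. nrm Y (w i))"
    using mono_Max_commute[of "(*) (norm c)" "(\<lambda>i. nrm Y (w i)) ` I"] I
    by (simp add: mono_def mult_left_mono image_image)
  finally show "nrm (powsp Y I) (c \<odot>\<^bsub>powsp Y I\<^esub> w) = norm c * nrm (powsp Y I) w"
    by (simp add: powsp_def)
qed

text \<open>The dual of a maximum sum is the l1 sum of the duals. For the norm estimate, nearly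
  maximising unit vectors with real values are placed in the separate components: together they form
  one vector of norm at most 1, at which F takes nearly the sum of the norms.\<close>

lemma powsp_functional:
  assumes F: "F \<in> lin_forms (powsp Y I)" and le: "\<And>w. w \<in> carrier (powsp Y I) \<Longrightarrow> norm (F w) \<le> nrm (powsp Y I) w"
  defines "cmp \<equiv> \<lambda>i y. if y \<in> carrier Y then F (\<lambda>j. if j = i then y else \<zero>\<^bsub>Y\<^esub>) else 0"
  shows "\<And>i. i \<in> I \<Longrightarrow> cmp i \<in> carrier (dual Y)"
    and "\<And>w. w \<in> carrier (powsp Y I) \<Longrightarrow> F w = (\<Sum>i\<in>I. cmp i (w i))"
    and "(\<Sum>i\<in>I. nrm (dual Y) (cmp i)) \<le> 1"
proof -
  note Yv = normed_spaceD(1)[OF Y] and Yh = homog_normed[OF Y]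
  note Fl = lin_formsD[OF F]
  let ?s = "\<lambda>i y j. if j = i then y else \<zero>\<^bsub>Y\<^esub>"
  show d: "cmp i \<in> carrier (dual Y)" if i: "i \<in> I" for i
  proof (rule dualI[where c = 1])
    have s: "?s i y \<in> carrier (powsp Y I)" if "y \<in> carrier Y" for y using that i Yv by auto
    show "cmp i \<in> lin_forms Y"
    proof (rule lin_formsI)
      fix v w assume v: "v \<in> carrier Y" and w: "w \<in> carrier Y"
      have "?s i (v \<oplus>\<^bsub>Y\<^esub> w) = ?s i v \<oplus>\<^bsub>powsp Y I\<^esub> ?s i w" using Yv by auto
      then show "cmp i (v \<oplus>\<^bsub>Y\<^esub> w) = cmp i v + cmp i w"
        using Fl(3)[OF s[OF v] s[OF w]] v w Yv by (simp add: cmp_def)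
    next
      fix c v assume v: "v \<in> carrier Y"
      have "?s i (c \<odot>\<^bsub>Y\<^esub> v) = c \<odot>\<^bsub>powsp Y I\<^esub> ?s i v" using Yv by auto
      then show "cmp i (c \<odot>\<^bsub>Y\<^esub> v) = c * cmp i v"
        using Fl(4)[OF s[OF v], of c] v Yv by (simp add: cmp_def)
    qed (simp add: cmp_def)
    fix y assume y: "y \<in> carrier Y"
    have "nrm (powsp Y I) (?s i y) \<le> nrm Y y"
      unfolding nrm_powsp_le_iff using y Y normed_spaceD(2)[OF Y y] by auto
    then show "norm (cmp i y) \<le> 1 * nrm Y y" using le[OF s[OF y]] y by (simp add: cmp_def)
  qed
  have sum: "F w = (\<Sum>i\<in>A. cmp i (w i))"
    if "finite A" "A \<subseteq> I" "w \<in> carrier (powsp Y I)" "\<forall>i. i \<notin> A \<longrightarrow> w i = \<zero>\<^bsub>Y\<^esub>" for A w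
    using that
  proof (induction A arbitrary: w rule: finite_induct)
    case empty
    then have "w = \<zero>\<^bsub>powsp Y I\<^esub>" by auto
    then show ?case using lin_forms_zero[OF vs_powsp F] by simp
  next
    case (insert a A)
    let ?w = "w(a := \<zero>\<^bsub>Y\<^esub>)"
    have 1: "?s a (w a) \<in> carrier (powsp Y I)" and 2: "?w \<in> carrier (powsp Y I)" using insert Yv by auto
    have "w = ?s a (w a) \<oplus>\<^bsub>powsp Y I\<^esub> ?w" using insert Yv by auto
    then have "F w = cmp a (w a) + F ?w" using Fl(3)[OF 1 2] insert by (simp add: cmp_def)
    also have "F ?w = (\<Sum>i\<in>A. cmp i (?w i))" using insert 2 by (intro insert.IH) auto
    also have "\<dots> = (\<Sum>i\<in>A. cmp i (w i))" using insert by (intro sum.cong) auto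
    finally show ?case using insert by simp
  qed
  show sumI: "F w = (\<Sum>i\<in>I. cmp i (w i))" if "w \<in> carrier (powsp Y I)" for w
    using that by (intro sum I) auto
  show "(\<Sum>i\<in>I. nrm (dual Y) (cmp i)) \<le> 1"
  proof (rule field_le_epsilon)
    fix e :: real assume e: "e > 0"
    define e' where "e' = e / card I"
    have e': "e' > 0" using e I by (simp add: e'_def card_gt_0_iff)
    have "\<forall>i\<in>I. \<exists>v. \<exists>r. v \<in> carrier Y \<and> nrm Y v \<le> 1 \<and> cmp i v = of_real r \<and> nrm (dual Y) (cmp i) - e' \<le> r"
      using dual_approx[OF Yv Yh d e'] by blast
    then obtain v r where vr: "\<And>i. i \<in> I \<Longrightarrow> v i \<in> carrier Y \<and> nrm Y (v i) \<le> 1 \<and> cmp i (v i) = of_real (r i) \<and> nrm (dual Y) (cmp i) - e' \<le> r i"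
      by metis
    let ?w = "\<lambda>i. if i \<in> I then v i else \<zero>\<^bsub>Y\<^esub>"
    have w: "?w \<in> carrier (powsp Y I)" using vr Yv by auto
    have "F ?w = of_real (\<Sum>i\<in>I. r i)" using sumI[OF w] vr by simp
    then have "\<bar>\<Sum>i\<in>I. r i\<bar> \<le> nrm (powsp Y I) ?w" using le[OF w] by (simp del: of_real_sum)
    also have "\<dots> \<le> 1" unfolding nrm_powsp_le_iff using vr by auto
    finally have "(\<Sum>i\<in>I. r i) \<le> 1" by simp
    moreover have "(\<Sum>i\<in>I. nrm (dual Y) (cmp i) - e') \<le> (\<Sum>i\<in>I. r i)" using vr by (intro sum_mono) auto
    moreover have "card I * e' = e" using I by (simp add: e'_def)
    ultimately show "(\<Sum>i\<in>I. nrm (dual Y) (cmp i)) \<le> 1 + e" by (simp add: sum_subtractf)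
  qed
qed

end

text \<open>The weak form of the principle of local reflexivity that the duality theorem needs: an
  operator on a dual space with finite dimensional range can be replaced, on finitely many points
  and at the cost of a factor \<open>1 + \<delta>\<close>, by a weak* continuous one. The distance in the proof
  measures how small the coefficients \<open>y k\<close> of such an operator can be chosen; the
  Hahn-Banach functional which realises it shows that it is at most 1.\<close>

lemma weak_local_reflexivity:
  fixes Y :: "('k::real_or_complex, 'a) nspace" and Z :: "('k, 'b) nspace" and H :: "('k, 'c) nspace"
  assumes Y: "normed_space Y" and J: "dual_copy Y Z J" and H: "normed_space H" "fin_dim H"
    and Q: "is_lin Z H Q" "\<And>z. z \<in> carrier Z \<Longrightarrow> nrm H (Q z) \<le> nrm Z z"
    and G: "set G \<subseteq> carrier Z" and \<delta>: "0 < \<delta>"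
  obtains yhs where "\<forall>(y, h)\<in>set yhs. y \<in> carrier Y \<and> h \<in> carrier H"
    "\<And>g. g \<in> set G \<Longrightarrow> lc H (map (\<lambda>(y, h). (J g y, h)) yhs) = Q g"
    "\<And>z. z \<in> carrier Z \<Longrightarrow> nrm H (lc H (map (\<lambda>(y, h). (J z y, h)) yhs)) \<le> (1 + \<delta>) * nrm Z z"
proof -
  note D = dual_copyD[OF Y J] and Yv = normed_spaceD(1)[OF Y] and Yh = homog_normed[OF Y]
  note Zv = normed_spaceD(1)[OF D(2)] and Hv = normed_spaceD(1)[OF H(1)] and Hh = homog_normed[OF H(1)]
  have Jl1: "J z (y \<oplus>\<^bsub>Y\<^esub> y') = J z y + J z y'"
    if "z \<in> carrier Z" "y \<in> carrier Y" "y' \<in> carrier Y" for z y y'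
    using lin_formsD(3)[OF D(4)[OF that(1)]] that by auto
  have Jl2: "J z (c \<odot>\<^bsub>Y\<^esub> y) = c * J z y" if "z \<in> carrier Z" "y \<in> carrier Y" for z y c
    using lin_formsD(4)[OF D(4)[OF that(1)]] that by auto
  note Jl = Jl1 Jl2
  obtain bfs where c: "coords H (carrier H) bfs" using fin_dim_coords[OF H] .
  note cD = coordsD[OF H(1) subsp_carrier[OF Hv] c]
  define m where "m = length bfs"
  define B where "B k = fst (bfs ! k)" for k
  define f where "f k = snd (bfs ! k)" for k
  have mem: "(B k, f k) \<in> set bfs" if "k < m" for k using that by (simp add: B_def f_def m_def)
  have BH: "B k \<in> carrier H" if "k < m" for k using cD(1)[OF mem[OF that]] .
  have fH: "f k \<in> lin_forms H" if "k < m" for k using cD(3)[OF mem[OF that]] .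
  have bfs: "bfs = map (\<lambda>k. (B k, f k)) [0..<m]"
    by (rule nth_equalityI) (auto simp: B_def f_def m_def)
  have coord: "lc H (map (\<lambda>k. (f k v, B k)) [0..<m]) = v" if "v \<in> carrier H" for v
    using cD(5)[OF that] by (subst (asm) bfs) (simp add: comp_def)
  \<comment> \<open>Two factors 1 + \<delta>' are lost, one by the norming set and one by not
    attaining the distance; their product is 1 + \<delta>.\<close>
  define \<delta>' where "\<delta>' = sqrt (1 + \<delta>) - 1"
  have \<delta>': "\<delta>' > 0" "(1 + \<delta>') * (1 + \<delta>') = 1 + \<delta>" using \<delta> by (auto simp: \<delta>'_def)
  obtain hs where hs: "set hs \<subseteq> lin_forms H" "\<And>h v. h \<in> set hs \<Longrightarrow> v \<in> carrier H \<Longrightarrow> norm (h v) \<le> nrm H v"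
    "\<And>v. v \<in> carrier H \<Longrightarrow> \<exists>h\<in>set hs. nrm H v \<le> (1 + \<delta>') * norm (h v)"
    using fin_dim_norming[OF H \<delta>'(1)] by blast
  let ?I = "set hs"
  have I: "finite ?I" "?I \<noteq> {}" using hs(3)[of "\<zero>\<^bsub>H\<^esub>"] Hv by auto
  let ?P = "powsp Y ?I"
  note Pv = vs_powsp[OF Y I] and Ps = seminorm_powsp[OF Y I] and [simp] = powsp_simps[OF Y I]
  define Yk where "Yk = {y. \<forall>k::nat. y k \<in> carrier Y}"
  \<comment> \<open>Pairing \<open>T y h\<close> with z gives the value of \<open>h\<close> at the
    sum of the \<open>J z (y k) \<odot> B k\<close>. So \<open>T y\<close> represents the operator
    with coefficients \<open>y\<close> by its compositions with the norming functionals, and the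
    maximum norm of \<open>T y\<close> controls the norm of that operator.\<close>
  define T where "T y h = (if h \<in> ?I then lc Y (map (\<lambda>k. (h (B k), y k)) [0..<m]) else \<zero>\<^bsub>Y\<^esub>)" for y and h :: "'c \<Rightarrow> 'k"
  have memY: "snd ` set (map (\<lambda>k. (g k, y k)) [0..<m]) \<subseteq> carrier Y" if "y \<in> Yk" for g :: "nat \<Rightarrow> 'k" and y
    using that by (auto simp: Yk_def)
  have TY: "T y h \<in> carrier Y" if "y \<in> Yk" for y h using lc_carrier[OF Yv memY[OF that]] Yv by (simp add: T_def)
  have TP: "T y \<in> carrier ?P" if "y \<in> Yk" for y using TY[OF that] by (auto simp: T_def)
  have fT: "g (T y h) = (\<Sum>k<m. h (B k) * g (y k))" if "g \<in> lin_forms Y" "y \<in> Yk" "h \<in> ?I" for g y h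
    using lin_forms_lc[OF Yv that(1) memY[OF that(2)]] that(3)
    by (simp add: T_def comp_def atLeast0LessThan interv_sum_list_conv_sum_set_nat)
  have Tadd: "T (\<lambda>k. y k \<oplus>\<^bsub>Y\<^esub> y' k) = T y \<oplus>\<^bsub>?P\<^esub> T y'" if "y \<in> Yk" "y' \<in> Yk" for y y'
  proof -
    have yy: "(\<lambda>k. y k \<oplus>\<^bsub>Y\<^esub> y' k) \<in> Yk" using that Yv by (auto simp: Yk_def)
    have "T (\<lambda>k. y k \<oplus>\<^bsub>Y\<^esub> y' k) h = T y h \<oplus>\<^bsub>Y\<^esub> T y' h" for h
    proof (cases "h \<in> ?I")
      case True
      show ?thesis
      proof (rule separated_eqI[OF Yv separated_normed[OF Y]])
        fix g assume g: "g \<in> lin_forms Y"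
        show "g (T (\<lambda>k. y k \<oplus>\<^bsub>Y\<^esub> y' k) h) = g (T y h \<oplus>\<^bsub>Y\<^esub> T y' h)"
          using that[unfolded Yk_def] TY[OF that(1)] TY[OF that(2)]
          by (simp add: lin_formsD[OF g] fT[OF g yy True] fT[OF g that(1) True] fT[OF g that(2) True]
              sum.distrib algebra_simps)
      qed (use TY that yy Yv in auto)
    qed (use Yv in \<open>simp add: T_def\<close>)
    then show ?thesis by auto
  qed
  have Tsm: "T (\<lambda>k. c \<odot>\<^bsub>Y\<^esub> y k) = c \<odot>\<^bsub>?P\<^esub> T y" if "y \<in> Yk" for y c
  proof -
    have yy: "(\<lambda>k. c \<odot>\<^bsub>Y\<^esub> y k) \<in> Yk" using that Yv by (auto simp: Yk_def)
    have "T (\<lambda>k. c \<odot>\<^bsub>Y\<^esub> y k) h = c \<odot>\<^bsub>Y\<^esub> T y h" for h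
    proof (cases "h \<in> ?I")
      case True
      show ?thesis
      proof (rule separated_eqI[OF Yv separated_normed[OF Y]])
        fix g assume g: "g \<in> lin_forms Y"
        show "g (T (\<lambda>k. c \<odot>\<^bsub>Y\<^esub> y k) h) = g (c \<odot>\<^bsub>Y\<^esub> T y h)"
          using that[unfolded Yk_def] TY[OF that]
          by (simp add: lin_formsD[OF g] fT[OF g yy True] fT[OF g that True] sum_distrib_left algebra_simps)
      qed (use TY that yy Yv in auto)
    qed (use Yv in \<open>simp add: T_def\<close>)
    then show ?thesis by auto
  qed
  \<comment> \<open>Coefficients of the operators that vanish on G; adding one of them leaves the
    values on G unchanged.\<close>
  define K where "K = {y \<in> Yk. \<forall>k<m. \<forall>g\<in>set G. J g (y k) = 0}"
  have K0: "(\<lambda>_. \<zero>\<^bsub>Y\<^esub>) \<in> K" using Yv G lin_forms_zero[OF Yv D(4)] by (auto simp: K_def Yk_def)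
  have S: "subsp ?P (T ` K)"
    unfolding subsp_def
  proof (intro conjI ballI allI)
    show "T ` K \<subseteq> carrier ?P" using TP by (auto simp: K_def)
    have "T (\<lambda>k. 0 \<odot>\<^bsub>Y\<^esub> \<zero>\<^bsub>Y\<^esub>) = 0 \<odot>\<^bsub>?P\<^esub> T (\<lambda>_. \<zero>\<^bsub>Y\<^esub>)" using K0 by (intro Tsm) (auto simp: K_def)
    then have "T (\<lambda>_. \<zero>\<^bsub>Y\<^esub>) = \<zero>\<^bsub>?P\<^esub>" using TY[of "\<lambda>_. \<zero>\<^bsub>Y\<^esub>"] K0 Yv by (auto simp: K_def)
    then show "\<zero>\<^bsub>?P\<^esub> \<in> T ` K" using K0 by (metis imageI)
  next
    fix v w assume "v \<in> T ` K" "w \<in> T ` K"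
    then obtain y y' where y: "y \<in> K" "y' \<in> K" "v = T y" "w = T y'" by auto
    have "(\<lambda>k. y k \<oplus>\<^bsub>Y\<^esub> y' k) \<in> K" using y Yv G by (auto simp: K_def Yk_def Jl subset_iff)
    then show "v \<oplus>\<^bsub>?P\<^esub> w \<in> T ` K" using Tadd[of y y'] y by (metis (no_types, lifting) K_def imageI mem_Collect_eq)
  next
    fix c v assume "v \<in> T ` K"
    then obtain y where y: "y \<in> K" "v = T y" by auto
    have "(\<lambda>k. c \<odot>\<^bsub>Y\<^esub> y k) \<in> K" using y Yv G by (auto simp: K_def Yk_def Jl subset_iff)
    then show "c \<odot>\<^bsub>?P\<^esub> v \<in> T ` K" using Tsm[of y c] y by (metis (no_types, lifting) K_def imageI mem_Collect_eq)
  qed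
  \<comment> \<open>Coefficients that reproduce Q exactly at finitely many points always exist, but
    without any bound; the bound is gained by varying them within \<open>K\<close>.\<close>
  have interp: "\<exists>y\<in>Yk. \<forall>k<m. \<forall>g\<in>set G'. J g (y k) = f k (Q g)" if G': "set G' \<subseteq> carrier Z" for G'
  proof -
    have "\<exists>y\<in>carrier Y. \<forall>g\<in>set G'. J g y = f k (Q g)" if k: "k < m" for k
    proof (rule interpolation[OF Zv Yv _ _ _ _ G'])
      fix z assume z: "z \<in> carrier Z"
      have "(\<lambda>y. if y \<in> carrier Y then J z y else 0) = J z" using lin_formsD(2)[OF D(4)[OF z]] by auto
      then show "(\<lambda>y. if y \<in> carrier Y then J z y else 0) \<in> lin_forms Y" using D(4)[OF z] by simp
    qed (use D is_lin_comp[OF Q(1) lin_formsD(1)[OF fH[OF k]]] in auto)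
    then have "\<forall>k. \<exists>y. y \<in> carrier Y \<and> (k < m \<longrightarrow> (\<forall>g\<in>set G'. J g y = f k (Q g)))"
      using vs_zero[OF Yv] by blast
    then obtain y where "\<And>k. y k \<in> carrier Y \<and> (k < m \<longrightarrow> (\<forall>g\<in>set G'. J g (y k) = f k (Q g)))" by metis
    then show ?thesis by (intro bexI[of _ y]) (auto simp: Yk_def)
  qed
  obtain y0 where y0: "y0 \<in> Yk" "\<forall>k<m. \<forall>g\<in>set G. J g (y0 k) = f k (Q g)" using interp[OF G] by blast
  let ?d = "sdist ?P (nrm ?P) (T ` K)"
  note ds = seminorm_sdist[OF Pv Ps S]
  obtain F where F: "F \<in> lin_forms ?P" "F (T y0) = of_real (?d (T y0))" "\<And>w. w \<in> carrier ?P \<Longrightarrow> norm (F w) \<le> ?d w"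
    using hahn_banach_norming[OF Pv ds TP[OF y0(1)]] by blast
  have Fle: "norm (F w) \<le> nrm ?P w" if "w \<in> carrier ?P" for w
    using F(3)[OF that] sdist_le_self[OF Pv Ps S that] by simp
  define C where "C = (\<lambda>i y. if y \<in> carrier Y then F (\<lambda>j. if j = i then y else \<zero>\<^bsub>Y\<^esub>) else 0)"
  have comp: "\<And>i. i \<in> ?I \<Longrightarrow> C i \<in> carrier (dual Y)"
    "\<And>w. w \<in> carrier ?P \<Longrightarrow> F w = (\<Sum>i\<in>?I. C i (w i))"
    "(\<Sum>i\<in>?I. nrm (dual Y) (C i)) \<le> 1"
    unfolding C_def by (rule powsp_functional[OF Y I F(1) Fle]; assumption)+
  \<comment> \<open>The components of the functional F are functionals on Y, hence come from points
    of Z, at which Q can be evaluated.\<close>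
  have "\<forall>h\<in>?I. \<exists>z. z \<in> carrier Z \<and> J z = C h"
  proof
    fix h assume "h \<in> ?I"
    from D(8)[OF comp(1)[OF this]] show "\<exists>z. z \<in> carrier Z \<and> J z = C h" by blast
  qed
  then obtain z where z: "\<And>h. h \<in> ?I \<Longrightarrow> z h \<in> carrier Z \<and> J (z h) = C h" by metis
  \<comment> \<open>Interpolating at the additional points \<open>z h\<close> as well makes F
    computable at \<open>T y1\<close>. Both \<open>y0\<close> and \<open>y1\<close> interpolate on
    G, so they differ by an element of \<open>K\<close>, on whose image F vanishes because it is
    dominated by the distance.\<close>
  obtain y1 where y1: "y1 \<in> Yk" "\<forall>k<m. \<forall>g\<in>set (G @ map z hs). J g (y1 k) = f k (Q g)"
    using interp[of "G @ map z hs"] G z by auto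
  have "F (T y0) = F (T y1)"
  proof -
    let ?y = "\<lambda>k. (-1) \<odot>\<^bsub>Y\<^esub> y0 k"
    have y: "?y \<in> Yk" using y0(1) Yv by (auto simp: Yk_def)
    have "(\<lambda>k. y1 k \<oplus>\<^bsub>Y\<^esub> ?y k) \<in> K"
      using y0 y1 Yv G by (auto simp: K_def Yk_def Jl subset_iff)
    then have "F (T (\<lambda>k. y1 k \<oplus>\<^bsub>Y\<^esub> ?y k)) = 0"
      using F(3)[OF TP, of "\<lambda>k. y1 k \<oplus>\<^bsub>Y\<^esub> ?y k"] sdist_zero_on[OF Pv Ps S, of "T (\<lambda>k. y1 k \<oplus>\<^bsub>Y\<^esub> ?y k)"]
      by (simp add: K_def)
    moreover have "F (T (\<lambda>k. y1 k \<oplus>\<^bsub>Y\<^esub> ?y k)) = F (T y1) + F (T ?y)"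
      unfolding Tadd[OF y1(1) y] by (rule lin_formsD(3)[OF F(1) TP[OF y1(1)] TP[OF y]])
    moreover have "F (T ?y) = (-1) * F (T y0)"
      unfolding Tsm[OF y0(1)] by (rule lin_formsD(4)[OF F(1) TP[OF y0(1)]])
    ultimately show ?thesis by simp
  qed
  also have "F (T y1) = (\<Sum>h\<in>?I. h (Q (z h)))"
    unfolding comp(2)[OF TP[OF y1(1)]]
  proof (rule sum.cong[OF refl])
    fix h assume h: "h \<in> ?I"
    have Cl: "C h \<in> lin_forms Y" using dualD(1)[OF Yv Yh comp(1)[OF h]] .
    have hH: "h \<in> lin_forms H" using hs(1) h by auto
    have Qz: "Q (z h) \<in> carrier H" using z[OF h] is_linD(1)[OF Q(1)] by blast
    have mH: "snd ` set (map (\<lambda>k. (g k, B k)) [0..<m]) \<subseteq> carrier H" for g :: "nat \<Rightarrow> 'k" using BH by auto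
    have "C h (T y1 h) = (\<Sum>k<m. h (B k) * C h (y1 k))" by (rule fT[OF Cl y1(1) h])
    also have "\<dots> = (\<Sum>k<m. f k (Q (z h)) * h (B k))"
    proof (rule sum.cong[OF refl])
      fix k assume "k \<in> {..<m}"
      then have "J (z h) (y1 k) = f k (Q (z h))" using y1(2) h by simp
      then show "h (B k) * C h (y1 k) = f k (Q (z h)) * h (B k)" using z[OF h] by simp
    qed
    also have "\<dots> = h (lc H (map (\<lambda>k. (f k (Q (z h)), B k)) [0..<m]))"
      using lin_forms_lc[OF Hv hH mH]
      by (simp add: comp_def atLeast0LessThan interv_sum_list_conv_sum_set_nat)
    also have "\<dots> = h (Q (z h))" using coord[OF Qz] by simp
    finally show "C h (T y1 h) = h (Q (z h))" .
  qed
  \<comment> \<open>From here on Q enters only as a contraction; the dual norms of the components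
    add up to at most 1 because F is bounded by the maximum norm.\<close>
  finally have "norm (F (T y0)) \<le> (\<Sum>h\<in>?I. norm (h (Q (z h))))" by (simp add: norm_sum)
  also have "\<dots> \<le> (\<Sum>h\<in>?I. nrm (dual Y) (C h))"
  proof (rule sum_mono)
    fix h assume h: "h \<in> ?I"
    have "norm (h (Q (z h))) \<le> nrm H (Q (z h))" using hs(2)[OF h] z[OF h] is_linD(1)[OF Q(1)] by blast
    also have "\<dots> \<le> nrm Z (z h)" using Q(2) z[OF h] by blast
    also have "\<dots> = nrm (dual Y) (C h)" using D(5) z[OF h] by metis
    finally show "norm (h (Q (z h))) \<le> nrm (dual Y) (C h)" .
  qed
  also have "\<dots> \<le> 1" by (rule comp(3))
  finally have "?d (T y0) < 1 + \<delta>'"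
    using F(2) seminorm_nonneg[OF Pv ds TP[OF y0(1)]] \<delta>' by simp
  then obtain y' where y': "y' \<in> K" "nrm ?P (T y' \<oplus>\<^bsub>?P\<^esub> T y0) < 1 + \<delta>'"
    using sdist_less[OF Pv Ps S TP[OF y0(1)]] by blast
  define y where "y k = y' k \<oplus>\<^bsub>Y\<^esub> y0 k" for k
  have yK: "y \<in> Yk" using y'(1) y0(1) Yv by (auto simp: y_def K_def Yk_def)
  have Ty: "nrm Y (T y h) \<le> 1 + \<delta>'" if "h \<in> ?I" for h
  proof -
    have "T y = T y' \<oplus>\<^bsub>?P\<^esub> T y0" unfolding y_def using y'(1) y0(1) by (intro Tadd) (auto simp: K_def)
    then show ?thesis using nrm_powsp_ge[OF Y I that, of "T y"] y'(2) by simp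
  qed
  let ?yhs = "map (\<lambda>k. (y k, B k)) [0..<m]"
  have V: "lc H (map (\<lambda>(y, h). (J z y, h)) ?yhs) = lc H (map (\<lambda>k. (J z (y k), B k)) [0..<m])" for z
    by (simp add: comp_def)
  have mH: "snd ` set (map (\<lambda>k. (g k, B k)) [0..<m]) \<subseteq> carrier H" for g :: "nat \<Rightarrow> 'k" using BH by auto
  show thesis
  proof (rule that[of ?yhs])
    show "\<forall>(y, h)\<in>set ?yhs. y \<in> carrier Y \<and> h \<in> carrier H" using yK BH by (auto simp: Yk_def)
    fix g assume g: "g \<in> set G"
    have "J g (y k) = f k (Q g)" if "k < m" for k
    proof -
      have "g \<in> carrier Z" "y' k \<in> carrier Y" "y0 k \<in> carrier Y" using g G y'(1) y0(1) by (auto simp: K_def Yk_def)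
      then show ?thesis using g that y'(1) y0(2) by (simp add: y_def Jl K_def)
    qed
    then have eq: "map (\<lambda>k. (J g (y k), B k)) [0..<m] = map (\<lambda>k. (f k (Q g), B k)) [0..<m]" by simp
    show "lc H (map (\<lambda>(y, h). (J g y, h)) ?yhs) = Q g"
      unfolding V eq using coord[OF is_linD(1)[OF Q(1), of g]] g G by auto
  next
    fix z assume z: "z \<in> carrier Z"
    let ?v = "lc H (map (\<lambda>k. (J z (y k), B k)) [0..<m])"
    have v: "?v \<in> carrier H" by (rule lc_carrier[OF Hv mH])
    obtain h where h: "h \<in> ?I" "nrm H ?v \<le> (1 + \<delta>') * norm (h ?v)" using hs(3)[OF v] by blast
    have hH: "h \<in> lin_forms H" using hs(1) h by auto
    have "h ?v = (\<Sum>k<m. h (B k) * J z (y k))"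
      using lin_forms_lc[OF Hv hH mH]
      by (simp add: comp_def atLeast0LessThan interv_sum_list_conv_sum_set_nat mult.commute)
    also have "\<dots> = J z (T y h)" by (rule fT[OF D(4)[OF z] yK h(1), symmetric])
    finally have "norm (h ?v) \<le> nrm Z z * nrm Y (T y h)" using D(6)[OF z TY[OF yK]] by simp
    also have "\<dots> \<le> nrm Z z * (1 + \<delta>')" using Ty[OF h(1)] normed_spaceD(2)[OF D(2) z] by (intro mult_left_mono)
    finally have "(1 + \<delta>') * norm (h ?v) \<le> (1 + \<delta>') * (nrm Z z * (1 + \<delta>'))" using \<delta>' by (intro mult_left_mono) auto
    also have "\<dots> = (1 + \<delta>) * nrm Z z" using \<delta>'(2) by (metis mult.assoc mult.commute)
    finally show "nrm H (lc H (map (\<lambda>(y, h). (J z y, h)) ?yhs)) \<le> (1 + \<delta>) * nrm Z z"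
      using h(2) unfolding V by simp
  qed
qed

section \<open>Tensor products\<close>

definition tsum :: "('d \<Rightarrow> 'k::real_or_complex) set \<Rightarrow> ('k \<times> 'd) list \<Rightarrow> ('d \<Rightarrow> 'k) \<Rightarrow> 'k" where
  "tsum M cds = (\<lambda>\<phi>. \<Sum>(c, d)\<leftarrow>cds. c * elem_tensor M d \<phi>)"

lemma tsum_apply: "tsum M cds \<phi> = (if \<phi> \<in> M then \<Sum>(c, d)\<leftarrow>cds. c * \<phi> d else 0)"
  by (induction cds) (auto simp: tsum_def elem_tensor_def)

lemma carrier_tens: "u \<in> carrier (tens D M N) \<longleftrightarrow> (\<exists>cds. snd ` set cds \<subseteq> D \<and> u = tsum M cds)"
  by (auto simp: tens_def tsum_def)

lemma tens_simps [simp]: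
  "\<zero>\<^bsub>tens D M N\<^esub> = (\<lambda>_. 0)" "u \<oplus>\<^bsub>tens D M N\<^esub> v = (\<lambda>\<phi>. u \<phi> + v \<phi>)" "c \<odot>\<^bsub>tens D M N\<^esub> u = (\<lambda>\<phi>. c * u \<phi>)"
  "nrm (tens D M N) = N"
  by (auto simp: tens_def)

lemma tsum_carrier [simp]: "snd ` set cds \<subseteq> D \<Longrightarrow> tsum M cds \<in> carrier (tens D M N)"
  unfolding carrier_tens by blast

lemma elem_tensor_eq_tsum: "elem_tensor M d = tsum M [(1, d)]"
  by (auto simp: tsum_def)

lemma elem_tensor_carrier [simp]: "d \<in> D \<Longrightarrow> elem_tensor M d \<in> carrier (tens D M N)"
  unfolding elem_tensor_eq_tsum by (rule tsum_carrier) auto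

lemma tens_closed:
  assumes "u \<in> carrier (tens D M N)" "v \<in> carrier (tens D M N)"
  shows "(\<lambda>\<phi>. u \<phi> + v \<phi>) \<in> carrier (tens D M N)" "(\<lambda>\<phi>. c * u \<phi>) \<in> carrier (tens D M N)"
proof -
  obtain cds eds where *: "snd ` set cds \<subseteq> D" "u = tsum M cds" "snd ` set eds \<subseteq> D" "v = tsum M eds"
    using assms by (auto simp: carrier_tens)
  have "(\<lambda>\<phi>. u \<phi> + v \<phi>) = tsum M (cds @ eds)" by (auto simp: * tsum_def)
  then show "(\<lambda>\<phi>. u \<phi> + v \<phi>) \<in> carrier (tens D M N)"
    using * by (simp only:) (rule tsum_carrier, auto)
  have "(\<lambda>\<phi>. c * u \<phi>) = tsum M (map (\<lambda>(e, d). (c * e, d)) cds)"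
    by (auto simp: * tsum_def comp_def case_prod_unfold sum_list_const_mult mult.assoc)
  then show "(\<lambda>\<phi>. c * u \<phi>) \<in> carrier (tens D M N)"
    using * by (simp only:) (rule tsum_carrier, auto)
qed

lemma vs_tens [simp]: "vs (tens D M N)"
  unfolding tens_def
  by (rule vs_fun_space_scalar)
    (use tens_closed[of _ D M N] tsum_carrier[of "[]" D M N] in \<open>auto simp: tens_def tsum_def\<close>)

lemma tens_norm_irrelevant:
  "carrier (tens D M N) = carrier (tens D M N')" "is_lin (tens D M N) W f = is_lin (tens D M N') W f"
  "is_lin V (tens D M N) g = is_lin V (tens D M N') g"
  by (auto simp: tens_def is_lin_def)

lemma tsum_Nil: "tsum M [] = (\<lambda>_. 0)"
  and tsum_Cons: "tsum M (cd # cds) = (\<lambda>\<phi>. fst cd * elem_tensor M (snd cd) \<phi> + tsum M cds \<phi>)"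
  by (simp_all add: tsum_def case_prod_unfold)

lemma tsum_lc: "tsum M cds = lc (tens D M N) (map (\<lambda>(c, d). (c, elem_tensor M d)) cds)"
  by (induction cds) (auto simp: tsum_Nil tsum_Cons case_prod_unfold)

lemma lin_tsum:
  assumes "vs W" "is_lin (tens D M N) W L" "snd ` set cds \<subseteq> D"
  shows "L (tsum M cds) = lc W (map (\<lambda>(c, d). (c, L (elem_tensor M d))) cds)"
  unfolding tsum_lc[of M cds D N]
  by (subst is_lin_lc[OF vs_tens assms(1,2)]) (use assms(3) in \<open>auto simp: comp_def case_prod_unfold\<close>)

text \<open>\<open>linearize\<close> is a choice, but linear maps that agree on decomposable tensors
  agree on their span. Exhibiting one suitable \<open>L\<close> therefore determines its values
  there.\<close>

lemma linearize_eq: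
  assumes W: "vs W" and L: "is_lin (tens D M N) W L" "\<And>d. d \<in> D \<Longrightarrow> L (elem_tensor M d) = T d"
    and u: "u \<in> carrier (tens D M N')"
  shows "linearize D M W T u = L u"
proof -
  define L' where "L' = linearize D M W T"
  have "is_lin (tens D M (\<lambda>_. 0)) W L' \<and> (\<forall>d\<in>D. L' (elem_tensor M d) = T d)"
    unfolding L'_def linearize_def
    by (rule someI[of _ L]) (use L tens_norm_irrelevant(2)[of D M N W L "\<lambda>_. 0"] in auto)
  then have L': "is_lin (tens D M N) W L'" "\<And>d. d \<in> D \<Longrightarrow> L' (elem_tensor M d) = T d"
    using tens_norm_irrelevant(2)[of D M N W L' "\<lambda>_. 0"] by auto
  obtain cds where cds: "snd ` set cds \<subseteq> D" "u = tsum M cds" using u by (auto simp: carrier_tens)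
  have "map (\<lambda>(c, d). (c, L' (elem_tensor M d))) cds = map (\<lambda>(c, d). (c, L (elem_tensor M d))) cds"
    using cds L(2) L'(2) by (intro map_cong) auto
  then show ?thesis
    unfolding L'_def[symmetric] cds(2) lin_tsum[OF W L'(1) cds(1)] lin_tsum[OF W L(1) cds(1)]
    by (rule arg_cong)
qed

lemma is_lin_apply: "\<phi> \<in> M \<Longrightarrow> is_lin (tens D M N) scalar_space (\<lambda>u. u \<phi>)"
  by (auto simp: is_lin_def)

text \<open>Tensors are realised as functionals on forms, so linearizing a scalar form is evaluation
  at it. The form \<phi> has to agree with \<open>T\<close> on D only, so it may be the version of
  \<open>T\<close> cut off outside D.\<close>

lemma linearize_scalar:
  assumes "\<phi> \<in> M" "\<And>d. d \<in> D \<Longrightarrow> \<phi> d = T d" "u \<in> carrier (tens D M N)"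
  shows "linearize D M scalar_space T u = u \<phi>"
  by (rule linearize_eq[OF vs_scalar_space is_lin_apply _ assms(3)]) (use assms in \<open>auto simp: elem_tensor_def\<close>)

text \<open>Existence of the linearization. Two representations of one tensor yield vectors with the
  same image under every linear form l, because l composed with \<open>T\<close> agrees on D with a
  member of \<open>M\<close>; separation then gives equality.\<close>

lemma linearize_separated:
  assumes W: "vs W" "separated W" and T: "\<And>d. d \<in> D \<Longrightarrow> T d \<in> carrier W"
    and compat: "\<And>l. l \<in> lin_forms W \<Longrightarrow> \<exists>\<phi>\<in>M. \<forall>d\<in>D. \<phi> d = l (T d)"
  shows "is_lin (tens D M N) W (linearize D M W T)"
    and "\<And>d. d \<in> D \<Longrightarrow> linearize D M W T (elem_tensor M d) = T d"
proof -
  let ?lc = "\<lambda>cds. lc W (map (\<lambda>(c, d). (c, T d)) cds)"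
  have mem: "snd ` set (map (\<lambda>(c, d). (c, T d)) cds) \<subseteq> carrier W" if "snd ` set cds \<subseteq> D" for cds
    using that T by auto
  have wd: "?lc cds = ?lc eds" if cd: "snd ` set cds \<subseteq> D" and ed: "snd ` set eds \<subseteq> D" and eq: "tsum M cds = tsum M eds" for cds eds
  proof (rule separated_eqI[OF W])
    fix l assume l: "l \<in> lin_forms W"
    obtain \<phi> where \<phi>: "\<phi> \<in> M" "\<forall>d\<in>D. \<phi> d = l (T d)" using compat[OF l] by blast
    have *: "l (?lc cds) = tsum M cds \<phi>" if "snd ` set cds \<subseteq> D" for cds
    proof -
      have "l (?lc cds) = (\<Sum>(c, d)\<leftarrow>cds. c * l (T d))"
        using lin_forms_lc[OF W(1) l mem[OF that]] by (simp add: comp_def case_prod_unfold)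
      also have "\<dots> = (\<Sum>(c, d)\<leftarrow>cds. c * \<phi> d)"
        by (rule arg_cong[where f = sum_list], rule map_cong[OF refl]) (use \<phi> that in auto)
      finally show ?thesis using \<phi> by (simp add: tsum_apply)
    qed
    show "l (?lc cds) = l (?lc eds)" unfolding *[OF cd] *[OF ed] eq ..
  qed (use W lc_carrier[OF W(1) mem] cd ed in auto)
  define L where "L u = ?lc (SOME cds. snd ` set cds \<subseteq> D \<and> u = tsum M cds)" for u
  have L: "L (tsum M cds) = ?lc cds" if "snd ` set cds \<subseteq> D" for cds
  proof -
    define eds where "eds = (SOME eds. snd ` set eds \<subseteq> D \<and> tsum M cds = tsum M eds)"
    have "snd ` set eds \<subseteq> D \<and> tsum M cds = tsum M eds"
      unfolding eds_def by (rule someI[of _ cds]) (use that in simp)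
    moreover have "L (tsum M cds) = ?lc eds" by (simp only: L_def eds_def)
    ultimately show ?thesis using wd[of eds cds] that by simp
  qed
  have lin: "is_lin (tens D M N) W L" for N
    unfolding is_lin_def
  proof (intro conjI Pi_I ballI allI)
    fix u assume "u \<in> carrier (tens D M N)"
    then obtain cds where c: "snd ` set cds \<subseteq> D" "u = tsum M cds" by (auto simp: carrier_tens)
    then show "L u \<in> carrier W" using L lc_carrier[OF W(1) mem] by simp
    { fix a
      have "a \<odot>\<^bsub>tens D M N\<^esub> u = tsum M (map (\<lambda>(e, d). (a * e, d)) cds)"
        using c by (auto simp: tsum_def comp_def case_prod_unfold sum_list_const_mult mult.assoc)
      moreover have "snd ` set (map (\<lambda>(e, d). (a * e, d)) cds) \<subseteq> D" using c by auto
      ultimately have "L (a \<odot>\<^bsub>tens D M N\<^esub> u) = ?lc (map (\<lambda>(e, d). (a * e, d)) cds)" using L by simp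
      also have "\<dots> = a \<odot>\<^bsub>W\<^esub> ?lc cds"
        using lc_smult[OF W(1) mem[OF c(1)], of a] by (simp add: comp_def case_prod_unfold)
      finally show "L (a \<odot>\<^bsub>tens D M N\<^esub> u) = a \<odot>\<^bsub>W\<^esub> L u" using L c by simp }
    fix v assume "v \<in> carrier (tens D M N)"
    then obtain eds where e: "snd ` set eds \<subseteq> D" "v = tsum M eds" by (auto simp: carrier_tens)
    have "u \<oplus>\<^bsub>tens D M N\<^esub> v = tsum M (cds @ eds)" using c e by (auto simp: tsum_def)
    moreover have "snd ` set (cds @ eds) \<subseteq> D" using c e by auto
    ultimately have "L (u \<oplus>\<^bsub>tens D M N\<^esub> v) = ?lc (cds @ eds)" using L by simp
    also have "\<dots> = ?lc cds \<oplus>\<^bsub>W\<^esub> ?lc eds"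
      using lc_append[OF W(1) mem[OF c(1)] mem[OF e(1)]] by simp
    finally show "L (u \<oplus>\<^bsub>tens D M N\<^esub> v) = L u \<oplus>\<^bsub>W\<^esub> L v" using L c e by simp
  qed
  have Le: "L (elem_tensor M d) = T d" if "d \<in> D" for d
    using L[of "[(1, d)]"] that T[OF that] W by (simp add: elem_tensor_eq_tsum)
  have "is_lin (tens D M (\<lambda>_. 0)) W (linearize D M W T) \<and> (\<forall>d\<in>D. linearize D M W T (elem_tensor M d) = T d)"
    unfolding linearize_def by (rule someI[of _ L]) (use lin Le in auto)
  then show "is_lin (tens D M N) W (linearize D M W T)"
    "\<And>d. d \<in> D \<Longrightarrow> linearize D M W T (elem_tensor M d) = T d"
    using tens_norm_irrelevant(2)[of D M N W _ "\<lambda>_. 0"] by auto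
qed

text \<open>The inclusion of tensor products is dual to the restriction of forms, and an evaluation
  at a point of D is the same before and after restriction.\<close>

lemma linearize_incl:
  assumes D: "D \<subseteq> D'" and r: "\<forall>\<psi>\<in>M'. (\<lambda>d. if d \<in> D then \<psi> d else 0) \<in> M"
  defines "incl \<equiv> \<lambda>u \<psi>. if \<psi> \<in> M' then u (\<lambda>d. if d \<in> D then \<psi> d else 0) else 0"
  shows "\<And>cds. snd ` set cds \<subseteq> D \<Longrightarrow> incl (tsum M cds) = tsum M' cds"
    and "is_lin (tens D M N) (tens D' M' N') incl"
    and "\<And>u. u \<in> carrier (tens D M N) \<Longrightarrow> linearize D M (tens D' M' N') (elem_tensor M') u = incl u"
proof -
  show ts: "incl (tsum M cds) = tsum M' cds" if "snd ` set cds \<subseteq> D" for cds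
  proof
    fix \<psi>
    have "(\<Sum>(c, d)\<leftarrow>cds. c * (if d \<in> D then \<psi> d else 0)) = (\<Sum>(c, d)\<leftarrow>cds. c * \<psi> d)"
      by (rule arg_cong[where f = sum_list], rule map_cong[OF refl]) (use that in auto)
    then show "incl (tsum M cds) \<psi> = tsum M' cds \<psi>"
      using r by (auto simp: incl_def tsum_apply)
  qed
  show lin: "is_lin (tens D M N) (tens D' M' N') incl"
    unfolding is_lin_def
  proof (intro conjI Pi_I ballI allI)
    fix u assume "u \<in> carrier (tens D M N)"
    then obtain cds where c: "snd ` set cds \<subseteq> D" "u = tsum M cds" by (auto simp: carrier_tens)
    show "incl u \<in> carrier (tens D' M' N')" using ts[OF c(1)] c D by (simp only:) (rule tsum_carrier, auto)
  qed (auto simp: incl_def)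
  show "linearize D M (tens D' M' N') (elem_tensor M') u = incl u" if u: "u \<in> carrier (tens D M N)" for u
    by (rule linearize_eq[OF vs_tens lin _ u]) (use ts in \<open>auto simp: elem_tensor_eq_tsum\<close>)
qed

section \<open>Multilinear maps\<close>

lemma in_listset_iff: "x \<in> listset As \<longleftrightarrow> length x = length As \<and> (\<forall>i<length As. x ! i \<in> As ! i)"
proof (induction As arbitrary: x)
  case (Cons A As)
  show ?case
  proof (cases x)
    case (Cons a y)
    then show ?thesis using Cons.IH[of y] by (auto simp: set_Cons_def less_Suc_eq_0_disj)
  qed (auto simp: set_Cons_def)
qed auto

lemma in_tuples_iff: "x \<in> tuples Xs \<longleftrightarrow> length x = length Xs \<and> (\<forall>i<length Xs. x ! i \<in> carrier (Xs ! i))"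
  by (auto simp: tuples_def in_listset_iff)

lemma tuples_update: "x \<in> tuples Xs \<Longrightarrow> i < length Xs \<Longrightarrow> a \<in> carrier (Xs ! i) \<Longrightarrow> x[i := a] \<in> tuples Xs"
  by (auto simp: in_tuples_iff nth_list_update)

lemma ml_mapsD:
  assumes "T \<in> ml_maps Xs W"
  shows "x \<in> tuples Xs \<Longrightarrow> T x \<in> carrier W" "x \<notin> tuples Xs \<Longrightarrow> T x = \<zero>\<^bsub>W\<^esub>"
    "x \<in> tuples Xs \<Longrightarrow> i < length Xs \<Longrightarrow> is_lin (Xs ! i) W (\<lambda>a. T (x[i := a]))"
    "x \<in> tuples Xs \<Longrightarrow> i < length Xs \<Longrightarrow> a \<in> carrier (Xs ! i) \<Longrightarrow> a' \<in> carrier (Xs ! i) \<Longrightarrow>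
      T (x[i := a \<oplus>\<^bsub>Xs ! i\<^esub> a']) = T (x[i := a]) \<oplus>\<^bsub>W\<^esub> T (x[i := a'])"
    "x \<in> tuples Xs \<Longrightarrow> i < length Xs \<Longrightarrow> a \<in> carrier (Xs ! i) \<Longrightarrow> T (x[i := c \<odot>\<^bsub>Xs ! i\<^esub> a]) = c \<odot>\<^bsub>W\<^esub> T (x[i := a])"
  using assms by (auto simp: ml_maps_def is_lin_def)

lemma ml_mapsI:
  assumes "\<And>x. x \<in> tuples Xs \<Longrightarrow> T x \<in> carrier W" "\<And>x. x \<notin> tuples Xs \<Longrightarrow> T x = \<zero>\<^bsub>W\<^esub>"
    "\<And>x i. x \<in> tuples Xs \<Longrightarrow> i < length Xs \<Longrightarrow> is_lin (Xs ! i) W (\<lambda>a. T (x[i := a]))"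
  shows "T \<in> ml_maps Xs W"
  using assms by (auto simp: ml_maps_def)

lemma ml_maps_comp:
  assumes Xs: "\<forall>X\<in>set Xs. vs X" and T: "T \<in> ml_maps Xs W" and S: "is_lin W W' S"
  shows "(\<lambda>x. if x \<in> tuples Xs then S (T x) else \<zero>\<^bsub>W'\<^esub>) \<in> ml_maps Xs W'"
proof (rule ml_mapsI)
  fix x i assume x: "x \<in> tuples Xs" and i: "i < length Xs"
  have "is_lin (Xs ! i) W' (\<lambda>a. S (T (x[i := a])))"
    using is_lin_comp[OF ml_mapsD(3)[OF T x i] S] .
  then show "is_lin (Xs ! i) W' (\<lambda>a. if x[i := a] \<in> tuples Xs then S (T (x[i := a])) else \<zero>\<^bsub>W'\<^esub>)"
    using tuples_update[OF x i] by (subst is_lin_cong[OF Xs[THEN bspec, OF nth_mem[OF i]]]) auto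
qed (use ml_mapsD(1)[OF T] is_linD(1)[OF S] in auto)

lemma ml_maps_comp_form:
  assumes Xs: "\<forall>X\<in>set Xs. vs X" and W: "vs W" and T: "T \<in> ml_maps Xs W" and l: "l \<in> lin_forms W"
  shows "(\<lambda>x. l (T x)) \<in> forms Xs"
proof -
  have "(\<lambda>x. l (T x)) = (\<lambda>x. if x \<in> tuples Xs then l (T x) else \<zero>\<^bsub>scalar_space\<^esub>)"
    using ml_mapsD(2)[OF T] lin_forms_zero[OF W l] by (auto simp: fun_eq_iff)
  then show ?thesis using ml_maps_comp[OF Xs T lin_formsD(1)[OF l]] by simp
qed

lemma tuple_zero:
  assumes "\<forall>X\<in>set Xs. vs X"
  shows "map zero Xs \<in> tuples Xs"
  using assms by (auto simp: in_tuples_iff)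

lemma ml_maps_zero_coord:
  assumes Xs: "\<forall>X\<in>set Xs. vs X" and W: "vs W" and T: "T \<in> ml_maps Xs W" and x: "x \<in> tuples Xs"
    and i: "i < length Xs" "x ! i = \<zero>\<^bsub>Xs ! i\<^esub>"
  shows "T x = \<zero>\<^bsub>W\<^esub>"
proof -
  have "T (x[i := \<zero>\<^bsub>Xs ! i\<^esub>]) = \<zero>\<^bsub>W\<^esub>"
    using is_lin_zero[OF Xs[THEN bspec, OF nth_mem[OF i(1)]] W ml_mapsD(3)[OF T x i(1)]] .
  then show ?thesis using i by (metis list_update_id)
qed

text \<open>\<open>f_of\<close> picks some tuple representing the tensor. Equal decomposable tensors
  agree on all forms, in particular on the forms l composed with \<open>T\<close>, and these
  separate the values.\<close>

lemma f_of_otimes: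
  assumes Xs: "\<forall>X\<in>set Xs. vs X" and W: "vs W" "separated W" and T: "T \<in> ml_maps Xs W" and x: "x \<in> tuples Xs"
  shows "f_of Xs T (otimes Xs x) = T x"
proof -
  define z where "z = (SOME z. z \<in> tuples Xs \<and> otimes Xs z = otimes Xs x)"
  have z: "z \<in> tuples Xs \<and> otimes Xs z = otimes Xs x"
    unfolding z_def by (rule someI[of _ x]) (use x in simp)
  have "T z = T x"
  proof (rule separated_eqI[OF W])
    fix l assume "l \<in> lin_forms W"
    then have f: "(\<lambda>x. l (T x)) \<in> forms Xs" by (rule ml_maps_comp_form[OF Xs W(1) T])
    have "otimes Xs z (\<lambda>x. l (T x)) = otimes Xs x (\<lambda>x. l (T x))" using z by simp
    then show "l (T z) = l (T x)" using f by (simp add: elem_tensor_def)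
  qed (use ml_mapsD(1)[OF T] z x in auto)
  then show ?thesis by (simp add: f_of_def z_def)
qed

lemma otimes_ml_maps:
  assumes Xs: "\<forall>X\<in>set Xs. vs X"
  shows "otimes Xs \<in> ml_maps Xs (tensor Xs N)"
proof (rule ml_mapsI)
  fix x assume "x \<notin> tuples Xs"
  then show "otimes Xs x = \<zero>\<^bsub>tensor Xs N\<^esub>" using ml_mapsD(2) by (force simp: elem_tensor_def)
next
  fix x i assume x: "x \<in> tuples Xs" and i: "i < length Xs"
  show "is_lin (Xs ! i) (tensor Xs N) (\<lambda>a. otimes Xs (x[i := a]))"
    unfolding is_lin_def
  proof (intro conjI Pi_I)
    fix a assume "a \<in> carrier (Xs ! i)"
    then show "otimes Xs (x[i := a]) \<in> carrier (tensor Xs N)" using tuples_update[OF x i] by simp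
  qed (use ml_mapsD(4,5)[OF _ x i, where W = scalar_space] in \<open>auto simp: elem_tensor_def fun_eq_iff\<close>)
qed simp

text \<open>A multilinear map is determined on tuples of generators. In the induction the first k
  coordinates are already arbitrary and the others are still generators; each step replaces one
  coordinate by linearity.\<close>

lemma ml_maps_eq_zero:
  assumes Xs: "\<forall>X\<in>set Xs. vs X" and W: "vs W" and T: "T \<in> ml_maps Xs W"
    and B: "\<And>i. i < length Xs \<Longrightarrow> lspan (Xs ! i) (B i) = carrier (Xs ! i)"
      "\<And>i. i < length Xs \<Longrightarrow> B i \<subseteq> carrier (Xs ! i)"
    and zB: "\<And>x. x \<in> tuples Xs \<Longrightarrow> (\<forall>i<length Xs. x ! i \<in> B i) \<Longrightarrow> T x = \<zero>\<^bsub>W\<^esub>" and x: "x \<in> tuples Xs"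
  shows "T x = \<zero>\<^bsub>W\<^esub>"
proof -
  have "\<forall>x\<in>tuples Xs. (\<forall>i<length Xs. k \<le> i \<longrightarrow> x ! i \<in> B i) \<longrightarrow> T x = \<zero>\<^bsub>W\<^esub>" if "k \<le> length Xs" for k
    using that
  proof (induction k)
    case 0 then show ?case using zB by auto
  next
    case (Suc k)
    then have k: "k < length Xs" by simp
    show ?case
    proof (intro ballI impI)
      fix x assume x: "x \<in> tuples Xs" and xB: "\<forall>i<length Xs. Suc k \<le> i \<longrightarrow> x ! i \<in> B i"
      let ?S = "{a \<in> carrier (Xs ! k). T (x[k := a]) = \<zero>\<^bsub>W\<^esub>}"
      note Xk = Xs[THEN bspec, OF nth_mem[OF k]] and lin = ml_mapsD(3)[OF T x k]
      have "subsp (Xs ! k) ?S"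
        unfolding subsp_def using is_lin_zero[OF Xk W lin] is_linD[OF lin] Xk W by auto
      moreover have "B k \<subseteq> ?S"
      proof
        fix b assume b: "b \<in> B k"
        have bc: "b \<in> carrier (Xs ! k)" using b B(2)[OF k] by auto
        have "length x = length Xs" using x by (simp add: in_tuples_iff)
        then have "\<forall>i<length Xs. k \<le> i \<longrightarrow> x[k := b] ! i \<in> B i"
          using xB b k by (auto simp: nth_list_update)
        then have "T (x[k := b]) = \<zero>\<^bsub>W\<^esub>" using Suc.IH tuples_update[OF x k bc] k by simp
        then show "b \<in> ?S" using bc by simp
      qed
      ultimately have "carrier (Xs ! k) \<subseteq> ?S"
        using lspan_minimal[of "Xs ! k" ?S "B k"] unfolding B(1)[OF k] by blast
      moreover have "x ! k \<in> carrier (Xs ! k)" using x k by (simp add: in_tuples_iff)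
      ultimately show "T x = \<zero>\<^bsub>W\<^esub>" by auto
    qed
  qed
  from this[of "length Xs"] show ?thesis using x by auto
qed

lemma prod_update:
  assumes "i < (n::nat)"
  shows "(\<Prod>j<n. f j (x[i := a] ! j)) = (if i < length x then f i a else f i (x ! i)) * (\<Prod>j\<in>{..<n} - {i}. f j (x ! j))"
proof -
  have "(\<Prod>j\<in>{..<n} - {i}. f j (x[i := a] ! j)) = (\<Prod>j\<in>{..<n} - {i}. f j (x ! j))"
    by (rule prod.cong) auto
  then show ?thesis using assms prod.remove[of "{..<n}" i "\<lambda>j. f j (x[i := a] ! j)"]
    by (cases "i < length x") (auto simp: not_less list_update_beyond)
qed

lemma prod_form:
  assumes Xs: "\<forall>X\<in>set Xs. vs X" and f: "\<And>i. i < length Xs \<Longrightarrow> f i \<in> lin_forms (Xs ! i)"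
  shows "(\<lambda>x. if x \<in> tuples Xs then \<Prod>i<length Xs. f i (x ! i) else 0) \<in> forms Xs"
proof (rule ml_mapsI)
  fix x i assume x: "x \<in> tuples Xs" and i: "i < length Xs"
  have len: "i < length x" using x i by (simp add: in_tuples_iff)
  let ?r = "\<Prod>j\<in>{..<length Xs} - {i}. f j (x ! j)"
  have "is_lin (Xs ! i) scalar_space (\<lambda>a. f i a * ?r)"
    using lin_formsD(3,4)[OF f[OF i]] by (auto simp: is_lin_def algebra_simps)
  moreover have "(if x[i := a] \<in> tuples Xs then \<Prod>j<length Xs. f j (x[i := a] ! j) else 0) = f i a * ?r"
    if "a \<in> carrier (Xs ! i)" for a
    using prod_update[OF i, of f x a] len tuples_update[OF x i that] by simp
  ultimately show "is_lin (Xs ! i) scalar_space (\<lambda>a. if x[i := a] \<in> tuples Xs then \<Prod>j<length Xs. f j (x[i := a] ! j) else 0)"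
    by (subst is_lin_cong[OF Xs[THEN bspec, OF nth_mem[OF i]]]) auto
qed auto

lemma dual_zero: "normed_space V \<Longrightarrow> (\<lambda>_. 0) \<in> carrier (dual V) \<and> nrm (dual V) (\<lambda>_. 0) = 0"
  using normed_dual[of V] nrm_zero[of "dual V"] vs_zero[of "dual V"] by simp

text \<open>On finite dimensional spaces every multilinear map is a sum of maps of the form
  \<open>x \<mapsto> (\<Prod>i. f i (x ! i)) \<odot> w\<close>; the induction expands one variable after the other.\<close>

lemma ml_maps_generated:
  fixes Es :: "('k::real_or_complex, 'a) nspace list" and W :: "('k, 'b) nspace"
  assumes Es: "\<forall>E\<in>set Es. normed_space E \<and> fin_dim E" and W: "vs W"
    and C0: "(\<lambda>_. \<zero>\<^bsub>W\<^esub>) \<in> C" and Cadd: "\<And>S T. S \<in> C \<Longrightarrow> T \<in> C \<Longrightarrow> (\<lambda>x. S x \<oplus>\<^bsub>W\<^esub> T x) \<in> C"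
    and Cprod: "\<And>f w. (\<And>i. i < length Es \<Longrightarrow> f i \<in> carrier (dual (Es ! i))) \<Longrightarrow> w \<in> carrier W \<Longrightarrow>
      (\<lambda>x. if x \<in> tuples Es then (\<Prod>i<length Es. f i (x ! i)) \<odot>\<^bsub>W\<^esub> w else \<zero>\<^bsub>W\<^esub>) \<in> C"
    and T: "T \<in> ml_maps Es W"
  shows "T \<in> C"
proof -
  let ?n = "length Es"
  \<comment> \<open>Interpolates between \<open>T\<close> itself (k = 0) and a product map (k = the
    number of factors): the first k arguments of \<open>T\<close> are frozen at \<open>a\<close> and
    the variables freed in this way enter through the \<open>f i\<close>. The claim for k follows
    from the claim for k + 1 by expanding coordinate k in a basis, hence the descending
    induction.\<close>
  define P where "P k f a = (\<lambda>x. if x \<in> tuples Es then (\<Prod>i<k. f i (x ! i)) \<odot>\<^bsub>W\<^esub> T (take k a @ drop k x) else \<zero>\<^bsub>W\<^esub>)"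
    for k and f :: "nat \<Rightarrow> 'a \<Rightarrow> 'k" and a
  have Ev: "\<forall>E\<in>set Es. vs E" using Es by auto
  have mix: "take k a @ drop k x \<in> tuples Es" if "a \<in> tuples Es" "x \<in> tuples Es" "k \<le> ?n" for k a x
    using that by (auto simp: in_tuples_iff nth_append)
  have "\<forall>f. (\<forall>i<?n. f i \<in> carrier (dual (Es ! i))) \<longrightarrow> (\<forall>a\<in>tuples Es. P k f a \<in> C)" if "k \<le> ?n" for k
    using that
  proof (induction k rule: inc_induct)
    case base
    show ?case
    proof (intro allI impI ballI)
      fix f a assume f: "\<forall>i<?n. f i \<in> carrier (dual (Es ! i))" and a: "a \<in> tuples Es"
      have "P ?n f a = (\<lambda>x. if x \<in> tuples Es then (\<Prod>i<?n. f i (x ! i)) \<odot>\<^bsub>W\<^esub> T a else \<zero>\<^bsub>W\<^esub>)"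
        using a by (auto simp: P_def fun_eq_iff in_tuples_iff)
      then show "P ?n f a \<in> C" using Cprod[of f "T a"] f ml_mapsD(1)[OF T a] by simp
    qed
  next
    case (step k)
    show ?case
    proof (intro allI impI ballI)
      fix f a assume f: "\<forall>i<?n. f i \<in> carrier (dual (Es ! i))" and a: "a \<in> tuples Es"
      have k: "k < ?n" using step by simp
      have E: "normed_space (Es ! k)" "fin_dim (Es ! k)" using Es k by auto
      note Evk = normed_spaceD(1)[OF E(1)]
      obtain bfs where c: "coords (Es ! k) (carrier (Es ! k)) bfs" using fin_dim_coords[OF E] .
      note cD = coordsD[OF E(1) subsp_carrier[OF Evk] c]
      define R where "R bfs' = (\<lambda>x. if x \<in> tuples Es then (\<Prod>i<k. f i (x ! i)) \<odot>\<^bsub>W\<^esub>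
          lc W (map (\<lambda>(b, g). (g (x ! k), T ((take k a @ drop k x)[k := b]))) bfs') else \<zero>\<^bsub>W\<^esub>)" for bfs'
      have Tb: "T ((take k a @ drop k x)[k := b]) \<in> carrier W" if "x \<in> tuples Es" "(b, g) \<in> set bfs" for x b g
        using ml_mapsD(1)[OF T] tuples_update[OF mix[OF a that(1), of k] k cD(1)[OF that(2)]] k by simp
      have "R bfs' \<in> C" if "set bfs' \<subseteq> set bfs" for bfs'
        using that
      proof (induction bfs')
        case Nil
        have "R [] = (\<lambda>_. \<zero>\<^bsub>W\<^esub>)" using W by (auto simp: R_def)
        then show ?case using C0 by simp
      next
        case (Cons bg bfs')
        obtain b g where bg: "bg = (b, g)" by force
        have bgs: "(b, g) \<in> set bfs" using Cons.prems bg by auto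
        let ?f = "f(k := g)" and ?a = "a[k := b]"
        have "P (Suc k) ?f ?a \<in> C"
          using step.IH f cD(2)[OF bgs] tuples_update[OF a k cD(1)[OF bgs]] by auto
        moreover have "R (bg # bfs') = (\<lambda>x. P (Suc k) ?f ?a x \<oplus>\<^bsub>W\<^esub> R bfs' x)"
        proof
          fix x
          show "R (bg # bfs') x = P (Suc k) ?f ?a x \<oplus>\<^bsub>W\<^esub> R bfs' x"
          proof (cases "x \<in> tuples Es")
            case True
            have la: "length a = ?n" "length x = ?n" using a True by (auto simp: in_tuples_iff)
            have eq: "take (Suc k) ?a @ drop (Suc k) x = (take k a @ drop k x)[k := b]"
              using la k by (intro nth_equalityI) (auto simp: nth_append nth_list_update min_def)
            have "snd ` set (map (\<lambda>(b, g). (g (x ! k), T ((take k a @ drop k x)[k := b]))) bfs') \<subseteq> carrier W"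
              using Tb[OF True] Cons.prems by force
            then have l: "lc W (map (\<lambda>(b, g). (g (x ! k), T ((take k a @ drop k x)[k := b]))) bfs') \<in> carrier W"
              by (rule lc_carrier[OF W])
            have "(\<Prod>i<Suc k. ?f i (x ! i)) = (\<Prod>i<k. f i (x ! i)) * g (x ! k)" by simp
            then show ?thesis
              using True l Tb[OF True bgs] W unfolding R_def P_def eq
              by (simp add: bg vs_smult_right_distrib)
          qed (use W in \<open>simp add: R_def P_def\<close>)
        qed
        ultimately show ?case using Cadd Cons by simp
      qed
      then have "R bfs \<in> C" by simp
      also have "R bfs = P k f a"
      proof
        fix x
        show "R bfs x = P k f a x"
        proof (cases "x \<in> tuples Es")
          case True
          let ?y = "take k a @ drop k x"
          have y: "?y \<in> tuples Es" using mix[OF a True] k by simp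
          have la: "length a = ?n" "length x = ?n" using a True by (auto simp: in_tuples_iff)
          have xk: "x ! k \<in> carrier (Es ! k)" using True k by (simp add: in_tuples_iff)
          have yx: "?y[k := x ! k] = ?y"
            using la k by (intro nth_equalityI) (auto simp: nth_append nth_list_update)
          have "lc W (map (\<lambda>(b, g). (g (x ! k), T (?y[k := b]))) bfs) = T (?y[k := lc (Es ! k) (map (\<lambda>(b, g). (g (x ! k), b)) bfs)])"
            using is_lin_lc[OF Evk W ml_mapsD(3)[OF T y k] cD(4), of "\<lambda>g. g (x ! k)"] by (simp add: comp_def case_prod_unfold)
          then show ?thesis using True cD(5)[OF xk] yx by (simp add: R_def P_def)
        qed (simp add: R_def P_def)
      qed
      finally show "P k f a \<in> C" .
    qed
  qed
  from this[of 0] have *: "\<forall>f. (\<forall>i<?n. f i \<in> carrier (dual (Es ! i))) \<longrightarrow> (\<forall>a\<in>tuples Es. P 0 f a \<in> C)" by simp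
  have d0: "(\<lambda>_. 0) \<in> carrier (dual (Es ! i))" if "i < ?n" for i
    using dual_zero[of "Es ! i"] Es that by simp
  have "P 0 (\<lambda>_ _. 0) (map zero Es) \<in> C"
    using *[rule_format, of "\<lambda>_ _. 0", OF _ tuple_zero[OF Ev]] d0 by simp
  also have "P 0 (\<lambda>_ _. 0) (map zero Es) = T"
    using ml_mapsD(1,2)[OF T] W by (auto simp: P_def fun_eq_iff)
  finally show ?thesis .
qed

section \<open>Reasonable crossnorms\<close>

lemma electionD:
  assumes "election Xs Y \<beta>"
  shows "Xs \<noteq> []" "\<forall>X\<in>set Xs. normed_space X" "\<forall>X\<in>set Xs. vs X" "banach_space Y" "normed_space Y" "vs Y"
    "reasonable Xs \<beta>" "i < length Xs \<Longrightarrow> normed_space (Xs ! i)" "i < length Xs \<Longrightarrow> vs (Xs ! i)"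
    "\<forall>X\<in>set Xs. banach_space X"
  using assms by (auto simp: election_def banach_normed)

lemma prod_nrm_nonneg:
  "\<forall>X\<in>set Xs. normed_space X \<Longrightarrow> x \<in> tuples Xs \<Longrightarrow> 0 \<le> (\<Prod>i<length Xs. nrm (Xs ! i) (x ! i))"
  by (rule prod_nonneg) (auto simp: in_tuples_iff intro: normed_spaceD(2))

lemma sum_prod_nrm_nonneg:
  "\<forall>X\<in>set Xs. normed_space X \<Longrightarrow> set xs \<subseteq> tuples Xs \<Longrightarrow> 0 \<le> (\<Sum>x\<leftarrow>xs. \<Prod>i<length Xs. nrm (Xs ! i) (x ! i))"
  by (rule sum_list_nonneg) (auto simp: subset_iff intro: prod_nrm_nonneg)

lemma proj_norm_le:
  assumes "\<forall>X\<in>set Xs. normed_space X" "set xs \<subseteq> tuples Xs" "u = (\<lambda>\<phi>. \<Sum>x\<leftarrow>xs. otimes Xs x \<phi>)"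
  shows "proj_norm Xs u \<le> (\<Sum>x\<leftarrow>xs. \<Prod>i<length Xs. nrm (Xs ! i) (x ! i))"
  unfolding proj_norm_def
  by (rule cInf_lower) (use assms sum_prod_nrm_nonneg in \<open>auto intro!: bdd_belowI[of _ 0]\<close>)

lemma beta_otimes_le:
  assumes "election Xs Y \<beta>" "x \<in> tuples Xs"
  shows "\<beta> (otimes Xs x) \<le> (\<Prod>i<length Xs. nrm (Xs ! i) (x ! i))"
proof -
  have "\<beta> (otimes Xs x) \<le> proj_norm Xs (otimes Xs x)"
    using electionD(7)[OF assms(1)] elem_tensor_carrier[OF assms(2), of "forms Xs" \<beta>]
    unfolding reasonable_def by blast
  also have "\<dots> \<le> (\<Sum>x\<leftarrow>[x]. \<Prod>i<length Xs. nrm (Xs ! i) (x ! i))"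
    by (rule proj_norm_le[OF electionD(2)[OF assms(1)]]) (use assms(2) in auto)
  finally show ?thesis by simp
qed

lemma unit_dual_tuple:
  assumes "\<forall>X\<in>set Xs. normed_space X" "f \<in> listset (map (\<lambda>X. {g \<in> carrier (dual X). nrm (dual X) g \<le> 1}) Xs)" "i < length Xs"
  shows "f ! i \<in> carrier (dual (Xs ! i))" "f ! i \<in> lin_forms (Xs ! i)"
    "a \<in> carrier (Xs ! i) \<Longrightarrow> norm ((f ! i) a) \<le> nrm (Xs ! i) a"
proof -
  have X: "normed_space (Xs ! i)" using assms by auto
  have f: "f ! i \<in> carrier (dual (Xs ! i))" "nrm (dual (Xs ! i)) (f ! i) \<le> 1"
    using assms(2,3) by (auto simp: in_listset_iff)
  note D = dualD[OF normed_spaceD(1)[OF X] homog_normed[OF X] f(1)]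
  show "f ! i \<in> carrier (dual (Xs ! i))" "f ! i \<in> lin_forms (Xs ! i)" using f D by auto
  assume a: "a \<in> carrier (Xs ! i)"
  have "nrm (dual (Xs ! i)) (f ! i) * nrm (Xs ! i) a \<le> 1 * nrm (Xs ! i) a"
    using f(2) normed_spaceD(2)[OF X a] by (intro mult_right_mono)
  then show "norm ((f ! i) a) \<le> nrm (Xs ! i) a" using D(2)[OF a] by simp
qed

lemma norm_sum_list_le: "norm (\<Sum>x\<leftarrow>xs. f x) \<le> (\<Sum>x\<leftarrow>xs. norm (f x))"
  by (induction xs) (auto intro: order_trans[OF norm_triangle_ineq])

lemma unit_prod_form_eq:
  assumes Xs: "\<forall>X\<in>set Xs. normed_space X" and u: "u \<in> carrier (tensor Xs N)"
    and f: "f \<in> listset (map (\<lambda>X. {g \<in> carrier (dual X). nrm (dual X) g \<le> 1}) Xs)"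
  shows "lin_ext Xs scalar_space (\<lambda>x. \<Prod>i<length Xs. (f ! i) (x ! i)) u
    = u (\<lambda>x. if x \<in> tuples Xs then \<Prod>i<length Xs. (f ! i) (x ! i) else 0)"
  by (rule linearize_scalar[OF prod_form _ u]) (use Xs unit_dual_tuple(2)[OF Xs f] in auto)

text \<open>The supremum in \<open>inj_norm\<close> is taken in the reals, so it yields upper bounds
  only together with this fact. Any one representation of u provides a bound.\<close>

lemma inj_norm_bdd:
  assumes Xs: "\<forall>X\<in>set Xs. normed_space X" and u: "u \<in> carrier (tensor Xs N)"
  shows "bdd_above ((\<lambda>f. norm (lin_ext Xs scalar_space (\<lambda>x. \<Prod>i<length Xs. (f ! i) (x ! i)) u)) `
    listset (map (\<lambda>X. {g \<in> carrier (dual X). nrm (dual X) g \<le> 1}) Xs))"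
proof -
  obtain cds where cds: "snd ` set cds \<subseteq> tuples Xs" "u = tsum (forms Xs) cds" using u by (auto simp: carrier_tens)
  have "norm (lin_ext Xs scalar_space (\<lambda>x. \<Prod>i<length Xs. (f ! i) (x ! i)) u)
      \<le> (\<Sum>(c, x)\<leftarrow>cds. norm c * (\<Prod>i<length Xs. nrm (Xs ! i) (x ! i)))"
    if f: "f \<in> listset (map (\<lambda>X. {g \<in> carrier (dual X). nrm (dual X) g \<le> 1}) Xs)" for f
  proof -
    let ?p = "\<lambda>x. if x \<in> tuples Xs then \<Prod>i<length Xs. (f ! i) (x ! i) else 0"
    have "?p \<in> forms Xs" by (rule prod_form) (use Xs unit_dual_tuple(2)[OF Xs f] in auto)
    then have "norm (u ?p) = norm (\<Sum>(c, x)\<leftarrow>cds. c * ?p x)" by (simp add: cds(2) tsum_apply)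
    also have "\<dots> \<le> (\<Sum>(c, x)\<leftarrow>cds. norm (c * ?p x))"
      using norm_sum_list_le[of "\<lambda>(c, x). c * ?p x" cds] by (simp add: case_prod_unfold)
    also have "\<dots> \<le> (\<Sum>(c, x)\<leftarrow>cds. norm c * (\<Prod>i<length Xs. nrm (Xs ! i) (x ! i)))"
    proof (rule sum_list_mono)
      fix cx assume "cx \<in> set cds"
      then have x: "snd cx \<in> tuples Xs" using cds by auto
      have "norm (?p (snd cx)) \<le> (\<Prod>i<length Xs. nrm (Xs ! i) (snd cx ! i))"
        using x unit_dual_tuple(3)[OF Xs f] by (auto simp: in_tuples_iff simp flip: prod_norm intro!: prod_mono)
      then show "(case cx of (c, x) \<Rightarrow> norm (c * ?p x)) \<le> (case cx of (c, x) \<Rightarrow> norm c * (\<Prod>i<length Xs. nrm (Xs ! i) (x ! i)))"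
        by (simp add: case_prod_unfold norm_mult mult_left_mono)
    qed
    finally show ?thesis using unit_prod_form_eq[OF Xs u f] by simp
  qed
  then show ?thesis by (intro bdd_aboveI2) blast
qed

lemma inj_norm_ge:
  assumes Xs: "\<forall>X\<in>set Xs. normed_space X" and u: "u \<in> carrier (tensor Xs N)"
    and f: "f \<in> listset (map (\<lambda>X. {g \<in> carrier (dual X). nrm (dual X) g \<le> 1}) Xs)"
  shows "norm (u (\<lambda>x. if x \<in> tuples Xs then \<Prod>i<length Xs. (f ! i) (x ! i) else 0)) \<le> inj_norm Xs u"
  unfolding inj_norm_def unit_prod_form_eq[OF Xs u f, symmetric]
  by (rule cSUP_upper[OF f inj_norm_bdd[OF Xs u]])

text \<open>The coefficients are absorbed into the first factor, which is where at least one factor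
  is required. It shows that the infimum in \<open>proj_norm\<close>, over sums without
  coefficients, is over a nonempty set.\<close>

lemma tensor_simple_rep:
  assumes Xs: "Xs \<noteq> []" "\<forall>X\<in>set Xs. vs X" and u: "u \<in> carrier (tensor Xs N)"
  shows "\<exists>xs. set xs \<subseteq> tuples Xs \<and> u = (\<lambda>\<phi>. \<Sum>x\<leftarrow>xs. otimes Xs x \<phi>)"
proof -
  obtain cds where cds: "snd ` set cds \<subseteq> tuples Xs" "u = tsum (forms Xs) cds" using u by (auto simp: carrier_tens)
  have n: "0 < length Xs" using Xs by simp
  let ?f = "\<lambda>(c, x). x[0 := c \<odot>\<^bsub>Xs ! 0\<^esub> (x ! 0)]"
  have X0: "vs (Xs ! 0)" using Xs n by auto
  have *: "?f (c, x) \<in> tuples Xs" "otimes Xs (?f (c, x)) \<phi> = c * otimes Xs x \<phi>" if x: "x \<in> tuples Xs" for c x \<phi>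
  proof -
    have x0: "x ! 0 \<in> carrier (Xs ! 0)" using x n by (simp add: in_tuples_iff)
    show "?f (c, x) \<in> tuples Xs" using tuples_update[OF x n vs_smult[OF X0 x0]] by simp
    show "otimes Xs (?f (c, x)) \<phi> = c * otimes Xs x \<phi>"
      using ml_mapsD(5)[where W = scalar_space, OF _ x n x0, of \<phi> c] by (simp add: elem_tensor_def)
  qed
  have "u \<phi> = (\<Sum>x\<leftarrow>map ?f cds. otimes Xs x \<phi>)" for \<phi>
    unfolding cds(2) tsum_def map_map
    by (rule arg_cong[where f = sum_list], rule map_cong[OF refl]) (use * cds in auto)
  moreover have "set (map ?f cds) \<subseteq> tuples Xs" using *(1) cds(1) by auto
  ultimately show ?thesis by blast
qed

section \<open>Restriction to finite dimensional subspaces\<close>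

lemma listset_fin_subspacesD:
  assumes Xs: "\<forall>X\<in>set Xs. normed_space X" and Es: "Es \<in> listset (map fin_subspaces Xs)"
  shows "length Es = length Xs" "\<forall>E\<in>set Es. normed_space E \<and> fin_dim E" "\<forall>E\<in>set Es. vs E" "\<forall>E\<in>set Es. banach_space E"
    "i < length Xs \<Longrightarrow> subsp (Xs ! i) (carrier (Es ! i))" "i < length Xs \<Longrightarrow> Es ! i = (Xs ! i)\<lparr>carrier := carrier (Es ! i)\<rparr>"
    "tuples Es \<subseteq> tuples Xs" "\<forall>E\<in>set Es. normed_space E"
proof -
  have E: "length Es = length Xs" "\<And>i. i < length Xs \<Longrightarrow> Es ! i \<in> fin_subspaces (Xs ! i)"
    using Es by (auto simp: in_listset_iff)
  have D: "normed_space (Es ! i)" "fin_dim (Es ! i)" "banach_space (Es ! i)" "subsp (Xs ! i) (carrier (Es ! i))"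
    "Es ! i = (Xs ! i)\<lparr>carrier := carrier (Es ! i)\<rparr>" if "i < length Xs" for i
    using fin_subspacesD[OF _ E(2)[OF that]] Xs that by auto
  show "length Es = length Xs" by (rule E)
  show "\<forall>E\<in>set Es. normed_space E \<and> fin_dim E" "\<forall>E\<in>set Es. vs E" "\<forall>E\<in>set Es. banach_space E" "\<forall>E\<in>set Es. normed_space E"
    using D(1-3) E(1) by (auto simp: in_set_conv_nth)
  show "i < length Xs \<Longrightarrow> subsp (Xs ! i) (carrier (Es ! i))" "i < length Xs \<Longrightarrow> Es ! i = (Xs ! i)\<lparr>carrier := carrier (Es ! i)\<rparr>"
    using D by auto
  show "tuples Es \<subseteq> tuples Xs"
    using D(4) E(1) subspD(1) by (fastforce simp: in_tuples_iff)
qed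

lemma restrict_forms:
  assumes Xs: "\<forall>X\<in>set Xs. normed_space X" and Es: "Es \<in> listset (map fin_subspaces Xs)" and W: "vs W"
    and T: "T \<in> ml_maps Xs W" and S: "is_lin W W' S"
  shows "(\<lambda>x. if x \<in> tuples Es then S (T x) else \<zero>\<^bsub>W'\<^esub>) \<in> ml_maps Es W'"
proof (rule ml_mapsI)
  note D = listset_fin_subspacesD[OF Xs Es]
  fix x assume x: "x \<in> tuples Es"
  then have xX: "x \<in> tuples Xs" using D(7) by auto
  then show "(if x \<in> tuples Es then S (T x) else \<zero>\<^bsub>W'\<^esub>) \<in> carrier W'"
    using x ml_mapsD(1)[OF T] is_linD(1)[OF S] by simp
  fix i assume i: "i < length Es"
  then have iX: "i < length Xs" using D(1) by simp
  have "is_lin (Xs ! i) W' (\<lambda>a. S (T (x[i := a])))" using is_lin_comp[OF ml_mapsD(3)[OF T xX iX] S] .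
  then have "is_lin ((Xs ! i)\<lparr>carrier := carrier (Es ! i)\<rparr>) W' (\<lambda>a. S (T (x[i := a])))"
    using subspD(1)[OF D(5)[OF iX]] by (intro is_lin_subsp) auto
  then have "is_lin (Es ! i) W' (\<lambda>a. S (T (x[i := a])))" using D(6)[OF iX] by simp
  moreover have "vs (Es ! i)" using D(3) i by auto
  ultimately show "is_lin (Es ! i) W' (\<lambda>a. if x[i := a] \<in> tuples Es then S (T (x[i := a])) else \<zero>\<^bsub>W'\<^esub>)"
    using tuples_update[OF x i] by (subst is_lin_cong) auto
qed simp

lemma fin_subspace_projection:
  assumes X: "normed_space X" and E: "E \<in> fin_subspaces X"
  shows "\<exists>P. is_lin X E P \<and> (\<forall>v\<in>carrier E. P v = v)"
proof -
  note D = fin_subspacesD[OF X E] and Xv = normed_spaceD(1)[OF X]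
  obtain G where G: "set G \<subseteq> carrier E" "carrier E = lspan X (set G)"
    using E by (auto simp: fin_subspaces_iff[OF Xv])
  have "set G \<subseteq> carrier X" using G subspD(1)[OF D(4)] by auto
  then obtain bfs where c: "coords X (carrier E) bfs" using coords_exist[OF X, of "set G"] G(2) by auto
  note cD = coordsD[OF X D(4) c]
  let ?P = "\<lambda>v. lc X (map (\<lambda>(b, f). (f v, b)) bfs)"
  have mem: "?P v \<in> carrier E" for v
    by (rule lc_closed[OF D(4)]) (use c in \<open>auto simp: coords_def\<close>)
  have h: "h (?P v) = (\<Sum>(b, f)\<leftarrow>bfs. f v * h b)" if "h \<in> lin_forms X" for h v
    using lin_forms_lc[OF Xv that cD(4)] by (simp add: comp_def case_prod_unfold)
  have mX: "?P v \<in> carrier X" for v by (rule lc_carrier[OF Xv cD(4)])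
  have add: "?P (v \<oplus>\<^bsub>X\<^esub> w) = ?P v \<oplus>\<^bsub>X\<^esub> ?P w" if "v \<in> carrier X" "w \<in> carrier X" for v w
  proof (rule separated_eqI[OF Xv separated_normed[OF X]])
    fix l assume l: "l \<in> lin_forms X"
    have "(\<Sum>(b, f)\<leftarrow>bfs. f (v \<oplus>\<^bsub>X\<^esub> w) * l b) = (\<Sum>(b, f)\<leftarrow>bfs. f v * l b + f w * l b)"
      by (rule arg_cong[where f = sum_list], rule map_cong[OF refl])
        (use cD(3) that in \<open>auto simp: lin_formsD algebra_simps\<close>)
    then show "l (?P (v \<oplus>\<^bsub>X\<^esub> w)) = l (?P v \<oplus>\<^bsub>X\<^esub> ?P w)"
      unfolding lin_formsD(3)[OF l mX mX] h[OF l] by (simp add: sum_list_addf case_prod_unfold)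
  qed (use mX that Xv in auto)
  have sm: "?P (c \<odot>\<^bsub>X\<^esub> v) = c \<odot>\<^bsub>X\<^esub> ?P v" if "v \<in> carrier X" for v c
  proof (rule separated_eqI[OF Xv separated_normed[OF X]])
    fix l assume l: "l \<in> lin_forms X"
    have "(\<Sum>(b, f)\<leftarrow>bfs. f (c \<odot>\<^bsub>X\<^esub> v) * l b) = (\<Sum>(b, f)\<leftarrow>bfs. c * (f v * l b))"
      by (rule arg_cong[where f = sum_list], rule map_cong[OF refl])
        (use cD(3) that in \<open>auto simp: lin_formsD algebra_simps\<close>)
    then show "l (?P (c \<odot>\<^bsub>X\<^esub> v)) = l (c \<odot>\<^bsub>X\<^esub> ?P v)"
      unfolding lin_formsD(4)[OF l mX] h[OF l] by (simp add: sum_list_const_mult case_prod_unfold)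
  qed (use mX that Xv in auto)
  have "is_lin X (X\<lparr>carrier := carrier E\<rparr>) ?P" unfolding is_lin_def using add sm mem by simp
  then have "is_lin X E ?P" using D(5) by simp
  then show ?thesis using cD(5) by blast
qed

text \<open>Composition with a projection onto the subspace in each variable. Consequently every
  form on Es is tested by forms on Xs, and the inclusion of the tensor products is
  injective.\<close>

lemma extend_form:
  assumes Xs: "\<forall>X\<in>set Xs. normed_space X" and Es: "Es \<in> listset (map fin_subspaces Xs)" and \<phi>: "\<phi> \<in> forms Es"
  shows "\<exists>\<psi>\<in>forms Xs. \<phi> = (\<lambda>x. if x \<in> tuples Es then \<psi> x else 0)"
proof -
  note D = listset_fin_subspacesD[OF Xs Es]
  have "\<exists>P. is_lin (Xs ! i) (Es ! i) P \<and> (\<forall>v\<in>carrier (Es ! i). P v = v)" if "i < length Xs" for i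
    using fin_subspace_projection[of "Xs ! i" "Es ! i"] Xs Es that by (simp add: in_listset_iff)
  then obtain P where P: "\<And>i. i < length Xs \<Longrightarrow> is_lin (Xs ! i) (Es ! i) (P i)"
    "\<And>i v. i < length Xs \<Longrightarrow> v \<in> carrier (Es ! i) \<Longrightarrow> P i v = v" by metis
  define R where "R x = map (\<lambda>i. P i (x ! i)) [0..<length Xs]" for x
  have Rt: "R x \<in> tuples Es" if "x \<in> tuples Xs" for x
    using that is_linD(1)[OF P(1)] D(1) by (auto simp: R_def in_tuples_iff)
  have Rid: "R x = x" if "x \<in> tuples Es" for x
    using that D(1) P(2) by (intro nth_equalityI) (auto simp: R_def in_tuples_iff)
  have Ru: "R (x[i := a]) = (R x)[i := P i a]" if "i < length Xs" "x \<in> tuples Xs" for x i a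
    using that by (intro nth_equalityI) (auto simp: R_def nth_list_update in_tuples_iff)
  have "(\<lambda>x. if x \<in> tuples Xs then \<phi> (R x) else 0) \<in> forms Xs"
  proof (rule ml_mapsI)
    fix x i assume x: "x \<in> tuples Xs" and i: "i < length Xs"
    have Xi: "vs (Xs ! i)" using Xs i by auto
    have iE: "i < length Es" using i D(1) by simp
    have "is_lin (Xs ! i) scalar_space (\<lambda>a. \<phi> ((R x)[i := P i a]))"
      by (rule is_lin_comp[OF P(1)[OF i] ml_mapsD(3)[OF \<phi> Rt[OF x] iE]])
    then show "is_lin (Xs ! i) scalar_space (\<lambda>a. if x[i := a] \<in> tuples Xs then \<phi> (R (x[i := a])) else 0)"
      using tuples_update[OF x i] Ru[OF i x] by (subst is_lin_cong[OF Xi]) auto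
  qed auto
  moreover have "\<phi> = (\<lambda>x. if x \<in> tuples Es then (if x \<in> tuples Xs then \<phi> (R x) else 0) else 0)"
    using Rid D(7) ml_mapsD(2)[OF \<phi>] by (auto simp: fun_eq_iff)
  ultimately show ?thesis by (intro bexI)
qed

lemma tensor_incl_props:
  assumes Xs: "\<forall>X\<in>set Xs. normed_space X" and Es: "Es \<in> listset (map fin_subspaces Xs)"
  shows "u \<in> carrier (tensor Es N) \<Longrightarrow> tensor_incl Es Xs u = (\<lambda>\<psi>. if \<psi> \<in> forms Xs then u (\<lambda>x. if x \<in> tuples Es then \<psi> x else 0) else 0)"
    "snd ` set cds \<subseteq> tuples Es \<Longrightarrow> tensor_incl Es Xs (tsum (forms Es) cds) = tsum (forms Xs) cds"
    "u \<in> carrier (tensor Es N) \<Longrightarrow> tensor_incl Es Xs u \<in> carrier (tensor Xs N')"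
proof -
  note D = listset_fin_subspacesD[OF Xs Es]
  have r: "\<forall>\<psi>\<in>forms Xs. (\<lambda>x. if x \<in> tuples Es then \<psi> x else 0) \<in> forms Es"
    using restrict_forms[OF Xs Es vs_scalar_space _ is_lin_id[of scalar_space], unfolded scalar_space_simps] by blast
  note I = linearize_incl[OF D(7) r]
  show 1: "tensor_incl Es Xs u = (\<lambda>\<psi>. if \<psi> \<in> forms Xs then u (\<lambda>x. if x \<in> tuples Es then \<psi> x else 0) else 0)"
    if "u \<in> carrier (tensor Es N)" for u N
    unfolding tensor_incl_def using I(3)[OF that] by simp
  show "tensor_incl Es Xs u \<in> carrier (tensor Xs N')" if u: "u \<in> carrier (tensor Es N)"
    unfolding 1[OF u] using is_linD(1)[OF I(2)] u by simp
  show "tensor_incl Es Xs (tsum (forms Es) cds) = tsum (forms Xs) cds" if "snd ` set cds \<subseteq> tuples Es"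
    using 1[of "tsum (forms Es) cds"] I(1)[OF that] that by simp
qed

text \<open>Definiteness is the injectivity of the inclusion. The lower estimate holds because norm
  one functionals on the subspaces extend by Hahn-Banach, so the injective norm cannot grow on
  passing to Es; the upper one because a representation over Es is also one over Xs, so the
  projective norm can only be larger over Es.\<close>

lemma reasonable_restr_norm:
  assumes Xs: "Xs \<noteq> []" "\<forall>X\<in>set Xs. normed_space X" and \<beta>: "reasonable Xs \<beta>"
    and Es: "Es \<in> listset (map fin_subspaces Xs)"
  shows "reasonable Es (restr_norm Es Xs \<beta>)"
proof -
  note D = listset_fin_subspacesD[OF Xs(2) Es]
  let ?\<beta> = "restr_norm Es Xs \<beta>" and ?i = "tensor_incl Es Xs"
  note I = tensor_incl_props[OF Xs(2) Es]
  have n\<beta>: "is_norm (tensor Xs \<beta>) \<beta>" and le: "\<And>u. u \<in> carrier (tensor Xs \<beta>) \<Longrightarrow> inj_norm Xs u \<le> \<beta> u \<and> \<beta> u \<le> proj_norm Xs u"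
    using \<beta> by (auto simp: reasonable_def)
  have inj: "u = (\<lambda>_. 0)" if u: "u \<in> carrier (tensor Es N)" and z: "?i u = (\<lambda>_. 0)" for u N
  proof
    fix \<phi>
    obtain cds where cds: "u = tsum (forms Es) cds" using u by (auto simp: carrier_tens)
    show "u \<phi> = 0"
    proof (cases "\<phi> \<in> forms Es")
      case True
      then obtain \<psi> where \<psi>: "\<psi> \<in> forms Xs" "\<phi> = (\<lambda>x. if x \<in> tuples Es then \<psi> x else 0)"
        using extend_form[OF Xs(2) Es] by blast
      have "?i u \<psi> = u \<phi>" using I(1)[OF u] \<psi> by simp
      then show ?thesis using z by simp
    qed (simp add: cds tsum_apply)
  qed
  have iu: "?i u \<in> carrier (tensor Xs \<beta>)" if "u \<in> carrier (tensor Es N)" for u N using I(3)[OF that] .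
  show ?thesis
    unfolding reasonable_def
  proof (intro conjI ballI)
    show "is_norm (tensor Es ?\<beta>) ?\<beta>"
      unfolding is_norm_def
    proof (intro conjI ballI allI)
      fix u assume u: "u \<in> carrier (tensor Es ?\<beta>)"
      show "0 \<le> ?\<beta> u" using n\<beta> iu[OF u] by (auto simp: is_norm_def restr_norm_def)
      have "?\<beta> u = 0 \<longleftrightarrow> ?i u = (\<lambda>_. 0)" using n\<beta> iu[OF u] by (auto simp: is_norm_def restr_norm_def)
      also have "\<dots> \<longleftrightarrow> u = (\<lambda>_. 0)"
      proof
        assume "u = (\<lambda>_. 0)" then show "?i u = (\<lambda>_. 0)" using I(1)[OF u] by auto
      qed (rule inj[OF u])
      finally show "?\<beta> u = 0 \<longleftrightarrow> u = \<zero>\<^bsub>tensor Es ?\<beta>\<^esub>" by simp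
      fix c
      have "?i (\<lambda>\<phi>. c * u \<phi>) = (\<lambda>\<psi>. c * ?i u \<psi>)" using I(1)[OF u] I(1)[OF tens_closed(2)[OF u u, of c]] by auto
      then show "?\<beta> (c \<odot>\<^bsub>tensor Es ?\<beta>\<^esub> u) = norm c * ?\<beta> u"
        using n\<beta> iu[OF u] by (auto simp: is_norm_def restr_norm_def)
      fix v assume v: "v \<in> carrier (tensor Es ?\<beta>)"
      have "?i (\<lambda>\<phi>. u \<phi> + v \<phi>) = (\<lambda>\<psi>. ?i u \<psi> + ?i v \<psi>)"
        using I(1)[OF u] I(1)[OF v] I(1)[OF tens_closed(1)[OF u v]] by auto
      then show "?\<beta> (u \<oplus>\<^bsub>tensor Es ?\<beta>\<^esub> v) \<le> ?\<beta> u + ?\<beta> v"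
        using n\<beta> iu[OF u] iu[OF v] by (auto simp: is_norm_def restr_norm_def)
    qed
  next
    fix u assume u: "u \<in> carrier (tensor Es ?\<beta>)"
    have "inj_norm Es u \<le> inj_norm Xs (?i u)"
      unfolding inj_norm_def[of Es]
    proof (rule cSUP_least)
      have "map (\<lambda>E. (\<lambda>_. 0)) Es \<in> listset (map (\<lambda>X. {g \<in> carrier (dual X). nrm (dual X) g \<le> 1}) Es)"
      proof -
        have "(\<lambda>_. 0) \<in> carrier (dual E) \<and> nrm (dual E) (\<lambda>_. 0) \<le> 1" if "E \<in> set Es" for E
          using dual_zero[of E] D(8) that by simp
        then show ?thesis by (auto simp: in_listset_iff)
      qed
      then show "listset (map (\<lambda>X. {g \<in> carrier (dual X). nrm (dual X) g \<le> 1}) Es) \<noteq> {}" by blast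
      fix f assume f: "f \<in> listset (map (\<lambda>X. {g \<in> carrier (dual X). nrm (dual X) g \<le> 1}) Es)"
      have "\<exists>g. g \<in> carrier (dual (Xs ! i)) \<and> nrm (dual (Xs ! i)) g \<le> 1 \<and> (\<forall>a\<in>carrier (Es ! i). g a = (f ! i) a)"
        if i: "i < length Xs" for i
      proof -
        have X: "normed_space (Xs ! i)" using Xs i by auto
        have iE: "i < length Es" using i D(1) by simp
        have nE: "nrm (Es ! i) = nrm (Xs ! i)" by (subst D(6)[OF i]) simp
        have "is_lin ((Xs ! i)\<lparr>carrier := carrier (Es ! i)\<rparr>) scalar_space (f ! i)"
          using lin_formsD(1)[OF unit_dual_tuple(2)[OF D(8) f iE]] D(6)[OF i] by simp
        then obtain g where g: "g \<in> lin_forms (Xs ! i)" "\<And>a. a \<in> carrier (Es ! i) \<Longrightarrow> g a = (f ! i) a"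
            "\<And>a. a \<in> carrier (Xs ! i) \<Longrightarrow> norm (g a) \<le> nrm (Xs ! i) a"
          using hahn_banach[OF normed_spaceD(1)[OF X] normed_seminorm[OF X] D(5)[OF i], of "f ! i"]
            unit_dual_tuple(3)[OF D(8) f iE] nE by auto
        have "g \<in> carrier (dual (Xs ! i))" by (rule dualI[OF g(1), where c = 1]) (use g(3) in simp)
        moreover have "nrm (dual (Xs ! i)) g \<le> 1"
          by (rule nrm_dual_le[OF normed_spaceD(1)[OF X] homog_normed[OF X]]) (use g(3) in auto)
        ultimately show ?thesis using g(2) by blast
      qed
      then obtain g where g: "\<And>i. i < length Xs \<Longrightarrow> g i \<in> carrier (dual (Xs ! i)) \<and> nrm (dual (Xs ! i)) (g i) \<le> 1 \<and> (\<forall>a\<in>carrier (Es ! i). g i a = (f ! i) a)"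
        by metis
      let ?g = "map g [0..<length Xs]"
      have gl: "?g \<in> listset (map (\<lambda>X. {g \<in> carrier (dual X). nrm (dual X) g \<le> 1}) Xs)"
        using g by (auto simp: in_listset_iff)
      let ?pg = "\<lambda>x. if x \<in> tuples Xs then \<Prod>i<length Xs. (?g ! i) (x ! i) else 0"
      have pg: "?pg \<in> forms Xs" by (rule prod_form) (use Xs unit_dual_tuple(2)[OF Xs(2) gl] in auto)
      have "(\<lambda>x. if x \<in> tuples Es then ?pg x else 0) = (\<lambda>x. if x \<in> tuples Es then \<Prod>i<length Es. (f ! i) (x ! i) else 0)"
      proof
        fix x
        show "(if x \<in> tuples Es then ?pg x else 0) = (if x \<in> tuples Es then \<Prod>i<length Es. (f ! i) (x ! i) else 0)"
        proof (cases "x \<in> tuples Es")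
          case True
          have "(\<Prod>i<length Xs. (?g ! i) (x ! i)) = (\<Prod>i<length Es. (f ! i) (x ! i))"
            using True g D(1) by (intro prod.cong) (auto simp: in_tuples_iff)
          then show ?thesis using True D(7) by auto
        qed simp
      qed
      then have "?i u ?pg = u (\<lambda>x. if x \<in> tuples Es then \<Prod>i<length Es. (f ! i) (x ! i) else 0)"
        using I(1)[OF u] pg by simp
      then show "norm (lin_ext Es scalar_space (\<lambda>x. \<Prod>i<length Es. (f ! i) (x ! i)) u) \<le> inj_norm Xs (?i u)"
        using inj_norm_ge[OF Xs(2) iu[OF u] gl] unit_prod_form_eq[OF D(8) u f] by simp
    qed
    then show "inj_norm Es u \<le> ?\<beta> u" using le[OF iu[OF u]] by (simp add: restr_norm_def)
    have "proj_norm Xs (?i u) \<le> proj_norm Es u"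
      unfolding proj_norm_def[of Es]
    proof (rule cInf_greatest)
      have "Es \<noteq> []" using Xs(1) D(1) by auto
      then obtain xs where "set xs \<subseteq> tuples Es" "u = (\<lambda>\<phi>. \<Sum>x\<leftarrow>xs. otimes Es x \<phi>)"
        using tensor_simple_rep[OF _ D(3) u] by blast
      then show "{\<Sum>x\<leftarrow>xs. \<Prod>i<length Es. nrm (Es ! i) (x ! i) |xs. set xs \<subseteq> tuples Es \<and> u = (\<lambda>\<phi>. \<Sum>x\<leftarrow>xs. otimes Es x \<phi>)} \<noteq> {}"
        by blast
      fix r assume "r \<in> {\<Sum>x\<leftarrow>xs. \<Prod>i<length Es. nrm (Es ! i) (x ! i) |xs. set xs \<subseteq> tuples Es \<and> u = (\<lambda>\<phi>. \<Sum>x\<leftarrow>xs. otimes Es x \<phi>)}"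
      then obtain xs where xs: "set xs \<subseteq> tuples Es" "u = (\<lambda>\<phi>. \<Sum>x\<leftarrow>xs. otimes Es x \<phi>)"
        and r: "r = (\<Sum>x\<leftarrow>xs. \<Prod>i<length Es. nrm (Es ! i) (x ! i))" by blast
      have nE: "nrm (Es ! i) = nrm (Xs ! i)" if "i < length Xs" for i by (subst D(6)[OF that]) simp
      have "u = tsum (forms Es) (map (\<lambda>x. (1, x)) xs)" by (simp add: xs(2) tsum_def comp_def)
      then have "?i u = tsum (forms Xs) (map (\<lambda>x. (1, x)) xs)" using I(2)[of "map (\<lambda>x. (1, x)) xs"] xs(1)
        by (simp add: image_image)
      then have "?i u = (\<lambda>\<phi>. \<Sum>x\<leftarrow>xs. otimes Xs x \<phi>)" by (simp add: tsum_def comp_def)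
      then have "proj_norm Xs (?i u) \<le> (\<Sum>x\<leftarrow>xs. \<Prod>i<length Xs. nrm (Xs ! i) (x ! i))"
        using xs(1) D(7) by (intro proj_norm_le[OF Xs(2)]) auto
      also have "\<dots> = r" unfolding r using nE D(1) by simp
      finally show "proj_norm Xs (?i u) \<le> r" .
    qed
    then show "?\<beta> u \<le> proj_norm Es u" using le[OF iu[OF u]] by (simp add: restr_norm_def)
  qed
qed

section \<open>Finite dimensional duality\<close>

text \<open>A tensor is a combination of evaluations at points of D, so identities between forms are
  required at those points only.\<close>

lemma tens_additive:
  assumes "u \<in> carrier (tens D M N)"
  shows "\<phi> \<in> M \<Longrightarrow> \<psi> \<in> M \<Longrightarrow> \<kappa> \<in> M \<Longrightarrow> (\<And>d. d \<in> D \<Longrightarrow> \<kappa> d = \<phi> d + \<psi> d) \<Longrightarrow> u \<kappa> = u \<phi> + u \<psi>"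
    "\<phi> \<in> M \<Longrightarrow> \<kappa> \<in> M \<Longrightarrow> (\<And>d. d \<in> D \<Longrightarrow> \<kappa> d = c * \<phi> d) \<Longrightarrow> u \<kappa> = c * u \<phi>"
proof -
  obtain cds where cds: "snd ` set cds \<subseteq> D" "u = tsum M cds" using assms by (auto simp: carrier_tens)
  show "u \<kappa> = u \<phi> + u \<psi>" if "\<phi> \<in> M" "\<psi> \<in> M" "\<kappa> \<in> M" "\<And>d. d \<in> D \<Longrightarrow> \<kappa> d = \<phi> d + \<psi> d"
  proof -
    have "(\<Sum>(c, d)\<leftarrow>cds. c * \<kappa> d) = (\<Sum>(c, d)\<leftarrow>cds. c * \<phi> d + c * \<psi> d)"
      by (rule arg_cong[where f = sum_list], rule map_cong[OF refl]) (use cds that in \<open>auto simp: algebra_simps\<close>)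
    then show ?thesis using that by (simp add: cds(2) tsum_apply sum_list_addf case_prod_unfold)
  qed
  show "u \<kappa> = c * u \<phi>" if "\<phi> \<in> M" "\<kappa> \<in> M" "\<And>d. d \<in> D \<Longrightarrow> \<kappa> d = c * \<phi> d"
  proof -
    have "(\<Sum>(c, d)\<leftarrow>cds. c * \<kappa> d) = (\<Sum>(e, d)\<leftarrow>cds. c * (e * \<phi> d))"
      by (rule arg_cong[where f = sum_list], rule map_cong[OF refl]) (use cds that in \<open>auto simp: algebra_simps\<close>)
    then show ?thesis using that by (simp add: cds(2) tsum_apply sum_list_const_mult case_prod_unfold)
  qed
qed

lemma forms_closed:
  assumes Xs: "\<forall>X\<in>set Xs. vs X" and \<phi>: "\<phi> \<in> forms Xs"
  shows "\<psi> \<in> forms Xs \<Longrightarrow> (\<lambda>x. \<phi> x + \<psi> x) \<in> forms Xs" "(\<lambda>x. c * \<phi> x) \<in> forms Xs"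
proof -
  show "(\<lambda>x. \<phi> x + \<psi> x) \<in> forms Xs" if \<psi>: "\<psi> \<in> forms Xs"
    using ml_mapsD[OF \<phi>] ml_mapsD[OF \<psi>] by (intro ml_mapsI) (auto simp: is_lin_def algebra_simps)
  show "(\<lambda>x. c * \<phi> x) \<in> forms Xs"
    using ml_mapsD[OF \<phi>] by (intro ml_mapsI) (auto simp: is_lin_def algebra_simps)
qed

lemma beta_forms_iff:
  "\<phi> \<in> carrier (beta_forms Xs \<beta>) \<longleftrightarrow> \<phi> \<in> forms Xs \<and> (\<exists>c. \<forall>u\<in>carrier (tensor Xs \<beta>). norm (u \<phi>) \<le> c * \<beta> u)"
proof -
  have "bounded_op (tensor Xs \<beta>) scalar_space (lin_ext Xs scalar_space \<phi>) \<longleftrightarrow>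
      (\<exists>c. \<forall>u\<in>carrier (tensor Xs \<beta>). norm (u \<phi>) \<le> c * \<beta> u)" if \<phi>: "\<phi> \<in> forms Xs"
  proof -
    have "lin_ext Xs scalar_space \<phi> u = u \<phi>" if "u \<in> carrier (tensor Xs \<beta>)" for u
      by (rule linearize_scalar[OF \<phi> _ that]) simp
    then have "bounded_op (tensor Xs \<beta>) scalar_space (lin_ext Xs scalar_space \<phi>) \<longleftrightarrow>
      bounded_op (tensor Xs \<beta>) scalar_space (\<lambda>u. u \<phi>)"
      by (intro bounded_op_cong) auto
    then show ?thesis using is_lin_apply[OF \<phi>, of "tuples Xs" \<beta>] by (simp add: bounded_op_def)
  qed
  then show ?thesis by (auto simp: beta_forms_def)
qed

lemma beta_forms_ops [simp]:
  "add (beta_forms Xs \<beta>) = (\<lambda>f g x. f x + g x)" "smult (beta_forms Xs \<beta>) = (\<lambda>c f x. c * f x)"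
  by (auto simp: beta_forms_def)

lemma beta_forms_closed:
  assumes Xs: "\<forall>X\<in>set Xs. vs X" and \<phi>: "\<phi> \<in> carrier (beta_forms Xs \<beta>)"
  shows "\<psi> \<in> carrier (beta_forms Xs \<beta>) \<Longrightarrow> (\<lambda>x. \<phi> x + \<psi> x) \<in> carrier (beta_forms Xs \<beta>)"
    "(\<lambda>x. c * \<phi> x) \<in> carrier (beta_forms Xs \<beta>)"
proof -
  obtain a where a: "\<phi> \<in> forms Xs" "\<And>u. u \<in> carrier (tensor Xs \<beta>) \<Longrightarrow> norm (u \<phi>) \<le> a * \<beta> u"
    using \<phi> by (auto simp: beta_forms_iff)
  show "(\<lambda>x. \<phi> x + \<psi> x) \<in> carrier (beta_forms Xs \<beta>)" if \<psi>: "\<psi> \<in> carrier (beta_forms Xs \<beta>)"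
  proof -
    obtain b where b: "\<psi> \<in> forms Xs" "\<And>u. u \<in> carrier (tensor Xs \<beta>) \<Longrightarrow> norm (u \<psi>) \<le> b * \<beta> u"
      using \<psi> by (auto simp: beta_forms_iff)
    note s = forms_closed(1)[OF Xs a(1) b(1)]
    have "norm (u (\<lambda>x. \<phi> x + \<psi> x)) \<le> (a + b) * \<beta> u" if u: "u \<in> carrier (tensor Xs \<beta>)" for u
      using tens_additive(1)[OF u a(1) b(1) s] a(2)[OF u] b(2)[OF u] norm_triangle_ineq[of "u \<phi>" "u \<psi>"]
      by (simp add: algebra_simps)
    then show ?thesis using s by (auto simp: beta_forms_iff)
  qed
  note s = forms_closed(2)[OF Xs a(1), of c]
  have "norm (u (\<lambda>x. c * \<phi> x)) \<le> (norm c * a) * \<beta> u" if u: "u \<in> carrier (tensor Xs \<beta>)" for u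
    using tens_additive(2)[OF u a(1) s, of c] mult_left_mono[OF a(2)[OF u], of "norm c"]
    by (simp add: norm_mult mult.assoc)
  then show "(\<lambda>x. c * \<phi> x) \<in> carrier (beta_forms Xs \<beta>)" using s by (auto simp: beta_forms_iff)
qed

text \<open>Scaling each functional into the unit ball turns the product into a form controlled by
  the injective norm, which \<beta> dominates. The summand 1 in the scaling factor allows zero
  functionals.\<close>

lemma prod_form_beta:
  assumes Xs: "\<forall>X\<in>set Xs. normed_space X" and \<beta>: "reasonable Xs \<beta>"
    and f: "\<And>i. i < length Xs \<Longrightarrow> f i \<in> carrier (dual (Xs ! i))"
  shows "(\<lambda>x. if x \<in> tuples Xs then \<Prod>i<length Xs. f i (x ! i) else 0) \<in> carrier (beta_forms Xs \<beta>)"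
proof -
  have X: "normed_space (Xs ! i)" "vs (Xs ! i)" "homog (Xs ! i) (nrm (Xs ! i))" if "i < length Xs" for i
    using Xs that by auto
  have fl: "f i \<in> lin_forms (Xs ! i)" "0 \<le> nrm (dual (Xs ! i)) (f i)" if "i < length Xs" for i
    using dualD(1,3)[OF X(2,3)[OF that] f[OF that]] by auto
  define c where "c i = nrm (dual (Xs ! i)) (f i) + 1" for i
  have c: "c i > 0" if "i < length Xs" for i using fl(2)[OF that] by (simp add: c_def)
  define g where "g i = (\<lambda>a. of_real (inverse (c i)) * f i a + 0 * f i a)" for i
  have g: "g i \<in> carrier (dual (Xs ! i))" "nrm (dual (Xs ! i)) (g i) \<le> 1" if i: "i < length Xs" for i
  proof -
    show "g i \<in> carrier (dual (Xs ! i))" unfolding g_def by (rule dual_comb[OF X(2,3)[OF i] f[OF i] f[OF i]])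
    show "nrm (dual (Xs ! i)) (g i) \<le> 1"
    proof (rule nrm_dual_le[OF X(2,3)[OF i]])
      fix a assume a: "a \<in> carrier (Xs ! i)"
      have "norm (f i a) \<le> c i * nrm (Xs ! i) a"
        using dualD(2)[OF X(2,3)[OF i] f[OF i] a] normed_spaceD(2)[OF X(1)[OF i] a] by (simp add: c_def algebra_simps)
      then show "norm (g i a) \<le> 1 * nrm (Xs ! i) a"
        using c[OF i] by (simp add: g_def norm_mult norm_inverse norm_divide field_simps)
    qed simp
  qed
  let ?G = "map g [0..<length Xs]"
  have G: "?G \<in> listset (map (\<lambda>X. {g \<in> carrier (dual X). nrm (dual X) g \<le> 1}) Xs)"
    using g by (auto simp: in_listset_iff)
  let ?p = "\<lambda>x. if x \<in> tuples Xs then \<Prod>i<length Xs. f i (x ! i) else 0"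
  let ?q = "\<lambda>x. if x \<in> tuples Xs then \<Prod>i<length Xs. (?G ! i) (x ! i) else 0"
  have p: "?p \<in> forms Xs" by (rule prod_form) (use Xs fl in auto)
  have q: "?q \<in> forms Xs" by (rule prod_form) (use Xs unit_dual_tuple(2)[OF Xs G] in auto)
  define C where "C = (\<Prod>i<length Xs. c i)"
  have C: "C > 0" unfolding C_def using c by (intro prod_pos) auto
  have pq: "?p x = of_real C * ?q x" for x
  proof -
    have "(\<Prod>i<length Xs. f i (x ! i)) = (\<Prod>i<length Xs. of_real (c i) * g i (x ! i))"
      by (rule prod.cong) (use c in \<open>auto simp: g_def less_le\<close>)
    then show ?thesis by (simp add: C_def prod.distrib)
  qed
  have "norm (u ?p) \<le> C * \<beta> u" if u: "u \<in> carrier (tensor Xs \<beta>)" for u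
  proof -
    have "u ?p = of_real C * u ?q" by (rule tens_additive(2)[OF u q p]) (rule pq)
    moreover have "norm (u ?q) \<le> inj_norm Xs u" by (rule inj_norm_ge[OF Xs u G])
    moreover have "inj_norm Xs u \<le> \<beta> u" using \<beta> u by (auto simp: reasonable_def)
    ultimately show ?thesis using C by (simp add: norm_mult mult_left_mono)
  qed
  then show ?thesis using p by (auto simp: beta_forms_iff)
qed

text \<open>Since tensors are functionals on forms, \<open>u (pform Xs Y b T)\<close> is the value
  at u of the functional that corresponds to T under the duality.\<close>

definition pform :: "('k::real_or_complex, 'a) nspace list \<Rightarrow> ('k, 'b) nspace \<Rightarrow> ('c \<Rightarrow> 'b \<Rightarrow> 'k) \<Rightarrow>
    ('a list \<Rightarrow> 'c) \<Rightarrow> 'a list \<times> 'b \<Rightarrow> 'k" where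
  "pform Xs Y b T = (\<lambda>(x, y). if x \<in> tuples Xs \<and> y \<in> carrier Y then b (T x) y else 0)"

lemma pform_mem:
  assumes Xs: "\<forall>X\<in>set Xs. vs X" and Y: "vs Y" and b: "pairing_on Z Y b" and T: "T \<in> ml_maps Xs Z"
  shows "pform Xs Y b T \<in> forms_with (forms Xs) Y"
  unfolding forms_with_def
proof (safe)
  fix y assume y: "y \<in> carrier Y"
  have "is_lin Z scalar_space (\<lambda>z. b z y)" using b y by (auto simp: pairing_on_def)
  from ml_maps_comp[OF Xs T this, unfolded scalar_space_simps]
  have "(\<lambda>x. if x \<in> tuples Xs then b (T x) y else 0) \<in> forms Xs" .
  also have "(\<lambda>x. if x \<in> tuples Xs then b (T x) y else 0) = (\<lambda>x. pform Xs Y b T (x, y))"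
    using y by (auto simp: pform_def)
  finally show "(\<lambda>x. pform Xs Y b T (x, y)) \<in> forms Xs" .
next
  fix x
  show "(\<lambda>y. pform Xs Y b T (x, y)) \<in> lin_forms Y"
  proof (cases "x \<in> tuples Xs")
    case True
    have "(\<lambda>y. if y \<in> carrier Y then b (T x) y else 0) \<in> lin_forms Y"
      using b ml_mapsD(1)[OF T True] by (auto simp: pairing_on_def)
    then show ?thesis using True by (simp add: pform_def)
  qed (simp add: pform_def lin_forms_0)
qed

lemma pform_tsum:
  assumes "\<forall>X\<in>set Xs. vs X" "vs Y" "pairing_on Z Y b" "T \<in> ml_maps Xs Z" "snd ` set cds \<subseteq> tuples Xs \<times> carrier Y"
  shows "tsum (forms_with (forms Xs) Y) cds (pform Xs Y b T) = (\<Sum>(c, d)\<leftarrow>cds. c * b (T (fst d)) (snd d))"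
  unfolding tsum_apply using pform_mem[OF assms(1-4)]
  by (simp, intro arg_cong[where f = sum_list] map_cong[OF refl]) (use assms(5) in \<open>auto simp: pform_def\<close>)

lemma pairing_on_dual_copy: "normed_space Y \<Longrightarrow> dual_copy Y Z J \<Longrightarrow> pairing_on Z Y J"
  using good_pair_dual_copy by (auto simp: good_pair_def)

text \<open>Expanding the argument of a functional in coordinates writes it as the combination of
  the coordinate functionals with its values at the \<open>b\<close> as coefficients.\<close>

lemma dual_copy_fin_dim:
  assumes F: "normed_space F" "fin_dim F" and J: "dual_copy F W J"
  shows "fin_dim W"
proof -
  note D = dual_copyD[OF F(1) J] and Fv = normed_spaceD(1)[OF F(1)] and Fh = homog_normed[OF F(1)]
  note Wv = normed_spaceD(1)[OF D(2)]
  obtain bfs where c: "coords F (carrier F) bfs" using fin_dim_coords[OF F] .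
  note cD = coordsD[OF F(1) subsp_carrier[OF Fv] c]
  define w where "w f = (SOME w. w \<in> carrier W \<and> J w = f)" for f
  have w: "w f \<in> carrier W \<and> J (w f) = f" if bf: "(b, f) \<in> set bfs" for b f
  proof -
    have "\<exists>w. w \<in> carrier W \<and> J w = f" using D(8)[OF cD(2)[OF bf]] by blast
    then show ?thesis unfolding w_def by (rule someI_ex)
  qed
  let ?B = "(\<lambda>(b, f). w f) ` set bfs"
  have B: "?B \<subseteq> carrier W" using w by auto
  have "z \<in> lspan W ?B" if z: "z \<in> carrier W" for z
  proof -
    let ?l = "map (\<lambda>(b, f). (J z b, w f)) bfs"
    have mem: "snd ` set ?l \<subseteq> carrier W" using w by auto
    have l: "lc W ?l \<in> carrier W" by (rule lc_carrier[OF Wv mem])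
    have "J (lc W ?l) y = J z y" if y: "y \<in> carrier F" for y
    proof -
      have "J (lc W ?l) y = (\<Sum>(b, f)\<leftarrow>bfs. J z b * J (w f) y)"
        using is_lin_lc[OF Wv vs_scalar_space D(7) mem, of y] by (simp add: lc_scalar comp_def case_prod_unfold)
      also have "\<dots> = (\<Sum>(b, f)\<leftarrow>bfs. f y * J z b)"
        by (rule arg_cong[where f = sum_list], rule map_cong[OF refl]) (use w in auto)
      also have "\<dots> = J z (lc F (map (\<lambda>(b, f). (f y, b)) bfs))"
        using lin_forms_lc[OF Fv D(4)[OF z] cD(4), of "\<lambda>f. f y"] by (simp add: comp_def case_prod_unfold)
      also have "\<dots> = J z y" using cD(5)[OF y] by simp
      finally show ?thesis .
    qed
    then have "J (lc W ?l) y = J z y" for y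
      using lin_formsD(2)[OF D(4)[OF z]] lin_formsD(2)[OF D(4)[OF l]] by (cases "y \<in> carrier F") auto
    then have "J (lc W ?l) = J z" ..
    then have "lc W ?l = z" by (rule D(9)[OF l z])
    moreover have "lc W ?l \<in> lspan W ?B" unfolding lspan_def by (intro CollectI exI[of _ ?l]) force
    ultimately show ?thesis by simp
  qed
  then have "lspan W ?B = carrier W" using subspD(1)[OF subsp_lspan[OF Wv B]] by auto
  then show ?thesis unfolding fin_dim_iff[OF Wv] using B by (intro exI[of _ ?B]) auto
qed

section \<open>Consequences of the ideal axioms and duality in finite dimensions\<close>

context
  fixes \<A> :: "('k::real_or_complex, 'u) ideal_sets" and A :: "('k, 'u) ideal_norms"
  assumes ideal: "sigma_ideal \<A> A"
begin

lemmas ideal_unfolded = ideal[unfolded sigma_ideal_def]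
lemmas ideal_banach = conjunct1[OF ideal_unfolded, rule_format]
  and ideal_prod' = conjunct1[OF conjunct2[OF ideal_unfolded], rule_format]
  and ideal_lip = conjunct1[OF conjunct2[OF conjunct2[OF ideal_unfolded]], rule_format]
  and ideal_comp = conjunct2[OF conjunct2[OF conjunct2[OF ideal_unfolded]], rule_format]

lemma idealD:
  assumes e: "election Xs Y \<beta>"
  shows "normed_space (ideal_space \<A> A Xs Y \<beta>)" "vs (ideal_space \<A> A Xs Y \<beta>)"
    "homog (ideal_space \<A> A Xs Y \<beta>) (A Xs Y \<beta>)"
    "T \<in> \<A> Xs Y \<beta> \<Longrightarrow> T \<in> ml_maps Xs Y" "T \<in> \<A> Xs Y \<beta> \<Longrightarrow> 0 \<le> A Xs Y \<beta> T"
proof -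
  have "\<A> Xs Y \<beta> \<subseteq> bounded_ml_maps Xs Y" "banach_space (ideal_space \<A> A Xs Y \<beta>)"
    using ideal_banach[OF e] by blast+
  then show n: "normed_space (ideal_space \<A> A Xs Y \<beta>)" and v: "vs (ideal_space \<A> A Xs Y \<beta>)"
    and "T \<in> \<A> Xs Y \<beta> \<Longrightarrow> T \<in> ml_maps Xs Y" by (auto simp: banach_normed bounded_ml_maps_def)
  show "homog (ideal_space \<A> A Xs Y \<beta>) (A Xs Y \<beta>)" using homog_normed[OF n] by simp
  show "T \<in> \<A> Xs Y \<beta> \<Longrightarrow> 0 \<le> A Xs Y \<beta> T" using normed_spaceD(2)[OF n] by simp
qed

lemma ideal_prod:
  assumes e: "election Xs Y \<beta>" and "\<phi> \<in> carrier (beta_forms Xs \<beta>)" "y \<in> carrier Y"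
  shows "(\<lambda>x. \<phi> x \<odot>\<^bsub>Y\<^esub> y) \<in> \<A> Xs Y \<beta>"
  using ideal_prod'[OF assms] by blast

text \<open>The Lipschitz estimate (I2) is applied to the tensor of x and the zero tensor, at which
  T vanishes, and \<beta> of a decomposable tensor is at most the product of the norms. The
  Lipschitz constant is an infimum, so the argument runs through constants slightly above
  it.\<close>

lemma ideal_pointwise:
  assumes e: "election Xs Y \<beta>" and T: "T \<in> \<A> Xs Y \<beta>" and x: "x \<in> tuples Xs"
  shows "nrm Y (T x) \<le> A Xs Y \<beta> T * (\<Prod>i<length Xs. nrm (Xs ! i) (x ! i))"
proof -
  note E = electionD[OF e]
  have Tm: "T \<in> ml_maps Xs Y" by (rule idealD(4)[OF e T])
  have "lip Xs Y \<beta> T \<le> ereal (A Xs Y \<beta> T)" by (rule ideal_lip[OF e T])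
  define z where "z = map zero Xs"
  have z: "z \<in> tuples Xs" unfolding z_def by (rule tuple_zero[OF E(3)])
  have n: "0 < length Xs" using E(1) by simp
  have z0: "z ! 0 = \<zero>\<^bsub>Xs ! 0\<^esub>" using n by (simp add: z_def)
  have Tz: "T z = \<zero>\<^bsub>Y\<^esub>" by (rule ml_maps_zero_coord[OF E(3) E(6) Tm z n z0])
  have oz: "otimes Xs z = (\<lambda>_. 0)"
  proof
    fix \<phi> show "otimes Xs z \<phi> = 0"
      using ml_maps_zero_coord[OF E(3) vs_scalar_space _ z n z0, of \<phi>] by (auto simp: elem_tensor_def)
  qed
  have fo: "f_of Xs T (otimes Xs w) = T w" if "w \<in> tuples Xs" for w
    by (rule f_of_otimes[OF E(3) E(6) separated_normed[OF E(5)] Tm that])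
  have ox: "otimes Xs x \<in> carrier (tensor Xs \<beta>)" using x by simp
  have minus: "otimes Xs x \<ominus>\<^bsub>tensor Xs \<beta>\<^esub> otimes Xs z = otimes Xs x"
  proof -
    have "otimes Xs z \<in> carrier (tensor Xs \<beta>)" using z by simp
    from vs_minus_eq[OF vs_tens ox this] show ?thesis by (simp add: oz)
  qed
  have Tx: "T x \<in> carrier Y" using ml_mapsD(1)[OF Tm x] .
  have TY: "T x \<ominus>\<^bsub>Y\<^esub> T z = T x" using vs_minus_eq[OF E(6) Tx, of "T z"] Tz Tx E(6) by simp
  have \<beta>0: "0 \<le> \<beta> (otimes Xs x)" using E(7) ox by (auto simp: reasonable_def is_norm_def)
  have "nrm Y (T x) \<le> (A Xs Y \<beta> T + e) * \<beta> (otimes Xs x)" if e: "e > 0" for e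
  proof -
    have "lip Xs Y \<beta> T < ereal (A Xs Y \<beta> T + e)" using \<open>lip Xs Y \<beta> T \<le> ereal (A Xs Y \<beta> T)\<close> e
      by (metis ereal_less(2) less_add_same_cancel1 less_ereal.simps(1) order_le_less_trans)
    then obtain c where c: "c < A Xs Y \<beta> T + e"
      "\<forall>p\<in>Sig Xs. \<forall>q\<in>Sig Xs. nrm Y (f_of Xs T p \<ominus>\<^bsub>Y\<^esub> f_of Xs T q) \<le> c * \<beta> (p \<ominus>\<^bsub>tensor Xs \<beta>\<^esub> q)"
      unfolding lip_def Inf_less_iff by auto
    have "nrm Y (f_of Xs T (otimes Xs x) \<ominus>\<^bsub>Y\<^esub> f_of Xs T (otimes Xs z)) \<le> c * \<beta> (otimes Xs x \<ominus>\<^bsub>tensor Xs \<beta>\<^esub> otimes Xs z)"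
      using c(2) x z by (auto simp: Sig_def)
    then have "nrm Y (T x) \<le> c * \<beta> (otimes Xs x)" by (simp add: fo x z minus TY)
    also have "\<dots> \<le> (A Xs Y \<beta> T + e) * \<beta> (otimes Xs x)" using c(1) \<beta>0 by (intro mult_right_mono) auto
    finally show ?thesis .
  qed
  then have le: "nrm Y (T x) - A Xs Y \<beta> T * \<beta> (otimes Xs x) \<le> e * \<beta> (otimes Xs x)" if "e > 0" for e
    using that by (simp add: algebra_simps)
  have "nrm Y (T x) - A Xs Y \<beta> T * \<beta> (otimes Xs x) \<le> 0"
  proof (rule field_le_epsilon)
    fix e :: real assume e: "e > 0"
    have "e / (\<beta> (otimes Xs x) + 1) * \<beta> (otimes Xs x) \<le> e"
      using \<beta>0 e by (simp add: field_simps)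
    then show "nrm Y (T x) - A Xs Y \<beta> T * \<beta> (otimes Xs x) \<le> 0 + e"
      using le[of "e / (\<beta> (otimes Xs x) + 1)"] \<beta>0 e by simp
  qed
  then have "nrm Y (T x) \<le> A Xs Y \<beta> T * \<beta> (otimes Xs x)" by simp
  also have "\<dots> \<le> A Xs Y \<beta> T * (\<Prod>i<length Xs. nrm (Xs ! i) (x ! i))"
    using beta_otimes_le[OF e x] idealD(5)[OF e T] by (intro mult_left_mono)
  finally show ?thesis .
qed

text \<open>With this map in the place of R, whose linearization is the identity, axiom (I3) becomes
  a statement about composition on the left.\<close>

lemma sigma_op_otimes:
  assumes e: "election Xs Y \<beta>"
  shows "sigma_op Xs \<beta> Xs \<beta> (otimes Xs)"
    "opnorm (tensor Xs \<beta>) (tensor Xs \<beta>) (lin_ext Xs (tensor Xs \<beta>) (otimes Xs)) \<le> 1"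
proof -
  note E = electionD[OF e]
  have hom: "homog (tensor Xs \<beta>) \<beta>" using E(7) by (auto simp: reasonable_def is_norm_def homog_def)
  have id: "lin_ext Xs (tensor Xs \<beta>) (otimes Xs) u = u" if "u \<in> carrier (tensor Xs \<beta>)" for u
    by (rule linearize_eq[OF vs_tens is_lin_id _ that]) simp
  have "bounded_op (tensor Xs \<beta>) (tensor Xs \<beta>) (\<lambda>u. u)"
    by (rule bounded_opI[OF is_lin_id, where c = 1]) simp
  then have "bounded_op (tensor Xs \<beta>) (tensor Xs \<beta>) (lin_ext Xs (tensor Xs \<beta>) (otimes Xs))"
    using id by (subst bounded_op_cong[where g = "\<lambda>u. u"]) auto
  then show "sigma_op Xs \<beta> Xs \<beta> (otimes Xs)"
    using otimes_ml_maps[OF E(3)] by (auto simp: sigma_op_def Sig_def)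
  show "opnorm (tensor Xs \<beta>) (tensor Xs \<beta>) (lin_ext Xs (tensor Xs \<beta>) (otimes Xs)) \<le> 1"
    by (rule opnorm_le) (use hom id in auto)
qed

lemma ideal_left_comp:
  assumes e: "election Xs Y \<beta>" and W: "banach_space W" and T: "T \<in> \<A> Xs Y \<beta>" and S: "bounded_op Y W S"
  shows "(\<lambda>x. if x \<in> tuples Xs then S (T x) else \<zero>\<^bsub>W\<^esub>) \<in> \<A> Xs W \<beta>"
    "A Xs W \<beta> (\<lambda>x. if x \<in> tuples Xs then S (T x) else \<zero>\<^bsub>W\<^esub>) \<le> A Xs Y \<beta> T * opnorm Y W S"
proof -
  note E = electionD[OF e]
  have eW: "election Xs W \<beta>" using e W by (simp add: election_def)
  have Tm: "T \<in> ml_maps Xs Y" by (rule idealD(4)[OF e T])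
  have eq: "sigma_comp Xs W Xs S T (otimes Xs) = (\<lambda>x. if x \<in> tuples Xs then S (T x) else \<zero>\<^bsub>W\<^esub>)"
    using f_of_otimes[OF E(3) E(6) separated_normed[OF E(5)] Tm] by (auto simp: sigma_comp_def)
  have "sigma_comp Xs W Xs S T (otimes Xs) \<in> \<A> Xs W \<beta> \<and> A Xs W \<beta> (sigma_comp Xs W Xs S T (otimes Xs))
      \<le> opnorm (tensor Xs \<beta>) (tensor Xs \<beta>) (lin_ext Xs (tensor Xs \<beta>) (otimes Xs)) * A Xs Y \<beta> T * opnorm Y W S"
    using ideal_comp[OF _ T, of Xs W \<beta> "otimes Xs" S] e eW sigma_op_otimes(1)[OF e] S by blast
  moreover have "opnorm (tensor Xs \<beta>) (tensor Xs \<beta>) (lin_ext Xs (tensor Xs \<beta>) (otimes Xs)) * A Xs Y \<beta> T * opnorm Y W S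
      \<le> 1 * A Xs Y \<beta> T * opnorm Y W S"
    using sigma_op_otimes(2)[OF e] idealD(5)[OF e T] opnorm_nonneg[OF E(6) homog_normed[OF E(5)] homog_normed[OF banach_normed[OF W]] S]
    by (intro mult_right_mono) auto
  ultimately show "(\<lambda>x. if x \<in> tuples Xs then S (T x) else \<zero>\<^bsub>W\<^esub>) \<in> \<A> Xs W \<beta>"
    "A Xs W \<beta> (\<lambda>x. if x \<in> tuples Xs then S (T x) else \<zero>\<^bsub>W\<^esub>) \<le> A Xs Y \<beta> T * opnorm Y W S"
    unfolding eq by auto
qed

text \<open>Axiom (I1) puts products of functionals times a vector into the ideal, and these
  generate all multilinear maps on finite dimensional spaces.\<close>

lemma fin_ml_maps_ideal:
  assumes e: "election Es W \<beta>" and Es: "\<forall>E\<in>set Es. normed_space E \<and> fin_dim E" and T: "T \<in> ml_maps Es W"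
  shows "T \<in> \<A> Es W \<beta>"
proof (rule ml_maps_generated[OF Es _ _ _ _ T])
  note E = electionD[OF e] and I = idealD(2)[OF e]
  show "vs W" by (rule E(6))
  show "(\<lambda>_. \<zero>\<^bsub>W\<^esub>) \<in> \<A> Es W \<beta>" using vs_zero[OF I] by simp
  show "(\<lambda>x. S x \<oplus>\<^bsub>W\<^esub> T x) \<in> \<A> Es W \<beta>" if "S \<in> \<A> Es W \<beta>" "T \<in> \<A> Es W \<beta>" for S T
    using vs_add[OF I, of S T] that by simp
  fix f w assume f: "\<And>i. i < length Es \<Longrightarrow> f i \<in> carrier (dual (Es ! i))" and w: "w \<in> carrier W"
  let ?p = "\<lambda>x. if x \<in> tuples Es then \<Prod>i<length Es. f i (x ! i) else 0"
  have "?p \<in> carrier (beta_forms Es \<beta>)" by (rule prod_form_beta[OF E(2) E(7) f])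
  then have "(\<lambda>x. ?p x \<odot>\<^bsub>W\<^esub> w) \<in> \<A> Es W \<beta>" by (rule ideal_prod[OF e _ w])
  also have "(\<lambda>x. ?p x \<odot>\<^bsub>W\<^esub> w) = (\<lambda>x. if x \<in> tuples Es then (\<Prod>i<length Es. f i (x ! i)) \<odot>\<^bsub>W\<^esub> w else \<zero>\<^bsub>W\<^esub>)"
    using w E(6) by auto
  finally show "(\<lambda>x. if x \<in> tuples Es then (\<Prod>i<length Es. f i (x ! i)) \<odot>\<^bsub>W\<^esub> w else \<zero>\<^bsub>W\<^esub>) \<in> \<A> Es W \<beta>" .
qed

text \<open>The norm dual to A, expressed through the ideal alone and for an arbitrary copy (W, J)
  of the dual of F. \<open>afin_eq_nu\<close> identifies it with the norm that \<nu>
  defines.\<close>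

definition afin :: "('k, 'u) nspace list \<Rightarrow> ('k, 'b) nspace \<Rightarrow> ((('u list \<Rightarrow> 'k) \<Rightarrow> 'k) \<Rightarrow> real) \<Rightarrow> ('k, 'u) nspace \<Rightarrow>
    ('u \<Rightarrow> 'b \<Rightarrow> 'k) \<Rightarrow> (('u list \<times> 'b \<Rightarrow> 'k) \<Rightarrow> 'k) \<Rightarrow> real" where
  "afin Es F \<beta> W J v = opnorm (ideal_space \<A> A Es W \<beta>) scalar_space (\<lambda>T. v (pform Es F J T))"

text \<open>An operator norm yields estimates only for bounded operators. Boundedness comes from any
  one representation of v and the pointwise estimate for T.\<close>

lemma pform_bounded:
  fixes F :: "('k, 'b) nspace"
  assumes e: "election Es W \<beta>" and F: "normed_space F" and J: "dual_copy F W J"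
    and v: "v \<in> carrier (tensor_with Es F N)"
  shows "bounded_op (ideal_space \<A> A Es W \<beta>) scalar_space (\<lambda>T. v (pform Es F J T))"
proof -
  note E = electionD[OF e] and I = idealD[OF e] and D = dual_copyD[OF F J] and Fv = normed_spaceD(1)[OF F]
  note b = pairing_on_dual_copy[OF F J]
  have m: "pform Es F J T \<in> forms_with (forms Es) F" if "T \<in> \<A> Es W \<beta>" for T
    by (rule pform_mem[OF E(3) Fv b I(4)[OF that]])
  obtain cds where cds: "snd ` set cds \<subseteq> tuples Es \<times> carrier F" "v = tsum (forms_with (forms Es) F) cds"
    using v by (auto simp: carrier_tens)
  show ?thesis
  proof (rule bounded_opI)
    show "is_lin (ideal_space \<A> A Es W \<beta>) scalar_space (\<lambda>T. v (pform Es F J T))"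
      unfolding is_lin_def
    proof (intro conjI ballI allI)
      fix S T assume S: "S \<in> carrier (ideal_space \<A> A Es W \<beta>)" and T: "T \<in> carrier (ideal_space \<A> A Es W \<beta>)"
      let ?U = "S \<oplus>\<^bsub>ideal_space \<A> A Es W \<beta>\<^esub> T"
      have U: "?U \<in> carrier (ideal_space \<A> A Es W \<beta>)" using S T I(2) by (intro vs_add)
      have "v (pform Es F J ?U) = v (pform Es F J S) + v (pform Es F J T)"
      proof (rule tens_additive(1)[OF v])
        fix d assume "d \<in> tuples Es \<times> carrier F"
        then show "pform Es F J ?U d = pform Es F J S d + pform Es F J T d"
          using ml_mapsD(1)[OF I(4)] S T is_linD(2)[OF D(7)] by (auto simp: pform_def)
      qed (use m S T U in auto)
      then show "v (pform Es F J ?U) = v (pform Es F J S) \<oplus>\<^bsub>scalar_space\<^esub> v (pform Es F J T)" by simp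
    next
      fix c T assume T: "T \<in> carrier (ideal_space \<A> A Es W \<beta>)"
      let ?U = "c \<odot>\<^bsub>ideal_space \<A> A Es W \<beta>\<^esub> T"
      have U: "?U \<in> carrier (ideal_space \<A> A Es W \<beta>)" using T I(2) by (intro vs_smult)
      have "v (pform Es F J ?U) = c * v (pform Es F J T)"
      proof (rule tens_additive(2)[OF v])
        fix d assume "d \<in> tuples Es \<times> carrier F"
        then show "pform Es F J ?U d = c * pform Es F J T d"
          using ml_mapsD(1)[OF I(4)] T is_linD(3)[OF D(7)] by (auto simp: pform_def)
      qed (use m T U in auto)
      then show "v (pform Es F J ?U) = c \<odot>\<^bsub>scalar_space\<^esub> v (pform Es F J T)" by simp
    qed simp
    fix T assume "T \<in> carrier (ideal_space \<A> A Es W \<beta>)"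
    then have T: "T \<in> \<A> Es W \<beta>" by simp
    let ?n = "\<lambda>d. (\<Prod>i<length Es. nrm (Es ! i) (fst d ! i)) * nrm F (snd d)"
    have "norm (v (pform Es F J T)) = norm (\<Sum>(c, d)\<leftarrow>cds. c * J (T (fst d)) (snd d))"
      unfolding cds(2) pform_tsum[OF E(3) Fv b I(4)[OF T] cds(1)] ..
    also have "\<dots> \<le> (\<Sum>(c, d)\<leftarrow>cds. norm (c * J (T (fst d)) (snd d)))"
      using norm_sum_list_le[of "\<lambda>(c, d). c * J (T (fst d)) (snd d)" cds] by (simp add: case_prod_unfold)
    also have "\<dots> \<le> (\<Sum>(c, d)\<leftarrow>cds. (norm c * ?n d) * A Es W \<beta> T)"
    proof (rule sum_list_mono)
      fix cd assume "cd \<in> set cds"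
      then have "snd cd \<in> tuples Es \<times> carrier F" using cds(1) by blast
      then obtain c x y where cd: "cd = (c, x, y)" "x \<in> tuples Es" "y \<in> carrier F" by (cases cd) auto
      have "norm (J (T x) y) \<le> nrm W (T x) * nrm F y" by (rule D(6)[OF ml_mapsD(1)[OF I(4)[OF T] cd(2)] cd(3)])
      also have "\<dots> \<le> (A Es W \<beta> T * (\<Prod>i<length Es. nrm (Es ! i) (x ! i))) * nrm F y"
        by (rule mult_right_mono[OF ideal_pointwise[OF e T cd(2)] normed_spaceD(2)[OF F cd(3)]])
      finally have "norm c * norm (J (T x) y)
          \<le> norm c * ((A Es W \<beta> T * (\<Prod>i<length Es. nrm (Es ! i) (x ! i))) * nrm F y)"
        by (rule mult_left_mono) simp
      then show "(case cd of (c, d) \<Rightarrow> norm (c * J (T (fst d)) (snd d))) \<le> (case cd of (c, d) \<Rightarrow> norm c * ?n d * A Es W \<beta> T)"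
        by (simp add: cd norm_mult mult.assoc mult.left_commute mult.commute)
    qed
    also have "\<dots> = (\<Sum>(c, d)\<leftarrow>cds. norm c * ?n d) * A Es W \<beta> T"
      by (simp add: sum_list_mult_const case_prod_unfold)
    finally show "nrm scalar_space (v (pform Es F J T)) \<le> (\<Sum>(c, d)\<leftarrow>cds. norm c * ?n d) * nrm (ideal_space \<A> A Es W \<beta>) T"
      by simp
  qed
qed

lemma afin_bound:
  fixes F :: "('k, 'b) nspace"
  assumes e: "election Es W \<beta>" and F: "normed_space F" and J: "dual_copy F W J"
    and v: "v \<in> carrier (tensor_with Es F N)" and T: "T \<in> \<A> Es W \<beta>"
  shows "norm (v (pform Es F J T)) \<le> A Es W \<beta> T * afin Es F \<beta> W J v"
  using opnorm_bound[OF idealD(2)[OF e] _ _ pform_bounded[OF e F J v], of T] idealD(3)[OF e] T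
  by (simp add: afin_def mult.commute)

lemma afin_elem_le:
  fixes F :: "('k, 'b) nspace"
  assumes e: "election Es W \<beta>" and F: "normed_space F" and J: "dual_copy F W J"
    and x: "x \<in> tuples Es" and y: "y \<in> carrier F"
  shows "afin Es F \<beta> W J (otimes_with Es F x y) \<le> (\<Prod>i<length Es. nrm (Es ! i) (x ! i)) * nrm F y"
  unfolding afin_def
proof (rule opnorm_le[OF idealD(2)[OF e]])
  note E = electionD[OF e] and I = idealD[OF e] and D = dual_copyD[OF F J] and Fv = normed_spaceD(1)[OF F]
  show "0 \<le> (\<Prod>i<length Es. nrm (Es ! i) (x ! i)) * nrm F y"
    using prod_nrm_nonneg[OF E(2) x] normed_spaceD(2)[OF F y] by simp
  fix T assume "T \<in> carrier (ideal_space \<A> A Es W \<beta>)"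
  then have T: "T \<in> \<A> Es W \<beta>" by simp
  have "otimes_with Es F x y (pform Es F J T) = J (T x) y"
    using pform_mem[OF E(3) Fv pairing_on_dual_copy[OF F J] I(4)[OF T]] x y by (simp add: elem_tensor_def pform_def)
  moreover have "norm (J (T x) y) \<le> nrm W (T x) * nrm F y" by (rule D(6)[OF ml_mapsD(1)[OF I(4)[OF T] x] y])
  moreover have "\<dots> \<le> (A Es W \<beta> T * (\<Prod>i<length Es. nrm (Es ! i) (x ! i))) * nrm F y"
    by (rule mult_right_mono[OF ideal_pointwise[OF e T x] normed_spaceD(2)[OF F y]])
  ultimately show "nrm scalar_space (otimes_with Es F x y (pform Es F J T))
      \<le> (\<Prod>i<length Es. nrm (Es ! i) (x ! i)) * nrm F y * nrm (ideal_space \<A> A Es W \<beta>) T"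
    by (simp add: mult.assoc mult.left_commute mult.commute)
qed (use idealD(3)[OF e] in simp)

lemma afin_homog:
  fixes F :: "('k, 'b) nspace"
  assumes e: "election Es W \<beta>" and F: "normed_space F" and J: "dual_copy F W J"
    and v: "v \<in> carrier (tensor_with Es F N)"
  shows "0 \<le> afin Es F \<beta> W J v" "afin Es F \<beta> W J (\<lambda>\<phi>. c * v \<phi>) \<le> norm c * afin Es F \<beta> W J v"
proof -
  note I = idealD[OF e]
  have h: "homog (ideal_space \<A> A Es W \<beta>) (nrm (ideal_space \<A> A Es W \<beta>))" using I(3) by simp
  show n: "0 \<le> afin Es F \<beta> W J v"
    unfolding afin_def by (rule opnorm_nonneg[OF I(2) h _ pform_bounded[OF e F J v]]) simp
  show "afin Es F \<beta> W J (\<lambda>\<phi>. c * v \<phi>) \<le> norm c * afin Es F \<beta> W J v"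
    unfolding afin_def[of _ _ _ _ _ "\<lambda>\<phi>. c * v \<phi>"]
  proof (rule opnorm_le[OF I(2) h])
    fix T assume "T \<in> carrier (ideal_space \<A> A Es W \<beta>)"
    then have "norm (v (pform Es F J T)) \<le> A Es W \<beta> T * afin Es F \<beta> W J v" by (intro afin_bound[OF e F J v]) simp
    then show "nrm scalar_space (c * v (pform Es F J T)) \<le> norm c * afin Es F \<beta> W J v * nrm (ideal_space \<A> A Es W \<beta>) T"
      using mult_left_mono[of _ _ "norm c"] by (simp add: norm_mult mult.assoc mult.commute[of "A Es W \<beta> T"])
  qed (use n in simp)
qed

text \<open>A norming functional for \<open>T\<close> on the finite dimensional space of all multilinear maps is a
  combination of evaluations at basis tuples, that is, it is given by a tensor.\<close>

lemma afin_norming: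
  fixes F :: "('k, 'b) nspace"
  assumes e: "election Es W \<beta>" and F: "normed_space F" "fin_dim F" and J: "dual_copy F W J"
    and Es: "\<forall>E\<in>set Es. normed_space E \<and> fin_dim E" and T: "T \<in> \<A> Es W \<beta>" and c: "0 \<le> c"
    and le: "\<And>v. v \<in> carrier (tensor_with Es F N) \<Longrightarrow> norm (v (pform Es F J T)) \<le> c * afin Es F \<beta> W J v"
  shows "A Es W \<beta> T \<le> c"
proof -
  note E = electionD[OF e] and I = idealD[OF e] and D = dual_copyD[OF F(1) J] and Fv = normed_spaceD(1)[OF F(1)]
  let ?I = "ideal_space \<A> A Es W \<beta>"
  note b = pairing_on_dual_copy[OF F(1) J]
  have h: "homog ?I (nrm ?I)" using I(3) by simp
  obtain \<psi> where \<psi>: "\<psi> \<in> lin_forms ?I" "\<psi> T = of_real (A Es W \<beta> T)" "\<And>S. S \<in> \<A> Es W \<beta> \<Longrightarrow> norm (\<psi> S) \<le> A Es W \<beta> S"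
    using hahn_banach_norming[OF I(2) normed_seminorm[OF I(1)], of T] T by auto
  have "\<forall>i. \<exists>B. i < length Es \<longrightarrow> set B \<subseteq> carrier (Es ! i) \<and> lspan (Es ! i) (set B) = carrier (Es ! i)"
    using fin_dim_iff[OF normed_spaceD(1)] Es by (metis finite_list nth_mem)
  then obtain B where B: "\<And>i. i < length Es \<Longrightarrow> set (B i) \<subseteq> carrier (Es ! i) \<and> lspan (Es ! i) (set (B i)) = carrier (Es ! i)"
    by metis
  obtain G where G: "set G \<subseteq> carrier F" "lspan F (set G) = carrier F"
    using fin_dim_iff[OF Fv] F(2) by (metis finite_list)
  define xs where "xs = product_lists (map B [0..<length Es])"
  have xs: "x \<in> set xs \<longleftrightarrow> length x = length Es \<and> (\<forall>i<length Es. x ! i \<in> set (B i))" for x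
    by (auto simp: xs_def product_lists_set list_all2_conv_all_nth)
  have xt: "x \<in> tuples Es" if "x \<in> set xs" for x
    using that B by (auto simp: xs in_tuples_iff)
  define ev where "ev d = (\<lambda>S. if S \<in> \<A> Es W \<beta> then J (S (fst d)) (snd d) else 0)" for d
  define ds where "ds = List.product xs G"
  have ds: "d \<in> tuples Es \<times> carrier F" if "d \<in> set ds" for d
    using that xt G by (auto simp: ds_def)
  have ev: "ev d \<in> lin_forms ?I" if d: "d \<in> tuples Es \<times> carrier F" for d
  proof (rule lin_formsI)
    fix S T assume S: "S \<in> carrier ?I" and T: "T \<in> carrier ?I"
    show "ev d (S \<oplus>\<^bsub>?I\<^esub> T) = ev d S + ev d T"
      using vs_add[OF I(2) S T] S T d is_linD(2)[OF D(7)] ml_mapsD(1)[OF I(4)] by (auto simp: ev_def)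
    fix c show "ev d (c \<odot>\<^bsub>?I\<^esub> S) = c * ev d S"
      using vs_smult[OF I(2) S, of c] S d is_linD(3)[OF D(7)] ml_mapsD(1)[OF I(4)] by (auto simp: ev_def)
  qed (simp add: ev_def)
  \<comment> \<open>A map whose values at the tuples of generators pair to zero with generators of F
    is zero. So \<psi> vanishes where these finitely many evaluations do, and is a combination of
    them.\<close>
  have ker: "\<psi> S = 0" if S: "S \<in> carrier ?I" and 0: "\<forall>f\<in>set (map ev ds). f S = 0" for S
  proof -
    have SA: "S \<in> \<A> Es W \<beta>" using S by simp
    note Sm = I(4)[OF SA]
    have S0: "S x = \<zero>\<^bsub>W\<^esub>" if x: "x \<in> tuples Es" "\<forall>i<length Es. x ! i \<in> set (B i)" for x
    proof (rule D(10)[OF ml_mapsD(1)[OF Sm x(1)]])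
      have xl: "x \<in> set xs" using x by (auto simp: xs in_tuples_iff)
      note Jl = D(4)[OF ml_mapsD(1)[OF Sm x(1)]]
      have "subsp F {y \<in> carrier F. J (S x) y = 0}"
        using lin_formsD[OF Jl] lin_forms_zero[OF Fv Jl] Fv by (auto simp: subsp_def)
      moreover have "set G \<subseteq> {y \<in> carrier F. J (S x) y = 0}"
        using G 0 xl SA by (auto simp: ds_def ev_def)
      ultimately show "\<forall>y\<in>carrier F. J (S x) y = 0" using lspan_minimal G(2) by blast
    qed
    have "S x = \<zero>\<^bsub>W\<^esub>" for x
    proof (cases "x \<in> tuples Es")
      case True
      show ?thesis
        by (rule ml_maps_eq_zero[where B = "\<lambda>i. set (B i)", OF E(3) E(6) Sm _ _ S0 True]) (use B in auto)
    qed (rule ml_mapsD(2)[OF Sm])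
    then have "S = \<zero>\<^bsub>?I\<^esub>" by auto
    then show ?thesis using lin_forms_zero[OF I(2) \<psi>(1)] by simp
  qed
  have "set (map ev ds) \<subseteq> lin_forms ?I" using ev ds by auto
  from lin_forms_kernel[OF I(2) this \<psi>(1) ker]
  obtain cs where cs: "length cs = length (map ev ds)" "\<forall>S. \<psi> S = (\<Sum>(c, f)\<leftarrow>zip cs (map ev ds). c * f S)" by blast
  \<comment> \<open>The coefficients of \<psi> in terms of evaluations, read as a tensor; evaluating
    it at the form of S returns \<psi> S. Its dual norm is at most 1 because \<psi> is dominated by
    A.\<close>
  define v where "v = tsum (forms_with (forms Es) F) (zip cs ds)"
  have mem: "snd ` set (zip cs ds) \<subseteq> tuples Es \<times> carrier F" using ds by (auto dest!: set_zip_rightD)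
  have v: "v \<in> carrier (tensor_with Es F N)" unfolding v_def using mem by (rule tsum_carrier)
  have vS: "v (pform Es F J S) = \<psi> S" if S: "S \<in> \<A> Es W \<beta>" for S
    unfolding v_def pform_tsum[OF E(3) Fv b I(4)[OF S] mem] cs(2)[rule_format]
    using S by (simp add: zip_map2 comp_def case_prod_unfold ev_def)
  have "afin Es F \<beta> W J v \<le> 1"
    unfolding afin_def by (rule opnorm_le[OF I(2) h]) (use vS \<psi>(3) in auto)
  then have "c * afin Es F \<beta> W J v \<le> c" using c by (simp add: mult_left_le)
  moreover have "norm (v (pform Es F J T)) = A Es W \<beta> T" using vS[OF T] \<psi>(2) I(5)[OF T] by simp
  ultimately show ?thesis using le[OF v] by simp
qed

text \<open>Two copies of the dual of F are linked by the isometry that preserves the represented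
  functional, and composing with an isometry does not increase A.\<close>

lemma change_copy:
  fixes F :: "('k, 'b) nspace"
  assumes e: "election Es W \<beta>" and F: "normed_space F" and J: "dual_copy F W J" and J': "dual_copy F W' J'"
    and T: "T \<in> \<A> Es W \<beta>"
  shows "\<exists>T'\<in>\<A> Es W' \<beta>. A Es W' \<beta> T' \<le> A Es W \<beta> T \<and> pform Es F J' T' = pform Es F J T"
proof -
  note D = dual_copyD[OF F J] and D' = dual_copyD[OF F J'] and I = idealD[OF e]
  have "\<forall>w\<in>carrier W. \<exists>w'. w' \<in> carrier W' \<and> J' w' = J w" using D'(8)[OF D(3)] by blast
  then obtain S where S: "\<And>w. w \<in> carrier W \<Longrightarrow> S w \<in> carrier W' \<and> J' (S w) = J w" by metis
  have J'lin: "J' (w \<oplus>\<^bsub>W'\<^esub> z) = (\<lambda>y. J' w y + J' z y)" "J' (c \<odot>\<^bsub>W'\<^esub> w) = (\<lambda>y. c * J' w y)"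
    if "w \<in> carrier W'" "z \<in> carrier W'" for w z c
    using is_linD(2,3)[OF D'(7)] that by (auto simp: fun_eq_iff)
  have Jlin: "J (w \<oplus>\<^bsub>W\<^esub> z) = (\<lambda>y. J w y + J z y)" "J (c \<odot>\<^bsub>W\<^esub> w) = (\<lambda>y. c * J w y)"
    if "w \<in> carrier W" "z \<in> carrier W" for w z c
    using is_linD(2,3)[OF D(7)] that by (auto simp: fun_eq_iff)
  note Wv = normed_spaceD(1)[OF D(2)] and Wv' = normed_spaceD(1)[OF D'(2)]
  have lin: "is_lin W W' S"
    unfolding is_lin_def
  proof (intro conjI ballI allI Pi_I)
    fix w z assume w: "w \<in> carrier W" and z: "z \<in> carrier W"
    show "S (w \<oplus>\<^bsub>W\<^esub> z) = S w \<oplus>\<^bsub>W'\<^esub> S z"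
      using S[OF w] S[OF z] S[OF vs_add[OF Wv w z]] Jlin(1)[OF w z] J'lin(1)[of "S w" "S z"] Wv'
      by (intro D'(9)) auto
  next
    fix c w assume w: "w \<in> carrier W"
    show "S (c \<odot>\<^bsub>W\<^esub> w) = c \<odot>\<^bsub>W'\<^esub> S w"
      using S[OF w] S[OF vs_smult[OF Wv w, of c]] Jlin(2)[OF w w] J'lin(2)[of "S w" "S w"] Wv'
      by (intro D'(9)) auto
  qed (use S in auto)
  have iso: "nrm W' (S w) = nrm W w" if "w \<in> carrier W" for w
    using D(5)[OF that] D'(5)[of "S w"] S[OF that] by simp
  have bS: "bounded_op W W' S" by (rule bounded_opI[OF lin, where c = 1]) (use iso in simp)
  have nS: "opnorm W W' S \<le> 1" by (rule opnorm_le[OF Wv homog_normed[OF D(2)]]) (use iso in auto)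
  note C = ideal_left_comp[OF e D'(1) T bS]
  have "A Es W \<beta> T * opnorm W W' S \<le> A Es W \<beta> T" using nS I(5)[OF T] by (simp add: mult_left_le)
  moreover have "pform Es F J' (\<lambda>x. if x \<in> tuples Es then S (T x) else \<zero>\<^bsub>W'\<^esub>) = pform Es F J T"
    using S ml_mapsD(1)[OF I(4)[OF T]] by (auto simp: pform_def fun_eq_iff)
  ultimately show ?thesis using C by (intro bexI[of _ "\<lambda>x. if x \<in> tuples Es then S (T x) else \<zero>\<^bsub>W'\<^esub>"]) auto
qed

text \<open>Association is an isometric bijection, so it carries the unit ball of \<nu> onto that of
  A, and the pairing with v turns into evaluation of v at the form of the corresponding map. The two
  operator norms are suprema of the same set.\<close>

lemma afin_eq_nu:
  fixes F :: "('k, 'b) nspace"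
  assumes assoc: "associated \<A> A \<nu>" and e: "election Es W \<beta>" and Es: "\<forall>E\<in>set Es. normed_space E \<and> fin_dim E"
    and F: "normed_space F" "fin_dim F" and J: "dual_copy F W J" and v: "v \<in> carrier (tensor_with Es F N)"
  shows "opnorm (nu_space \<nu> Es W \<beta>) scalar_space (pairing Es F \<beta> W J v) = afin Es F \<beta> W J v"
proof -
  note E = electionD[OF e] and I = idealD[OF e] and D = dual_copyD[OF F(1) J] and Fv = normed_spaceD(1)[OF F(1)]
  note b = pairing_on_dual_copy[OF F(1) J] and Wv = normed_spaceD(1)[OF D(2)]
  let ?I = "ideal_space \<A> A Es W \<beta>" and ?BF = "beta_forms Es \<beta>" and ?nu = "nu_space \<nu> Es W \<beta>"
  let ?D = "carrier ?BF \<times> carrier W" and ?M = "forms_with (lin_forms ?BF) W"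
  define \<Phi> where "\<Phi> = lin_ext2 ?BF W ?I (\<lambda>\<phi> w x. \<phi> x \<odot>\<^bsub>W\<^esub> w)"
  have "fin_election Es W \<beta>"
    using E Es dual_copy_fin_dim[OF F J] D(2) by (simp add: fin_election_def)
  then have iso: "isometric_iso ?nu ?I \<Phi>" using assoc unfolding associated_def \<Phi>_def by blast
  have prod: "(\<lambda>x. \<phi> x \<odot>\<^bsub>W\<^esub> w) \<in> \<A> Es W \<beta>" if "\<phi> \<in> carrier ?BF" "w \<in> carrier W" for \<phi> w
    by (rule ideal_prod[OF e that])
  \<comment> \<open>\<open>associated\<close> speaks about a chosen linearization. That it takes the
    intended values on elementary tensors needs the universal property: any linear form on the ideal
    space, applied to \<phi> times w, is linear in \<phi> and in w.\<close>
  have \<Phi>_elem: "\<Phi> (elem_tensor ?M (\<phi>, w)) = (\<lambda>x. \<phi> x \<odot>\<^bsub>W\<^esub> w)" if \<phi>: "\<phi> \<in> carrier ?BF" and w: "w \<in> carrier W" for \<phi> w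
  proof -
    have "linearize ?D ?M ?I (\<lambda>(\<phi>, w) x. \<phi> x \<odot>\<^bsub>W\<^esub> w) (elem_tensor ?M (\<phi>, w)) = (case (\<phi>, w) of (\<phi>, w) \<Rightarrow> \<lambda>x. \<phi> x \<odot>\<^bsub>W\<^esub> w)"
    proof (rule linearize_separated(2)[OF I(2) separated_normed[OF I(1)]])
      fix l assume l: "l \<in> lin_forms ?I"
      let ?m = "\<lambda>(\<phi>, w). if \<phi> \<in> carrier ?BF \<and> w \<in> carrier W then l (\<lambda>x. \<phi> x \<odot>\<^bsub>W\<^esub> w) else 0"
      have "?m \<in> ?M"
        unfolding forms_with_def
      proof (intro CollectI conjI ballI allI)
        fix w assume w: "w \<in> carrier W"
        show "(\<lambda>\<phi>. ?m (\<phi>, w)) \<in> lin_forms ?BF"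
        proof (rule lin_formsI)
          fix \<phi> \<psi> assume \<phi>: "\<phi> \<in> carrier ?BF" and \<psi>: "\<psi> \<in> carrier ?BF"
          have "l (\<lambda>x. (\<phi> x + \<psi> x) \<odot>\<^bsub>W\<^esub> w) = l (\<lambda>x. \<phi> x \<odot>\<^bsub>W\<^esub> w) + l (\<lambda>x. \<psi> x \<odot>\<^bsub>W\<^esub> w)"
            using lin_formsD(3)[OF l, of "\<lambda>x. \<phi> x \<odot>\<^bsub>W\<^esub> w" "\<lambda>x. \<psi> x \<odot>\<^bsub>W\<^esub> w"] prod[OF \<phi> w] prod[OF \<psi> w] w Wv
            by (simp add: vs_smult_left_distrib)
          then show "?m (\<phi> \<oplus>\<^bsub>?BF\<^esub> \<psi>, w) = ?m (\<phi>, w) + ?m (\<psi>, w)"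
            using \<phi> \<psi> w beta_forms_closed(1)[OF E(3) \<phi> \<psi>] by simp
        next
          fix c \<phi> assume \<phi>: "\<phi> \<in> carrier ?BF"
          have "l (\<lambda>x. (c * \<phi> x) \<odot>\<^bsub>W\<^esub> w) = c * l (\<lambda>x. \<phi> x \<odot>\<^bsub>W\<^esub> w)"
            using lin_formsD(4)[OF l, of "\<lambda>x. \<phi> x \<odot>\<^bsub>W\<^esub> w" c] prod[OF \<phi> w] w Wv by simp
          then show "?m (c \<odot>\<^bsub>?BF\<^esub> \<phi>, w) = c * ?m (\<phi>, w)"
            using \<phi> w beta_forms_closed(2)[OF E(3) \<phi>, of c] by simp
        qed simp
      next
        fix \<phi>
        show "(\<lambda>w. ?m (\<phi>, w)) \<in> lin_forms W"
        proof (cases "\<phi> \<in> carrier ?BF")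
          case \<phi>: True
          show ?thesis
          proof (rule lin_formsI)
            fix w z assume w: "w \<in> carrier W" and z: "z \<in> carrier W"
            have "l (\<lambda>x. \<phi> x \<odot>\<^bsub>W\<^esub> (w \<oplus>\<^bsub>W\<^esub> z)) = l (\<lambda>x. \<phi> x \<odot>\<^bsub>W\<^esub> w) + l (\<lambda>x. \<phi> x \<odot>\<^bsub>W\<^esub> z)"
              using lin_formsD(3)[OF l, of "\<lambda>x. \<phi> x \<odot>\<^bsub>W\<^esub> w" "\<lambda>x. \<phi> x \<odot>\<^bsub>W\<^esub> z"] prod[OF \<phi> w] prod[OF \<phi> z] w z Wv
              by (simp add: vs_smult_right_distrib)
            then show "?m (\<phi>, w \<oplus>\<^bsub>W\<^esub> z) = ?m (\<phi>, w) + ?m (\<phi>, z)" using \<phi> w z Wv by simp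
          next
            fix c w assume w: "w \<in> carrier W"
            have "l (\<lambda>x. \<phi> x \<odot>\<^bsub>W\<^esub> (c \<odot>\<^bsub>W\<^esub> w)) = c * l (\<lambda>x. \<phi> x \<odot>\<^bsub>W\<^esub> w)"
              using lin_formsD(4)[OF l, of "\<lambda>x. \<phi> x \<odot>\<^bsub>W\<^esub> w" c] prod[OF \<phi> w] w Wv by (simp add: mult.commute)
            then show "?m (\<phi>, c \<odot>\<^bsub>W\<^esub> w) = c * ?m (\<phi>, w)" using \<phi> w Wv by simp
          qed simp
        qed (simp add: lin_forms_0)
      qed
      then show "\<exists>m\<in>?M. \<forall>d\<in>?D. m d = l (case d of (\<phi>, w) \<Rightarrow> \<lambda>x. \<phi> x \<odot>\<^bsub>W\<^esub> w)" by (rule bexI[rotated]) auto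
    qed (use prod \<phi> w in auto)
    then show ?thesis by (simp add: \<Phi>_def)
  qed
  have \<Phi>lin: "is_lin ?nu ?I \<Phi>" and \<Phi>bij: "bij_betw \<Phi> (carrier ?nu) (carrier ?I)"
    and \<Phi>n: "\<And>t. t \<in> carrier ?nu \<Longrightarrow> A Es W \<beta> (\<Phi> t) = nrm ?nu t"
    using iso by (auto simp: isometric_iso_def)
  have pair: "pairing Es F \<beta> W J v t = v (pform Es F J (\<Phi> t))" if t: "t \<in> carrier ?nu" for t
    unfolding pairing_def
  proof (rule linearize_eq[OF vs_scalar_space is_lin_comp[OF \<Phi>lin bounded_opD(1)[OF pform_bounded[OF e F(1) J v]]] _ t])
    fix d assume "d \<in> ?D"
    then obtain \<phi> w where d: "d = (\<phi>, w)" "\<phi> \<in> carrier ?BF" "w \<in> carrier W" by auto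
    have "lin_ext_with Es F scalar_space (\<lambda>x y. \<phi> x * J w y) v = v (pform Es F J (\<lambda>x. \<phi> x \<odot>\<^bsub>W\<^esub> w))"
      by (rule linearize_scalar[OF pform_mem[OF E(3) Fv b I(4)[OF prod[OF d(2,3)]]] _ v])
        (use is_linD(3)[OF D(7) d(3)] in \<open>auto simp: pform_def\<close>)
    then show "v (pform Es F J (\<Phi> (elem_tensor ?M d))) = (case d of (\<phi>, w) \<Rightarrow> lin_ext_with Es F scalar_space (\<lambda>x y. \<phi> x * J w y) v)"
      using \<Phi>_elem[OF d(2,3)] d(1) by simp
  qed
  have "(\<lambda>t. norm (pairing Es F \<beta> W J v t)) ` {t \<in> carrier ?nu. nrm ?nu t \<le> 1}
      = (\<lambda>T. norm (v (pform Es F J T))) ` {T \<in> carrier ?I. nrm ?I T \<le> 1}" (is "?L = ?R")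
  proof
    show "?L \<subseteq> ?R"
    proof clarify
      fix t assume t: "t \<in> carrier ?nu" "nrm ?nu t \<le> 1"
      have "\<Phi> t \<in> carrier ?I" using is_linD(1)[OF \<Phi>lin t(1)] .
      then show "norm (pairing Es F \<beta> W J v t) \<in> ?R"
        using pair[OF t(1)] \<Phi>n[OF t(1)] t(2) by (intro image_eqI[of _ _ "\<Phi> t"]) auto
    qed
    show "?R \<subseteq> ?L"
    proof clarify
      fix T assume T: "T \<in> carrier ?I" "nrm ?I T \<le> 1"
      obtain t where t: "t \<in> carrier ?nu" "T = \<Phi> t" using \<Phi>bij T(1) unfolding bij_betw_def by blast
      then show "norm (v (pform Es F J T)) \<in> ?L"
        using pair[OF t(1)] \<Phi>n[OF t(1)] T(2) by (intro image_eqI[of _ _ t]) auto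
    qed
  qed
  then show ?thesis by (simp add: opnorm_def afin_def)
qed

text \<open>\<open>alpha_fin\<close> is computed with one chosen copy of the dual of F, whereas the
  maps take values in an arbitrary copy W, for instance a quotient. \<open>change_copy\<close> moves
  the map to the chosen copy and back.\<close>

theorem fin_duality:
  fixes F :: "('k, 'b) nspace"
  assumes assoc: "associated \<A> A \<nu>" and Es: "\<forall>E\<in>set Es. normed_space E \<and> fin_dim E" and e: "election Es W \<beta>"
    and F: "normed_space F" "fin_dim F" and J: "dual_copy F W J"
  shows "T \<in> ml_maps Es W \<Longrightarrow> T \<in> \<A> Es W \<beta>"
    "T \<in> ml_maps Es W \<Longrightarrow> v \<in> carrier (tensor_with Es F N) \<Longrightarrow>
      norm (v (pform Es F J T)) \<le> A Es W \<beta> T * alpha_fin \<nu> Es F \<beta> v"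
    "T \<in> ml_maps Es W \<Longrightarrow> 0 \<le> c \<Longrightarrow>
      (\<And>v. v \<in> carrier (tensor_with Es F N) \<Longrightarrow> norm (v (pform Es F J T)) \<le> c * alpha_fin \<nu> Es F \<beta> v) \<Longrightarrow> A Es W \<beta> T \<le> c"
    "v \<in> carrier (tensor_with Es F N) \<Longrightarrow> 0 \<le> alpha_fin \<nu> Es F \<beta> v"
    "v \<in> carrier (tensor_with Es F N) \<Longrightarrow> alpha_fin \<nu> Es F \<beta> (\<lambda>\<phi>. a * v \<phi>) \<le> norm a * alpha_fin \<nu> Es F \<beta> v"
    "x \<in> tuples Es \<Longrightarrow> y \<in> carrier F \<Longrightarrow>
      alpha_fin \<nu> Es F \<beta> (otimes_with Es F x y) \<le> (\<Prod>i<length Es. nrm (Es ! i) (x ! i)) * nrm F y"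
proof -
  obtain W' :: "('k, 'u) nspace" and J' where c: "(SOME (W, J). dual_copy F W J) = (W', J')" by force
  have "case (SOME (W :: ('k, 'u) nspace, J). dual_copy F W J) of (W, J) \<Rightarrow> dual_copy F W J"
    by (rule someI[of "\<lambda>(W, J). dual_copy F W J" "(W, J)"]) (use J in simp)
  then have J': "dual_copy F W' J'" using c by simp
  have e': "election Es W' \<beta>" using e dual_copyD(1)[OF F(1) J'] by (simp add: election_def)
  have af: "alpha_fin \<nu> Es F \<beta> v = afin Es F \<beta> W' J' v" if "v \<in> carrier (tensor_with Es F N)" for v N
    unfolding alpha_fin_def Let_def c prod.case by (rule afin_eq_nu[OF assoc e' Es F J' that])
  show TA: "T \<in> \<A> Es W \<beta>" if "T \<in> ml_maps Es W" for T by (rule fin_ml_maps_ideal[OF e Es that])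
  show "norm (v (pform Es F J T)) \<le> A Es W \<beta> T * alpha_fin \<nu> Es F \<beta> v"
    if T: "T \<in> ml_maps Es W" and v: "v \<in> carrier (tensor_with Es F N)" for T v N
  proof -
    obtain T' where T': "T' \<in> \<A> Es W' \<beta>" "A Es W' \<beta> T' \<le> A Es W \<beta> T" "pform Es F J' T' = pform Es F J T"
      using change_copy[OF e F(1) J J' TA[OF T]] by blast
    have "norm (v (pform Es F J T)) \<le> A Es W' \<beta> T' * afin Es F \<beta> W' J' v"
      using afin_bound[OF e' F(1) J' v T'(1)] T'(3) by simp
    also have "\<dots> \<le> A Es W \<beta> T * afin Es F \<beta> W' J' v"
      using T'(2) afin_homog(1)[OF e' F(1) J' v] by (rule mult_right_mono)
    finally show ?thesis using af[OF v] by simp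
  qed
  show "A Es W \<beta> T \<le> c"
    if T: "T \<in> ml_maps Es W" and c: "0 \<le> c" and le: "\<And>v. v \<in> carrier (tensor_with Es F N) \<Longrightarrow> norm (v (pform Es F J T)) \<le> c * alpha_fin \<nu> Es F \<beta> v"
    for T c N
  proof -
    obtain T' where T': "T' \<in> \<A> Es W' \<beta>" "A Es W' \<beta> T' \<le> A Es W \<beta> T" "pform Es F J' T' = pform Es F J T"
      using change_copy[OF e F(1) J J' TA[OF T]] by blast
    \<comment> \<open>Moving back yields a map with the same form as T, hence T itself because J is
      injective. This turns the bound for T' into one for T.\<close>
    obtain T'' where T'': "T'' \<in> \<A> Es W \<beta>" "A Es W \<beta> T'' \<le> A Es W' \<beta> T'" "pform Es F J T'' = pform Es F J' T'"
      using change_copy[OF e' F(1) J' J T'(1)] by blast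
    have "A Es W' \<beta> T' \<le> c"
      by (rule afin_norming[OF e' F J' Es T'(1) c, of N]) (use le af T'(3) in auto)
    moreover have "T'' = T"
    proof
      fix x
      note T''m = idealD(4)[OF e T''(1)] and D = dual_copyD[OF F(1) J]
      show "T'' x = T x"
      proof (cases "x \<in> tuples Es")
        case True
        note m = ml_mapsD(1)[OF T''m True] ml_mapsD(1)[OF T True]
        have "J (T'' x) y = J (T x) y" for y
        proof (cases "y \<in> carrier F")
          case y: True
          have "pform Es F J T'' (x, y) = pform Es F J T (x, y)" using T''(3) T'(3) by simp
          then show ?thesis using True y by (simp add: pform_def)
        qed (use lin_formsD(2)[OF D(4)] m in auto)
        then show ?thesis using D(9)[OF m] by blast
      qed (use ml_mapsD(2)[OF T''m] ml_mapsD(2)[OF T] in simp)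
    qed
    ultimately show ?thesis using T''(2) by simp
  qed
  show "0 \<le> alpha_fin \<nu> Es F \<beta> v" if v: "v \<in> carrier (tensor_with Es F N)"
    using af[OF v] afin_homog(1)[OF e' F(1) J' v] by simp
  show "alpha_fin \<nu> Es F \<beta> (\<lambda>\<phi>. a * v \<phi>) \<le> norm a * alpha_fin \<nu> Es F \<beta> v" if v: "v \<in> carrier (tensor_with Es F N)"
    using af[OF v] af[OF tens_closed(2)[OF v v]] afin_homog(2)[OF e' F(1) J' v] by simp
  show "alpha_fin \<nu> Es F \<beta> (otimes_with Es F x y) \<le> (\<Prod>i<length Es. nrm (Es ! i) (x ! i)) * nrm F y"
    if "x \<in> tuples Es" "y \<in> carrier F"
    using af[OF elem_tensor_carrier, of "(x, y)"] that afin_elem_le[OF e' F(1) J' that] by simp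
qed

end

section \<open>The duality theorem\<close>

lemma restrict_forms_with:
  assumes Xs: "\<forall>X\<in>set Xs. normed_space X" and Es: "Es \<in> listset (map fin_subspaces Xs)"
    and Y: "normed_space Y" and F: "F \<in> fin_subspaces Y" and \<psi>: "\<psi> \<in> forms_with (forms Xs) Y"
  shows "(\<lambda>d. if d \<in> tuples Es \<times> carrier F then \<psi> d else 0) \<in> forms_with (forms Es) F"
proof -
  note FD = fin_subspacesD[OF Y F]
  have ops: "add F = add Y" "smult F = smult Y" by (subst FD(5), simp)+
  note Fv = normed_spaceD(1)[OF FD(1)]
  show ?thesis
    unfolding forms_with_def
  proof (intro CollectI conjI ballI allI)
    fix y assume y: "y \<in> carrier F"
    then have "(\<lambda>x. \<psi> (x, y)) \<in> forms Xs" using \<psi> subspD(1)[OF FD(4)] by (auto simp: forms_with_def)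
    from restrict_forms[OF Xs Es vs_scalar_space this is_lin_id[of scalar_space], unfolded scalar_space_simps]
    show "(\<lambda>x. if (x, y) \<in> tuples Es \<times> carrier F then \<psi> (x, y) else 0) \<in> forms Es" using y by simp
  next
    fix x
    have "(\<lambda>y. \<psi> (x, y)) \<in> lin_forms Y" using \<psi> by (auto simp: forms_with_def)
    from lin_formsD(3,4)[OF this] subspD(1)[OF FD(4)]
    show "(\<lambda>y. if (x, y) \<in> tuples Es \<times> carrier F then \<psi> (x, y) else 0) \<in> lin_forms F"
      using vs_add[OF Fv] vs_smult[OF Fv] by (intro lin_formsI) (auto simp: ops)
  qed
qed

lemma tensor_with_incl_props:
  assumes Xs: "\<forall>X\<in>set Xs. normed_space X" and Es: "Es \<in> listset (map fin_subspaces Xs)"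
    and Y: "normed_space Y" and F: "F \<in> fin_subspaces Y"
  shows "snd ` set cds \<subseteq> tuples Es \<times> carrier F \<Longrightarrow>
      tensor_with_incl Es F Xs Y (tsum (forms_with (forms Es) F) cds) = tsum (forms_with (forms Xs) Y) cds"
    "u \<in> carrier (tensor_with Es F N) \<Longrightarrow> tensor_with_incl Es F Xs Y u \<in> carrier (tensor_with Xs Y N')"
    "u \<in> carrier (tensor_with Es F N) \<Longrightarrow> tensor_with_incl Es F Xs Y (\<lambda>\<phi>. c * u \<phi>) = (\<lambda>\<phi>. c * tensor_with_incl Es F Xs Y u \<phi>)"
proof -
  have D: "tuples Es \<times> carrier F \<subseteq> tuples Xs \<times> carrier Y"
    using listset_fin_subspacesD(7)[OF Xs Es] subspD(1)[OF fin_subspacesD(4)[OF Y F]] by auto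
  have r: "\<forall>\<psi>\<in>forms_with (forms Xs) Y. (\<lambda>d. if d \<in> tuples Es \<times> carrier F then \<psi> d else 0) \<in> forms_with (forms Es) F"
    using restrict_forms_with[OF assms] by blast
  note I = linearize_incl[OF D r]
  let ?i = "\<lambda>u \<psi>. if \<psi> \<in> forms_with (forms Xs) Y then u (\<lambda>d. if d \<in> tuples Es \<times> carrier F then \<psi> d else 0) else 0"
  have eta: "(\<lambda>(x, y). otimes_with Xs Y x y) = elem_tensor (forms_with (forms Xs) Y)" by auto
  have 1: "tensor_with_incl Es F Xs Y u = ?i u" if "u \<in> carrier (tensor_with Es F N)" for u N
    unfolding tensor_with_incl_def eta by (rule I(3)[OF that])
  show "tensor_with_incl Es F Xs Y (tsum (forms_with (forms Es) F) cds) = tsum (forms_with (forms Xs) Y) cds"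
    if "snd ` set cds \<subseteq> tuples Es \<times> carrier F"
    unfolding 1[OF tsum_carrier[OF that]] by (rule I(1)[OF that])
  show "tensor_with_incl Es F Xs Y u \<in> carrier (tensor_with Xs Y N')" if u: "u \<in> carrier (tensor_with Es F N)"
    unfolding 1[OF u] by (rule is_linD(1)[OF I(2) u])
  show "tensor_with_incl Es F Xs Y (\<lambda>\<phi>. c * u \<phi>) = (\<lambda>\<phi>. c * tensor_with_incl Es F Xs Y u \<phi>)"
    if u: "u \<in> carrier (tensor_with Es F N)"
    unfolding 1[OF u] 1[OF tens_closed(2)[OF u u]] by auto
qed

text \<open>The entries of one finite representation span finite dimensional subspaces. Hence the
  set whose infimum is \<open>alpha\<close> is never empty.\<close>

lemma fin_subspaces_cover:
  assumes Xs: "\<forall>X\<in>set Xs. normed_space X" and Y: "normed_space Y"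
    and cds: "snd ` set cds \<subseteq> tuples Xs \<times> carrier Y"
  shows "\<exists>Es\<in>listset (map fin_subspaces Xs). \<exists>F\<in>fin_subspaces Y. snd ` set cds \<subseteq> tuples Es \<times> carrier F"
proof -
  define G where "G i = map (\<lambda>(c, x, y). x ! i) cds" for i
  define H where "H = map (\<lambda>(c, x, y). y) cds"
  have x: "x \<in> tuples Xs" "y \<in> carrier Y" if "(c, x, y) \<in> set cds" for c x y using cds that by auto
  have G: "set (G i) \<subseteq> carrier (Xs ! i)" if "i < length Xs" for i
    using that x by (auto simp: G_def in_tuples_iff)
  have H: "set H \<subseteq> carrier Y" using x by (auto simp: H_def)
  have Xv: "vs (Xs ! i)" if "i < length Xs" for i using Xs that by auto
  have Yv: "vs Y" using Y by simp
  let ?Es = "map (\<lambda>i. (Xs ! i)\<lparr>carrier := lspan (Xs ! i) (set (G i))\<rparr>) [0..<length Xs]"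
  let ?F = "Y\<lparr>carrier := lspan Y (set H)\<rparr>"
  have "?Es \<in> listset (map fin_subspaces Xs)"
    using fin_subspaces_span[OF Xv G] by (auto simp: in_listset_iff)
  moreover have "?F \<in> fin_subspaces Y" by (rule fin_subspaces_span[OF Yv H])
  moreover have "snd ` set cds \<subseteq> tuples ?Es \<times> carrier ?F"
  proof
    fix d assume "d \<in> snd ` set cds"
    then obtain c x y where d: "d = (x, y)" "(c, x, y) \<in> set cds" by auto
    have "x ! i \<in> lspan (Xs ! i) (set (G i))" if i: "i < length Xs" for i
      using lspan_superset[OF Xv[OF i] G[OF i]] d(2) by (force simp: G_def)
    moreover have "y \<in> lspan Y (set H)" using lspan_superset[OF Yv H] d(2) by (force simp: H_def)
    ultimately show "d \<in> tuples ?Es \<times> carrier ?F"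
      using x(1)[OF d(2)] d(1) by (auto simp: in_tuples_iff)
  qed
  ultimately show ?thesis by blast
qed

lemma ml_maps_restrict_quot:
  assumes e: "election Xs Z \<beta>" and Es: "Es \<in> listset (map fin_subspaces Xs)" and L: "L \<in> cofin_subspaces Z"
    and T: "T \<in> ml_maps Xs Z"
  shows "sigma_comp Es (quot_space Z L) Xs (quot_map Z L) T (otimes Xs) =
      (\<lambda>x. if x \<in> tuples Es then quot_map Z L (T x) else \<zero>\<^bsub>quot_space Z L\<^esub>)"
    "(\<lambda>x. if x \<in> tuples Es then quot_map Z L (T x) else \<zero>\<^bsub>quot_space Z L\<^esub>) \<in> ml_maps Es (quot_space Z L)"
    "election Es (quot_space Z L) (restr_norm Es Xs \<beta>)"
proof -
  note E = electionD[OF e]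
  note D = listset_fin_subspacesD[OF E(2) Es] and C = cofin_quot[OF E(5) L]
  show "sigma_comp Es (quot_space Z L) Xs (quot_map Z L) T (otimes Xs) =
      (\<lambda>x. if x \<in> tuples Es then quot_map Z L (T x) else \<zero>\<^bsub>quot_space Z L\<^esub>)"
    using f_of_otimes[OF E(3) E(6) separated_normed[OF E(5)] T] D(7) by (fastforce simp: sigma_comp_def fun_eq_iff)
  show "(\<lambda>x. if x \<in> tuples Es then quot_map Z L (T x) else \<zero>\<^bsub>quot_space Z L\<^esub>) \<in> ml_maps Es (quot_space Z L)"
    by (rule restrict_forms[OF E(2) Es E(6) T bounded_opD(1)[OF C(6)]])
  have "Es \<noteq> []" using E(1) D(1) by auto
  then show "election Es (quot_space Z L) (restr_norm Es Xs \<beta>)"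
    using D(4) C(5) reasonable_restr_norm[OF E(1,2,7) Es] by (simp add: election_def)
qed

section \<open>Bounds between \<open>alpha\<close> and \<open>A_max\<close> for a dual pair (Z,
  Y)\<close>

context
  fixes \<A> :: "('k::real_or_complex, 'u) ideal_sets" and A :: "('k, 'u) ideal_norms" and \<nu> :: "('k, 'u) dual_norms"
    and Xs :: "('k, 'u) nspace list" and Z :: "('k, 'u) nspace" and \<beta> :: "(('u list \<Rightarrow> 'k) \<Rightarrow> 'k) \<Rightarrow> real"
    and Y :: "('k, 'b) nspace" and b :: "'u \<Rightarrow> 'b \<Rightarrow> 'k"
  assumes ideal: "sigma_ideal \<A> A" and assoc: "associated \<A> A \<nu>"
    and e: "election Xs Z \<beta>" and Y: "normed_space Y" and good: "good_pair Z Y b"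
begin

lemma pair_on: "pairing_on Z Y b"
  using good by (simp add: good_pair_def)

lemma good_perp:
  assumes F: "F \<in> fin_subspaces Y"
  shows "perp Z b (carrier F) \<in> cofin_subspaces Z"
    "dual_copy F (quot_space Z (perp Z b (carrier F))) (\<lambda>q y. if y \<in> carrier F then b q y else 0)"
  using good F by (auto simp: good_pair_def)

text \<open>Passing to the quotient changes T x by an element that annihilates F, which the pairing
  with F does not notice. So a tensor over Es and F sees the same functional before and after its
  inclusion into the large tensor product.\<close>

lemma pform_restrict:
  assumes Es: "Es \<in> listset (map fin_subspaces Xs)" and F: "F \<in> fin_subspaces Y" and T: "T \<in> ml_maps Xs Z"
    and v: "v \<in> carrier (tensor_with Es F N)"
  defines "L \<equiv> perp Z b (carrier F)"
  shows "v (pform Es F (\<lambda>q y. if y \<in> carrier F then b q y else 0)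
        (\<lambda>x. if x \<in> tuples Es then quot_map Z L (T x) else \<zero>\<^bsub>quot_space Z L\<^esub>))
      = tensor_with_incl Es F Xs Y v (pform Xs Y b T)"
proof -
  note E = electionD[OF e]
  note D = listset_fin_subspacesD[OF E(2) Es] and FD = fin_subspacesD[OF Y F] and G = good_perp[OF F]
  note C = cofin_quot[OF E(5) G(1), folded L_def]
  note R = ml_maps_restrict_quot[OF e Es G(1) T, folded L_def]
  obtain cds where cds: "snd ` set cds \<subseteq> tuples Es \<times> carrier F" "v = tsum (forms_with (forms Es) F) cds"
    using v by (auto simp: carrier_tens)
  have cds': "snd ` set cds \<subseteq> tuples Xs \<times> carrier Y"
  proof -
    have "tuples Es \<times> carrier F \<subseteq> tuples Xs \<times> carrier Y" using D(7) subspD(1)[OF FD(4)] by auto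
    then show ?thesis using cds(1) by simp
  qed
  have bQ: "b (quot_map Z L z) y = b z y" if z: "z \<in> carrier Z" and y: "y \<in> carrier F" for z y
  proof -
    obtain l where "l \<in> L" "quot_map Z L z = l \<oplus>\<^bsub>Z\<^esub> z" using quot_map_in[OF E(6) C(2) z] by blast
    then show ?thesis using z y subspD(1)[OF FD(4) y] pair_lin(1)[OF E(5) Y pair_on] by (auto simp: L_def perp_def)
  qed
  let ?J = "\<lambda>q y. if y \<in> carrier F then b q y else 0"
  let ?T = "\<lambda>x. if x \<in> tuples Es then quot_map Z L (T x) else \<zero>\<^bsub>quot_space Z L\<^esub>"
  have "v (pform Es F ?J ?T) = (\<Sum>(c, d)\<leftarrow>cds. c * ?J (?T (fst d)) (snd d))"
    unfolding cds(2)
    by (rule pform_tsum[OF D(3) normed_spaceD(1)[OF FD(1)] pairing_on_dual_copy[OF FD(1) G(2), folded L_def] R(2) cds(1)])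
  also have "\<dots> = (\<Sum>(c, d)\<leftarrow>cds. c * b (T (fst d)) (snd d))"
  proof (rule arg_cong[where f = sum_list], rule map_cong[OF refl])
    fix cd assume "cd \<in> set cds"
    then have "snd cd \<in> tuples Es \<times> carrier F" using cds(1) by blast
    then obtain c x y where cd: "cd = (c, x, y)" "x \<in> tuples Es" "y \<in> carrier F" by (cases cd) auto
    then have "T x \<in> carrier Z" using ml_mapsD(1)[OF T] D(7) by blast
    then show "(case cd of (c, d) \<Rightarrow> c * ?J (?T (fst d)) (snd d)) = (case cd of (c, d) \<Rightarrow> c * b (T (fst d)) (snd d))"
      using cd bQ by simp
  qed
  also have "\<dots> = tsum (forms_with (forms Xs) Y) cds (pform Xs Y b T)"
    by (rule pform_tsum[OF E(3) normed_spaceD(1)[OF Y] pair_on T cds', symmetric])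
  also have "tsum (forms_with (forms Xs) Y) cds = tensor_with_incl Es F Xs Y v"
    unfolding cds(2) by (rule tensor_with_incl_props(1)[OF E(2) Es Y F cds(1), symmetric])
  finally show ?thesis .
qed

text \<open>Fills the place of the map in \<open>ml_maps_restrict_quot\<close> when only its claim
  about the election is wanted.\<close>

lemma zero_ml_map: "(\<lambda>_. \<zero>\<^bsub>Z\<^esub>) \<in> ml_maps Xs Z"
  using electionD(6)[OF e] by (intro ml_mapsI) (auto simp: is_lin_def)

lemma fin_duality_restrict:
  assumes Es: "Es \<in> listset (map fin_subspaces Xs)" and F: "F \<in> fin_subspaces Y"
  defines "W \<equiv> quot_space Z (perp Z b (carrier F))"
  shows "\<forall>E\<in>set Es. normed_space E \<and> fin_dim E" "election Es W (restr_norm Es Xs \<beta>)" "normed_space F" "fin_dim F"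
    "dual_copy F W (\<lambda>q y. if y \<in> carrier F then b q y else 0)"
proof -
  show "\<forall>E\<in>set Es. normed_space E \<and> fin_dim E" by (rule listset_fin_subspacesD(2)[OF electionD(2)[OF e] Es])
  show "normed_space F" "fin_dim F" by (rule fin_subspacesD(1,2)[OF Y F])+
  show "election Es W (restr_norm Es Xs \<beta>)"
    unfolding W_def by (rule ml_maps_restrict_quot(3)[OF e Es good_perp(1)[OF F] zero_ml_map])
  show "dual_copy F W (\<lambda>q y. if y \<in> carrier F then b q y else 0)"
    unfolding W_def by (rule good_perp(2)[OF F])
qed

text \<open>Each of the five facts of \<open>fin_duality_restrict\<close> brings its own pair of
  premises on Es and F, whence the fivefold \<open>EF\<close> in the uses below.\<close>

lemmas fin_dual = fin_duality[OF ideal assoc fin_duality_restrict]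

lemma alpha_le:
  assumes Es: "Es \<in> listset (map fin_subspaces Xs)" and F: "F \<in> fin_subspaces Y"
    and v: "v \<in> carrier (tensor_with Es F N)" and u: "tensor_with_incl Es F Xs Y v = u"
  shows "alpha \<nu> Xs Y \<beta> u \<le> alpha_fin \<nu> Es F (restr_norm Es Xs \<beta>) v"
  unfolding alpha_def
proof (rule cInf_lower)
  show "alpha_fin \<nu> Es F (restr_norm Es Xs \<beta>) v \<in> {alpha_fin \<nu> Es F (restr_norm Es Xs \<beta>) v |Es F v.
      Es \<in> listset (map fin_subspaces Xs) \<and> F \<in> fin_subspaces Y \<and>
      v \<in> carrier (tensor_with Es F (\<lambda>_. 0)) \<and> tensor_with_incl Es F Xs Y v = u}"
    using assms tens_norm_irrelevant(1) by blast
  show "bdd_below {alpha_fin \<nu> Es F (restr_norm Es Xs \<beta>) v |Es F v.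
      Es \<in> listset (map fin_subspaces Xs) \<and> F \<in> fin_subspaces Y \<and>
      v \<in> carrier (tensor_with Es F (\<lambda>_. 0)) \<and> tensor_with_incl Es F Xs Y v = u}"
    using fin_dual(4) by (intro bdd_belowI[of _ 0]) blast
qed

lemma alpha_ge:
  assumes u: "u \<in> carrier (tensor_with Xs Y N)"
    and le: "\<And>Es F v. Es \<in> listset (map fin_subspaces Xs) \<Longrightarrow> F \<in> fin_subspaces Y \<Longrightarrow>
      v \<in> carrier (tensor_with Es F (\<lambda>_. 0)) \<Longrightarrow> tensor_with_incl Es F Xs Y v = u \<Longrightarrow>
      c \<le> alpha_fin \<nu> Es F (restr_norm Es Xs \<beta>) v"
  shows "c \<le> alpha \<nu> Xs Y \<beta> u"
  unfolding alpha_def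
proof (rule cInf_greatest)
  obtain cds where cds: "snd ` set cds \<subseteq> tuples Xs \<times> carrier Y" "u = tsum (forms_with (forms Xs) Y) cds"
    using u by (auto simp: carrier_tens)
  obtain Es F where EF: "Es \<in> listset (map fin_subspaces Xs)" "F \<in> fin_subspaces Y" "snd ` set cds \<subseteq> tuples Es \<times> carrier F"
    using fin_subspaces_cover[OF electionD(2)[OF e] Y cds(1)] by blast
  have "tensor_with_incl Es F Xs Y (tsum (forms_with (forms Es) F) cds) = u"
    using tensor_with_incl_props(1)[OF electionD(2)[OF e] EF(1) Y EF(2,3)] cds(2) by simp
  then show "{alpha_fin \<nu> Es F (restr_norm Es Xs \<beta>) v |Es F v.
      Es \<in> listset (map fin_subspaces Xs) \<and> F \<in> fin_subspaces Y \<and>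
      v \<in> carrier (tensor_with Es F (\<lambda>_. 0)) \<and> tensor_with_incl Es F Xs Y v = u} \<noteq> {}"
    using EF tsum_carrier[OF EF(3)] by blast
qed (use le in blast)

lemma alpha_homog: "homog (alpha_space \<nu> Xs Y \<beta>) (alpha \<nu> Xs Y \<beta>)"
proof -
  note E = electionD[OF e]
  have nonneg: "0 \<le> alpha \<nu> Xs Y \<beta> u" if "u \<in> carrier (tensor_with Xs Y N)" for u N
    by (rule alpha_ge[OF that]) (use fin_dual(4) in blast)
  have le: "alpha \<nu> Xs Y \<beta> (\<lambda>\<phi>. c * u \<phi>) \<le> norm c * alpha \<nu> Xs Y \<beta> u" if u: "u \<in> carrier (tensor_with Xs Y N)" for c u N
  proof -
    have *: "alpha \<nu> Xs Y \<beta> (\<lambda>\<phi>. c * u \<phi>) \<le> norm c * alpha_fin \<nu> Es F (restr_norm Es Xs \<beta>) v"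
      if EF: "Es \<in> listset (map fin_subspaces Xs)" "F \<in> fin_subspaces Y"
        and v: "v \<in> carrier (tensor_with Es F (\<lambda>_. 0))" "tensor_with_incl Es F Xs Y v = u" for Es F v
    proof -
      have "tensor_with_incl Es F Xs Y (\<lambda>\<phi>. c * v \<phi>) = (\<lambda>\<phi>. c * u \<phi>)"
        using tensor_with_incl_props(3)[OF E(2) EF(1) Y EF(2) v(1)] v(2) by simp
      from alpha_le[OF EF tens_closed(2)[OF v(1) v(1)] this] fin_dual(5)[OF EF EF EF EF EF v(1), of c]
      show ?thesis by (rule order_trans)
    qed
    show ?thesis
    proof (cases "c = 0")
      case True
      \<comment> \<open>Division by the modulus of c is impossible here; a single representation of
        u suffices, as its bound is multiplied by zero.\<close>
      obtain cds where cds: "snd ` set cds \<subseteq> tuples Xs \<times> carrier Y" "u = tsum (forms_with (forms Xs) Y) cds"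
        using u by (auto simp: carrier_tens)
      obtain Es F where EF: "Es \<in> listset (map fin_subspaces Xs)" "F \<in> fin_subspaces Y" "snd ` set cds \<subseteq> tuples Es \<times> carrier F"
        using fin_subspaces_cover[OF E(2) Y cds(1)] by blast
      have "tensor_with_incl Es F Xs Y (tsum (forms_with (forms Es) F) cds) = u"
        using tensor_with_incl_props(1)[OF E(2) EF(1) Y EF(2,3)] cds(2) by simp
      from *[OF EF(1,2) tsum_carrier[OF EF(3)] this] show ?thesis using True by simp
    next
      case False
      have "alpha \<nu> Xs Y \<beta> (\<lambda>\<phi>. c * u \<phi>) / norm c \<le> alpha \<nu> Xs Y \<beta> u"
        by (rule alpha_ge[OF u]) (use * False in \<open>simp add: pos_divide_le_eq mult.commute\<close>)
      then show ?thesis using False by (simp add: pos_divide_le_eq mult.commute)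
    qed
  qed
  have "alpha \<nu> Xs Y \<beta> (\<lambda>\<phi>. c * u \<phi>) = norm c * alpha \<nu> Xs Y \<beta> u" if u: "u \<in> carrier (alpha_space \<nu> Xs Y \<beta>)" for c u
  proof (cases "c = 0")
    case True
    then show ?thesis using le[OF u, of 0] nonneg[OF tens_closed(2)[OF u u, of 0]] by simp
  next
    case False
    have "alpha \<nu> Xs Y \<beta> (\<lambda>\<phi>. inverse c * (c * u \<phi>)) \<le> norm (inverse c) * alpha \<nu> Xs Y \<beta> (\<lambda>\<phi>. c * u \<phi>)"
      by (rule le[OF tens_closed(2)[OF u u]])
    then have "norm c * alpha \<nu> Xs Y \<beta> u \<le> alpha \<nu> Xs Y \<beta> (\<lambda>\<phi>. c * u \<phi>)"
      using False by (simp add: norm_inverse norm_divide field_simps)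
    then show ?thesis using le[OF u, of c] by simp
  qed
  then show ?thesis using nonneg by (auto simp: homog_def)
qed

lemma alpha_elem_le:
  assumes x: "x \<in> tuples Xs" and y: "y \<in> carrier Y"
  shows "alpha \<nu> Xs Y \<beta> (otimes_with Xs Y x y) \<le> (\<Prod>i<length Xs. nrm (Xs ! i) (x ! i)) * nrm Y y"
proof -
  note E = electionD[OF e]
  have cds: "snd ` set [(1 :: 'k, x, y)] \<subseteq> tuples Xs \<times> carrier Y" using x y by simp
  obtain Es F where EF: "Es \<in> listset (map fin_subspaces Xs)" "F \<in> fin_subspaces Y"
    and xy: "snd ` set [(1 :: 'k, x, y)] \<subseteq> tuples Es \<times> carrier F"
    using fin_subspaces_cover[OF E(2) Y cds] by blast
  note D = listset_fin_subspacesD[OF E(2) EF(1)] and FD = fin_subspacesD[OF Y EF(2)]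
  have nE: "nrm (Es ! i) = nrm (Xs ! i)" if "i < length Xs" for i by (subst D(6)[OF that]) simp
  have nF: "nrm F = nrm Y" by (subst FD(5)) simp
  have xE: "x \<in> tuples Es" "y \<in> carrier F" using xy by auto
  have "tensor_with_incl Es F Xs Y (otimes_with Es F x y) = otimes_with Xs Y x y"
    using tensor_with_incl_props(1)[OF E(2) EF(1) Y EF(2) xy] by (simp add: elem_tensor_eq_tsum)
  from alpha_le[OF EF elem_tensor_carrier this] xE
  have "alpha \<nu> Xs Y \<beta> (otimes_with Xs Y x y) \<le> alpha_fin \<nu> Es F (restr_norm Es Xs \<beta>) (otimes_with Es F x y)" by simp
  also have "\<dots> \<le> (\<Prod>i<length Es. nrm (Es ! i) (x ! i)) * nrm F y"
    by (rule fin_dual(6)[OF EF EF EF EF EF xE])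
  also have "\<dots> = (\<Prod>i<length Xs. nrm (Xs ! i) (x ! i)) * nrm Y y" using nE nF D(1) by simp
  finally show ?thesis .
qed

text \<open>A representation of u over Es and F is estimated by the one term of the supremum in
  which L is the annihilator of F. The infimum over all representations is taken last.\<close>

lemma alpha_bound_of_A_max:
  assumes T: "T \<in> ml_maps Xs Z" and c: "0 \<le> c" "A_max A Xs Z \<beta> T \<le> ereal c"
    and u: "u \<in> carrier (tensor_with Xs Y N)"
  shows "norm (u (pform Xs Y b T)) \<le> c * alpha \<nu> Xs Y \<beta> u"
proof -
  have *: "norm (u (pform Xs Y b T)) \<le> c * alpha_fin \<nu> Es F (restr_norm Es Xs \<beta>) v"
    if EF: "Es \<in> listset (map fin_subspaces Xs)" "F \<in> fin_subspaces Y"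
      and v: "v \<in> carrier (tensor_with Es F (\<lambda>_. 0))" "tensor_with_incl Es F Xs Y v = u" for Es F v
  proof -
    let ?L = "perp Z b (carrier F)"
    let ?T = "\<lambda>x. if x \<in> tuples Es then quot_map Z ?L (T x) else \<zero>\<^bsub>quot_space Z ?L\<^esub>"
    note G = good_perp[OF EF(2)]
    note R = ml_maps_restrict_quot[OF e EF(1) G(1) T]
    have "ereal (A Es (quot_space Z ?L) (restr_norm Es Xs \<beta>) ?T) \<le> A_max A Xs Z \<beta> T"
      unfolding A_max_def R(1)[symmetric]
      by (rule SUP_upper2[of "(Es, ?L)"]) (use EF(1) G(1) in auto)
    from order_trans[OF this c(2)] have "A Es (quot_space Z ?L) (restr_norm Es Xs \<beta>) ?T \<le> c" by simp
    moreover have "norm (u (pform Xs Y b T)) \<le> A Es (quot_space Z ?L) (restr_norm Es Xs \<beta>) ?T * alpha_fin \<nu> Es F (restr_norm Es Xs \<beta>) v"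
      using fin_dual(2)[OF EF EF EF EF EF R(2) v(1)] pform_restrict[OF EF T v(1)] v(2) by simp
    moreover have "A Es (quot_space Z ?L) (restr_norm Es Xs \<beta>) ?T * alpha_fin \<nu> Es F (restr_norm Es Xs \<beta>) v
        \<le> c * alpha_fin \<nu> Es F (restr_norm Es Xs \<beta>) v"
      if "A Es (quot_space Z ?L) (restr_norm Es Xs \<beta>) ?T \<le> c"
      by (rule mult_right_mono[OF that fin_dual(4)[OF EF EF EF EF EF v(1)]])
    ultimately show ?thesis by linarith
  qed
  show ?thesis
  proof (cases "c = 0")
    case True
    have "norm (u (pform Xs Y b T)) \<le> 0"
    proof -
      obtain cds where cds: "snd ` set cds \<subseteq> tuples Xs \<times> carrier Y" "u = tsum (forms_with (forms Xs) Y) cds"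
        using u by (auto simp: carrier_tens)
      obtain Es F where EF: "Es \<in> listset (map fin_subspaces Xs)" "F \<in> fin_subspaces Y" "snd ` set cds \<subseteq> tuples Es \<times> carrier F"
        using fin_subspaces_cover[OF electionD(2)[OF e] Y cds(1)] by blast
      have "tensor_with_incl Es F Xs Y (tsum (forms_with (forms Es) F) cds) = u"
        using tensor_with_incl_props(1)[OF electionD(2)[OF e] EF(1) Y EF(2,3)] cds(2) by simp
      from *[OF EF(1,2) tsum_carrier[OF EF(3)] this] show ?thesis using True by simp
    qed
    then show ?thesis using True by simp
  next
    case False
    then have c: "c > 0" using c by simp
    have "norm (u (pform Xs Y b T)) / c \<le> alpha \<nu> Xs Y \<beta> u"
      by (rule alpha_ge[OF u]) (use * c in \<open>simp add: pos_divide_le_eq mult.commute\<close>)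
    then show ?thesis using c by (simp add: pos_divide_le_eq mult.commute)
  qed
qed

text \<open>In finite dimensions A is the dual norm of \<open>alpha_fin\<close>, and
  \<open>alpha_fin\<close> of a tensor over Es and F dominates \<open>alpha\<close> of its
  inclusion. This reaches those terms of the supremum in which L is an annihilator.\<close>

lemma A_perp_le_of_alpha_bound:
  assumes T: "T \<in> ml_maps Xs Z" and c: "0 \<le> c"
    and le: "\<And>u. u \<in> carrier (tensor_with Xs Y N) \<Longrightarrow> norm (u (pform Xs Y b T)) \<le> c * alpha \<nu> Xs Y \<beta> u"
    and EF: "Es \<in> listset (map fin_subspaces Xs)" "F \<in> fin_subspaces Y"
  defines "L \<equiv> perp Z b (carrier F)"
  shows "A Es (quot_space Z L) (restr_norm Es Xs \<beta>)
      (\<lambda>x. if x \<in> tuples Es then quot_map Z L (T x) else \<zero>\<^bsub>quot_space Z L\<^esub>) \<le> c"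
proof -
  note G = good_perp[OF EF(2)]
  note R = ml_maps_restrict_quot[OF e EF(1) G(1) T]
  show ?thesis
    unfolding L_def
  proof (rule fin_dual(3)[OF EF EF EF EF EF R(2) c])
    fix v assume v: "v \<in> carrier (tensor_with Es F N)"
    let ?u = "tensor_with_incl Es F Xs Y v"
    have "norm (?u (pform Xs Y b T)) \<le> c * alpha \<nu> Xs Y \<beta> ?u"
      by (rule le[OF tensor_with_incl_props(2)[OF electionD(2)[OF e] EF(1) Y EF(2) v]])
    also have "\<dots> \<le> c * alpha_fin \<nu> Es F (restr_norm Es Xs \<beta>) v"
      by (rule mult_left_mono[OF alpha_le[OF EF v refl] c])
    finally show "norm (v (pform Es F (\<lambda>q y. if y \<in> carrier F then b q y else 0)
        (\<lambda>x. if x \<in> tuples Es then quot_map Z (perp Z b (carrier F)) (T x) else \<zero>\<^bsub>quot_space Z (perp Z b (carrier F))\<^esub>)))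
      \<le> c * alpha_fin \<nu> Es F (restr_norm Es Xs \<beta>) v"
      unfolding pform_restrict[OF EF T v] .
  qed
qed

end

text \<open>Local reflexivity replaces the quotient map of L by a map V that agrees with it at the
  values of T on tuples of generators, hence on all values of T on Es. V factors through the
  quotient by the annihilator of a finite dimensional subspace of Y with norm at most 1 + \<delta>,
  so composition on the left bounds the term of L by that of the annihilator.\<close>

lemma A_quot_le_of_perp:
  fixes \<A> :: "('k::real_or_complex, 'u) ideal_sets" and Y :: "('k, 'b) nspace"
  assumes ideal: "sigma_ideal \<A> A" and e: "election Xs Z \<beta>" and Y: "normed_space Y" and J: "dual_copy Y Z J"
    and T: "T \<in> ml_maps Xs Z" and Es: "Es \<in> listset (map fin_subspaces Xs)" and L: "L \<in> cofin_subspaces Z"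
    and c: "0 \<le> c" and \<delta>: "0 < \<delta>"
    and le: "\<And>F. F \<in> fin_subspaces Y \<Longrightarrow> A Es (quot_space Z (perp Z J (carrier F))) (restr_norm Es Xs \<beta>)
      (\<lambda>x. if x \<in> tuples Es then quot_map Z (perp Z J (carrier F)) (T x) else \<zero>\<^bsub>quot_space Z (perp Z J (carrier F))\<^esub>) \<le> c"
  shows "A Es (quot_space Z L) (restr_norm Es Xs \<beta>)
      (\<lambda>x. if x \<in> tuples Es then quot_map Z L (T x) else \<zero>\<^bsub>quot_space Z L\<^esub>) \<le> c * (1 + \<delta>)"
proof -
  note E = electionD[OF e] and D = listset_fin_subspacesD[OF electionD(2)[OF e] Es] and JD = dual_copyD[OF Y J]
  note C = cofin_quot[OF E(5) L]
  let ?H = "quot_space Z L" and ?Q = "quot_map Z L" and ?\<beta> = "restr_norm Es Xs \<beta>"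
  note Hv = normed_spaceD(1)[OF C(3)] and Yv = normed_spaceD(1)[OF Y]
  note R = ml_maps_restrict_quot[OF e Es L T]
  have "\<forall>i. \<exists>B. i < length Es \<longrightarrow> set B \<subseteq> carrier (Es ! i) \<and> lspan (Es ! i) (set B) = carrier (Es ! i)"
    using fin_dim_iff[OF normed_spaceD(1)] D(2) by (metis finite_list nth_mem)
  then obtain B where B: "\<And>i. i < length Es \<Longrightarrow> set (B i) \<subseteq> carrier (Es ! i) \<and> lspan (Es ! i) (set (B i)) = carrier (Es ! i)"
    by metis
  \<comment> \<open>All tuples of generators of Es; the finitely many values of T at them are the
    points at which the quotient map has to be reproduced.\<close>
  define xs where "xs = product_lists (map B [0..<length Es])"
  have xs: "x \<in> set xs \<longleftrightarrow> length x = length Es \<and> (\<forall>i<length Es. x ! i \<in> set (B i))" for x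
    by (auto simp: xs_def product_lists_set list_all2_conv_all_nth)
  have xt: "x \<in> tuples Es" if "x \<in> set xs" for x
    using that B by (auto simp: xs in_tuples_iff)
  have TZ: "T x \<in> carrier Z" if "x \<in> tuples Es" for x using ml_mapsD(1)[OF T] D(7) that by blast
  have G: "set (map T xs) \<subseteq> carrier Z" using TZ xt by auto
  obtain yhs where yhs: "\<forall>(y, h)\<in>set yhs. y \<in> carrier Y \<and> h \<in> carrier ?H"
    and VG: "\<And>g. g \<in> set (map T xs) \<Longrightarrow> lc ?H (map (\<lambda>(y, h). (J g y, h)) yhs) = ?Q g"
    and Vn: "\<And>z. z \<in> carrier Z \<Longrightarrow> nrm ?H (lc ?H (map (\<lambda>(y, h). (J z y, h)) yhs)) \<le> (1 + \<delta>) * nrm Z z"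
    using weak_local_reflexivity[OF Y J C(3,4) bounded_opD(1)[OF C(6)] C(8) G \<delta>] by blast
  define V where "V z = lc ?H (map (\<lambda>(y, h). (J z y, h)) yhs)" for z
  have mem: "snd ` set (map (\<lambda>(y, h). (J z y, h)) yhs) \<subseteq> carrier ?H" for z using yhs by auto
  have VH: "V z \<in> carrier ?H" for z unfolding V_def by (rule lc_carrier[OF Hv mem])
  have lV: "l (V z) = (\<Sum>(y, h)\<leftarrow>yhs. J z y * l h)" if "l \<in> lin_forms ?H" for l z
    unfolding V_def using lin_forms_lc[OF Hv that mem, of z] by (simp add: comp_def case_prod_unfold)
  have Vadd: "V (z \<oplus>\<^bsub>Z\<^esub> w) = V z \<oplus>\<^bsub>?H\<^esub> V w" if "z \<in> carrier Z" "w \<in> carrier Z" for z w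
  proof (rule separated_eqI[OF Hv separated_normed[OF C(3)]])
    fix l assume l: "l \<in> lin_forms ?H"
    show "l (V (z \<oplus>\<^bsub>Z\<^esub> w)) = l (V z \<oplus>\<^bsub>?H\<^esub> V w)"
      unfolding lin_formsD(3)[OF l VH VH] lV[OF l] using is_linD(2)[OF JD(7) that]
      by (simp add: sum_list_addf case_prod_unfold algebra_simps)
  qed (use VH Hv in auto)
  have Vsm: "V (a \<odot>\<^bsub>Z\<^esub> z) = a \<odot>\<^bsub>?H\<^esub> V z" if "z \<in> carrier Z" for z a
  proof (rule separated_eqI[OF Hv separated_normed[OF C(3)]])
    fix l assume l: "l \<in> lin_forms ?H"
    show "l (V (a \<odot>\<^bsub>Z\<^esub> z)) = l (a \<odot>\<^bsub>?H\<^esub> V z)"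
      unfolding lin_formsD(4)[OF l VH] lV[OF l] using is_linD(3)[OF JD(7) that]
      by (simp add: sum_list_const_mult case_prod_unfold mult.assoc)
  qed (use VH Hv in auto)
  let ?ys = "map fst yhs"
  have ys: "set ?ys \<subseteq> carrier Y" using yhs by auto
  \<comment> \<open>V uses z only through its pairings with the vectors \<open>?ys\<close>, so it
    vanishes on the annihilator of their span.\<close>
  define F where "F = Y\<lparr>carrier := lspan Y (set ?ys)\<rparr>"
  have F: "F \<in> fin_subspaces Y" unfolding F_def by (rule fin_subspaces_span[OF Yv ys])
  have good: "good_pair Z Y J" by (rule good_pair_dual_copy[OF Y J])
  define K where "K = perp Z J (carrier F)"
  have K: "K \<in> cofin_subspaces Z" using good F by (simp add: good_pair_def K_def)
  note CK = cofin_quot[OF E(5) K]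
  let ?W = "quot_space Z K" and ?P = "quot_map Z K"
  have VK: "V l = \<zero>\<^bsub>?H\<^esub>" if "l \<in> K" for l
    unfolding V_def
  proof (rule lc_zero[OF Hv], safe)
    fix a h assume "(a, h) \<in> set (map (\<lambda>(y, h). (J l y, h)) yhs)"
    then obtain y where y: "(y, h) \<in> set yhs" "a = J l y" by auto
    then have "y \<in> carrier F" using lspan_superset[OF Yv ys] by (force simp: F_def)
    then show "a = 0" using that y by (simp add: K_def perp_def)
    show "h \<in> carrier ?H" using y yhs by auto
  qed
  have KZ: "l \<in> carrier Z" if "l \<in> K" for l using subspD(1)[OF CK(2) that] .
  have Vtr: "V (l \<oplus>\<^bsub>Z\<^esub> z) = V z" if "l \<in> K" "z \<in> carrier Z" for l z
    using Vadd[OF KZ[OF that(1)] that(2)] VK[OF that(1)] VH Hv by simp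
  have VP: "V (?P z) = V z" if "z \<in> carrier Z" for z
    using quot_map_in[OF E(6) CK(2) that] Vtr that by auto
  have lin: "is_lin ?W ?H V"
    unfolding is_lin_def quot_space_simps(1)[of Z K]
  proof (intro conjI Pi_I ballI allI; (elim imageE)?; hypsubst)
    fix z assume z: "z \<in> carrier Z"
    show "V (?P z) \<in> carrier ?H" by (rule VH)
    fix a show "V (a \<odot>\<^bsub>?W\<^esub> ?P z) = a \<odot>\<^bsub>?H\<^esub> V (?P z)"
      using is_linD(3)[OF is_lin_quot_map[OF E(6) CK(2)] z, of a, symmetric] VP z E(6) Vsm[OF z] by simp
  next
    fix z w assume z: "z \<in> carrier Z" and w: "w \<in> carrier Z"
    show "V (?P z \<oplus>\<^bsub>?W\<^esub> ?P w) = V (?P z) \<oplus>\<^bsub>?H\<^esub> V (?P w)"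
      using is_linD(2)[OF is_lin_quot_map[OF E(6) CK(2)] z w, symmetric] VP z w E(6) Vadd[OF z w] by simp
  qed
  have Vle: "nrm ?H (V q) \<le> (1 + \<delta>) * nrm ?W q" if q: "q \<in> carrier ?W" for q
  proof -
    obtain z where z: "z \<in> carrier Z" "q = ?P z" using q by (auto simp: quot_space_simps)
    \<comment> \<open>V does not change under translation by \<open>K\<close>, so its bound on Z
      becomes a bound by the distance from \<open>K\<close>, which is the norm of the
      quotient.\<close>
    have "nrm ?H (V z) / (1 + \<delta>) \<le> sdist Z (nrm Z) K z"
    proof (rule sdist_greatest[OF E(6) normed_seminorm[OF E(5)] CK(2)])
      fix l assume l: "l \<in> K"
      have "nrm ?H (V (l \<oplus>\<^bsub>Z\<^esub> z)) \<le> (1 + \<delta>) * nrm Z (l \<oplus>\<^bsub>Z\<^esub> z)"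
        unfolding V_def using KZ[OF l] z(1) E(6) by (intro Vn) simp
      then show "nrm ?H (V z) / (1 + \<delta>) \<le> nrm Z (l \<oplus>\<^bsub>Z\<^esub> z)"
        using Vtr[OF l z(1)] \<delta> by (simp add: pos_divide_le_eq mult.commute)
    qed
    then show ?thesis using VP[OF z(1)] nrm_quot_map[OF E(5) CK(2) z(1)] z(2) \<delta> by (simp add: pos_divide_le_eq mult.commute)
  qed
  have bV: "bounded_op ?W ?H V" by (rule bounded_opI[OF lin Vle])
  have nV: "opnorm ?W ?H V \<le> 1 + \<delta>"
    by (rule opnorm_le[OF normed_spaceD(1)[OF CK(3)] homog_normed[OF CK(3)] _ Vle]) (use \<delta> in auto)
  note RK = ml_maps_restrict_quot[OF e Es K T]
  let ?T = "\<lambda>x. if x \<in> tuples Es then ?P (T x) else \<zero>\<^bsub>?W\<^esub>"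
  have TA: "?T \<in> \<A> Es ?W ?\<beta>" by (rule fin_ml_maps_ideal[OF ideal, OF RK(3) D(2) RK(2)])
  note LC = ideal_left_comp[OF ideal, OF RK(3) C(5) TA bV]
  let ?U = "\<lambda>x. if x \<in> tuples Es then V (?T x) else \<zero>\<^bsub>?H\<^esub>"
  let ?S = "\<lambda>x. if x \<in> tuples Es then ?Q (T x) else \<zero>\<^bsub>?H\<^esub>"
  have SA: "?S \<in> \<A> Es ?H ?\<beta>" by (rule fin_ml_maps_ideal[OF ideal, OF R(3) D(2) R(2)])
  let ?I = "ideal_space \<A> A Es ?H ?\<beta>"
  note I = idealD[OF ideal, OF R(3)]
  \<comment> \<open>The two maps are compared through their difference, a multilinear map that
    vanishes on tuples of generators and is therefore zero.\<close>
  let ?d = "?U \<oplus>\<^bsub>?I\<^esub> (-1) \<odot>\<^bsub>?I\<^esub> ?S"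
  have "?d \<in> carrier ?I" using LC(1) SA I(2) by (intro vs_add vs_smult) auto
  then have dm: "?d \<in> ml_maps Es ?H" using I(4) by simp
  have d0: "?d x = \<zero>\<^bsub>?H\<^esub>" if x: "x \<in> tuples Es" "\<forall>i<length Es. x ! i \<in> set (B i)" for x
  proof -
    have "x \<in> set xs" using x by (auto simp: xs in_tuples_iff)
    then have "V (T x) = ?Q (T x)" using VG[of "T x"] by (simp add: V_def)
    then show ?thesis using x(1) VP[OF TZ[OF x(1)]] VH[of "T x"] Hv vs_add_neg[OF Hv, of "?Q (T x)"] by auto
  qed
  have "?d x = \<zero>\<^bsub>?H\<^esub>" for x
  proof (cases "x \<in> tuples Es")
    case True
    show ?thesis
      by (rule ml_maps_eq_zero[where B = "\<lambda>i. set (B i)", OF D(3) Hv dm _ _ d0 True]) (use B in auto)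
  qed (rule ml_mapsD(2)[OF dm])
  then have "?d = \<zero>\<^bsub>?I\<^esub>" by auto
  then have "?U = ?S" using vs_eq_iff[OF I(2), of ?U ?S] LC(1) SA by simp
  then have "A Es ?H ?\<beta> ?S \<le> A Es ?W ?\<beta> ?T * opnorm ?W ?H V" using LC(2) by simp
  also have "\<dots> \<le> c * (1 + \<delta>)"
    using le[OF F, folded K_def] nV c opnorm_nonneg[OF normed_spaceD(1)[OF CK(3)] homog_normed[OF CK(3)] homog_normed[OF C(3)] bV]
    by (intro mult_mono)
  finally show ?thesis .
qed

lemma A_max_le:
  assumes "election Xs Z \<beta>" "T \<in> ml_maps Xs Z"
    and "\<And>Es L. Es \<in> listset (map fin_subspaces Xs) \<Longrightarrow> L \<in> cofin_subspaces Z \<Longrightarrow>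
      A Es (quot_space Z L) (restr_norm Es Xs \<beta>) (\<lambda>x. if x \<in> tuples Es then quot_map Z L (T x) else \<zero>\<^bsub>quot_space Z L\<^esub>) \<le> c"
  shows "A_max A Xs Z \<beta> T \<le> ereal c"
  unfolding A_max_def
  by (rule SUP_least) (use assms ml_maps_restrict_quot(1)[OF assms(1) _ _ assms(2)] in auto)

lemma maximal_idealD:
  assumes "maximal_ideal \<A> A" "election Xs Z \<beta>"
  shows "T \<in> ml_maps Xs Z \<Longrightarrow> A_max A Xs Z \<beta> T \<le> ereal c \<Longrightarrow> T \<in> \<A> Xs Z \<beta> \<and> A Xs Z \<beta> T \<le> c"
    "T \<in> \<A> Xs Z \<beta> \<Longrightarrow> T \<in> ml_maps Xs Z \<and> A_max A Xs Z \<beta> T \<le> ereal (A Xs Z \<beta> T)"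
proof -
  have *: "\<A> Xs Z \<beta> = {T \<in> ml_maps Xs Z. A_max A Xs Z \<beta> T < \<infinity>}"
    "\<And>T. T \<in> \<A> Xs Z \<beta> \<Longrightarrow> ereal (A Xs Z \<beta> T) = A_max A Xs Z \<beta> T"
    using assms unfolding maximal_ideal_def by simp_all
  show "T \<in> \<A> Xs Z \<beta> \<and> A Xs Z \<beta> T \<le> c" if T: "T \<in> ml_maps Xs Z" "A_max A Xs Z \<beta> T \<le> ereal c"
  proof -
    have "A_max A Xs Z \<beta> T < \<infinity>" using T(2) by (rule order_le_less_trans) simp
    then have TA: "T \<in> \<A> Xs Z \<beta>" using * T by simp
    moreover have "ereal (A Xs Z \<beta> T) \<le> ereal c" using *(2)[OF TA] T(2) by simp
    ultimately show ?thesis by simp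
  qed
  show "T \<in> ml_maps Xs Z \<and> A_max A Xs Z \<beta> T \<le> ereal (A Xs Z \<beta> T)" if "T \<in> \<A> Xs Z \<beta>"
    using * that by auto
qed

text \<open>For Y paired with its dual, \<open>cofin_eq_perp\<close> exhibits every L of the
  supremum as the annihilator of a finite dimensional subspace of the dual, so the terms are bounded
  without a loss.\<close>

lemma alpha_dual_eq_predual:
  fixes \<nu> :: "('k::real_or_complex, 'u) dual_norms" and Y :: "('k, 'u) nspace"
  assumes ideal: "sigma_ideal \<A> A" and max: "maximal_ideal \<A> A" and assoc: "associated \<A> A \<nu>"
    and e: "election Xs Y \<beta>" and Tb: "T \<in> bounded_ml_maps Xs Y"
  defines "\<phi> \<equiv> lin_ext_with Xs (dual Y) scalar_space (\<lambda>x y'. y' (T x))"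
  shows "T \<in> \<A> Xs Y \<beta> \<longleftrightarrow> bounded_op (alpha_space \<nu> Xs (dual Y) \<beta>) scalar_space \<phi>"
    "T \<in> \<A> Xs Y \<beta> \<Longrightarrow> A Xs Y \<beta> T = opnorm (alpha_space \<nu> Xs (dual Y) \<beta>) scalar_space \<phi>"
proof -
  note E = electionD[OF e]
  note D = normed_dual[OF E(6) homog_normed[OF E(5)]]
  let ?b = "\<lambda>z f. f z" and ?V = "alpha_space \<nu> Xs (dual Y) \<beta>"
  have good: "good_pair Y (dual Y) ?b" by (rule good_pair_predual[OF E(5)])
  have T: "T \<in> ml_maps Xs Y" using Tb by (simp add: bounded_ml_maps_def)
  note M = pform_mem[OF E(3) normed_spaceD(1)[OF D] pair_on[OF ideal assoc e D good] T]
  have \<phi>: "\<phi> u = u (pform Xs (dual Y) ?b T)" if "u \<in> carrier ?V" for u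
    unfolding \<phi>_def by (rule linearize_scalar[OF M _ that]) (auto simp: pform_def)
  have hom: "homog ?V (nrm ?V)" using alpha_homog[OF ideal assoc e D good] by simp
  have b\<phi>: "bounded_op ?V scalar_space \<phi> \<longleftrightarrow> bounded_op ?V scalar_space (\<lambda>u. u (pform Xs (dual Y) ?b T))"
    by (rule bounded_op_cong[OF vs_tens \<phi>])
  have o\<phi>: "opnorm ?V scalar_space \<phi> = opnorm ?V scalar_space (\<lambda>u. u (pform Xs (dual Y) ?b T))"
    by (rule opnorm_cong) (simp add: \<phi>)
  have 1: "bounded_op ?V scalar_space \<phi> \<and> opnorm ?V scalar_space \<phi> \<le> A Xs Y \<beta> T" if TA: "T \<in> \<A> Xs Y \<beta>"
  proof -
    have le: "norm (u (pform Xs (dual Y) ?b T)) \<le> A Xs Y \<beta> T * alpha \<nu> Xs (dual Y) \<beta> u" if "u \<in> carrier ?V" for u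
      using alpha_bound_of_A_max[OF ideal assoc e D good, OF T idealD(5)[OF ideal e, OF TA] _ that]
        maximal_idealD(2)[OF max e, OF TA] by blast
    show ?thesis unfolding b\<phi> o\<phi>
      using le by (intro conjI bounded_opI[OF is_lin_apply[OF M], where c = "A Xs Y \<beta> T"]
          opnorm_le[OF vs_tens hom idealD(5)[OF ideal e, OF TA]]) auto
  qed
  have 2: "T \<in> \<A> Xs Y \<beta> \<and> A Xs Y \<beta> T \<le> opnorm ?V scalar_space \<phi>" if b: "bounded_op ?V scalar_space \<phi>"
  proof -
    let ?c = "opnorm ?V scalar_space \<phi>"
    have c: "0 \<le> ?c" by (rule opnorm_nonneg[OF vs_tens hom _ b]) simp
    have le: "norm (u (pform Xs (dual Y) ?b T)) \<le> ?c * alpha \<nu> Xs (dual Y) \<beta> u" if "u \<in> carrier ?V" for u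
      using opnorm_bound[OF vs_tens hom _ b that] \<phi>[OF that] by simp
    have "A_max A Xs Y \<beta> T \<le> ereal ?c"
    proof (rule A_max_le[OF e T])
      fix Es L assume Es: "Es \<in> listset (map fin_subspaces Xs)" and L: "L \<in> cofin_subspaces Y"
      obtain F where F: "F \<in> fin_subspaces (dual Y)" "L = perp Y ?b (carrier F)"
        using cofin_eq_perp[OF E(5) L] by blast
      show "A Es (quot_space Y L) (restr_norm Es Xs \<beta>) (\<lambda>x. if x \<in> tuples Es then quot_map Y L (T x) else \<zero>\<^bsub>quot_space Y L\<^esub>) \<le> ?c"
        unfolding F(2) by (rule A_perp_le_of_alpha_bound[OF ideal assoc e D good, OF T c le Es F(1)])
    qed
    then show ?thesis by (rule maximal_idealD(1)[OF max e, OF T])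
  qed
  show "T \<in> \<A> Xs Y \<beta> \<longleftrightarrow> bounded_op ?V scalar_space \<phi>" using 1 2 by blast
  show "A Xs Y \<beta> T = opnorm ?V scalar_space \<phi>" if "T \<in> \<A> Xs Y \<beta>" using 1 2 that by fastforce
qed

text \<open>For the dual of Y paired with Y, the terms of \<open>A_max\<close> with L an annihilator
  are bounded by the norm of the functional and the others by 1 + \<delta> times it. Letting
  \<delta> tend to 0 gives the isometry.\<close>

lemma alpha_dual_iso:
  fixes \<nu> :: "('k::real_or_complex, 'u) dual_norms" and Y :: "('k, 'u) nspace"
  assumes ideal: "sigma_ideal \<A> A" and max: "maximal_ideal \<A> A" and assoc: "associated \<A> A \<nu>"
    and eY: "election Xs Y \<beta>" and J: "dual_copy Y Z J"
  shows "\<exists>\<T>. isometric_iso (dual (alpha_space \<nu> Xs Y \<beta>)) (ideal_space \<A> A Xs Z \<beta>) \<T> \<and>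
    (\<forall>\<phi>\<in>carrier (dual (alpha_space \<nu> Xs Y \<beta>)). \<forall>x\<in>tuples Xs. \<forall>y\<in>carrier Y. J (\<T> \<phi> x) y = \<phi> (otimes_with Xs Y x y))"
proof -
  have Y: "normed_space Y" by (rule electionD(5)[OF eY])
  note JD = dual_copyD[OF Y J] and Yv = normed_spaceD(1)[OF Y]
  have e: "election Xs Z \<beta>" using eY JD(1) by (simp add: election_def)
  note E = electionD[OF e] and I = idealD[OF ideal e]
  let ?V = "alpha_space \<nu> Xs Y \<beta>" and ?M = "forms_with (forms Xs) Y" and ?I = "ideal_space \<A> A Xs Z \<beta>"
  have good: "good_pair Z Y J" by (rule good_pair_dual_copy[OF Y J])
  have hom: "homog ?V (nrm ?V)" using alpha_homog[OF ideal assoc e Y good] by simp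
  note VD = dualD[OF vs_tens hom] and nV = normed_dual[OF vs_tens hom]
  note M = pform_mem[OF E(3) Yv pair_on[OF ideal assoc e Y good]]
  define rep where "rep \<phi> x = (\<lambda>y. if y \<in> carrier Y then \<phi> (otimes_with Xs Y x y) else 0)" for \<phi> :: "(('u list \<times> 'u \<Rightarrow> 'k) \<Rightarrow> 'k) \<Rightarrow> 'k" and x
  \<comment> \<open>The element of Z that represents the functional sending y to \<phi> at x
    \<otimes> y. It exists because \<open>alpha_elem_le\<close> makes this functional bounded; the
    value off the tuples is the one \<open>ml_maps\<close> prescribes.\<close>
  define \<T> where "\<T> \<phi> x = (if x \<in> tuples Xs then SOME z. z \<in> carrier Z \<and> J z = rep \<phi> x else \<zero>\<^bsub>Z\<^esub>)" for \<phi> x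
  have ol: "(\<lambda>y. \<psi> (x, y)) \<in> lin_forms Y" if "\<psi> \<in> ?M" for \<psi> x using that by (simp add: forms_with_def)
  have oadd: "otimes_with Xs Y x (y \<oplus>\<^bsub>Y\<^esub> y') = otimes_with Xs Y x y \<oplus>\<^bsub>?V\<^esub> otimes_with Xs Y x y'"
    if "y \<in> carrier Y" "y' \<in> carrier Y" for x y y'
    using lin_formsD(3)[OF ol that] by (auto simp: elem_tensor_def fun_eq_iff)
  have osm: "otimes_with Xs Y x (c \<odot>\<^bsub>Y\<^esub> y) = c \<odot>\<^bsub>?V\<^esub> otimes_with Xs Y x y" if "y \<in> carrier Y" for x y c
    using lin_formsD(4)[OF ol that] by (auto simp: elem_tensor_def fun_eq_iff)
  have \<T>: "\<T> \<phi> x \<in> carrier Z" "J (\<T> \<phi> x) = rep \<phi> x" if \<phi>: "\<phi> \<in> carrier (dual ?V)" and x: "x \<in> tuples Xs" for \<phi> x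
  proof -
    note \<phi>l = lin_formsD[OF VD(1)[OF \<phi>]]
    have oV: "otimes_with Xs Y x y \<in> carrier ?V" if "y \<in> carrier Y" for y using that x by simp
    have "rep \<phi> x \<in> carrier (dual Y)"
    proof (rule dualI[where c = "nrm (dual ?V) \<phi> * (\<Prod>i<length Xs. nrm (Xs ! i) (x ! i))"])
      show "rep \<phi> x \<in> lin_forms Y"
      proof (rule lin_formsI)
        fix y y' assume y: "y \<in> carrier Y" "y' \<in> carrier Y"
        then show "rep \<phi> x (y \<oplus>\<^bsub>Y\<^esub> y') = rep \<phi> x y + rep \<phi> x y'"
          using \<phi>l(3)[OF oV[OF y(1)] oV[OF y(2)]] oadd[OF y] Yv by (simp only: rep_def vs_add if_True)
        fix c
        show "rep \<phi> x (c \<odot>\<^bsub>Y\<^esub> y) = c * rep \<phi> x y"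
          using \<phi>l(4)[OF oV[OF y(1)], of c] osm[OF y(1)] Yv y by (simp only: rep_def vs_smult if_True)
      qed (simp add: rep_def)
      fix y assume y: "y \<in> carrier Y"
      have "norm (\<phi> (otimes_with Xs Y x y)) \<le> nrm (dual ?V) \<phi> * alpha \<nu> Xs Y \<beta> (otimes_with Xs Y x y)"
        using VD(2)[OF \<phi> oV[OF y]] by simp
      also have "\<dots> \<le> nrm (dual ?V) \<phi> * ((\<Prod>i<length Xs. nrm (Xs ! i) (x ! i)) * nrm Y y)"
        by (rule mult_left_mono[OF alpha_elem_le[OF ideal assoc e Y good, OF x y] VD(3)[OF \<phi>]])
      finally show "norm (rep \<phi> x y) \<le> nrm (dual ?V) \<phi> * (\<Prod>i<length Xs. nrm (Xs ! i) (x ! i)) * nrm Y y"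
        using y by (simp add: rep_def mult.assoc)
    qed
    then have "\<exists>z. z \<in> carrier Z \<and> J z = rep \<phi> x" using JD(8) by blast
    then have "\<T> \<phi> x \<in> carrier Z \<and> J (\<T> \<phi> x) = rep \<phi> x"
      using someI_ex[of "\<lambda>z. z \<in> carrier Z \<and> J z = rep \<phi> x"] x by (simp add: \<T>_def)
    then show "\<T> \<phi> x \<in> carrier Z" "J (\<T> \<phi> x) = rep \<phi> x" by auto
  qed
  have J\<T>: "J (\<T> \<phi> x) y = \<phi> (otimes_with Xs Y x y)" if "\<phi> \<in> carrier (dual ?V)" "x \<in> tuples Xs" "y \<in> carrier Y" for \<phi> x y
    using \<T>(2)[OF that(1,2)] that(3) by (simp add: rep_def)
  have Zeq: "z = w" if "z \<in> carrier Z" "w \<in> carrier Z" "\<And>y. y \<in> carrier Y \<Longrightarrow> J z y = J w y" for z w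
  proof (rule JD(9)[OF that(1,2)])
    show "J z = J w"
    proof
      fix y show "J z y = J w y"
        using that(3) lin_formsD(2)[OF JD(4)[OF that(1)]] lin_formsD(2)[OF JD(4)[OF that(2)]]
        by (cases "y \<in> carrier Y") auto
    qed
  qed
  have Jl: "J (z \<oplus>\<^bsub>Z\<^esub> w) y = J z y + J w y" "J (c \<odot>\<^bsub>Z\<^esub> z) y = c * J z y" if "z \<in> carrier Z" "w \<in> carrier Z" for z w y c
    using is_linD(2,3)[OF JD(7)] that by auto
  have \<T>m: "\<T> \<phi> \<in> ml_maps Xs Z" if \<phi>: "\<phi> \<in> carrier (dual ?V)" for \<phi>
  proof (rule ml_mapsI)
    fix x i assume x: "x \<in> tuples Xs" and i: "i < length Xs"
    note \<phi>l = lin_formsD[OF VD(1)[OF \<phi>]]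
    note xu = tuples_update[OF x i]
    have fm: "(\<lambda>x. \<psi> (x, y)) \<in> forms Xs" if "\<psi> \<in> ?M" "y \<in> carrier Y" for \<psi> y using that by (auto simp: forms_with_def)
    show "is_lin (Xs ! i) Z (\<lambda>a. \<T> \<phi> (x[i := a]))"
      unfolding is_lin_def
    proof (intro conjI Pi_I ballI allI)
      fix a assume a: "a \<in> carrier (Xs ! i)"
      show "\<T> \<phi> (x[i := a]) \<in> carrier Z" by (rule \<T>(1)[OF \<phi> xu[OF a]])
      fix c
      have ca: "c \<odot>\<^bsub>Xs ! i\<^esub> a \<in> carrier (Xs ! i)" using E(9)[OF i] a by simp
      show "\<T> \<phi> (x[i := c \<odot>\<^bsub>Xs ! i\<^esub> a]) = c \<odot>\<^bsub>Z\<^esub> \<T> \<phi> (x[i := a])"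
      proof (rule Zeq)
        fix y assume y: "y \<in> carrier Y"
        have "otimes_with Xs Y (x[i := c \<odot>\<^bsub>Xs ! i\<^esub> a]) y = c \<odot>\<^bsub>?V\<^esub> otimes_with Xs Y (x[i := a]) y"
          using ml_mapsD(5)[OF fm[OF _ y] x i a] by (auto simp: elem_tensor_def fun_eq_iff)
        then show "J (\<T> \<phi> (x[i := c \<odot>\<^bsub>Xs ! i\<^esub> a])) y = J (c \<odot>\<^bsub>Z\<^esub> \<T> \<phi> (x[i := a])) y"
          unfolding Jl(2)[OF \<T>(1)[OF \<phi> xu[OF a]] \<T>(1)[OF \<phi> xu[OF a]]] J\<T>[OF \<phi> xu[OF ca] y] J\<T>[OF \<phi> xu[OF a] y]
          using \<phi>l(4)[of "otimes_with Xs Y (x[i := a]) y" c] xu[OF a] y by simp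
      qed (use \<T>(1)[OF \<phi>] xu a ca E(6) in auto)
    next
      fix a a' assume a: "a \<in> carrier (Xs ! i)" and a': "a' \<in> carrier (Xs ! i)"
      have aa: "a \<oplus>\<^bsub>Xs ! i\<^esub> a' \<in> carrier (Xs ! i)" using E(9)[OF i] a a' by simp
      show "\<T> \<phi> (x[i := a \<oplus>\<^bsub>Xs ! i\<^esub> a']) = \<T> \<phi> (x[i := a]) \<oplus>\<^bsub>Z\<^esub> \<T> \<phi> (x[i := a'])"
      proof (rule Zeq)
        fix y assume y: "y \<in> carrier Y"
        have "otimes_with Xs Y (x[i := a \<oplus>\<^bsub>Xs ! i\<^esub> a']) y = otimes_with Xs Y (x[i := a]) y \<oplus>\<^bsub>?V\<^esub> otimes_with Xs Y (x[i := a']) y"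
          using ml_mapsD(4)[OF fm[OF _ y] x i a a'] by (auto simp: elem_tensor_def fun_eq_iff)
        then show "J (\<T> \<phi> (x[i := a \<oplus>\<^bsub>Xs ! i\<^esub> a'])) y = J (\<T> \<phi> (x[i := a]) \<oplus>\<^bsub>Z\<^esub> \<T> \<phi> (x[i := a'])) y"
          unfolding Jl(1)[OF \<T>(1)[OF \<phi> xu[OF a]] \<T>(1)[OF \<phi> xu[OF a']]]
            J\<T>[OF \<phi> xu[OF aa] y] J\<T>[OF \<phi> xu[OF a] y] J\<T>[OF \<phi> xu[OF a'] y]
          using \<phi>l(3)[of "otimes_with Xs Y (x[i := a]) y" "otimes_with Xs Y (x[i := a']) y"] xu[OF a] xu[OF a'] y by simp
      qed (use \<T>(1)[OF \<phi>] xu a a' aa E(6) in auto)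
    qed
  qed (use \<T>(1)[OF \<phi>] in \<open>auto simp: \<T>_def\<close>)
  have \<phi>pf: "\<phi> u = u (pform Xs Y J T)"
    if \<phi>: "is_lin ?V scalar_space \<phi>" and T: "T \<in> ml_maps Xs Z" and u: "u \<in> carrier ?V"
      and eq: "\<And>x y. x \<in> tuples Xs \<Longrightarrow> y \<in> carrier Y \<Longrightarrow> J (T x) y = \<phi> (otimes_with Xs Y x y)" for \<phi> T u
  proof -
    obtain cds where cds: "snd ` set cds \<subseteq> tuples Xs \<times> carrier Y" "u = tsum ?M cds" using u by (auto simp: carrier_tens)
    have "\<phi> u = (\<Sum>(c, d)\<leftarrow>cds. c * \<phi> (elem_tensor ?M d))"
      unfolding cds(2) using lin_tsum[OF vs_scalar_space \<phi> cds(1)] by (simp add: lc_scalar comp_def case_prod_unfold)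
    also have "\<dots> = (\<Sum>(c, d)\<leftarrow>cds. c * J (T (fst d)) (snd d))"
      by (rule arg_cong[where f = sum_list], rule map_cong[OF refl]) (use cds(1) eq in auto)
    also have "\<dots> = u (pform Xs Y J T)"
      unfolding cds(2) by (rule pform_tsum[OF E(3) Yv pair_on[OF ideal assoc e Y good] T cds(1), symmetric])
    finally show ?thesis .
  qed
  have \<phi>\<T>: "\<phi> u = u (pform Xs Y J (\<T> \<phi>))" if \<phi>: "\<phi> \<in> carrier (dual ?V)" and u: "u \<in> carrier ?V" for \<phi> u
    by (rule \<phi>pf[OF lin_formsD(1)[OF VD(1)[OF \<phi>]] \<T>m[OF \<phi>] u]) (rule J\<T>[OF \<phi>])
  have \<T>A: "\<T> \<phi> \<in> \<A> Xs Z \<beta>" "A Xs Z \<beta> (\<T> \<phi>) = nrm (dual ?V) \<phi>" if \<phi>: "\<phi> \<in> carrier (dual ?V)" for \<phi>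
  proof -
    let ?n = "nrm (dual ?V) \<phi>"
    have le: "norm (u (pform Xs Y J (\<T> \<phi>))) \<le> ?n * alpha \<nu> Xs Y \<beta> u" if "u \<in> carrier ?V" for u
      using VD(2)[OF \<phi> that] \<phi>\<T>[OF \<phi> that] by simp
    \<comment> \<open>The factor 1 + \<delta> is the price of local reflexivity, which is applied to
      every L at once, annihilator or not.\<close>
    have m: "A_max A Xs Z \<beta> (\<T> \<phi>) \<le> ereal (?n * (1 + \<delta>))" if \<delta>: "\<delta> > 0" for \<delta>
      by (rule A_max_le[OF e \<T>m[OF \<phi>]])
        (rule A_quot_le_of_perp[OF ideal e Y J, OF \<T>m[OF \<phi>] _ _ VD(3)[OF \<phi>] \<delta>
            A_perp_le_of_alpha_bound[OF ideal assoc e Y good, OF \<T>m[OF \<phi>] VD(3)[OF \<phi>] le]])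
    show TA: "\<T> \<phi> \<in> \<A> Xs Z \<beta>" using maximal_idealD(1)[OF max e, OF \<T>m[OF \<phi>] m[of 1]] by simp
    have le1: "A Xs Z \<beta> (\<T> \<phi>) \<le> ?n * (1 + \<delta>)" if "\<delta> > 0" for \<delta>
      using maximal_idealD(1)[OF max e, OF \<T>m[OF \<phi>] m[OF that]] by simp
    have "A Xs Z \<beta> (\<T> \<phi>) \<le> ?n"
    proof (rule field_le_epsilon)
      fix r :: real assume r: "r > 0"
      \<comment> \<open>Choosing \<delta> as r / (n + 1) keeps n \<delta> below r, and the summand 1
        covers the zero functional.\<close>
      have "?n * (1 + r / (?n + 1)) \<le> ?n + r"
        using VD(3)[OF \<phi>] r by (simp add: field_simps)
      then show "A Xs Z \<beta> (\<T> \<phi>) \<le> ?n + r" using le1[of "r / (?n + 1)"] VD(3)[OF \<phi>] r by (force intro: order_trans)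
    qed
    moreover have "?n \<le> A Xs Z \<beta> (\<T> \<phi>)"
    proof (rule nrm_dual_le[OF vs_tens hom I(5)[OF TA]])
      fix u assume u: "u \<in> carrier ?V"
      show "norm (\<phi> u) \<le> A Xs Z \<beta> (\<T> \<phi>) * nrm ?V u"
        unfolding \<phi>\<T>[OF \<phi> u] using alpha_bound_of_A_max[OF ideal assoc e Y good, OF \<T>m[OF \<phi>] I(5)[OF TA] _ u]
          maximal_idealD(2)[OF max e, OF TA] by simp
    qed
    ultimately show "A Xs Z \<beta> (\<T> \<phi>) = ?n" by simp
  qed
  have lin: "is_lin (dual ?V) ?I \<T>"
    unfolding is_lin_def
  proof (intro conjI Pi_I ballI allI)
    fix \<phi> assume \<phi>: "\<phi> \<in> carrier (dual ?V)"
    show "\<T> \<phi> \<in> carrier ?I" using \<T>A(1)[OF \<phi>] by simp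
    fix c
    have c\<phi>: "c \<odot>\<^bsub>dual ?V\<^esub> \<phi> \<in> carrier (dual ?V)" using \<phi> normed_spaceD(1)[OF nV] by (intro vs_smult)
    show "\<T> (c \<odot>\<^bsub>dual ?V\<^esub> \<phi>) = c \<odot>\<^bsub>?I\<^esub> \<T> \<phi>"
    proof
      fix x
      show "\<T> (c \<odot>\<^bsub>dual ?V\<^esub> \<phi>) x = (c \<odot>\<^bsub>?I\<^esub> \<T> \<phi>) x"
      proof (cases "x \<in> tuples Xs")
        case True
        have "\<T> (c \<odot>\<^bsub>dual ?V\<^esub> \<phi>) x = c \<odot>\<^bsub>Z\<^esub> \<T> \<phi> x"
          using \<T>(1)[OF \<phi> True] \<T>(1)[OF c\<phi> True] J\<T>[OF \<phi> True] J\<T>[OF c\<phi> True] Jl(2) E(6)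
          by (intro Zeq) auto
        then show ?thesis by simp
      qed (use E(6) in \<open>simp add: \<T>_def\<close>)
    qed
  next
    fix \<phi> \<psi> assume \<phi>: "\<phi> \<in> carrier (dual ?V)" and \<psi>: "\<psi> \<in> carrier (dual ?V)"
    have s: "\<phi> \<oplus>\<^bsub>dual ?V\<^esub> \<psi> \<in> carrier (dual ?V)" using \<phi> \<psi> normed_spaceD(1)[OF nV] by (intro vs_add)
    show "\<T> (\<phi> \<oplus>\<^bsub>dual ?V\<^esub> \<psi>) = \<T> \<phi> \<oplus>\<^bsub>?I\<^esub> \<T> \<psi>"
    proof
      fix x
      show "\<T> (\<phi> \<oplus>\<^bsub>dual ?V\<^esub> \<psi>) x = (\<T> \<phi> \<oplus>\<^bsub>?I\<^esub> \<T> \<psi>) x"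
      proof (cases "x \<in> tuples Xs")
        case True
        have "\<T> (\<phi> \<oplus>\<^bsub>dual ?V\<^esub> \<psi>) x = \<T> \<phi> x \<oplus>\<^bsub>Z\<^esub> \<T> \<psi> x"
          using \<T>(1)[OF \<phi> True] \<T>(1)[OF \<psi> True] \<T>(1)[OF s True] J\<T>[OF \<phi> True] J\<T>[OF \<psi> True] J\<T>[OF s True] Jl(1) E(6)
          by (intro Zeq) auto
        then show ?thesis by simp
      qed (use E(6) in \<open>simp add: \<T>_def\<close>)
    qed
  qed
  have "inj_on \<T> (carrier (dual ?V))"
  proof (rule inj_onI)
    fix \<phi> \<psi> assume \<phi>: "\<phi> \<in> carrier (dual ?V)" and \<psi>: "\<psi> \<in> carrier (dual ?V)" and eq: "\<T> \<phi> = \<T> \<psi>"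
    have "\<phi> u = \<psi> u" for u
      using \<phi>\<T>[OF \<phi>] \<phi>\<T>[OF \<psi>] eq lin_formsD(2)[OF VD(1)[OF \<phi>]] lin_formsD(2)[OF VD(1)[OF \<psi>]]
      by (cases "u \<in> carrier ?V") auto
    then show "\<phi> = \<psi>" ..
  qed
  moreover have "T \<in> \<T> ` carrier (dual ?V)" if TA: "T \<in> \<A> Xs Z \<beta>" for T
  proof -
    note T = I(4)[OF TA]
    \<comment> \<open>The preimage of T evaluates tensors at the form of T. It is cut off outside
      the carrier because elements of \<open>dual\<close> vanish there.\<close>
    define \<phi> where "\<phi> = (\<lambda>u. if u \<in> carrier ?V then u (pform Xs Y J T) else 0)"
    have \<phi>: "\<phi> \<in> carrier (dual ?V)"
    proof (rule dualI)
      show "\<phi> \<in> lin_forms ?V" unfolding \<phi>_def by (rule lin_forms_restrict[OF vs_tens is_lin_apply[OF M[OF T]]])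
      fix u assume "u \<in> carrier ?V"
      then show "norm (\<phi> u) \<le> A Xs Z \<beta> T * nrm ?V u"
        using alpha_bound_of_A_max[OF ideal assoc e Y good, OF T I(5)[OF TA], of u] maximal_idealD(2)[OF max e, OF TA]
        by (simp add: \<phi>_def)
    qed
    have "\<T> \<phi> x = T x" for x
    proof (cases "x \<in> tuples Xs")
      case True
      show ?thesis
      proof (rule Zeq[OF \<T>(1)[OF \<phi> True] ml_mapsD(1)[OF T True]])
        fix y assume y: "y \<in> carrier Y"
        have "otimes_with Xs Y x y \<in> carrier ?V" using True y by simp
        then have "\<phi> (otimes_with Xs Y x y) = otimes_with Xs Y x y (pform Xs Y J T)" by (simp add: \<phi>_def)
        then show "J (\<T> \<phi> x) y = J (T x) y"
          unfolding J\<T>[OF \<phi> True y] using True y M[OF T] by (simp add: elem_tensor_def pform_def)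
      qed
    qed (use ml_mapsD(2)[OF T] in \<open>simp add: \<T>_def\<close>)
    then have "T = \<T> \<phi>" by auto
    then show ?thesis using \<phi> by blast
  qed
  ultimately have "bij_betw \<T> (carrier (dual ?V)) (carrier ?I)"
    unfolding bij_betw_def using \<T>A(1) by auto
  then have "isometric_iso (dual ?V) ?I \<T>" unfolding isometric_iso_def using lin \<T>A(2) by simp
  then show ?thesis using J\<T> by blast
qed

theorem theorem5p4:
  fixes \<nu> :: "('k::real_or_complex, 'u) dual_norms"
    and \<A> :: "('k, 'u) ideal_sets" and A :: "('k, 'u) ideal_norms"
    and Xs :: "('k, 'u) nspace list" and Y :: "('k, 'u) nspace"
    and \<beta> :: "(('u list \<Rightarrow> 'k) \<Rightarrow> 'k) \<Rightarrow> real"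
  assumes "sigma_dual_norm \<nu>"
    and "sigma_ideal \<A> A" and "maximal_ideal \<A> A" and "associated \<A> A \<nu>"
    and "election Xs Y \<beta>"
  shows "(\<forall>(Y' :: ('k, 'u) nspace) J. dual_copy Y Y' J \<longrightarrow>
            (\<exists>\<T>. isometric_iso (dual (alpha_space \<nu> Xs Y \<beta>)) (ideal_space \<A> A Xs Y' \<beta>) \<T> \<and>
                 (\<forall>\<phi>\<in>carrier (dual (alpha_space \<nu> Xs Y \<beta>)). \<forall>x\<in>tuples Xs. \<forall>y\<in>carrier Y.
                    J (\<T> \<phi> x) y = \<phi> (otimes_with Xs Y x y))))
       \<and> (\<forall>T\<in>bounded_ml_maps Xs Y.
            (let \<phi>\<^sub>T = lin_ext_with Xs (dual Y) scalar_space (\<lambda>x y'. y' (T x)) in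
             (T \<in> \<A> Xs Y \<beta> \<longleftrightarrow> bounded_op (alpha_space \<nu> Xs (dual Y) \<beta>) scalar_space \<phi>\<^sub>T) \<and>
             (T \<in> \<A> Xs Y \<beta> \<longrightarrow>
                A Xs Y \<beta> T = opnorm (alpha_space \<nu> Xs (dual Y) \<beta>) scalar_space \<phi>\<^sub>T)))"
  unfolding Let_def
  using alpha_dual_iso[OF assms(2-5)] alpha_dual_eq_predual[OF assms(2-5)] by blast

end
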